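(* The graded space $J^{W(E_8)}_{*,E_8,3}$ of $W(E_8)$-invariant holomorphic Jacobi forms of index $3$ is a free $M_*$-module with basis $A_3,\ B_3,\ A_2\vartheta_{E_8},\ B_2\vartheta_{E_8},\ \vartheta_{E_8}^3$: $$J^{W(E_8)}_{*,E_8,3}=M_*\langle A_3,B_3,A_2\vartheta_{E_8},B_2\vartheta_{E_8},\vartheta_{E_8}^3\rangle.$$
   Context: Let $(\cdot,\cdot)$ be the standard scalar product on $\mathbb R^8$ and $E_8=\{x\in\frac12\mathbb Z^8: x_1\equiv\cdots\equiv x_8 \bmod 1,\ \sum x_i\equiv 0 \bmod 2\}$; $W(E_8)$ is its Weyl group acting on $\mathbb C^8$. Put $q=e^{2\pi i\tau}$. A $W(E_8)$-invariant holomorphic Jacobi form of weight $k\in\mathbb Z$ and index $t\in\mathbb N$ is a holomorphic $\varphi:\mathbb H\times\mathbb C^8\to\mathbb C$ invariant under $\mathfrak z\mapsto\sigma\mathfrak z$ ($\sigma\in W(E_8)$), with $\varphi(\tau,\mathfrak z+x\tau+y)=\exp(-t\pi i[(x,x)\tau+2(x,\mathfrak z)])\varphi(\tau,\mathfrak z)$ ($x,y\in E_8$), $\varphi(\frac{a\tau+b}{c\tau+d},\frac{\mathfrak z}{c\tau+d})=(c\tau+d)^k\exp(t\pi i\frac{c(\mathfrak z,\mathfrak z)}{c\tau+d})\varphi(\tau,\mathfrak z)$ for $\begin{pmatrix}a&b\\c&d\end{pmatrix}\in SL_2(\mathbb Z)$, and Fourier expansion $\sum_{n\ge0}\sum_{\ell\in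 E_8}f(n,\ell)q^ne^{2\pi i(\ell,\mathfrak z)}$ with $f(n,\ell)\ne0\Rightarrow2nt-(\ell,\ell)\ge0$. The space is $J^{W(E_8)}_{k,E_8,t}$; $J^{W(E_8)}_{*,E_8,t}=\bigoplus_kJ^{W(E_8)}_{k,E_8,t}$. $M_*=\mathbb C[E_4,E_6]$ is the ring of modular forms for $SL_2(\mathbb Z)$ ($E_4,E_6$ with constant term $1$), $E_2=1-24\sum\sigma(n)q^n$; $M_*\langle f_1,\dots,f_r\rangle$ denotes the free $M_*$-module with basis $f_1,\dots,f_r$. $\vartheta_{E_8}(\tau,\mathfrak z)=\sum_{\ell\in E_8}\exp(\pi i(\ell,\ell)\tau+2\pi i(\ell,\mathfrak z))$; $(\varphi|_kT_-(s))(\tau,\mathfrak z)=s^{-1}\sum_{ad=s,\,a,d>0}\sum_{b\bmod d}a^k\varphi(\frac{a\tau+b}{d},a\mathfrak z)$. $A_t=c_t\,(\vartheta_{E_8}|_4T_-(t))$ with $c_t$ chosen so that $A_t(\tau,0)=E_4(\tau)$ ($t=2,3$). For $\gamma=\begin{pmatrix}a&b\\c&d\end{pmatrix}\in SL_2(\mathbb Z)$, $(\phi|_{6,t}\gamma)(\tau,\mathfrak z)=(c\tau+d)^{-6}\exp(-t\pi i\frac{c(\mathfrak z,\mathfrak z)}{c\tau+d})\phi(\frac{a\tau+b}{c\tau+d},\frac{\mathfrak z}{c\tau+d})$; for $t\in\{2,3\}$, $B_t=c\sum_{\gamma\in\Gamma_0(t)\backslash SL_2(\mathbb Z)}[(tE_2(t\tau)-E_2(\tau))\vartheta_{E_8}(t\tau,t\mathfrak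 z)]|_{6,t}\gamma$ with the constant $c$ chosen so that $B_t(\tau,0)=E_6(\tau)$. *)

theory Defs
  imports "HOL-Analysis.Analysis" "HOL-Computational_Algebra.Polynomial"
begin

text \<open>
  Functions on \<open>\<H> \<times> \<complex>\<^sup>8\<close>, where \<open>\<H>\<close> is the upper half plane, are represented by total functions
  \<open>complex \<Rightarrow> complex ^ 8 \<Rightarrow> complex\<close>. Values at \<open>\<tau>\<close> outside \<open>\<H>\<close> are irrelevant: every condition
  and every equality of functions below is imposed for \<open>\<tau> \<in> \<H>\<close> only.
\<close>

type_synonym jfun = "complex \<Rightarrow> complex ^ 8 \<Rightarrow> complex"

definition uhp :: "complex set" where
  "uhp = {\<tau>. Im \<tau> > 0}"

section \<open>The lattice and its Weyl group\<close>

definition E8 :: "(real ^ 8) set" where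
  "E8 = {x. (\<forall>i. 2 * x $ i \<in> \<int>) \<and> (\<forall>i j. x $ i - x $ j \<in> \<int>) \<and>
            (\<exists>m::int. (\<Sum>i\<in>UNIV. x $ i) = 2 * of_int m)}"

definition cvec :: "real ^ 8 \<Rightarrow> complex ^ 8" where
  "cvec x = (\<chi> i. complex_of_real (x $ i))"

text \<open>The \<open>\<complex>\<close>-bilinear extension of the standard scalar product (the library's \<open>inner\<close> on
  \<open>complex ^ 8\<close> is real-valued and not \<open>\<complex>\<close>-bilinear).\<close>

definition cdot :: "complex ^ 8 \<Rightarrow> complex ^ 8 \<Rightarrow> complex" where
  "cdot z w = (\<Sum>i\<in>UNIV. z $ i * w $ i)"

text \<open>Roots have \<open>(r, r) = 2\<close>, so the reflection in \<open>r\<close> is \<open>z \<mapsto> z - (r, z) r\<close>.\<close>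

definition reflection :: "real ^ 8 \<Rightarrow> complex ^ 8 \<Rightarrow> complex ^ 8" where
  "reflection r z = z - cdot (cvec r) z *s cvec r"

text \<open>Reflections are involutions, so finite products of them form the generated group.\<close>

inductive_set weyl_E8 :: "(complex ^ 8 \<Rightarrow> complex ^ 8) set" where
  weyl_id: "id \<in> weyl_E8"
| weyl_step: "r \<in> E8 \<Longrightarrow> r \<bullet> r = 2 \<Longrightarrow> \<sigma> \<in> weyl_E8 \<Longrightarrow> reflection r \<circ> \<sigma> \<in> weyl_E8"

section \<open>Jacobi forms\<close>

definition SL2Z :: "(int ^ 2 ^ 2) set" where
  "SL2Z = {\<gamma>. det \<gamma> = 1}"

definition moeb :: "int ^ 2 ^ 2 \<Rightarrow> complex \<Rightarrow> complex" where
  "moeb \<gamma> \<tau> = (of_int (\<gamma> $ 1 $ 1) * \<tau> + of_int (\<gamma> $ 1 $ 2)) / (of_int (\<gamma> $ 2 $ 1) * \<tau> + of_int (\<gamma> $ 2 $ 2))"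

definition autfac :: "int ^ 2 ^ 2 \<Rightarrow> complex \<Rightarrow> complex" where
  "autfac \<gamma> \<tau> = of_int (\<gamma> $ 2 $ 1) * \<tau> + of_int (\<gamma> $ 2 $ 2)"

text \<open>Holomorphy in nine complex variables: \<open>\<complex>\<close>-differentiability at every point of the open set
  \<open>\<H> \<times> \<complex>\<^sup>8\<close>.\<close>

definition jholomorphic :: "jfun \<Rightarrow> bool" where
  "jholomorphic \<phi> \<longleftrightarrow>
     (\<forall>\<tau>\<in>uhp. \<forall>z. \<exists>D. ((\<lambda>(\<tau>, z). \<phi> \<tau> z) has_derivative D) (at (\<tau>, z)) \<and>
        (\<forall>c v w. D (c * v, c *s w) = c * D (v, w)))"

definition fourier_term :: "(nat \<Rightarrow> real ^ 8 \<Rightarrow> complex) \<Rightarrow> complex \<Rightarrow> complex ^ 8 \<Rightarrow> nat \<times> (real ^ 8) \<Rightarrow> complex" where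
  "fourier_term f \<tau> z = (\<lambda>(n, l). f n l * exp (2 * complex_of_real pi * \<i> * \<tau>) ^ n * exp (2 * complex_of_real pi * \<i> * cdot (cvec l) z))"

definition jacobi_forms :: "int \<Rightarrow> nat \<Rightarrow> jfun set" where
  "jacobi_forms k t = {\<phi>. jholomorphic \<phi> \<and>
     (\<forall>\<sigma>\<in>weyl_E8. \<forall>\<tau>\<in>uhp. \<forall>z. \<phi> \<tau> (\<sigma> z) = \<phi> \<tau> z) \<and>
     (\<forall>x\<in>E8. \<forall>y\<in>E8. \<forall>\<tau>\<in>uhp. \<forall>z.
        \<phi> \<tau> (z + \<tau> *s cvec x + cvec y) =
          exp (- (of_nat t * complex_of_real pi * \<i> * (cdot (cvec x) (cvec x) * \<tau> + 2 * cdot (cvec x) z))) * \<phi> \<tau> z) \<and>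
     (\<forall>\<gamma>\<in>SL2Z. \<forall>\<tau>\<in>uhp. \<forall>z.
        \<phi> (moeb \<gamma> \<tau>) (inverse (autfac \<gamma> \<tau>) *s z) =
          autfac \<gamma> \<tau> powi k *
          exp (of_nat t * complex_of_real pi * \<i> * (of_int (\<gamma> $ 2 $ 1) * cdot z z / autfac \<gamma> \<tau>)) * \<phi> \<tau> z) \<and>
     (\<exists>f. (\<forall>n. \<forall>l\<in>E8. f n l \<noteq> 0 \<longrightarrow> 2 * real n * real t - l \<bullet> l \<ge> 0) \<and>
          (\<forall>\<tau>\<in>uhp. \<forall>z. (fourier_term f \<tau> z has_sum \<phi> \<tau> z) (UNIV \<times> E8)))}"

text \<open>The direct sum over all weights, realised as finite sums of functions; that this sum is direct
  is lemma \<open>jacobi_forms_direct\<close>.\<close>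

definition jacobi_forms_graded :: "nat \<Rightarrow> jfun set" where
  "jacobi_forms_graded t = {\<phi>. \<exists>K \<Phi>. finite K \<and> (\<forall>k\<in>K. \<Phi> k \<in> jacobi_forms k t) \<and>
     (\<forall>\<tau>\<in>uhp. \<forall>z. \<phi> \<tau> z = (\<Sum>k\<in>K. \<Phi> k \<tau> z))}"

lemma uhp_affine_nonzero:
  assumes "\<tau> \<in> uhp"
  shows "\<tau> + of_int d \<noteq> 0"
proof
  assume "\<tau> + of_int d = 0"
  then have "Im (\<tau> + of_int d) = 0" by simp
  with assms show False by (simp add: uhp_def)
qed

lemma jacobi_forms_direct:
  assumes K: "finite K" and \<Phi>: "\<forall>k\<in>K. \<Phi> k \<in> jacobi_forms k t"
    and zero: "\<forall>\<tau>\<in>uhp. \<forall>z. (\<Sum>k\<in>K. \<Phi> k \<tau> z) = 0"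
    and k: "k \<in> K" and \<tau>: "\<tau> \<in> uhp"
  shows "\<Phi> k \<tau> z = 0"
proof -
  define m where "m = Min K"
  have m: "m \<le> j" if "j \<in> K" for j using K that by (simp add: m_def)
  define p where "p = (\<Sum>j\<in>K. monom (\<Phi> j \<tau> z) (nat (j - m)))"
  have root: "poly p (\<tau> + of_int d) = 0" for d :: int
  proof -
    define \<gamma> :: "int ^ 2 ^ 2" where "\<gamma> = vector [vector [0, - 1], vector [1, d]]"
    have \<gamma>: "\<gamma> $ 1 $ 1 = 0" "\<gamma> $ 1 $ 2 = - 1" "\<gamma> $ 2 $ 1 = 1" "\<gamma> $ 2 $ 2 = d"
      by (simp_all add: \<gamma>_def)
    have SL: "\<gamma> \<in> SL2Z" by (simp add: SL2Z_def det_2 \<gamma>)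
    have aut: "autfac \<gamma> \<tau> = \<tau> + of_int d" by (simp add: autfac_def \<gamma>)
    have nz: "\<tau> + of_int d \<noteq> 0" using \<tau> by (rule uhp_affine_nonzero)
    have moeb: "moeb \<gamma> \<tau> = - 1 / (\<tau> + of_int d)" by (simp add: moeb_def \<gamma>)
    have "moeb \<gamma> \<tau> \<in> uhp"
    proof -
      have "Im (- 1 / (\<tau> + of_int d)) = Im \<tau> / ((Re \<tau> + of_int d)\<^sup>2 + (Im \<tau>)\<^sup>2)"
        by (simp add: Im_divide)
      also have "\<dots> > 0"
        using \<tau> by (auto simp: uhp_def intro!: divide_pos_pos add_nonneg_pos)
      finally show ?thesis by (simp add: moeb uhp_def)
    qed
    with zero have "0 = (\<Sum>j\<in>K. \<Phi> j (moeb \<gamma> \<tau>) (inverse (autfac \<gamma> \<tau>) *s z))" by simp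
    also have "\<dots> = (\<Sum>j\<in>K. autfac \<gamma> \<tau> powi j *
        exp (of_nat t * complex_of_real pi * \<i> * (of_int (\<gamma> $ 2 $ 1) * cdot z z / autfac \<gamma> \<tau>)) * \<Phi> j \<tau> z)"
      using \<Phi> SL \<tau> by (intro sum.cong refl) (auto simp: jacobi_forms_def)
    also have "\<dots> = exp (of_nat t * complex_of_real pi * \<i> * (of_int (\<gamma> $ 2 $ 1) * cdot z z / autfac \<gamma> \<tau>)) *
        (\<Sum>j\<in>K. (\<tau> + of_int d) powi j * \<Phi> j \<tau> z)"
      unfolding aut sum_distrib_left by (intro sum.cong refl) (simp only: mult_ac)
    finally have S: "(\<Sum>j\<in>K. (\<tau> + of_int d) powi j * \<Phi> j \<tau> z) = 0" by simp
    have "poly p (\<tau> + of_int d) = (\<Sum>j\<in>K. \<Phi> j \<tau> z * (\<tau> + of_int d) ^ nat (j - m))"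
      by (simp add: p_def poly_sum poly_monom)
    also have "\<dots> = (\<Sum>j\<in>K. (\<tau> + of_int d) powi (- m) * ((\<tau> + of_int d) powi j * \<Phi> j \<tau> z))"
    proof (intro sum.cong refl)
      fix j assume "j \<in> K"
      then have "(\<tau> + of_int d) ^ nat (j - m) = (\<tau> + of_int d) powi (- m + j)"
        using m by (simp add: power_int_def)
      also have "\<dots> = (\<tau> + of_int d) powi (- m) * (\<tau> + of_int d) powi j"
        using nz by (intro power_int_add) simp
      finally show "\<Phi> j \<tau> z * (\<tau> + of_int d) ^ nat (j - m) =
          (\<tau> + of_int d) powi (- m) * ((\<tau> + of_int d) powi j * \<Phi> j \<tau> z)"
        by (simp only: mult_ac)
    qed
    also have "\<dots> = (\<tau> + of_int d) powi (- m) * (\<Sum>j\<in>K. (\<tau> + of_int d) powi j * \<Phi> j \<tau> z)"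
      by (simp only: sum_distrib_left)
    finally show ?thesis using S by simp
  qed
  have "infinite {x. poly p x = 0}"
  proof -
    have "inj (\<lambda>d::int. \<tau> + of_int d)" by (auto simp: inj_def)
    then have "infinite (range (\<lambda>d::int. \<tau> + of_int d))"
      using finite_imageD infinite_UNIV_int by blast
    moreover have "range (\<lambda>d::int. \<tau> + of_int d) \<subseteq> {x. poly p x = 0}" using root by auto
    ultimately show ?thesis using finite_subset by blast
  qed
  then have "p = 0" using poly_roots_finite by blast
  then have "0 = coeff p (nat (k - m))" by simp
  also have "\<dots> = (\<Sum>j\<in>K. if j = k then \<Phi> j \<tau> z else 0)"
    unfolding p_def coeff_sum coeff_monom using m k by (intro sum.cong refl) (auto simp: eq_nat_nat_iff)
  also have "\<dots> = \<Phi> k \<tau> z" using K k by simp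
  finally show ?thesis by simp
qed

section \<open>Modular forms\<close>

definition divisor_sum :: "nat \<Rightarrow> nat \<Rightarrow> nat" where
  "divisor_sum k n = (\<Sum>d | d dvd n. d ^ k)"

definition lambert :: "nat \<Rightarrow> complex \<Rightarrow> complex" where
  "lambert k \<tau> = (\<Sum>n. of_nat (divisor_sum k (Suc n)) * exp (2 * complex_of_real pi * \<i> * \<tau>) ^ Suc n)"

definition Eis2 :: "complex \<Rightarrow> complex" where "Eis2 \<tau> = 1 - 24 * lambert 1 \<tau>"
definition Eis4 :: "complex \<Rightarrow> complex" where "Eis4 \<tau> = 1 + 240 * lambert 3 \<tau>"
definition Eis6 :: "complex \<Rightarrow> complex" where "Eis6 \<tau> = 1 - 504 * lambert 5 \<tau>"

text \<open>The ring \<open>M\<^sub>* = \<complex>[E\<^sub>4, E\<^sub>6]\<close>, as functions on the upper half plane.\<close>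

definition mod_ring :: "(complex \<Rightarrow> complex) set" where
  "mod_ring = {f. \<exists>N (c :: nat \<Rightarrow> nat \<Rightarrow> complex).
     \<forall>\<tau>\<in>uhp. f \<tau> = (\<Sum>i\<le>N. \<Sum>j\<le>N. c i j * Eis4 \<tau> ^ i * Eis6 \<tau> ^ j)}"

text \<open>The set \<open>V\<close> of functions is a free \<open>M\<^sub>*\<close>-module with basis \<open>bs\<close>: it consists of the
  \<open>M\<^sub>*\<close>-linear combinations of \<open>bs\<close>, and \<open>bs\<close> is \<open>M\<^sub>*\<close>-linearly independent.\<close>

definition lin_comb :: "(nat \<Rightarrow> complex \<Rightarrow> complex) \<Rightarrow> jfun list \<Rightarrow> jfun" where
  "lin_comb m bs \<tau> z = (\<Sum>i<length bs. m i \<tau> * (bs ! i) \<tau> z)"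

definition free_basis :: "jfun set \<Rightarrow> jfun list \<Rightarrow> bool" where
  "free_basis V bs \<longleftrightarrow>
     V = {\<phi>. \<exists>m. (\<forall>i<length bs. m i \<in> mod_ring) \<and> (\<forall>\<tau>\<in>uhp. \<forall>z. \<phi> \<tau> z = lin_comb m bs \<tau> z)} \<and>
     (\<forall>m. (\<forall>i<length bs. m i \<in> mod_ring) \<longrightarrow> (\<forall>\<tau>\<in>uhp. \<forall>z. lin_comb m bs \<tau> z = 0) \<longrightarrow>
          (\<forall>i<length bs. \<forall>\<tau>\<in>uhp. m i \<tau> = 0))"

section \<open>The generators\<close>

definition theta_E8 :: jfun where
  "theta_E8 \<tau> z =
     (\<Sum>\<^sub>\<infinity>l\<in>E8. exp (complex_of_real pi * \<i> * cdot (cvec l) (cvec l) * \<tau> + 2 * complex_of_real pi * \<i> * cdot (cvec l) z))"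

definition hecke_minus :: "int \<Rightarrow> nat \<Rightarrow> jfun \<Rightarrow> jfun" where
  "hecke_minus k s \<phi> \<tau> z = inverse (of_nat s) *
     (\<Sum>(a, d) | a * d = s \<and> a > 0 \<and> d > 0. \<Sum>b<d.
        of_nat a powi k * \<phi> ((of_nat a * \<tau> + of_nat b) / of_nat d) (of_nat a *s z))"

definition slash :: "int \<Rightarrow> nat \<Rightarrow> jfun \<Rightarrow> int ^ 2 ^ 2 \<Rightarrow> jfun" where
  "slash k t \<phi> \<gamma> \<tau> z = autfac \<gamma> \<tau> powi (- k) *
     exp (- (of_nat t * complex_of_real pi * \<i> * (of_int (\<gamma> $ 2 $ 1) * cdot z z / autfac \<gamma> \<tau>))) *
     \<phi> (moeb \<gamma> \<tau>) (inverse (autfac \<gamma> \<tau>) *s z)"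

definition Gamma0 :: "nat \<Rightarrow> (int ^ 2 ^ 2) set" where
  "Gamma0 t = {\<gamma> \<in> SL2Z. int t dvd \<gamma> $ 2 $ 1}"

definition Gamma0_cosets :: "nat \<Rightarrow> (int ^ 2 ^ 2) set set" where
  "Gamma0_cosets t = (\<lambda>\<gamma>. (\<lambda>g. g ** \<gamma>) ` Gamma0 t) ` SL2Z"

text \<open>Rescaling by the constant for which the restriction to \<open>z = 0\<close> becomes the given function.\<close>

definition normalize_at_0 :: "(complex \<Rightarrow> complex) \<Rightarrow> jfun \<Rightarrow> jfun" where
  "normalize_at_0 e \<phi> \<tau> z = (THE c. \<forall>\<tau>\<in>uhp. c * \<phi> \<tau> 0 = e \<tau>) * \<phi> \<tau> z"

definition A_form :: "nat \<Rightarrow> jfun" where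
  "A_form t = normalize_at_0 Eis4 (hecke_minus 4 t theta_E8)"

text \<open>The summand is the slash of a \<open>\<Gamma>\<^sub>0(t)\<close>-invariant function, so any representative of a coset
  may be taken.\<close>

definition B_form :: "nat \<Rightarrow> jfun" where
  "B_form t = normalize_at_0 Eis6
     (\<lambda>\<tau> z. \<Sum>C\<in>Gamma0_cosets t.
        slash 6 t (\<lambda>\<tau> z. (of_nat t * Eis2 (of_nat t * \<tau>) - Eis2 \<tau>) *
                          theta_E8 (of_nat t * \<tau>) (of_nat t *s z))
          (SOME \<gamma>. \<gamma> \<in> C) \<tau> z)"

end

theory Submission
  imports Defs "HOL-Complex_Analysis.Complex_Analysis" "HOL-Library.Nat_Bijection"
begin

text \<open>
  By quasi-periodicity, a Jacobi form \<open>\<phi>\<close> of index 3 is a sum of theta functions attached to the classes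
  of \<open>E\<^sub>8/3E\<^sub>8\<close> with coefficients \<open>h\<^sub>l(\<tau>)\<close>, which are invariant under \<open>W(E\<^sub>8)\<close>. Every class is equivalent to
  one of five, so \<open>\<phi>\<close> is determined by a vector of five functions, on which \<open>\<tau> \<mapsto> -1/\<tau>\<close> acts by a matrix of
  constants and a power of \<open>\<tau>\<close>. The weights of the five generators add up to 40, so the \<open>5 \<times> 5\<close> determinant of
  their vectors has weight \<open>40 - 5 \<cdot> 4 = 20\<close>, and the exponents of \<open>q\<close> add up to \<open>5/3\<close>. Its cube divided by \<open>\<Delta>\<^sup>5\<close> is
  therefore constant, and the leading coefficients show that the constant is not zero. By Cramer's rule every
  \<open>\<phi>\<close> is a unique combination of the generators whose coefficients are holomorphic on the disc \<open>|q| < 1\<close>,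
  cusp included; by uniqueness they transform like modular forms, hence are polynomials in \<open>E\<^sub>4\<close> and \<open>E\<^sub>6\<close>.
\<close>

text \<open>The proof rests on a coincidence of numbers: the determinant has weight 20 and vanishes
  at the cusp to order at least 5/3 = 20/12, the most that the valence formula allows. So a nonzero
  leading coefficient already excludes zeros in the upper half plane, and Cramer's rule creates no
  poles. The modular input is built from scratch. The laws of \<open>Eis2\<close>,
  \<open>Eis4\<close> and \<open>Eis6\<close> under inversion are read off the Taylor coefficients
  at z = 0 of the logarithmic derivative of a theta product, and that of \<open>DelQ\<close> follows
  from the one for \<open>Eis2\<close>. Theta inversion avoids Poisson summation: quasi-periodicity
  fixes the theta function up to a factor, and the heat equation determines the eighth power of that
  factor. Two quantities are never evaluated. The determinant of the matrix by which inversion acts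
  enters only through the modulus of its cube. The number \<open>root_count\<close> of roots in a
  certain position enters the leading coefficients, but their matrix can be singular only if this
  number is 2, which three explicit roots exclude.\<close>

no_notation fps_nth (infixl \<open>$\<close> 75)

section \<open>The exponential function on the upper half plane\<close>

definition ee :: "complex \<Rightarrow> complex" where
  "ee x = exp (2 * complex_of_real pi * \<i> * x)"

lemma ee_add: "ee (x + y) = ee x * ee y"
  by (simp add: ee_def ring_distribs exp_add)

lemma ee_0 [simp]: "ee 0 = 1"
  by (simp add: ee_def)

lemma ee_nonzero [simp]: "ee x \<noteq> 0"
  by (simp add: ee_def)

lemma ee_minus: "ee (- x) = inverse (ee x)"
  by (simp add: ee_def exp_minus)

lemma ee_diff: "ee (x - y) = ee x / ee y"
  by (simp add: ee_def ring_distribs exp_diff)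

lemma ee_of_int [simp]: "ee (of_int n) = 1"
  using exp_integer_2pi[of "of_int n"] by (simp add: ee_def mult_ac)

lemma ee_of_nat [simp]: "ee (of_nat n) = 1"
  using ee_of_int[of "int n"] by simp

lemma ee_1 [simp]: "ee 1 = 1"
  using ee_of_nat[of 1] by simp

lemma ee_Ints: "x \<in> \<int> \<Longrightarrow> ee x = 1"
  by (auto elim: Ints_cases)

lemma ee_add_int [simp]: "ee (x + of_int n) = ee x"
  by (simp add: ee_add)

lemma ee_eq_1_iff: "ee x = 1 \<longleftrightarrow> x \<in> \<int>"
proof
  assume "ee x = 1"
  then obtain n :: int where n: "Re (2 * complex_of_real pi * \<i> * x) = 0"
      "Im (2 * complex_of_real pi * \<i> * x) = of_int (2 * n) * pi"
    unfolding ee_def exp_eq_1 by blast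
  then have "x = of_int n"
    by (intro complex_eqI) auto
  then show "x \<in> \<int>" by simp
qed (rule ee_Ints)

lemma ee_half: "ee (1 / 2) = - 1"
  by (simp add: ee_def exp_Euler)

lemma ee_power: "ee x ^ n = ee (of_nat n * x)"
  by (simp add: ee_def exp_of_nat_mult[symmetric] mult_ac)

lemma norm_ee: "norm (ee x) = exp (- 2 * pi * Im x)"
  by (simp add: ee_def)

lemma norm_ee_less_1: "\<tau> \<in> uhp \<Longrightarrow> norm (ee \<tau>) < 1"
  by (simp add: norm_ee uhp_def)

lemma ee_has_field_derivative [derivative_intros]:
  "(f has_field_derivative f') (at x within A) \<Longrightarrow>
    ((\<lambda>x. ee (f x)) has_field_derivative 2 * complex_of_real pi * \<i> * f' * ee (f x)) (at x within A)"
  unfolding ee_def by (auto intro!: derivative_eq_intros simp: mult_ac)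

lemma holomorphic_on_ee [holomorphic_intros]:
  "f holomorphic_on A \<Longrightarrow> (\<lambda>x. ee (f x)) holomorphic_on A"
  unfolding ee_def by (intro holomorphic_intros)

lemma continuous_on_ee [continuous_intros]:
  "continuous_on A f \<Longrightarrow> continuous_on A (\<lambda>x. ee (f x))"
  unfolding ee_def by (intro continuous_intros)

lemma ee_surj_uhp:
  assumes "q \<noteq> 0" "norm q < 1"
  obtains \<tau> where "\<tau> \<in> uhp" "ee \<tau> = q"
proof
  define \<tau> where "\<tau> = Ln q / (2 * complex_of_real pi * \<i>)"
  show "ee \<tau> = q"
    using assms by (simp add: ee_def \<tau>_def)
  then have "exp (- 2 * pi * Im \<tau>) < 1"
    using assms norm_ee[of \<tau>] by simp
  then show "\<tau> \<in> uhp"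
    by (simp add: uhp_def zero_less_mult_iff)
qed

lemma open_uhp: "open uhp"
  unfolding uhp_def by (intro open_Collect_less continuous_intros)

lemma convex_uhp: "convex uhp"
  unfolding uhp_def by (rule convex_halfspace_Im_gt)

lemma uhp_nonzero: "\<tau> \<in> uhp \<Longrightarrow> \<tau> \<noteq> 0"
  by (auto simp: uhp_def)

lemma ii_in_uhp [simp]: "\<i> \<in> uhp"
  by (simp add: uhp_def)

lemma Im_inversion: "Im (- 1 / \<tau>) = Im \<tau> / (norm \<tau>)\<^sup>2"
  by (simp add: Im_divide cmod_power2)

lemma inversion_in_uhp [simp]: "\<tau> \<in> uhp \<Longrightarrow> - 1 / \<tau> \<in> uhp"
  unfolding uhp_def mem_Collect_eq Im_inversion using uhp_nonzero[of \<tau>] by (auto simp: uhp_def)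

lemma inversion_in_uhp' [simp]: "\<tau> \<in> uhp \<Longrightarrow> - (1 / \<tau>) \<in> uhp"
  using inversion_in_uhp[of \<tau>] by simp

lemma uhp_add_int [simp]: "\<tau> \<in> uhp \<Longrightarrow> \<tau> + of_int n \<in> uhp" "\<tau> \<in> uhp \<Longrightarrow> \<tau> + 1 \<in> uhp"
    "\<tau> \<in> uhp \<Longrightarrow> \<tau> + of_nat m \<in> uhp"
  by (auto simp: uhp_def)

lemma uhp_mult_of_nat: "\<tau> \<in> uhp \<Longrightarrow> t > 0 \<Longrightarrow> of_nat t * \<tau> \<in> uhp"
  by (auto simp: uhp_def)

lemma uhp_divide_of_nat: "\<tau> \<in> uhp \<Longrightarrow> t > 0 \<Longrightarrow> \<tau> / of_nat t \<in> uhp"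
  by (auto simp: uhp_def)

section \<open>Reduction by translations and inversion\<close>

lemma periodic_of_int:
  assumes T: "\<And>\<tau>. \<tau> \<in> uhp \<Longrightarrow> G (\<tau> + 1) = G \<tau>" and "\<tau> \<in> uhp"
  shows "G (\<tau> + of_int n) = G \<tau>"
proof (induction n rule: int_induct[of _ 0])
  case (step1 i)
  have "G (\<tau> + of_int (i + 1)) = G (\<tau> + of_int i + 1)"
    by (simp add: add_ac)
  with step1 show ?case using T[of "\<tau> + of_int i"] assms by simp
next
  case (step2 i)
  have "G (\<tau> + of_int (i - 1)) = G (\<tau> + of_int (i - 1) + 1)"
    using T[of "\<tau> + of_int (i - 1)"] assms by (simp del: of_int_diff)
  also have "\<dots> = G (\<tau> + of_int i)" by simp
  finally show ?case using step2 by simp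
qed simp

text \<open>If Im tau < 1/2, an integer translation brings |Re tau| to at most 1/2; then |tau|^2 <=
  1/2, and inversion at least doubles the imaginary part. The inner induction runs over a number
  \<open>n\<close> of doublings that is large enough. The bound 1/2, weaker than that of the usual
  fundamental domain, already keeps the values of \<open>ee\<close> in a compact disc.\<close>

lemma uhp_reduce:
  assumes T: "\<And>\<tau>. \<tau> \<in> uhp \<Longrightarrow> G (\<tau> + 1) = G \<tau>"
    and S: "\<And>\<tau>. \<tau> \<in> uhp \<Longrightarrow> G (- 1 / \<tau>) = G \<tau>"
    and \<tau>: "\<tau> \<in> uhp"
  obtains \<tau>' where "\<tau>' \<in> uhp" "Im \<tau>' \<ge> 1 / 2" "G \<tau>' = G \<tau>"
proof -
  have "\<exists>\<tau>'. \<tau>' \<in> uhp \<and> Im \<tau>' \<ge> 1 / 2 \<and> G \<tau>' = G \<tau>" if "\<tau> \<in> uhp" "2 ^ n * Im \<tau> \<ge> 1 / 2" for n \<tau>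
    using that
  proof (induction n arbitrary: \<tau>)
    case (Suc n)
    show ?case
    proof (cases "Im \<tau> \<ge> 1 / 2")
      case False
      define \<tau>1 where "\<tau>1 = \<tau> + of_int (- round (Re \<tau>))"
      have 1: "\<tau>1 \<in> uhp" "Im \<tau>1 = Im \<tau>"
        using Suc.prems by (auto simp: \<tau>1_def uhp_def)
      have "\<bar>Re \<tau>1\<bar> \<le> 1 / 2"
        using of_int_round_abs_le[of "Re \<tau>"] by (simp add: \<tau>1_def abs_minus_commute)
      then have "\<bar>Re \<tau>1\<bar>\<^sup>2 \<le> (1 / 2)\<^sup>2"
        by (intro power_mono) auto
      then have "(Re \<tau>1)\<^sup>2 \<le> 1 / 4"
        by (simp add: power2_eq_square)
      moreover have "(Im \<tau>1)\<^sup>2 \<le> 1 / 4"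
      proof -
        have "(Im \<tau>1)\<^sup>2 \<le> (1 / 2)\<^sup>2"
          using False 1 Suc.prems by (intro power_mono) (auto simp: uhp_def)
        then show ?thesis by (simp add: power2_eq_square)
      qed
      ultimately have n: "(norm \<tau>1)\<^sup>2 \<le> 1 / 2"
        by (simp add: cmod_power2)
      have "norm \<tau>1 > 0" using 1 uhp_nonzero by auto
      then have "Im \<tau>1 / (1 / 2) \<le> Im (- 1 / \<tau>1)"
        unfolding Im_inversion using n 1 by (intro divide_left_mono) (auto simp: uhp_def)
      then have "2 * Im \<tau>1 \<le> Im (- 1 / \<tau>1)" by simp
      then have "2 ^ n * (2 * Im \<tau>1) \<le> 2 ^ n * Im (- 1 / \<tau>1)"
        by (intro mult_left_mono) auto
      moreover have "2 ^ n * (2 * Im \<tau>1) \<ge> 1 / 2"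
        using Suc.prems 1 by (simp add: mult_ac)
      ultimately have "2 ^ n * Im (- 1 / \<tau>1) \<ge> 1 / 2" by linarith
      from Suc.IH[OF _ this] 1 obtain \<tau>' where "\<tau>' \<in> uhp" "Im \<tau>' \<ge> 1 / 2" "G \<tau>' = G (- 1 / \<tau>1)"
        by auto
      moreover have "G (- 1 / \<tau>1) = G \<tau>"
        using S[OF 1(1)] periodic_of_int[of G \<tau> "- round (Re \<tau>)"] T Suc.prems by (simp add: \<tau>1_def)
      ultimately show ?thesis by auto
    next
      case True
      then show ?thesis using Suc.prems(1) by (intro exI[of _ \<tau>]) simp
    qed
  next
    case 0
    then show ?case by (intro exI[of _ \<tau>]) simp
  qed
  note * = this
  obtain n where "1 / 2 / Im \<tau> < 2 ^ n"
    using real_arch_pow[of 2 "1 / 2 / Im \<tau>"] by auto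
  then have "2 ^ n * Im \<tau> \<ge> 1 / 2"
    using \<tau> by (simp add: uhp_def field_simps)
  from *[OF \<tau> this] show ?thesis using that by auto
qed

text \<open>The supremum of the modulus over the disc is attained on the compact disc corresponding to
  \<open>Im \<tau> \<ge> 1/2\<close>, which contains the cusp \<open>q = 0\<close>.\<close>

lemma modular_invariant_constant:
  assumes G: "G holomorphic_on ball 0 1"
    and S: "\<And>\<tau>. \<tau> \<in> uhp \<Longrightarrow> norm (G (ee (- 1 / \<tau>))) = norm (G (ee \<tau>))"
    and q: "norm q < 1"
  shows "G q = G 0"
proof -
  \<comment> \<open>The modulus of \<open>ee\<close> on the line Im tau = 1/2.\<close>
  define r where "r = exp (- pi)"
  have r: "0 < r" "r < 1" by (auto simp: r_def)
  have "continuous_on (cball 0 r) G"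
    using G r by (intro holomorphic_on_imp_continuous_on holomorphic_on_subset[OF G]) auto
  then obtain q1 where q1: "q1 \<in> cball 0 r" "\<And>w. w \<in> cball 0 r \<Longrightarrow> norm (G w) \<le> norm (G q1)"
    using continuous_attains_sup[of "cball 0 r" "\<lambda>w. norm (G w)"] r
    by (force intro!: continuous_intros)
  have max: "norm (G w) \<le> norm (G q1)" if "w \<in> ball 0 1" for w
  proof (cases "w = 0")
    case False
    with that obtain \<tau> where \<tau>: "\<tau> \<in> uhp" "ee \<tau> = w"
      using ee_surj_uhp[of w] by auto
    obtain \<tau>' where \<tau>': "Im \<tau>' \<ge> 1 / 2" "norm (G (ee \<tau>')) = norm (G (ee \<tau>))"
      using uhp_reduce[of "\<lambda>\<tau>. norm (G (ee \<tau>))" \<tau>] S \<tau> by (auto simp: ee_add)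
    have "ee \<tau>' \<in> cball 0 r"
      using \<tau>' by (simp add: norm_ee r_def)
    with q1(2)[of "ee \<tau>'"] \<tau> \<tau>' show ?thesis by simp
  qed (use q1 r in auto)
  have "G constant_on ball 0 1"
    using G max q1 r by (intro maximum_modulus_principle[of G "ball 0 1" "ball 0 1" q1]) auto
  with q show ?thesis
    by (auto simp: constant_on_def)
qed

section \<open>Power series and Lambert series on the unit disc\<close>

lemma holomorphic_on_power_series:
  fixes a :: "nat \<Rightarrow> complex"
  assumes "\<And>q. norm q < 1 \<Longrightarrow> summable (\<lambda>n. a n * q ^ n)"
  shows "(\<lambda>q. \<Sum>n. a n * q ^ n) holomorphic_on ball 0 1"
proof -
  have "\<exists>D. ((\<lambda>q. \<Sum>n. a n * q ^ n) has_field_derivative D) (at q)" if q: "norm q < 1" for q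
  proof -
    obtain K where K: "norm q < K" "K < 1" using dense[OF q] by blast
    then have "summable (\<lambda>n. a n * of_real K ^ n)"
      using norm_ge_zero[of q] by (intro assms) (auto simp del: norm_ge_zero)
    from termdiffs_strong[OF this, of q] K show ?thesis
      using norm_ge_zero[of q] by (auto simp del: norm_ge_zero)
  qed
  then show ?thesis
    unfolding holomorphic_on_def field_differentiable_def
    by (meson has_field_derivative_at_within mem_ball_0)
qed

text \<open>Each factor n arises from one termwise differentiation followed by a multiplication by
  x.\<close>

lemma summable_power_times_geometric:
  fixes x :: complex
  assumes "norm x < 1"
  shows "summable (\<lambda>n. of_nat n ^ k * x ^ n)"
  using assms
proof (induction k arbitrary: x)
  case 0
  then show ?case by (simp add: summable_geometric)
next
  case (Suc k)
  have "summable (\<lambda>n. diffs (\<lambda>n. of_nat n ^ k) n * x ^ n)"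
    using Suc by (intro termdiff_converges[of x 1]) auto
  then have "summable (\<lambda>n. (diffs (\<lambda>n. of_nat n ^ k) n * x ^ n) * x)"
    by (rule summable_mult2)
  also have "(\<lambda>n. (diffs (\<lambda>n. of_nat n ^ k) n * x ^ n) * x) = (\<lambda>n. of_nat (Suc n) ^ Suc k * x ^ Suc n)"
    by (simp add: diffs_def mult_ac)
  finally show ?case
    by (subst (asm) summable_Suc_iff)
qed

lemma divisor_sum_le: "divisor_sum k n \<le> n ^ Suc k"
proof (cases "n = 0")
  case False
  have "divisor_sum k n \<le> (\<Sum>d | d dvd n. n ^ k)"
    unfolding divisor_sum_def using False by (intro sum_mono power_mono) (auto intro: dvd_imp_le)
  also have "\<dots> \<le> n * n ^ k"
  proof -
    have "{d. d dvd n} \<subseteq> {1..n}" using False by (auto intro: dvd_imp_le Suc_leI simp: Suc_le_eq dvd_pos_nat)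
    then have "card {d. d dvd n} \<le> n"
      using card_mono[of "{1..n}" "{d. d dvd n}"] by simp
    then show ?thesis by simp
  qed
  finally show ?thesis by simp
qed (simp add: divisor_sum_def)

text \<open>The explicit 0 at n = 0 allows series indexed by all naturals, like Taylor series at q =
  0, whereas \<open>lambert\<close> starts at 1.\<close>

definition sig :: "nat \<Rightarrow> nat \<Rightarrow> nat" where
  "sig k n = (if n = 0 then 0 else divisor_sum k n)"

text \<open>The suffix Q marks functions of q on the unit disc. There the cusp is the ordinary point
  q = 0, so holomorphy at the cusp is part of holomorphy on the disc.\<close>

definition lamQ :: "nat \<Rightarrow> complex \<Rightarrow> complex" where
  "lamQ k q = (\<Sum>n. of_nat (sig k n) * q ^ n)"

lemma summable_sig:
  fixes q :: complex
  assumes "norm q < 1"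
  shows "summable (\<lambda>n. of_nat (sig k n) * q ^ n)"
proof (rule summable_comparison_test')
  show "summable (\<lambda>n. norm (of_nat n ^ Suc k * complex_of_real (norm q) ^ n))"
  proof -
    have "summable (\<lambda>n. complex_of_real (norm (of_nat n ^ Suc k * complex_of_real (norm q) ^ n)))"
      using summable_power_times_geometric[of "complex_of_real (norm q)" "Suc k"] assms
      by (simp add: norm_mult norm_power del: power_Suc)
    then show ?thesis by (simp only: summable_complex_of_real)
  qed
  show "norm (of_nat (sig k n) * q ^ n) \<le> norm (of_nat n ^ Suc k * complex_of_real (norm q) ^ n)" for n
    using divisor_sum_le[of k n]
    by (auto simp: sig_def norm_mult norm_power simp del: power_Suc intro!: mult_right_mono simp flip: of_nat_power)
qed

lemma lamQ_has_sum:
  fixes q :: complex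
  assumes "norm q < 1"
  shows "((\<lambda>n. of_nat (sig k n) * q ^ n) has_sum lamQ k q) UNIV"
proof (rule norm_summable_imp_has_sum)
  show "(\<lambda>n. of_nat (sig k n) * q ^ n) sums lamQ k q"
    unfolding lamQ_def using summable_sig[OF assms] by (rule summable_sums)
  have "summable (\<lambda>n. of_nat (sig k n) * complex_of_real (norm q) ^ n)"
    using assms by (intro summable_sig) auto
  then have "summable (\<lambda>n. complex_of_real (norm (of_nat (sig k n) * q ^ n)))"
    by (simp add: norm_mult norm_power)
  then show "summable (\<lambda>n. norm (of_nat (sig k n) * q ^ n))"
    by (simp only: summable_complex_of_real)
qed

lemma lamQ_holomorphic: "lamQ k holomorphic_on ball 0 1"
  unfolding lamQ_def by (intro holomorphic_on_power_series summable_sig)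

lemma lambert_eq:
  assumes "\<tau> \<in> uhp"
  shows "lambert k \<tau> = lamQ k (ee \<tau>)"
  using suminf_split_head[OF summable_sig[of "ee \<tau>" k]] assms
  by (simp add: lambert_def lamQ_def norm_ee_less_1 ee_def[symmetric] sig_def)

lemma lamQ_0 [simp]: "lamQ k 0 = 0"
  by (simp add: lamQ_def sig_def suminf_finite[of "{0}"] power_0_left)

section \<open>Eisenstein series from the logarithmic derivative of the theta function\<close>

definition aL :: "complex \<Rightarrow> complex \<Rightarrow> nat \<Rightarrow> complex" where
  "aL q \<zeta> m = q ^ m * \<zeta> / (1 - q ^ m * \<zeta>)"

definition bL :: "complex \<Rightarrow> complex \<Rightarrow> nat \<Rightarrow> complex" where
  "bL q \<zeta> m = q ^ Suc m / (\<zeta> - q ^ Suc m)"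

text \<open>With q = \<open>ee \<tau>\<close> and zeta = \<open>ee z\<close> this is the derivative
  in z of the logarithm of zeta^(-1/2) times the product over m >= 0 of (1 - q^m zeta) (1 - q^(m+1)
  / zeta), which is Jacobi's odd theta function up to a factor independent of z. \<open>aL\<close>
  and \<open>bL\<close> come from the two kinds of factors.\<close>

definition logder :: "complex \<Rightarrow> complex \<Rightarrow> complex" where
  "logder \<tau> z = - complex_of_real pi * \<i> -
     2 * complex_of_real pi * \<i> * ((\<Sum>m. aL (ee \<tau>) (ee z) m) - (\<Sum>m. bL (ee \<tau>) (ee z) m))"

definition period_lattice :: "complex \<Rightarrow> complex set" where
  "period_lattice \<tau> = {z. \<exists>m n :: int. z = of_int m + of_int n * \<tau>}"

text \<open>For large m the denominator has modulus at least 1/2, uniformly for |zeta| <= K. This is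
  the majorant behind locally uniform convergence.\<close>

lemma aL_bound:
  assumes "norm q < 1" "norm \<zeta> \<le> K" "K > 0"
  shows "\<exists>M. \<forall>m\<ge>M. \<forall>\<zeta>. norm \<zeta> \<le> K \<longrightarrow> norm (aL q \<zeta> m) \<le> 2 * K * norm q ^ m"
proof -
  have "(\<lambda>m. norm q ^ m * K) \<longlonglongrightarrow> 0 * K"
    using assms by (intro tendsto_intros LIMSEQ_realpow_zero) auto
  then have "eventually (\<lambda>m. norm q ^ m * K < 1 / 2) sequentially"
    by (intro order_tendstoD) auto
  then obtain M where M: "\<And>m. m \<ge> M \<Longrightarrow> norm q ^ m * K < 1 / 2"
    by (auto simp: eventually_sequentially)
  have "norm (aL q \<zeta> m) \<le> 2 * K * norm q ^ m" if "m \<ge> M" "norm \<zeta> \<le> K" for m \<zeta>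
  proof -
    have le: "norm (q ^ m * \<zeta>) \<le> norm q ^ m * K"
      using that by (simp add: norm_mult norm_power mult_left_mono)
    also have "\<dots> < 1 / 2" using M that by simp
    finally have "norm (1 - q ^ m * \<zeta>) \<ge> 1 / 2"
      using norm_triangle_ineq2[of 1 "q ^ m * \<zeta>"] by simp
    then have "norm (aL q \<zeta> m) \<le> (norm q ^ m * K) / (1 / 2)"
      unfolding aL_def norm_divide using le by (intro frac_le) (auto intro: order_trans[OF norm_ge_zero])
    then show ?thesis by (simp add: mult_ac)
  qed
  then show ?thesis by blast
qed

lemma bL_eq_aL: "\<zeta> \<noteq> 0 \<Longrightarrow> bL q \<zeta> m = aL q (inverse \<zeta>) (Suc m)"
  by (simp add: bL_def aL_def field_simps)

lemma summable_aL: "norm q < 1 \<Longrightarrow> summable (aL q \<zeta>)"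
proof -
  assume q: "norm q < 1"
  have "norm \<zeta> \<le> norm \<zeta> + 1" "norm \<zeta> + 1 > 0"
    by (auto intro: add_nonneg_pos)
  then obtain M where M: "\<And>m. m \<ge> M \<Longrightarrow> norm (aL q \<zeta> m) \<le> 2 * (norm \<zeta> + 1) * norm q ^ m"
    using aL_bound[OF q] by meson
  show ?thesis
    by (rule summable_comparison_test'[of "\<lambda>m. 2 * (norm \<zeta> + 1) * norm q ^ m" M])
      (use q M in \<open>auto intro!: summable_mult summable_geometric\<close>)
qed

lemma summable_bL: "norm q < 1 \<Longrightarrow> \<zeta> \<noteq> 0 \<Longrightarrow> summable (bL q \<zeta>)"
proof -
  assume *: "norm q < 1" "\<zeta> \<noteq> 0"
  then have "bL q \<zeta> = (\<lambda>m. aL q (inverse \<zeta>) (Suc m))"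
    by (intro ext bL_eq_aL)
  with * show ?thesis using summable_aL[of q "inverse \<zeta>"] by (simp add: summable_Suc_iff)
qed

lemma logder_add_1: "logder \<tau> (z + 1) = logder \<tau> z"
  by (simp add: logder_def ee_add)

text \<open>Replacing zeta by q zeta moves each series by one index. What is left over, zeta / (1 -
  zeta) + 1 / (zeta - 1) = -1, produces the quasi-period. At integers z these boundary terms would
  have zero denominators.\<close>

lemma logder_add_tau:
  assumes \<tau>: "\<tau> \<in> uhp" and z: "z \<notin> \<int>"
  shows "logder \<tau> (z + \<tau>) = logder \<tau> z - 2 * complex_of_real pi * \<i>"
proof -
  define q \<zeta> where "q = ee \<tau>" and "\<zeta> = ee z"
  have q: "norm q < 1" "q \<noteq> 0" using \<tau> by (auto simp: q_def norm_ee_less_1)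
  have \<zeta>: "\<zeta> \<noteq> 0" "\<zeta> \<noteq> 1" using z by (auto simp: \<zeta>_def ee_eq_1_iff)
  have a: "(\<Sum>m. aL q (q * \<zeta>) m) = (\<Sum>m. aL q \<zeta> m) - aL q \<zeta> 0"
    using suminf_split_head[OF summable_aL[OF q(1), of \<zeta>]] by (simp add: aL_def[abs_def] mult_ac)
  have "(\<Sum>m. bL q (q * \<zeta>) (Suc m)) = (\<Sum>m. bL q (q * \<zeta>) m) - bL q (q * \<zeta>) 0"
    using q \<zeta> by (intro suminf_split_head summable_bL) auto
  also have "(\<lambda>m. bL q (q * \<zeta>) (Suc m)) = bL q \<zeta>"
  proof
    fix m
    have "bL q (q * \<zeta>) (Suc m) = (q * q ^ Suc m) / (q * (\<zeta> - q ^ Suc m))"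
      by (simp add: bL_def algebra_simps)
    also have "\<dots> = bL q \<zeta> m"
      unfolding bL_def using q by (subst mult_divide_mult_cancel_left) auto
    finally show "bL q (q * \<zeta>) (Suc m) = bL q \<zeta> m" .
  qed
  finally have b: "(\<Sum>m. bL q (q * \<zeta>) m) = (\<Sum>m. bL q \<zeta> m) + bL q (q * \<zeta>) 0"
    by simp
  have "bL q (q * \<zeta>) 0 = q / (q * (\<zeta> - 1))"
    by (simp add: bL_def algebra_simps)
  also have "\<dots> = 1 / (\<zeta> - 1)" using q by simp
  finally have ab: "aL q \<zeta> 0 + bL q (q * \<zeta>) 0 = - 1"
    using \<zeta> by (simp add: aL_def divide_simps) (simp add: algebra_simps)
  have "logder \<tau> (z + \<tau>) = - complex_of_real pi * \<i> -
      2 * complex_of_real pi * \<i> * ((\<Sum>m. aL q (q * \<zeta>) m) - (\<Sum>m. bL q (q * \<zeta>) m))"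
    by (simp add: logder_def ee_add q_def \<zeta>_def mult.commute)
  also have "\<dots> = logder \<tau> z + 2 * complex_of_real pi * \<i> * (aL q \<zeta> 0 + bL q (q * \<zeta>) 0)"
  proof -
    have "logder \<tau> z = - complex_of_real pi * \<i> -
        2 * complex_of_real pi * \<i> * ((\<Sum>m. aL q \<zeta> m) - (\<Sum>m. bL q \<zeta> m))"
      by (simp add: logder_def q_def \<zeta>_def)
    then show ?thesis unfolding a b by (simp add: algebra_simps)
  qed
  finally show ?thesis by (simp add: ab)
qed

text \<open>In the real coordinates of z with respect to 1 and tau, the lattice is the preimage of
  the closed set of integers.\<close>

lemma closed_period_lattice:
  assumes \<tau>: "\<tau> \<in> uhp"
  shows "closed (period_lattice \<tau>)"
proof -
  have "period_lattice \<tau> = (\<lambda>z. Im z / Im \<tau>) -` \<int> \<inter> (\<lambda>z. Re z - Im z / Im \<tau> * Re \<tau>) -` \<int>"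
  proof (intro set_eqI iffI)
    fix z assume "z \<in> (\<lambda>z. Im z / Im \<tau>) -` \<int> \<inter> (\<lambda>z. Re z - Im z / Im \<tau> * Re \<tau>) -` \<int>"
    then have "Im z / Im \<tau> \<in> \<int>" "Re z - Im z / Im \<tau> * Re \<tau> \<in> \<int>" by auto
    then obtain m n :: int where mn: "Im z / Im \<tau> = of_int n" "Re z - Im z / Im \<tau> * Re \<tau> = of_int m"
      unfolding Ints_def by (elim imageE)
    have "Im z = of_int n * Im \<tau>"
      using \<tau> mn(1) by (simp add: uhp_def field_simps)
    moreover have "Re z = of_int m + of_int n * Re \<tau>"
      using mn(2) unfolding mn(1) by simp
    ultimately have "z = of_int m + of_int n * \<tau>"
      by (intro complex_eqI) auto
    then show "z \<in> period_lattice \<tau>" by (auto simp: period_lattice_def)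
  qed (use \<tau> in \<open>auto simp: period_lattice_def uhp_def\<close>)
  also have "closed \<dots>"
    using \<tau> by (intro closed_Int continuous_closed_vimage continuous_intros closed_Ints) (auto simp: uhp_def)
  finally show ?thesis .
qed

text \<open>The denominators vanish only at lattice points. Since \<open>bL\<close> at zeta is
  \<open>aL\<close> at 1 / zeta with the index raised by one, the same bound serves both
  series.\<close>

lemma logder_holomorphic:
  assumes \<tau>: "\<tau> \<in> uhp"
  shows "logder \<tau> holomorphic_on - period_lattice \<tau>"
proof -
  define S q where "S = - period_lattice \<tau>" and "q = ee \<tau>"
  have S: "open S" using closed_period_lattice[OF \<tau>] by (simp add: S_def open_Compl)
  have q: "norm q < 1" "q \<noteq> 0" using \<tau> by (auto simp: q_def norm_ee_less_1)
  have na: "1 - q ^ m * ee z \<noteq> 0" if "z \<in> S" for z m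
  proof
    assume "1 - q ^ m * ee z = 0"
    then have "ee (of_nat m * \<tau> + z) = 1" by (simp add: q_def ee_power ee_add)
    then obtain n where "of_nat m * \<tau> + z = of_int n" by (auto simp: ee_eq_1_iff elim: Ints_cases)
    then have "z = of_int n + of_int (- int m) * \<tau>" by (simp add: algebra_simps)
    with that show False unfolding S_def period_lattice_def by blast
  qed
  have nb: "ee z - q ^ m \<noteq> 0" if "z \<in> S" for z m
  proof
    assume "ee z - q ^ m = 0"
    then have "ee (z - of_nat m * \<tau>) = 1" by (simp add: q_def ee_power ee_diff)
    then obtain n where "z - of_nat m * \<tau> = of_int n" by (auto simp: ee_eq_1_iff elim: Ints_cases)
    then have "z = of_int n + of_int (int m) * \<tau>" by (simp add: algebra_simps)
    with that show False unfolding S_def period_lattice_def by blast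
  qed
  have *: "\<exists>d>0. cball z d \<subseteq> S \<and>
      uniform_limit (cball z d) (\<lambda>n z. \<Sum>m<n. aL q (ee z) m) (\<lambda>z. \<Sum>m. aL q (ee z) m) sequentially"
    if z: "z \<in> S" for z
  proof -
    obtain d where d: "d > 0" "cball z d \<subseteq> S"
      using S z open_contains_cball by blast
    have "compact (ee ` cball z d)"
      by (intro compact_continuous_image continuous_intros compact_cball)
    then have "bounded (ee ` cball z d)" by (rule compact_imp_bounded)
    then obtain K where K: "K > 0" "\<And>w. w \<in> cball z d \<Longrightarrow> norm (ee w) \<le> K"
      unfolding bounded_pos by auto
    obtain M where M: "\<And>m \<zeta>. m \<ge> M \<Longrightarrow> norm \<zeta> \<le> K \<Longrightarrow> norm (aL q \<zeta> m) \<le> 2 * K * norm q ^ m"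
      using aL_bound[OF q(1), of 0 K] K by auto
    have "uniform_limit (cball z d) (\<lambda>n z. \<Sum>m<n. aL q (ee z) m) (\<lambda>z. \<Sum>m. aL q (ee z) m) sequentially"
    proof (rule Weierstrass_m_test_ev)
      show "summable (\<lambda>m. 2 * K * norm q ^ m)"
        using q by (auto intro!: summable_mult summable_geometric)
      show "\<forall>\<^sub>F m in sequentially. \<forall>w\<in>cball z d. norm (aL q (ee w) m) \<le> 2 * K * norm q ^ m"
        using eventually_ge_at_top[of M] by eventually_elim (use M K in blast)
    qed
    with d show ?thesis by blast
  qed
  have A: "(\<lambda>z. \<Sum>m. aL q (ee z) m) holomorphic_on S"
  proof (rule holomorphic_uniform_sequence[OF S, where f = "\<lambda>n z. \<Sum>m<n. aL q (ee z) m"])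
    show "(\<lambda>z. \<Sum>m<n. aL q (ee z) m) holomorphic_on S" for n
      unfolding aL_def by (intro holomorphic_intros) (use na in auto)
  qed (use * in blast)
  have "(\<lambda>z. \<Sum>m. bL q (ee z) m) holomorphic_on S"
  proof (rule holomorphic_uniform_sequence[OF S, where f = "\<lambda>n z. \<Sum>m<n. bL q (ee z) m"])
    show "(\<lambda>z. \<Sum>m<n. bL q (ee z) m) holomorphic_on S" for n
      unfolding bL_def by (intro holomorphic_intros) (use nb in \<open>auto simp del: power_Suc\<close>)
    show "\<exists>d>0. cball z d \<subseteq> S \<and>
      uniform_limit (cball z d) (\<lambda>n z. \<Sum>m<n. bL q (ee z) m) (\<lambda>z. \<Sum>m. bL q (ee z) m) sequentially"
      if z: "z \<in> S" for z
    proof -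
      obtain d where d: "d > 0" "cball z d \<subseteq> S"
        using S z open_contains_cball by blast
      have "compact ((\<lambda>w. ee (- w)) ` cball z d)"
        by (intro compact_continuous_image continuous_intros compact_cball)
      then have "bounded ((\<lambda>w. ee (- w)) ` cball z d)" by (rule compact_imp_bounded)
      then obtain K where K: "K > 0" "\<And>w. w \<in> cball z d \<Longrightarrow> norm (ee (- w)) \<le> K"
        unfolding bounded_pos by auto
      obtain M where M: "\<And>m \<zeta>. m \<ge> M \<Longrightarrow> norm \<zeta> \<le> K \<Longrightarrow> norm (aL q \<zeta> m) \<le> 2 * K * norm q ^ m"
        using aL_bound[OF q(1), of 0 K] K by auto
      have "uniform_limit (cball z d) (\<lambda>n z. \<Sum>m<n. bL q (ee z) m) (\<lambda>z. \<Sum>m. bL q (ee z) m) sequentially"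
      proof (rule Weierstrass_m_test_ev)
        show "summable (\<lambda>m. 2 * K * norm q ^ Suc m)"
          using q by (auto intro!: summable_mult summable_geometric)
        show "\<forall>\<^sub>F m in sequentially. \<forall>w\<in>cball z d. norm (bL q (ee w) m) \<le> 2 * K * norm q ^ Suc m"
          using eventually_ge_at_top[of M]
        proof eventually_elim
          case (elim m)
          then show ?case using M[of "Suc m"] K by (simp add: bL_eq_aL flip: ee_minus)
        qed
      qed
      with d show ?thesis by blast
    qed
  qed
  with A show ?thesis
    unfolding logder_def S_def q_def by (intro holomorphic_intros)
qed

section \<open>Taylor expansion of the logarithmic derivative at z = 0\<close>

lemma eventually_norm_less_nhds_0: "\<epsilon> > 0 \<Longrightarrow> eventually (\<lambda>z::complex. norm z < \<epsilon>) (nhds 0)"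
  using eventually_nhds_metric[of "\<lambda>z::complex. norm z < \<epsilon>" 0] by auto

lemma has_sum_diff:
  fixes f g :: "'a \<Rightarrow> 'b :: real_normed_vector"
  assumes "(f has_sum a) A" "(g has_sum b) A"
  shows "((\<lambda>x. f x - g x) has_sum (a - b)) A"
  using has_sum_add[OF assms(1), of "\<lambda>x. - g x" "- b"] assms(2) by (simp add: has_sum_uminus)

lemma has_sum_exp: "((\<lambda>n. x ^ n / fact n) has_sum exp x) (UNIV :: nat set)" for x :: "'a :: {banach, real_normed_field}"
proof (rule norm_summable_imp_has_sum)
  show "(\<lambda>n. x ^ n / fact n) sums exp x"
    using exp_converges[of x] by (simp add: scaleR_conv_of_real divide_inverse mult_ac)
  show "summable (\<lambda>n. norm (x ^ n / fact n))"
    using summable_norm_exp[of x] by (simp add: scaleR_conv_of_real divide_inverse mult_ac norm_mult norm_power norm_inverse)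
qed

text \<open>Grouping the pairs (m, r) by their product n = m r turns the double sum into divisor
  sums.\<close>

lemma has_sum_divisors:
  fixes q :: complex
  assumes "norm q < 1"
  shows "((\<lambda>(m, r). of_nat r ^ k * q ^ (m * r)) has_sum lamQ k q) ({1..} \<times> {1..})"
proof -
  have fin: "finite {r. r dvd n}" if "n > 0" for n :: nat using that by simp
  have inner: "((\<lambda>r. of_nat r ^ k * q ^ n) has_sum (of_nat (sig k n) * q ^ n)) {r. r dvd n}"
    if "n \<in> {1..}" for n
    using that by (intro has_sum_finiteI) (auto simp: sig_def divisor_sum_def sum_distrib_right)
  have outer: "((\<lambda>n. of_nat (sig k n) * q ^ n) has_sum lamQ k q) {1..}"
    using lamQ_has_sum[OF assms, of k]
    by (subst has_sum_cong_neutral[of UNIV "{1..}" _ "\<lambda>n. of_nat (sig k n) * q ^ n"]) (auto simp: sig_def not_le)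
  have summ: "(\<lambda>(n, r). of_nat r ^ k * q ^ n) summable_on (SIGMA n:{1..}. {r. r dvd n})"
  proof (rule abs_summable_summable, rule summable_on_SigmaI)
    show "((\<lambda>r. norm (case (n, r) of (n, r) \<Rightarrow> of_nat r ^ k * q ^ n)) has_sum
        (of_nat (sig k n) * norm q ^ n)) {r. r dvd n}" if "n \<in> {1..}" for n
      using that by (intro has_sum_finiteI)
        (auto simp: sig_def divisor_sum_def sum_distrib_right norm_mult norm_power)
    have "(\<lambda>n. norm (of_nat (sig k n) * q ^ n)) summable_on {1..}"
      using has_sum_imp_summable[OF outer] by (subst (asm) summable_on_iff_abs_summable_on_complex)
    then show "(\<lambda>n. of_nat (sig k n) * norm q ^ n) summable_on {1..}"
      by (simp add: norm_mult norm_power)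
  qed auto
  have "((\<lambda>(n, r). of_nat r ^ k * q ^ n) has_sum lamQ k q) (SIGMA n:{1..}. {r. r dvd n})"
    by (rule has_sum_SigmaI[OF _ outer summ]) (use inner in auto)
  also have "?this \<longleftrightarrow> ?thesis"
    by (rule has_sum_reindex_bij_witness[of _ "\<lambda>(m, r). (m * r, r)" "\<lambda>(n, r). (n div r, r)"])
      (auto elim!: dvdE simp: Suc_le_eq mult.commute)
  finally show ?thesis .
qed

text \<open>The factor 1 - (-1)^j removes the even coefficients; j = 1, 3, 5 carry the q-expansions
  of \<open>Eis2\<close>, \<open>Eis4\<close>, \<open>Eis6\<close> apart from their constant
  terms.\<close>

definition logder_coeff :: "complex \<Rightarrow> nat \<Rightarrow> complex" where
  "logder_coeff \<tau> j = - 2 * complex_of_real pi * \<i> * (2 * complex_of_real pi * \<i>) ^ j * (1 - (- 1) ^ j) / fact j *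
     lamQ j (ee \<tau>)"

text \<open>The term m = 0 of \<open>aL\<close>, which has the pole at z = 0, is left out. The
  remaining geometric series give the sum over m, r >= 1 of q^(m r) (zeta^r - zeta^(-r)); expanding
  both exponentials in z and summing over (m, r) first yields the coefficients. The triple sum
  converges absolutely for |z| < Im tau.\<close>

lemma logder_regular_part_expansion:
  assumes \<tau>: "\<tau> \<in> uhp"
  shows "(\<lambda>z. - 2 * complex_of_real pi * \<i> * ((\<Sum>m. aL (ee \<tau>) (ee z) (Suc m)) - (\<Sum>m. bL (ee \<tau>) (ee z) m)))
    has_fps_expansion Abs_fps (logder_coeff \<tau>)"
proof (rule has_fps_expansionI)
  define q where "q = ee \<tau>"
  have q: "norm q < 1" "q \<noteq> 0" using \<tau> by (auto simp: q_def norm_ee_less_1)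
  define w where "w = 2 * complex_of_real pi * \<i>"
  define \<epsilon> where "\<epsilon> = Im \<tau>"
  have \<epsilon>: "\<epsilon> > 0" using \<tau> by (simp add: \<epsilon>_def uhp_def)
  have main: "((\<lambda>j. w ^ j * (1 - (- 1) ^ j) / fact j * lamQ j q * z ^ j) sums
      ((\<Sum>m. aL q (ee z) (Suc m)) - (\<Sum>m. bL q (ee z) m)))" if z: "norm z < \<epsilon>" for z
  proof -
    define \<zeta> where "\<zeta> = ee z"
    have \<zeta>0: "\<zeta> \<noteq> 0" by (simp add: \<zeta>_def)
    have \<zeta>: "exp (w * of_nat r * z) = \<zeta> ^ r" "exp (- (w * of_nat r * z)) = inverse \<zeta> ^ r" for r
      by (simp_all add: \<zeta>_def ee_power w_def power_inverse ee_minus[symmetric])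
         (simp_all add: ee_def mult_ac)
    define t where "t = (\<lambda>((m::nat, r::nat), j::nat). q ^ (m * r) * ((w * of_nat r * z) ^ j / fact j - (- (w * of_nat r * z)) ^ j / fact j))"
    \<comment> \<open>The ratio of the majorising geometric series in r; |z| < Im tau says exactly
      that it is below 1.\<close>
    define s where "s = norm q * exp (2 * pi * norm z)"
    have s: "0 \<le> s" "s < 1"
    proof -
      have "s = exp (- 2 * pi * Im \<tau> + 2 * pi * norm z)"
        by (simp add: s_def q_def norm_ee flip: exp_add)
      also have "\<dots> < 1"
        using z by (simp add: \<epsilon>_def)
      finally show "s < 1" .
    qed (simp add: s_def)
    have inner: "((\<lambda>j. t ((m, r), j)) has_sum (q ^ (m * r) * (\<zeta> ^ r - inverse \<zeta> ^ r))) UNIV" for m r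
      unfolding t_def prod.case
      by (intro has_sum_cmult_right has_sum_diff) (use has_sum_exp[of "w * of_nat r * z"] has_sum_exp[of "- (w * of_nat r * z)"] in \<open>simp_all add: \<zeta>\<close>)
    have geo: "(\<lambda>(m, r). norm q ^ (m - 1) * s ^ r) summable_on {1..} \<times> {1..}"
    proof (rule summable_on_SigmaI[where g = "\<lambda>m. norm q ^ (m - 1) * (s / (1 - s))"])
      show "((\<lambda>r. case (m, r) of (m, r) \<Rightarrow> norm q ^ (m - 1) * s ^ r) has_sum (norm q ^ (m - 1) * (s / (1 - s)))) {1..}" for m
        unfolding prod.case by (intro has_sum_cmult_right has_sum_geometric_from_1) (use s in auto)
      have "(\<lambda>m. norm q ^ m) summable_on UNIV"
        using q by (intro summable_nonneg_imp_summable_on summable_geometric) auto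
      also have "?this \<longleftrightarrow> (\<lambda>m. norm q ^ (m - 1)) summable_on {1..}"
        by (rule summable_on_reindex_bij_witness[of _ "\<lambda>m. m - 1" Suc]) auto
      finally show "(\<lambda>m. norm q ^ (m - 1) * (s / (1 - s))) summable_on {1..}"
        by (rule summable_on_cmult_left)
      show "0 \<le> (case (m, r) of (m, r) \<Rightarrow> norm q ^ (m - 1) * s ^ r)" for m r
        unfolding prod.case by (intro mult_nonneg_nonneg zero_le_power norm_ge_zero s)
    qed
    have summ: "t summable_on (({1..} \<times> {1..}) \<times> UNIV)"
    proof -
      define u where "u = (\<lambda>((m::nat, r::nat), j::nat). norm q ^ (m * r) * (2 * ((2 * pi * real r * norm z) ^ j / fact j)))"
      have "u summable_on (({1..} \<times> {1..}) \<times> UNIV)"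
      proof (rule summable_on_SigmaI[where g = "\<lambda>(m, r). norm q ^ (m * r) * (2 * exp (2 * pi * real r * norm z))"])
        show "((\<lambda>j. u (mr, j)) has_sum (case mr of (m, r) \<Rightarrow> norm q ^ (m * r) * (2 * exp (2 * pi * real r * norm z)))) UNIV" for mr
        proof (cases mr)
          case (Pair m r)
          show ?thesis
            unfolding u_def Pair prod.case by (intro has_sum_cmult_right has_sum_exp)
        qed
        show "(\<lambda>(m, r). norm q ^ (m * r) * (2 * exp (2 * pi * real r * norm z))) summable_on {1..} \<times> {1..}"
        proof (rule summable_on_comparison_test)
          show "(\<lambda>x. 2 * (case x of (m, r) \<Rightarrow> norm q ^ (m - 1) * s ^ r)) summable_on {1..} \<times> {1..}"
            by (intro summable_on_cmult_right geo)
          show "0 \<le> (case x of (m, r) \<Rightarrow> norm q ^ (m * r) * (2 * exp (2 * pi * real r * norm z)))" for x :: "nat \<times> nat"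
            by (cases x) auto
          show "(case x of (m, r) \<Rightarrow> norm q ^ (m * r) * (2 * exp (2 * pi * real r * norm z)))
            \<le> 2 * (case x of (m, r) \<Rightarrow> norm q ^ (m - 1) * s ^ r)" if xin: "x \<in> {1..} \<times> {1..}" for x
          proof -
            obtain m r where x: "x = (m, r)" "m \<ge> 1" "r \<ge> 1" using xin by (cases x) auto
            \<comment> \<open>Since m r >= (m - 1) + r, the majorant splits into separate geometric
              factors in m and in r.\<close>
            have "norm q ^ (m * r) = norm q ^ ((m - 1) * r) * norm q ^ r"
              using x by (cases m) (simp_all add: power_add)
            also have "\<dots> \<le> norm q ^ (m - 1) * norm q ^ r"
              using x q by (intro mult_right_mono power_decreasing) auto
            finally have "norm q ^ (m * r) * exp (2 * pi * real r * norm z) \<le> norm q ^ (m - 1) * norm q ^ r * exp (2 * pi * real r * norm z)"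
              by (intro mult_right_mono) auto
            also have "\<dots> = norm q ^ (m - 1) * s ^ r"
              by (simp add: s_def power_mult_distrib exp_of_nat_mult[symmetric] mult_ac)
            finally show ?thesis by (simp add: x)
          qed
        qed
        show "0 \<le> u (mr, j)" for mr j
          unfolding u_def prod.case by (cases mr) auto
      qed
      moreover have "norm (t x) \<le> u x" for x
      proof -
        obtain m r j where x: "x = ((m, r), j)" by (cases x) auto
        have "norm ((w * of_nat r * z) ^ j / fact j - (- (w * of_nat r * z)) ^ j / fact j) \<le>
          norm ((w * of_nat r * z) ^ j / fact j) + norm ((- (w * of_nat r * z)) ^ j / fact j)"
          by (rule norm_triangle_ineq4)
        also have "\<dots> = 2 * ((2 * pi * real r * norm z) ^ j / fact j)"
          by (simp add: norm_mult norm_power norm_divide w_def)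
        finally have "norm q ^ (m * r) * norm ((w * of_nat r * z) ^ j / fact j - (- (w * of_nat r * z)) ^ j / fact j)
            \<le> norm q ^ (m * r) * (2 * ((2 * pi * real r * norm z) ^ j / fact j))"
          by (intro mult_left_mono) auto
        then show ?thesis
          unfolding x t_def u_def prod.case norm_mult norm_power .
      qed
      ultimately have "(\<lambda>x. norm (t x)) summable_on (({1..} \<times> {1..}) \<times> UNIV)"
        by (rule Infinite_Sum.abs_summable_on_comparison_test')
      then show ?thesis by (rule abs_summable_summable)
    qed
    define T where "T = infsum t (({1..} \<times> {1..}) \<times> UNIV)"
    have T: "(t has_sum T) (({1..} \<times> {1..}) \<times> UNIV)"
      using summ by (simp add: T_def)
    have T1: "((\<lambda>mr. case mr of (m, r) \<Rightarrow> q ^ (m * r) * (\<zeta> ^ r - inverse \<zeta> ^ r)) has_sum T) ({1..} \<times> {1..})"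
      by (rule has_sum_SigmaD[OF T]) (use inner in auto)
    have T2: "((\<lambda>r. q ^ (m * r) * (\<zeta> ^ r - inverse \<zeta> ^ r)) has_sum (aL q \<zeta> m - bL q \<zeta> (m - 1))) {1..}"
      if "m \<in> {1..}" for m
    proof -
      have n: "norm \<zeta> \<le> exp (2 * pi * norm z)" "norm (inverse \<zeta>) \<le> exp (2 * pi * norm z)"
        using abs_Im_le_cmod[of z] mult_left_mono[of "- Im z" "norm z" pi] mult_left_mono[of "Im z" "norm z" pi]
        by (auto simp: \<zeta>_def norm_ee ee_minus[symmetric])
      have "norm (q ^ m * x) < 1" if "norm x \<le> exp (2 * pi * norm z)" for x
      proof -
        have "norm (q ^ m * x) \<le> norm q ^ 1 * exp (2 * pi * norm z)"
          unfolding norm_mult norm_power using \<open>m \<in> {1..}\<close> q that by (intro mult_mono power_decreasing) auto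
        with s show ?thesis by (simp add: s_def)
      qed
      from this[OF n(1)] this[OF n(2)]
      have "((\<lambda>r. (q ^ m * \<zeta>) ^ r - (q ^ m * inverse \<zeta>) ^ r) has_sum
          (q ^ m * \<zeta> / (1 - q ^ m * \<zeta>) - q ^ m * inverse \<zeta> / (1 - q ^ m * inverse \<zeta>))) {1..}"
        by (intro has_sum_diff has_sum_geometric_from_1)
      moreover have "bL q \<zeta> (m - 1) = q ^ m * inverse \<zeta> / (1 - q ^ m * inverse \<zeta>)"
        using that \<zeta>0 by (simp add: bL_eq_aL aL_def)
      moreover have "(\<lambda>r. q ^ (m * r) * (\<zeta> ^ r - inverse \<zeta> ^ r)) = (\<lambda>r. (q ^ m * \<zeta>) ^ r - (q ^ m * inverse \<zeta>) ^ r)"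
        unfolding power_mult_distrib power_mult right_diff_distrib ..
      ultimately show ?thesis
        by (simp add: aL_def)
    qed
    have "((\<lambda>m. aL q \<zeta> m - bL q \<zeta> (m - 1)) has_sum T) {1..}"
      by (rule has_sum_SigmaD[OF T1]) (use T2 in auto)
    also have "?this \<longleftrightarrow> ((\<lambda>m. aL q \<zeta> (Suc m) - bL q \<zeta> m) has_sum T) UNIV"
      by (rule has_sum_reindex_bij_witness[of _ Suc "\<lambda>m. m - 1"]) auto
    finally have "(\<lambda>m. aL q \<zeta> (Suc m) - bL q \<zeta> m) sums T"
      by (rule has_sum_imp_sums)
    moreover have "(\<lambda>m. aL q \<zeta> (Suc m) - bL q \<zeta> m) sums ((\<Sum>m. aL q \<zeta> (Suc m)) - (\<Sum>m. bL q \<zeta> m))"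
      using summable_aL[OF q(1), of \<zeta>] summable_bL[OF q(1) \<zeta>0]
      by (intro sums_diff summable_sums) (simp_all add: summable_Suc_iff)
    ultimately have Teq: "T = (\<Sum>m. aL q \<zeta> (Suc m)) - (\<Sum>m. bL q \<zeta> m)"
      by (rule sums_unique2)
    \<comment> \<open>Exchange of summation: j becomes the outer index, (m, r) the inner
      one.\<close>
    from T have T3: "((\<lambda>(j, mr). t (mr, j)) has_sum T) (UNIV \<times> ({1..} \<times> {1..}))"
      by (subst (asm) has_sum_swap)
    have T4: "((\<lambda>mr. t (mr, j)) has_sum (w ^ j * (1 - (- 1) ^ j) / fact j * z ^ j * lamQ j q)) ({1..} \<times> {1..})" for j
    proof -
      have "((\<lambda>mr. (w ^ j * (1 - (- 1) ^ j) / fact j * z ^ j) * (case mr of (m, r) \<Rightarrow> of_nat r ^ j * q ^ (m * r))) has_sum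
          (w ^ j * (1 - (- 1) ^ j) / fact j * z ^ j * lamQ j q)) ({1..} \<times> {1..})"
        by (intro has_sum_cmult_right has_sum_divisors q)
      also have "(\<lambda>mr. (w ^ j * (1 - (- 1) ^ j) / fact j * z ^ j) * (case mr of (m, r) \<Rightarrow> of_nat r ^ j * q ^ (m * r))) = (\<lambda>mr. t (mr, j))"
        by (auto simp: t_def fun_eq_iff power_mult_distrib power_minus[of "_ * _"] diff_divide_distrib algebra_simps)
      finally show ?thesis .
    qed
    have "((\<lambda>j. w ^ j * (1 - (- 1) ^ j) / fact j * z ^ j * lamQ j q) has_sum T) UNIV"
      by (rule has_sum_SigmaD[OF T3]) (use T4 in auto)
    then show ?thesis
      unfolding Teq \<zeta>_def by (intro has_sum_imp_sums) (simp add: mult_ac)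
  qed
  show "\<forall>\<^sub>F z in nhds 0. (\<lambda>n. fps_nth (Abs_fps (logder_coeff \<tau>)) n * z ^ n) sums
     (- 2 * complex_of_real pi * \<i> * ((\<Sum>m. aL (ee \<tau>) (ee z) (Suc m)) - (\<Sum>m. bL (ee \<tau>) (ee z) m)))"
    using eventually_norm_less_nhds_0[OF \<epsilon>]
  proof eventually_elim
    case (elim z)
    from sums_mult[OF main[OF elim], of "- w"] show ?case
      by (simp add: logder_coeff_def w_def q_def mult_ac)
  qed
qed

text \<open>This is pi cot(pi z) - 1/z, with its removable value 0 at the origin.\<close>

definition cot_regular :: "complex \<Rightarrow> complex" where
  "cot_regular z = (if z = 0 then 0 else
     (complex_of_real pi * \<i> * z * (ee z + 1) - (ee z - 1)) / (z * (ee z - 1)))"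

text \<open>With w = 2 pi i, the coefficient of z^(n-1) is w^n B_n / n!, which for n = 2, 4, 6 gives
  the factors 1/12, -1/720, 1/30240. They are found recursively from \<open>C * G = F\<close>, where
  numerator and denominator are explicit exponential series.\<close>

lemma cot_regular_expansion:
  obtains C where "cot_regular has_fps_expansion C"
    and "fps_nth C 1 = (2 * complex_of_real pi * \<i>) ^ 2 / 12"
    and "fps_nth C 3 = - ((2 * complex_of_real pi * \<i>) ^ 4) / 720"
    and "fps_nth C 5 = (2 * complex_of_real pi * \<i>) ^ 6 / 30240"
proof -
  define w where "w = 2 * complex_of_real pi * \<i>"
  have w: "w \<noteq> 0" by (simp add: w_def)
  define F where "F = fps_const (w / 2) * fps_X * (fps_exp w + 1) - (fps_exp w - 1)"
  define G where "G = fps_X * (fps_exp w - 1)"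
  have F: "(\<lambda>z. w / 2 * z * (exp (w * z) + 1) - (exp (w * z) - 1)) has_fps_expansion F"
    unfolding F_def by (intro fps_expansion_intros)
  have G: "(\<lambda>z. z * (exp (w * z) - 1)) has_fps_expansion G"
    unfolding G_def by (intro fps_expansion_intros)
  have Fn: "fps_nth F n = (if n = 0 then 0 else if n = 1 then 0 else w ^ n * (1 / (2 * fact (n - 1)) - 1 / fact n))" for n
  proof (cases n)
    case (Suc m)
    then show ?thesis
      by (cases m) (simp_all add: F_def mult.assoc fps_exp_def field_simps del: fact_Suc)
  qed (simp add: F_def)
  have Gn: "fps_nth G n = (if n \<le> 1 then 0 else w ^ (n - 1) / fact (n - 1))" for n
    by (cases n) (auto simp: G_def fps_exp_def)
  have G2: "fps_nth G 2 = w" by (simp add: Gn)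
  have sG: "subdegree G = 2"
    by (rule subdegreeI) (use w G2 in \<open>auto simp: Gn\<close>)
  have F2: "fps_nth F n = 0" if "n \<le> 2" for n
  proof -
    have "n = 0 \<or> n = 1 \<or> n = 2" using that by linarith
    then show ?thesis by (auto simp: Fn)
  qed
  have F3: "fps_nth F 3 = w ^ 3 / 12"
    by (simp add: Fn fact_numeral)
  have sF: "subdegree F \<ge> 3"
    by (rule subdegree_geI) (use F3 w F2 in auto)
  have G0: "G \<noteq> 0" using sG by auto
  have "(\<lambda>z. if z = 0 then 0 else (w / 2 * z * (exp (w * z) + 1) - (exp (w * z) - 1)) / (z * (exp (w * z) - 1)))
      has_fps_expansion F / G"
    using sF sG F2[of 2] by (intro has_fps_expansion_divide F G G0) auto
  also have "(\<lambda>z. if z = 0 then 0 else (w / 2 * z * (exp (w * z) + 1) - (exp (w * z) - 1)) / (z * (exp (w * z) - 1))) = cot_regular"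
    by (auto simp: cot_regular_def w_def ee_def)
  finally have exp: "cot_regular has_fps_expansion F / G" .
  define C where "C = F / G"
  have CG: "C * G = F"
  proof -
    have "F \<noteq> 0" using sF by auto
    then have "G dvd F" using sF sG G0 by (simp add: fps_dvd_iff)
    then show ?thesis by (simp add: C_def)
  qed
  have nth: "(\<Sum>i=0..n. fps_nth C i * fps_nth G (n - i)) = fps_nth F n" for n
    using CG by (simp flip: fps_mult_nth)
  have C0: "fps_nth C 0 = 0"
    using nth[of 2] w F2[of 2] by (simp add: sum.atLeast0_atMost_Suc numeral_2_eq_2 Gn)
  have C1: "fps_nth C 1 = w ^ 2 / 12"
    using nth[of 3] w C0 unfolding F3 by (simp add: sum.atLeast0_atMost_Suc eval_nat_numeral Gn)
  have C2: "fps_nth C 2 = 0"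
    using nth[of 4] w
    by (simp add: sum.atLeast0_atMost_Suc eval_nat_numeral Gn Fn C0 C1[unfolded One_nat_def] field_simps)
  have C2': "fps_nth C (Suc (Suc 0)) = 0" using C2 by (simp add: eval_nat_numeral)
  have C3: "fps_nth C 3 = - (w ^ 4) / 720"
  proof -
    have "w * (fps_nth C 3 * 5760 + 8 * w ^ 4) = 0"
      using nth[of 5] w
      by (simp add: sum.atLeast0_atMost_Suc eval_nat_numeral Gn Fn C0 C1[unfolded One_nat_def]
        C2' field_simps)
    then have "fps_nth C 3 * 5760 = - 8 * w ^ 4"
      using w by (simp add: add_eq_0_iff)
    moreover have "fps_nth C 3 = fps_nth C 3 * 5760 / 5760" by simp
    ultimately have "fps_nth C 3 = - 8 * w ^ 4 / 5760" by (simp only:)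
    then show ?thesis by simp
  qed
  have C3': "fps_nth C (Suc (Suc (Suc 0))) = - (w ^ 4) / 720" using C3 by (simp add: eval_nat_numeral)
  have C4: "fps_nth C 4 = 0"
    using nth[of 6] w
    by (simp add: sum.atLeast0_atMost_Suc eval_nat_numeral Gn Fn C0 C1[unfolded One_nat_def]
      C2' C3' field_simps)
  have C4': "fps_nth C (Suc (Suc (Suc (Suc 0)))) = 0" using C4 by (simp add: eval_nat_numeral)
  have C5: "fps_nth C 5 = w ^ 6 / 30240"
    using nth[of 7] w
    by (simp add: sum.atLeast0_atMost_Suc eval_nat_numeral Gn Fn C0 C1[unfolded One_nat_def]
      C2' C3' C4' field_simps)
  from that[of C] exp C1 C3 C5 show ?thesis
    unfolding C_def w_def by blast
qed

lemma has_fps_expansion_scale: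
  fixes f :: "complex \<Rightarrow> complex"
  assumes "f has_fps_expansion F"
  shows "(\<lambda>z. f (c * z)) has_fps_expansion Abs_fps (\<lambda>n. fps_nth F n * c ^ n)"
proof (rule has_fps_expansionI)
  have "eventually (\<lambda>z. z \<in> eball 0 (fps_conv_radius F)) (nhds 0)"
    using assms by (intro eventually_nhds_in_open) (auto simp: has_fps_expansion_def zero_ereal_def)
  moreover have "eventually (\<lambda>z. eval_fps F z = f z) (nhds 0)"
    using assms by (simp add: has_fps_expansion_def)
  ultimately have "eventually (\<lambda>z. (\<lambda>n. fps_nth F n * z ^ n) sums f z) (nhds 0)"
    by eventually_elim (metis sums_eval_fps in_eball_iff dist_0_norm dist_norm diff_zero norm_minus_commute)
  moreover have "filterlim (\<lambda>z. c * z) (nhds 0) (nhds 0)"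
    by (rule tendsto_eq_intros filterlim_ident | simp)+
  ultimately have "eventually (\<lambda>z. (\<lambda>n. fps_nth F n * (c * z) ^ n) sums f (c * z)) (nhds 0)"
    by (rule eventually_compose_filterlim)
  then show "eventually (\<lambda>z. (\<lambda>n. fps_nth (Abs_fps (\<lambda>n. fps_nth F n * c ^ n)) n * z ^ n) sums f (c * z)) (nhds 0)"
    by (simp add: power_mult_distrib mult_ac)
qed

text \<open>The difference \<open>N\<close> of the transformed and the original
  \<open>logder\<close>, corrected by a term linear in z, is doubly periodic: the linear term
  compensates the different quasi-periods. The poles 1/z cancel, so \<open>N\<close> is entire and
  bounded, hence constant, and it is 0 at the origin. Its vanishing Taylor coefficients are the
  claim for all n at once; the linear term is seen only at n = 1, where it becomes the anomaly of
  \<open>Eis2\<close>.\<close>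

lemma logder_inversion_coeffs:
  assumes \<tau>: "\<tau> \<in> uhp" and C: "cot_regular has_fps_expansion C"
  shows "(fps_nth C n + logder_coeff (- 1 / \<tau>) n) / \<tau> ^ Suc n =
    fps_nth C n + logder_coeff \<tau> n + (if n = 1 then 2 * complex_of_real pi * \<i> / \<tau> else 0)"
proof -
  define \<tau>' w where "\<tau>' = - 1 / \<tau>" and "w = 2 * complex_of_real pi * \<i>"
  define R where "R = (\<lambda>\<tau> z. - w * ((\<Sum>m. aL (ee \<tau>) (ee z) (Suc m)) - (\<Sum>m. bL (ee \<tau>) (ee z) m)))"
  have \<tau>': "\<tau>' \<in> uhp" using \<tau> by (simp add: \<tau>'_def)
  have \<tau>0: "\<tau> \<noteq> 0" using \<tau> by (rule uhp_nonzero)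
  have R: "R \<tau> has_fps_expansion Abs_fps (logder_coeff \<tau>)" if "\<tau> \<in> uhp" for \<tau>
    using logder_regular_part_expansion[OF that] by (simp add: R_def w_def)
  define \<Lambda> where "\<Lambda> = period_lattice \<tau>"
  have \<Lambda>': "z / \<tau> \<in> period_lattice \<tau>' \<longleftrightarrow> z \<in> \<Lambda>" for z
  proof
    assume "z / \<tau> \<in> period_lattice \<tau>'"
    then obtain m n :: int where "z / \<tau> = of_int m + of_int n * \<tau>'" by (auto simp: period_lattice_def)
    then have "z = of_int (- n) + of_int m * \<tau>" using \<tau>0 by (simp add: \<tau>'_def field_simps)
    then show "z \<in> \<Lambda>" unfolding \<Lambda>_def period_lattice_def by blast
  next
    assume "z \<in> \<Lambda>"
    then obtain m n :: int where "z = of_int m + of_int n * \<tau>" by (auto simp: period_lattice_def \<Lambda>_def)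
    then have "z / \<tau> = of_int n + of_int (- m) * \<tau>'" using \<tau>0 by (simp add: \<tau>'_def field_simps)
    then show "z / \<tau> \<in> period_lattice \<tau>'" unfolding period_lattice_def by blast
  qed
  have \<Lambda>_shift: "z + of_int m + of_int n * \<tau> \<in> \<Lambda> \<longleftrightarrow> z \<in> \<Lambda>" for z m n
  proof
    assume "z + of_int m + of_int n * \<tau> \<in> \<Lambda>"
    then obtain a b :: int where "z + of_int m + of_int n * \<tau> = of_int a + of_int b * \<tau>"
      by (auto simp: period_lattice_def \<Lambda>_def)
    then have "z = of_int (a - m) + of_int (b - n) * \<tau>" by (simp add: algebra_simps)
    then show "z \<in> \<Lambda>" unfolding \<Lambda>_def period_lattice_def by blast
  next
    assume "z \<in> \<Lambda>"
    then obtain a b :: int where "z = of_int a + of_int b * \<tau>"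
      by (auto simp: period_lattice_def \<Lambda>_def)
    then have "z + of_int m + of_int n * \<tau> = of_int (a + m) + of_int (b + n) * \<tau>" by (simp add: algebra_simps)
    then show "z + of_int m + of_int n * \<tau> \<in> \<Lambda>" unfolding \<Lambda>_def period_lattice_def by blast
  qed
  have Ints_\<Lambda>: "\<int> \<subseteq> period_lattice s" for s
  proof
    fix x :: complex assume "x \<in> \<int>"
    then obtain m where "x = of_int m + of_int 0 * s" by (auto elim: Ints_cases)
    then show "x \<in> period_lattice s" unfolding period_lattice_def by blast
  qed
  \<comment> \<open>The value 0 at lattice points is the one that removes the singularity;
    \<open>N_eq\<close> checks this at the origin.\<close>
  define N where "N = (\<lambda>z. if z \<in> \<Lambda> then 0 else logder \<tau>' (z / \<tau>) / \<tau> - w * z / \<tau> - logder \<tau> z)"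
  have N1: "N (z + 1) = N z" for z
  proof (cases "z \<in> \<Lambda>")
    case False
    have not: "z + 1 \<notin> \<Lambda>" using \<Lambda>_shift[of z 1 0] False by simp
    have "z / \<tau> - \<tau>' \<notin> \<int>"
      using not \<Lambda>'[of "z + 1"] Ints_\<Lambda>[of \<tau>'] by (auto simp: \<tau>'_def add_divide_distrib)
    from logder_add_tau[OF \<tau>' this] have "logder \<tau>' ((z + 1) / \<tau>) = logder \<tau>' (z / \<tau>) + w"
      by (simp add: w_def \<tau>'_def add_divide_distrib)
    with not have "N (z + 1) = (logder \<tau>' (z / \<tau>) + w) / \<tau> - w * (z + 1) / \<tau> - logder \<tau> z"
      by (simp add: N_def logder_add_1)
    also have "\<dots> = N z"
      using False by (simp add: N_def add_divide_distrib ring_distribs)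
    finally show ?thesis .
  next
    case True
    then show ?thesis using \<Lambda>_shift[of z 1 0] by (simp add: N_def)
  qed
  have N\<tau>: "N (z + \<tau>) = N z" for z
  proof (cases "z \<in> \<Lambda>")
    case False
    have not: "z + \<tau> \<notin> \<Lambda>" using \<Lambda>_shift[of z 0 1] False by simp
    have "z \<notin> \<int>" using False Ints_\<Lambda>[of \<tau>] by (auto simp: \<Lambda>_def)
    from logder_add_tau[OF \<tau> this] show ?thesis using False not \<tau>0
      by (simp add: N_def logder_add_1 w_def add_divide_distrib ring_distribs)
  next
    case True
    then show ?thesis using \<Lambda>_shift[of z 0 1] by (simp add: N_def)
  qed
  have N_int: "N (z + of_int m) = N z" for z m
  proof (induction m rule: int_induct[of _ 0])
    case (step1 i)
    with N1[of "z + of_int i"] show ?case by (simp add: add_ac)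
  next
    case (step2 i)
    with N1[of "z + of_int (i - 1)"] show ?case by (simp add: algebra_simps)
  qed simp
  have N_int\<tau>: "N (z + of_int n * \<tau>) = N z" for z n
  proof (induction n rule: int_induct[of _ 0])
    case (step1 i)
    with N\<tau>[of "z + of_int i * \<tau>"] show ?case by (simp add: algebra_simps)
  next
    case (step2 i)
    with N\<tau>[of "z + of_int (i - 1) * \<tau>"] show ?case by (simp add: algebra_simps)
  qed simp
  have N_per: "N (z + of_int m + of_int n * \<tau>) = N z" for z m n
    by (simp add: N_int N_int\<tau>)
  define H where "H = Abs_fps (\<lambda>n. fps_nth C n * (1 / \<tau>) ^ n) * fps_const (1 / \<tau>) +
    Abs_fps (\<lambda>n. fps_nth (Abs_fps (logder_coeff \<tau>')) n * (1 / \<tau>) ^ n) * fps_const (1 / \<tau>) -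
    fps_const (w / \<tau>) * fps_X - C - Abs_fps (logder_coeff \<tau>)"
  have N_near: "(\<lambda>z. cot_regular (1 / \<tau> * z) * (1 / \<tau>) + R \<tau>' (1 / \<tau> * z) * (1 / \<tau>) - w / \<tau> * z - cot_regular z - R \<tau> z)
      has_fps_expansion H"
    unfolding H_def using R[OF \<tau>] R[OF \<tau>'] C
    by (intro fps_expansion_intros has_fps_expansion_scale)
  have logder_split: "logder s z = 1 / z + cot_regular z + R s z" if "z \<notin> \<int>" "s \<in> uhp" for s z
  proof -
    have z: "z \<noteq> 0" "ee z \<noteq> 1" using that by (auto simp: ee_eq_1_iff)
    have "(\<Sum>m. aL (ee s) (ee z) m) = aL (ee s) (ee z) 0 + (\<Sum>m. aL (ee s) (ee z) (Suc m))"
      using suminf_split_head[OF summable_aL[of "ee s" "ee z"]] norm_ee_less_1[OF that(2)] by simp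
    then have "logder s z = - w / 2 - w * aL (ee s) (ee z) 0 + R s z"
      by (simp add: logder_def R_def w_def algebra_simps)
    moreover have "- w / 2 - w * aL (ee s) (ee z) 0 = 1 / z + cot_regular z"
      using z by (simp add: aL_def cot_regular_def w_def divide_simps) (simp add: algebra_simps)
    ultimately show ?thesis by simp
  qed
  have R0: "R s 0 = 0" if "s \<in> uhp" for s
  proof -
    have "aL (ee s) 1 (Suc m) = bL (ee s) 1 m" for m by (simp add: aL_def bL_def)
    then show ?thesis by (simp add: R_def)
  qed
  have "eventually (\<lambda>z::complex. norm z < min 1 (Im \<tau>)) (nhds 0)"
    using \<tau> by (intro eventually_norm_less_nhds_0) (auto simp: uhp_def)
  then have N_eq: "eventually (\<lambda>z. cot_regular (1 / \<tau> * z) * (1 / \<tau>) + R \<tau>' (1 / \<tau> * z) * (1 / \<tau>) - w / \<tau> * z - cot_regular z - R \<tau> z = N z) (nhds 0)"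
  proof eventually_elim
    case (elim z)
    show ?case
    proof (cases "z = 0")
      case True
      have "0 \<in> \<Lambda>" using Ints_\<Lambda>[of \<tau>] by (auto simp: \<Lambda>_def)
      then show ?thesis using True \<tau> \<tau>' by (simp add: N_def R0 cot_regular_def)
    next
      case False
      have "z \<notin> \<Lambda>"
      proof
        assume "z \<in> \<Lambda>"
        then obtain m n :: int where z: "z = of_int m + of_int n * \<tau>" by (auto simp: \<Lambda>_def period_lattice_def)
        have "\<bar>Im z\<bar> < Im \<tau>" using abs_Im_le_cmod[of z] elim by linarith
        then have "\<bar>real_of_int n\<bar> * Im \<tau> < 1 * Im \<tau>" using \<tau> by (simp add: z abs_mult uhp_def)
        then have "\<bar>real_of_int n\<bar> < 1" using \<tau> by (simp add: uhp_def)
        then have "n = 0" by linarith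
        with elim z have "\<bar>real_of_int m\<bar> < 1" by simp
        then have "m = 0" by linarith
        with \<open>n = 0\<close> z False show False by simp
      qed
      moreover have "z \<notin> \<int>" using calculation Ints_\<Lambda>[of \<tau>] by (auto simp: \<Lambda>_def)
      moreover have "z / \<tau> \<notin> \<int>" using calculation(1) \<Lambda>' Ints_\<Lambda>[of \<tau>'] by auto
      ultimately show ?thesis using False \<tau>0
        by (simp add: N_def logder_split \<tau> \<tau>' field_simps)
    qed
  qed
  have NH: "N has_fps_expansion H"
    using N_near N_eq by (subst has_fps_expansion_cong[OF _ refl]) (auto elim: eventually_mono)
  have diff: "N field_differentiable at z" for z
  proof (cases "z \<in> \<Lambda>")
    case False
    have "N holomorphic_on - \<Lambda>"
    proof -
      have "(\<lambda>z. logder \<tau>' (z / \<tau>)) holomorphic_on - \<Lambda>"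
        using logder_holomorphic[OF \<tau>'] \<tau>0 \<Lambda>'
        by (intro holomorphic_on_compose_gen[of "\<lambda>z. z / \<tau>" _ "logder \<tau>'" "- period_lattice \<tau>'", unfolded o_def] holomorphic_intros) auto
      then have "(\<lambda>z. logder \<tau>' (z / \<tau>) / \<tau> - w * z / \<tau> - logder \<tau> z) holomorphic_on - \<Lambda>"
        using logder_holomorphic[OF \<tau>] \<tau>0 by (intro holomorphic_intros) (auto simp: \<Lambda>_def)
      then show ?thesis by (rule holomorphic_transform) (simp add: N_def)
    qed
    then show ?thesis
      using closed_period_lattice[OF \<tau>] False
      by (intro holomorphic_on_imp_differentiable_at[of N "- \<Lambda>"]) (auto simp: \<Lambda>_def open_Compl)
  next
    case True
    \<comment> \<open>At a lattice point differentiability is transported from the origin by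
      periodicity.\<close>
    then obtain m n :: int where z: "z = of_int m + of_int n * \<tau>" by (auto simp: \<Lambda>_def period_lattice_def)
    obtain s where "open s" "0 \<in> s" "N holomorphic_on s"
      using has_fps_expansion_imp_holomorphic[OF NH] by metis
    then have "N field_differentiable at (z - z)"
      by (simp add: holomorphic_on_imp_differentiable_at)
    then obtain D where "(N has_field_derivative D) (at (z - z))"
      by (auto simp: field_differentiable_def)
    then have "((\<lambda>x. N (x - z)) has_field_derivative D * 1) (at z)"
      by (rule DERIV_chain2) (auto intro!: derivative_eq_intros)
    moreover have "N (x - z) = N x" for x
      using N_per[of "x - z" m n] by (simp add: z algebra_simps)
    ultimately show ?thesis by (auto simp: field_differentiable_def)
  qed
  then have hol: "N holomorphic_on UNIV" by (simp add: holomorphic_on_def)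
  have "bounded (range N)"
  proof -
    \<comment> \<open>The closed period parallelogram; \<open>N\<close> takes all its values
      there.\<close>
    let ?P = "(\<lambda>(s, t). complex_of_real s + complex_of_real t * \<tau>) ` ({0..1} \<times> {0..1})"
    have "compact ?P"
      unfolding case_prod_unfold by (intro compact_continuous_image continuous_intros compact_Times compact_Icc)
    then have "compact (N ` ?P)"
      using hol by (intro compact_continuous_image[of ?P N] holomorphic_on_imp_continuous_on holomorphic_on_subset[OF hol]) auto
    moreover have "range N \<subseteq> N ` ?P"
    proof safe
      fix z
      define t s where "t = Im z / Im \<tau>" and "s = Re z - t * Re \<tau>"
      have z: "z = complex_of_real s + complex_of_real t * \<tau>"
        using \<tau> by (intro complex_eqI) (auto simp: s_def t_def uhp_def)
      have "N z = N (complex_of_real (frac s) + complex_of_real (frac t) * \<tau>)"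
        using N_per[of z "- \<lfloor>s\<rfloor>" "- \<lfloor>t\<rfloor>"] by (simp add: z frac_def algebra_simps)
      moreover have "complex_of_real (frac s) + complex_of_real (frac t) * \<tau> \<in> ?P"
        using frac_ge_0 frac_lt_1 by (force intro!: image_eqI[of _ _ "(frac s, frac t)"] less_imp_le)
      ultimately show "N z \<in> N ` ?P" by (metis imageI)
    qed
    ultimately show ?thesis using bounded_subset compact_imp_bounded by blast
  qed
  with hol have "N constant_on UNIV" by (rule Liouville_theorem)
  moreover have "N 0 = 0"
    using Ints_\<Lambda>[of \<tau>] by (auto simp: N_def \<Lambda>_def)
  ultimately have "N = (\<lambda>_. 0)" by (auto simp: constant_on_def)
  then have "(\<lambda>_. 0) has_fps_expansion H" using NH by simp
  then have "fps_nth H n = 0"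
    using fps_nth_fps_expansion[of "\<lambda>_. 0" H n] fps_nth_fps_expansion[OF has_fps_expansion_0, of n] by simp
  then have "fps_nth C n * (1 / \<tau>) ^ n * (1 / \<tau>) + logder_coeff \<tau>' n * (1 / \<tau>) ^ n * (1 / \<tau>) -
      (if n = 1 then w / \<tau> else 0) - fps_nth C n - logder_coeff \<tau> n = 0"
    by (cases "n = 0"; cases "n = 1") (simp_all add: H_def fps_X_nth)
  moreover have "fps_nth C n * (1 / \<tau>) ^ n * (1 / \<tau>) + logder_coeff \<tau>' n * (1 / \<tau>) ^ n * (1 / \<tau>) =
      (fps_nth C n + logder_coeff \<tau>' n) / \<tau> ^ Suc n"
    by (simp add: power_divide add_divide_distrib mult_ac)
  ultimately show ?thesis
    unfolding \<tau>'_def w_def by (simp only: diff_eq_eq) (simp add: algebra_simps)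
qed

text \<open>These are the coefficients n = 3, 5 and 1. In each of them the cotangent part supplies
  the constant term of the Eisenstein series and \<open>logder_coeff\<close> the rest, up to a
  common factor.\<close>

theorem Eis4_inversion: "\<tau> \<in> uhp \<Longrightarrow> Eis4 (- 1 / \<tau>) = \<tau> ^ 4 * Eis4 \<tau>"
  and Eis6_inversion: "\<tau> \<in> uhp \<Longrightarrow> Eis6 (- 1 / \<tau>) = \<tau> ^ 6 * Eis6 \<tau>"
  and Eis2_inversion: "\<tau> \<in> uhp \<Longrightarrow> Eis2 (- 1 / \<tau>) = \<tau>\<^sup>2 * Eis2 \<tau> + 6 * \<tau> / (complex_of_real pi * \<i>)"
proof -
  assume \<tau>: "\<tau> \<in> uhp"
  have \<tau>0: "\<tau> \<noteq> 0" using \<tau> by (rule uhp_nonzero)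
  obtain C where C: "cot_regular has_fps_expansion C"
    and c: "fps_nth C 1 = (2 * complex_of_real pi * \<i>) ^ 2 / 12"
      "fps_nth C 3 = - ((2 * complex_of_real pi * \<i>) ^ 4) / 720"
      "fps_nth C 5 = (2 * complex_of_real pi * \<i>) ^ 6 / 30240"
    by (rule cot_regular_expansion)
  define w where "w = 2 * complex_of_real pi * \<i>"
  have w: "w \<noteq> 0" by (simp add: w_def)
  have lc: "logder_coeff s j = - w * w ^ j * (1 - (- 1) ^ j) / fact j * lamQ j (ee s)" for s j
    by (simp add: logder_coeff_def w_def)
  note c' = c[folded w_def]
  have 4: "fps_nth C 3 + logder_coeff s 3 = - (w ^ 4) / 720 * Eis4 s" if "s \<in> uhp" for s
    unfolding c' lc Eis4_def lambert_eq[OF that] by (simp add: fact_numeral field_simps power_numeral_reduce)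
  have 6: "fps_nth C 5 + logder_coeff s 5 = w ^ 6 / 30240 * Eis6 s" if "s \<in> uhp" for s
    unfolding c' lc Eis6_def lambert_eq[OF that] by (simp add: fact_numeral field_simps power_numeral_reduce)
  have 2: "fps_nth C 1 + logder_coeff s 1 = w ^ 2 / 12 * Eis2 s" if "s \<in> uhp" for s
    unfolding c' lc Eis2_def lambert_eq[OF that] by (simp add: field_simps power_numeral_reduce)
  have t: "- 1 / \<tau> \<in> uhp" using \<tau> by (rule inversion_in_uhp)
  show "Eis4 (- 1 / \<tau>) = \<tau> ^ 4 * Eis4 \<tau>"
    using logder_inversion_coeffs[OF \<tau> C, of 3] w \<tau>0 unfolding 4[OF \<tau>] 4[OF t]
    by (simp add: field_simps eval_nat_numeral)
  show "Eis6 (- 1 / \<tau>) = \<tau> ^ 6 * Eis6 \<tau>"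
    using logder_inversion_coeffs[OF \<tau> C, of 5] w \<tau>0 unfolding 6[OF \<tau>] 6[OF t]
    by (simp add: field_simps eval_nat_numeral)
  have "w ^ 2 / 12 * Eis2 (- 1 / \<tau>) / \<tau>\<^sup>2 = w ^ 2 / 12 * Eis2 \<tau> + w / \<tau>"
    using logder_inversion_coeffs[OF \<tau> C, of 1] unfolding 2[OF \<tau>] 2[OF t]
    by (simp add: eval_nat_numeral flip: w_def)
  then have "w * (w * Eis2 (- 1 / \<tau>)) = w * (w * (\<tau>\<^sup>2 * Eis2 \<tau>) + 12 * \<tau>)"
    using w \<tau>0 by (simp add: field_simps power2_eq_square)
  then have "w * Eis2 (- 1 / \<tau>) = w * (\<tau>\<^sup>2 * Eis2 \<tau>) + 12 * \<tau>"
    using w by (simp only: mult_cancel_left) simp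
  then have "Eis2 (- 1 / \<tau>) = \<tau>\<^sup>2 * Eis2 \<tau> + 12 * \<tau> / w"
    using w by (simp add: field_simps)
  then show "Eis2 (- 1 / \<tau>) = \<tau>\<^sup>2 * Eis2 \<tau> + 6 * \<tau> / (complex_of_real pi * \<i>)"
    by (simp add: w_def)
qed

section \<open>Eisenstein series as functions of q\<close>

definition E2Q :: "complex \<Rightarrow> complex" where "E2Q q = 1 - 24 * lamQ 1 q"
definition E4Q :: "complex \<Rightarrow> complex" where "E4Q q = 1 + 240 * lamQ 3 q"
definition E6Q :: "complex \<Rightarrow> complex" where "E6Q q = 1 - 504 * lamQ 5 q"

lemma EisQ_holomorphic:
  "E2Q holomorphic_on ball 0 1" "E4Q holomorphic_on ball 0 1" "E6Q holomorphic_on ball 0 1"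
  unfolding E2Q_def E4Q_def E6Q_def by (intro holomorphic_intros lamQ_holomorphic)+

lemma EisQ_ee:
  assumes "\<tau> \<in> uhp"
  shows "E2Q (ee \<tau>) = Eis2 \<tau>" "E4Q (ee \<tau>) = Eis4 \<tau>" "E6Q (ee \<tau>) = Eis6 \<tau>"
  using assms by (simp_all add: E2Q_def E4Q_def E6Q_def Eis2_def Eis4_def Eis6_def lambert_eq)

lemma EisQ_0 [simp]: "E2Q 0 = 1" "E4Q 0 = 1" "E6Q 0 = 1"
  by (simp_all add: E2Q_def E4Q_def E6Q_def)

section \<open>The discriminant\<close>

text \<open>The sum of sigma(n) q^n / n is minus the logarithm of the product of all 1 - q^n. Hence
  \<open>eulerQ\<close> is the 24th power of that product, and being an exponential it has no
  zeros.\<close>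

definition log_eulerQ :: "complex \<Rightarrow> complex" where
  "log_eulerQ q = (\<Sum>n. of_nat (sig 1 n) / of_nat n * q ^ n)"

definition eulerQ :: "complex \<Rightarrow> complex" where
  "eulerQ q = exp (- 24 * log_eulerQ q)"

definition DelQ :: "complex \<Rightarrow> complex" where
  "DelQ q = q * eulerQ q"

lemma log_eulerQ_derivative:
  assumes q: "norm q < 1"
  shows "\<exists>D. (log_eulerQ has_field_derivative D) (at q) \<and> q * D = lamQ 1 q"
proof -
  have summ: "summable (\<lambda>n. of_nat (sig 1 n) / of_nat n * x ^ n)" if "norm x < 1" for x :: complex
  proof (rule summable_comparison_test')
    show "summable (\<lambda>n. norm (of_nat (sig 1 n) * complex_of_real (norm x) ^ n))"
    proof -
      have "summable (\<lambda>n. complex_of_real (norm (of_nat (sig 1 n) * complex_of_real (norm x) ^ n)))"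
        using summable_sig[of "complex_of_real (norm x)" 1] that by (simp add: norm_mult norm_power)
      then show ?thesis by (simp only: summable_complex_of_real)
    qed
    fix n
    have "norm (of_nat (sig 1 n) / of_nat n :: complex) \<le> real (sig 1 n)"
      by (cases "n = 0") (auto simp: sig_def norm_divide divide_le_eq mult_le_cancel_left1)
    then show "norm (of_nat (sig 1 n) / of_nat n * x ^ n) \<le> norm (of_nat (sig 1 n) * complex_of_real (norm x) ^ n)"
      unfolding norm_mult norm_power norm_of_nat norm_of_real abs_norm_cancel
      by (intro mult_right_mono) auto
  qed
  obtain K where K: "norm q < K" "K < 1" using dense[OF q] by blast
  have K0: "norm (complex_of_real K) = K" using K norm_ge_zero[of q] by (simp del: norm_ge_zero)
  have "(log_eulerQ has_field_derivative (\<Sum>n. diffs (\<lambda>n. of_nat (sig 1 n) / of_nat n) n * q ^ n)) (at q)"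
    unfolding log_eulerQ_def using K K0 by (intro termdiffs_strong[of _ "complex_of_real K"] summ) auto
  moreover have "q * (\<Sum>n. diffs (\<lambda>n. of_nat (sig 1 n) / of_nat n) n * q ^ n) = lamQ 1 q"
  proof -
    have "diffs (\<lambda>n. of_nat (sig 1 n) / of_nat n :: complex) = (\<lambda>n. of_nat (sig 1 (Suc n)))"
      by (auto simp: diffs_def fun_eq_iff simp del: of_nat_Suc)
    moreover have "lamQ 1 q = (\<Sum>n. of_nat (sig 1 (Suc n)) * q ^ Suc n)"
      using suminf_split_head[OF summable_sig[OF q, of 1]] by (simp add: lamQ_def sig_def)
    moreover have "summable (\<lambda>n. of_nat (sig 1 (Suc n)) * q ^ n)"
    proof (cases "q = 0")
      case False
      have "summable (\<lambda>n. of_nat (sig 1 (Suc n)) * q ^ Suc n)"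
        using summable_sig[OF q, of 1] by (subst summable_Suc_iff)
      then have "summable (\<lambda>n. (of_nat (sig 1 (Suc n)) * q ^ Suc n) * (1 / q))"
        by (rule summable_mult2)
      with False show ?thesis by (simp add: field_simps)
    next
      case True
      then show ?thesis by (intro summable_finite[of "{0}"]) (auto simp: power_0_left)
    qed
    then have "q * (\<Sum>n. of_nat (sig 1 (Suc n)) * q ^ n) = (\<Sum>n. q * (of_nat (sig 1 (Suc n)) * q ^ n))"
      by (rule suminf_mult[symmetric])
    ultimately show ?thesis
      by (simp add: mult_ac)
  qed
  ultimately show ?thesis by blast
qed

lemma eulerQ_holomorphic: "eulerQ holomorphic_on ball 0 1"
proof -
  have "log_eulerQ holomorphic_on ball 0 1"
    unfolding holomorphic_on_def field_differentiable_def
    using log_eulerQ_derivative by (meson has_field_derivative_at_within mem_ball_0)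
  then show ?thesis unfolding eulerQ_def by (intro holomorphic_intros)
qed

lemma eulerQ_nonzero [simp]: "eulerQ q \<noteq> 0"
  by (simp add: eulerQ_def)

lemma eulerQ_0 [simp]: "eulerQ 0 = 1"
  by (simp add: eulerQ_def log_eulerQ_def sig_def suminf_finite[of "{0}"] power_0_left)

lemma DelQ_holomorphic: "DelQ holomorphic_on ball 0 1"
  unfolding DelQ_def by (intro holomorphic_intros eulerQ_holomorphic)

lemma DelQ_0 [simp]: "DelQ 0 = 0"
  by (simp add: DelQ_def)

lemma DelQ_nonzero: "q \<noteq> 0 \<Longrightarrow> DelQ q \<noteq> 0"
  by (simp add: DelQ_def)

lemma DelQ_ee_derivative:
  assumes \<tau>: "\<tau> \<in> uhp"
  shows "((\<lambda>\<tau>. DelQ (ee \<tau>)) has_field_derivative 2 * complex_of_real pi * \<i> * Eis2 \<tau> * DelQ (ee \<tau>)) (at \<tau>)"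
proof -
  obtain D where D: "(log_eulerQ has_field_derivative D) (at (ee \<tau>))" "ee \<tau> * D = lamQ 1 (ee \<tau>)"
    using log_eulerQ_derivative[OF norm_ee_less_1[OF \<tau>]] by blast
  have "(log_eulerQ has_field_derivative D) (at (ee (1 * \<tau>)))" using D by simp
  from DERIV_chain2[OF D(1) ee_has_field_derivative[OF DERIV_ident]]
  have "((\<lambda>\<tau>. log_eulerQ (ee \<tau>)) has_field_derivative D * (2 * complex_of_real pi * \<i> * 1 * ee \<tau>)) (at \<tau>)" .
  also have "D * (2 * complex_of_real pi * \<i> * 1 * ee \<tau>) = 2 * complex_of_real pi * \<i> * lamQ 1 (ee \<tau>)"
    using D(2) by (simp add: mult_ac)
  finally have *: "((\<lambda>\<tau>. log_eulerQ (ee \<tau>)) has_field_derivative 2 * complex_of_real pi * \<i> * lamQ 1 (ee \<tau>)) (at \<tau>)" .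
  show ?thesis
    unfolding DelQ_def eulerQ_def
    by (rule derivative_eq_intros * refl)+ (simp add: Eis2_def lambert_eq \<tau> algebra_simps)
qed

text \<open>By the law of \<open>Eis2\<close>, the logarithmic derivative of the left side exceeds
  that of \<open>DelQ (ee \<tau>)\<close> by 12 / tau, which is the logarithmic derivative of
  tau^12. So the quotient \<open>Q\<close> is constant, and at the fixed point i of the inversion it
  equals 1.\<close>

lemma DelQ_inversion:
  assumes \<tau>: "\<tau> \<in> uhp"
  shows "DelQ (ee (- 1 / \<tau>)) = \<tau> ^ 12 * DelQ (ee \<tau>)"
proof -
  define Q where "Q = (\<lambda>\<tau>. DelQ (ee (- 1 / \<tau>)) / (\<tau> ^ 12 * DelQ (ee \<tau>)))"
  have "(Q has_field_derivative 0) (at s within uhp)" if s: "s \<in> uhp" for s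
  proof -
    have s0: "s \<noteq> 0" using s by (rule uhp_nonzero)
    have 1: "((\<lambda>\<tau>. DelQ (ee \<tau>)) has_field_derivative 2 * complex_of_real pi * \<i> * Eis2 s * DelQ (ee s)) (at s)"
      using DelQ_ee_derivative[OF s] .
    have "((\<lambda>\<tau>. - 1 / \<tau>) has_field_derivative 1 / s\<^sup>2) (at s)"
      using s0 by (auto intro!: derivative_eq_intros simp: power2_eq_square field_simps)
    from DERIV_chain2[OF DelQ_ee_derivative[OF inversion_in_uhp[OF s]] this]
    have 2: "((\<lambda>\<tau>. DelQ (ee (- 1 / \<tau>))) has_field_derivative
      2 * complex_of_real pi * \<i> * Eis2 (- 1 / s) * DelQ (ee (- 1 / s)) * (1 / s\<^sup>2)) (at s)" .
    define d1 d2 where "d1 = DelQ (ee s)" and "d2 = DelQ (ee (- 1 / s))"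
    have nz: "d1 \<noteq> 0" by (simp add: d1_def DelQ_nonzero)
    have "2 * complex_of_real pi * \<i> * Eis2 (- 1 / s) * d2 * (1 / s\<^sup>2) =
        (2 * complex_of_real pi * \<i> * Eis2 s + 12 / s) * d2"
      unfolding Eis2_inversion[OF s] using s0 by (simp add: field_simps power2_eq_square)
    with 2 have d2': "((\<lambda>\<tau>. DelQ (ee (- 1 / \<tau>))) has_field_derivative (2 * complex_of_real pi * \<i> * Eis2 s + 12 / s) * d2) (at s)"
      by (simp add: d2_def)
    have "((\<lambda>\<tau>. \<tau> ^ 12 * DelQ (ee \<tau>)) has_field_derivative
        (12 / s + 2 * complex_of_real pi * \<i> * Eis2 s) * (s ^ 12 * d1)) (at s)"
      by (rule derivative_eq_intros 1 refl)+ (use s0 in \<open>simp add: d1_def field_simps eval_nat_numeral\<close>)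
    from DERIV_divide[OF d2' this] nz s0
    have "(Q has_field_derivative ((2 * complex_of_real pi * \<i> * Eis2 s + 12 / s) * d2 * (s ^ 12 * d1) -
        d2 * ((12 / s + 2 * complex_of_real pi * \<i> * Eis2 s) * (s ^ 12 * d1))) / (s ^ 12 * d1 * (s ^ 12 * d1))) (at s)"
      by (simp add: Q_def d1_def d2_def)
    then show ?thesis by (simp add: algebra_simps has_field_derivative_at_within)
  qed
  then obtain c where c: "\<And>s. s \<in> uhp \<Longrightarrow> Q s = c"
    using has_field_derivative_zero_constant[OF convex_uhp] by blast
  have "Q \<i> = 1"
    by (simp add: Q_def DelQ_nonzero power_numeral_reduce)
  with c[of \<i>] c[OF \<tau>] have "Q \<tau> = 1" by simp
  then show ?thesis by (simp add: Q_def DelQ_nonzero uhp_nonzero[OF \<tau>] field_simps)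
qed

section \<open>Modular forms as functions of \<open>q\<close>\<close>

text \<open>Invariance under tau + 1 is implicit in writing the form as a function of q, and
  holomorphy on the full disc includes the cusp.\<close>

definition mform :: "int \<Rightarrow> (complex \<Rightarrow> complex) \<Rightarrow> bool" where
  "mform k G \<longleftrightarrow> G holomorphic_on ball 0 1 \<and> (\<forall>\<tau>\<in>uhp. G (ee (- 1 / \<tau>)) = \<tau> powi k * G (ee \<tau>))"

lemma mform_E4Q: "mform 4 E4Q" and mform_E6Q: "mform 6 E6Q" and mform_DelQ: "mform 12 DelQ"
  using Eis4_inversion Eis6_inversion DelQ_inversion
  by (auto simp: mform_def EisQ_holomorphic DelQ_holomorphic EisQ_ee power_int_def)

lemma mform_const: "mform 0 (\<lambda>_. c)"
  by (auto simp: mform_def)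

lemma mform_cmult: "mform k G \<Longrightarrow> mform k (\<lambda>q. c * G q)"
  by (auto simp: mform_def intro!: holomorphic_intros)

lemma mform_diff: "mform k F \<Longrightarrow> mform k G \<Longrightarrow> mform k (\<lambda>q. F q - G q)"
  by (auto simp: mform_def ring_distribs intro!: holomorphic_intros)

lemma mform_mult: "mform k F \<Longrightarrow> mform l G \<Longrightarrow> mform (k + l) (\<lambda>q. F q * G q)"
  by (auto simp: mform_def power_int_add uhp_nonzero intro!: holomorphic_intros)

lemma mform_power: "mform k F \<Longrightarrow> mform (k * int n) (\<lambda>q. F q ^ n)"
proof (induction n)
  case 0
  then show ?case using mform_const[of 1] by simp
next
  case (Suc n)
  from mform_mult[OF Suc.prems Suc.IH[OF Suc.prems]] show ?case by (simp add: algebra_simps)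
qed

lemma mform_holomorphic: "mform k G \<Longrightarrow> G holomorphic_on ball 0 1"
  by (simp add: mform_def)

lemma mform_0_constant:
  assumes "mform 0 G" "norm q < 1"
  shows "G q = G 0"
  using assms by (intro modular_invariant_constant) (auto simp: mform_def)

text \<open>\<open>F\<close> is the quotient of G by q with its removable value at 0; dividing
  further by \<open>eulerQ\<close> creates no poles.\<close>

lemma mform_divide_DelQ:
  assumes G: "mform k G" and G0: "G 0 = 0"
  obtains H where "mform (k - 12) H" "\<And>q. norm q < 1 \<Longrightarrow> G q = DelQ q * H q"
proof
  define F where "F = (\<lambda>q. if q = 0 then deriv G 0 else (G q - G 0) / (q - 0))"
  define H where "H = (\<lambda>q. F q / eulerQ q)"
  have F: "F holomorphic_on ball 0 1"
    unfolding F_def using G by (intro pole_lemma) (auto simp: mform_def)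
  have eq: "G q = DelQ q * H q" for q
    using G0 by (cases "q = 0") (auto simp: H_def F_def DelQ_def)
  then show "G q = DelQ q * H q" if "norm q < 1" for q .
  have "H (ee (- 1 / \<tau>)) = \<tau> powi (k - 12) * H (ee \<tau>)" if \<tau>: "\<tau> \<in> uhp" for \<tau>
  proof -
    have "\<tau> ^ 12 * DelQ (ee \<tau>) * H (ee (- 1 / \<tau>)) = \<tau> powi k * (DelQ (ee \<tau>) * H (ee \<tau>))"
      using G \<tau> by (simp only: DelQ_inversion[OF \<tau>, symmetric] eq[symmetric]) (auto simp: mform_def)
    then have "\<tau> ^ 12 * H (ee (- 1 / \<tau>)) = \<tau> powi k * H (ee \<tau>)"
      by (simp add: DelQ_nonzero)
    then show ?thesis
      using uhp_nonzero[OF \<tau>] by (simp add: power_int_diff field_simps)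
  qed
  moreover have "H holomorphic_on ball 0 1"
    unfolding H_def by (intro holomorphic_intros F eulerQ_holomorphic) simp
  ultimately show "mform (k - 12) H" by (simp add: mform_def)
qed

lemma holomorphic_zero_at_0:
  assumes "G holomorphic_on ball 0 1" "\<And>q. q \<noteq> 0 \<Longrightarrow> norm q < 1 \<Longrightarrow> G q = 0"
  shows "G 0 = 0"
proof -
  have "isCont G 0"
    using assms(1) by (intro holomorphic_on_imp_continuous_on[THEN continuous_on_interior]) auto
  then have "(G \<longlongrightarrow> G 0) (at 0)" by (simp add: isCont_def)
  moreover have "eventually (\<lambda>q. q \<in> ball 0 1 - {0}) (at (0::complex))"
    by (intro eventually_at_in_open) auto
  then have "eventually (\<lambda>q. G q = 0) (at 0)"
    by eventually_elim (use assms(2) in auto)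
  then have "(G \<longlongrightarrow> 0) (at 0)" by (rule tendsto_eventually)
  ultimately show ?thesis using tendsto_unique[of "at (0::complex)"] by auto
qed

text \<open>The product of G^12 and the power -k of \<open>DelQ\<close> has weight 0, so it is
  constant, and it vanishes at the cusp.\<close>

lemma mform_neg_weight:
  assumes G: "mform k G" and k: "k < 0" and q: "norm q < 1"
  shows "G q = 0"
proof -
  have "mform (k * int 12 + 12 * int (nat (- k))) (\<lambda>q. G q ^ 12 * DelQ q ^ nat (- k))"
    by (intro mform_mult mform_power G mform_DelQ)
  then have "mform 0 (\<lambda>q. G q ^ 12 * DelQ q ^ nat (- k))" using k by simp
  from mform_0_constant[OF this] have "G q ^ 12 * DelQ q ^ nat (- k) = 0" if "norm q < 1" for q
    using k that by (simp add: power_0_left)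
  then have *: "G q = 0" if "norm q < 1" "q \<noteq> 0" for q
    using that DelQ_nonzero[of q] by (metis mult_eq_0_iff power_not_zero)
  with holomorphic_zero_at_0[OF mform_holomorphic[OF G]] q show ?thesis by (cases "q = 0") auto
qed

text \<open>The difference of the two sides vanishes at the cusp; divided by \<open>DelQ\<close> it
  has negative weight.\<close>

lemma mform_one_dim:
  assumes G: "mform k G" and E: "mform k E" "E 0 = 1" and k: "k < 12" and q: "norm q < 1"
  shows "G q = G 0 * E q"
proof -
  have "mform k (\<lambda>q. G q - G 0 * E q)" by (intro mform_diff mform_cmult G E)
  then obtain H where H: "mform (k - 12) H" "\<And>q. norm q < 1 \<Longrightarrow> G q - G 0 * E q = DelQ q * H q"
    using mform_divide_DelQ[of k "\<lambda>q. G q - G 0 * E q"] E(2) by auto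
  have "H q = 0" using mform_neg_weight[OF H(1)] k q by simp
  with H(2)[OF q] show ?thesis by simp
qed

text \<open>Inverting twice returns to tau and multiplies by (-1)^k.\<close>

lemma mform_odd_weight:
  assumes G: "mform k G" and k: "odd k" and q: "norm q < 1"
  shows "G q = 0"
proof -
  have *: "G q = 0" if q: "norm q < 1" "q \<noteq> 0" for q
  proof -
    obtain \<tau> where \<tau>: "\<tau> \<in> uhp" "ee \<tau> = q" using ee_surj_uhp[OF q(2,1)] by blast
    have t: "- 1 / (- 1 / \<tau>) = \<tau>" using uhp_nonzero[OF \<tau>(1)] by simp
    have "G (ee (- 1 / (- 1 / \<tau>))) = (- 1 / \<tau>) powi k * (\<tau> powi k * G (ee \<tau>))"
      using G \<tau>(1) inversion_in_uhp[OF \<tau>(1)] unfolding mform_def by metis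
    also have "\<dots> = ((- 1 / \<tau>) * \<tau>) powi k * G (ee \<tau>)"
      by (simp only: power_int_mult_distrib mult.assoc)
    also have "(- 1 / \<tau>) * \<tau> = - 1" using uhp_nonzero[OF \<tau>(1)] by simp
    also have "(- 1 :: complex) powi k = - 1" using k by (simp add: power_int_minus_left)
    finally have "G (ee \<tau>) = - G (ee \<tau>)" unfolding t by simp
    with \<tau> show ?thesis by simp
  qed
  with holomorphic_zero_at_0[OF mform_holomorphic[OF G]] q show ?thesis by (cases "q = 0") auto
qed

lemma sums_lamQ_derivative: "(lamQ k has_field_derivative 1) (at 0)"
proof -
  have "(lamQ k has_field_derivative (\<Sum>n. diffs (\<lambda>n. of_nat (sig k n)) n * 0 ^ n)) (at 0)"
    unfolding lamQ_def
    by (rule termdiffs_strong[of _ "1 / 2"]) (use summable_sig[of "1 / 2" k] in \<open>auto simp: norm_divide\<close>)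
  also have "(\<Sum>n. diffs (\<lambda>n. of_nat (sig k n)) n * 0 ^ n) = (1 :: complex)"
    by (simp add: powser_zero diffs_def sig_def divisor_sum_def)
  finally show ?thesis .
qed

text \<open>The derivatives at q = 0 are 3 * 240 = 720 and - 2 * 504 = - 1008; they differ by
  1728.\<close>

lemma E4_cubed_neq_E6_squared: "\<not> (\<forall>q. norm q < 1 \<longrightarrow> E4Q q ^ 3 = E6Q q ^ 2)"
proof
  assume *: "\<forall>q. norm q < 1 \<longrightarrow> E4Q q ^ 3 = E6Q q ^ 2"
  have E4': "(E4Q has_field_derivative 240) (at 0)" and E6': "(E6Q has_field_derivative - 504) (at 0)"
    unfolding E4Q_def[abs_def] E6Q_def[abs_def]
    by (rule derivative_eq_intros sums_lamQ_derivative refl | simp)+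
  have "((\<lambda>q. E4Q q ^ 3 - E6Q q ^ 2) has_field_derivative 1728) (at 0)"
    by (rule derivative_eq_intros E4' E6' refl | simp)+
  moreover have "((\<lambda>q. E4Q q ^ 3 - E6Q q ^ 2) has_field_derivative 0) (at 0)"
  proof (rule DERIV_cong_ev[THEN iffD2, OF refl _ refl])
    have "eventually (\<lambda>q::complex. norm q < 1) (nhds 0)" by (rule eventually_norm_less_nhds_0) simp
    then show "\<forall>\<^sub>F q in nhds 0. E4Q q ^ 3 - E6Q q ^ 2 = 0"
      by eventually_elim (use * in auto)
  qed simp
  ultimately have "(1728 :: complex) = 0" by (rule DERIV_unique)
  then show False by simp
qed

text \<open>The weight 12 form E4^3 - E6^2 vanishes at the cusp, so its quotient by
  \<open>DelQ\<close> is constant, and this constant is nonzero by the preceding lemma.\<close>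

lemma DelQ_eq:
  obtains c where "\<And>q. norm q < 1 \<Longrightarrow> DelQ q = c * (E4Q q ^ 3 - E6Q q ^ 2)"
proof -
  have "mform (4 * int 3) (\<lambda>q. E4Q q ^ 3)" "mform (6 * int 2) (\<lambda>q. E6Q q ^ 2)"
    by (intro mform_power mform_E4Q mform_E6Q)+
  then have "mform 12 (\<lambda>q. E4Q q ^ 3 - E6Q q ^ 2)" using mform_diff by simp
  then obtain H where H: "mform (12 - 12) H" "\<And>q. norm q < 1 \<Longrightarrow> E4Q q ^ 3 - E6Q q ^ 2 = DelQ q * H q"
    using mform_divide_DelQ[of 12 "\<lambda>q. E4Q q ^ 3 - E6Q q ^ 2"] by auto
  have H0: "H q = H 0" if "norm q < 1" for q using mform_0_constant[of H q] H(1) that by simp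
  have "H 0 \<noteq> 0"
  proof
    assume "H 0 = 0"
    then have "E4Q q ^ 3 = E6Q q ^ 2" if "norm q < 1" for q
      using H(2)[OF that] H0[OF that] by simp
    with E4_cubed_neq_E6_squared show False by blast
  qed
  then have "DelQ q = 1 / H 0 * (E4Q q ^ 3 - E6Q q ^ 2)" if "norm q < 1" for q
    unfolding H(2)[OF that] H0[OF that] by simp
  with that show ?thesis by blast
qed

text \<open>G^2 and G^3 are multiples of \<open>E4Q\<close> and \<open>E6Q\<close>, so G^6 computed
  in two ways gives G(0)^6 E4^3 = G(0)^6 E6^2, which forces G(0) = 0.\<close>

lemma mform_weight_2:
  assumes G: "mform 2 G" and q: "norm q < 1"
  shows "G q = 0"
proof -
  have "mform (2 * int 2) (\<lambda>q. G q ^ 2)" "mform (2 * int 3) (\<lambda>q. G q ^ 3)"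
    by (intro mform_power G)+
  then have "mform 4 (\<lambda>q. G q ^ 2)" "mform 6 (\<lambda>q. G q ^ 3)" by simp_all
  then have 4: "G q ^ 2 = G 0 ^ 2 * E4Q q" and 6: "G q ^ 3 = G 0 ^ 3 * E6Q q" if "norm q < 1" for q
    using mform_one_dim[OF _ mform_E4Q _ _ that] mform_one_dim[OF _ mform_E6Q _ _ that] by auto
  have "G 0 = 0"
  proof (rule ccontr)
    assume "G 0 \<noteq> 0"
    moreover have "G 0 ^ 6 * E4Q q ^ 3 = G 0 ^ 6 * E6Q q ^ 2" if "norm q < 1" for q
    proof -
      have "(G q ^ 2) ^ 3 = (G q ^ 3) ^ 2" by (simp flip: power_mult)
      then show ?thesis unfolding 4[OF that] 6[OF that] by (simp add: power_mult_distrib flip: power_mult)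
    qed
    ultimately show False using E4_cubed_neq_E6_squared by simp
  qed
  with 4[OF q] show ?thesis by simp
qed

text \<open>Induction on half the weight: subtract G(0) E4^a E6^b of the same weight and divide by
  \<open>DelQ\<close>, which lowers the weight by 12. Of the two polynomial variables the outer one
  stands for E4 and the inner one for E6.\<close>

lemma mform_polynomial:
  assumes "mform k G"
  shows "\<exists>P :: complex poly poly. \<forall>q. norm q < 1 \<longrightarrow> G q = poly (poly P [:E4Q q:]) (E6Q q)"
proof (cases "k < 0 \<or> odd k")
  case True
  then have "\<forall>q. norm q < 1 \<longrightarrow> G q = 0"
    using mform_neg_weight[OF assms] mform_odd_weight[OF assms] by blast
  then show ?thesis by (intro exI[of _ 0]) simp
next
  case False
  then obtain n where "k = 2 * int n" by (metis evenE int_nat_eq nonneg_int_cases not_less zero_le_mult_iff mult_less_0_iff zero_less_numeral linorder_not_less)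
  then show ?thesis using assms
  proof (induction n arbitrary: k G rule: less_induct)
    case (less n)
    consider "n = 0" | "n = 1" | "n \<ge> 2" by linarith
    then show ?case
    proof cases
      case 1
      show ?thesis
      proof (intro exI[of _ "[:[:G 0:]:]"] allI impI)
        fix q :: complex assume "norm q < 1"
        with 1 less.prems have "G q = G 0" using mform_0_constant[of G q] by simp
        then show "G q = poly (poly [:[:G 0:]:] [:E4Q q:]) (E6Q q)" by simp
      qed
    next
      case 2
      with less.prems have "G q = 0" if "norm q < 1" for q
        using mform_weight_2[of G q] that by simp
      then show ?thesis by (intro exI[of _ 0]) simp
    next
      case 3
      \<comment> \<open>Weight 2 n requires 4 a + 6 b = 2 n, which is solvable for every n >=
        2.\<close>
      obtain a b where ab: "n = 2 * a + 3 * b"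
      proof (cases "even n")
        case True
        then obtain a where "n = 2 * a" by blast
        with that[of a 0] show ?thesis by simp
      next
        case False
        then obtain a where "n = 2 * a + 1" by (elim oddE)
        with 3 that[of "a - 1" 1] show ?thesis by simp
      qed
      have "mform (4 * int a + 6 * int b) (\<lambda>q. E4Q q ^ a * E6Q q ^ b)"
        by (intro mform_mult mform_power mform_E4Q mform_E6Q)
      then have "mform k (\<lambda>q. G q - G 0 * (E4Q q ^ a * E6Q q ^ b))"
        using less.prems ab by (intro mform_diff mform_cmult) (auto simp: algebra_simps)
      then obtain H where H: "mform (k - 12) H"
          "\<And>q. norm q < 1 \<Longrightarrow> G q - G 0 * (E4Q q ^ a * E6Q q ^ b) = DelQ q * H q"
        using mform_divide_DelQ[of k "\<lambda>q. G q - G 0 * (E4Q q ^ a * E6Q q ^ b)"] by auto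
      have "\<exists>P :: complex poly poly. \<forall>q. norm q < 1 \<longrightarrow> H q = poly (poly P [:E4Q q:]) (E6Q q)"
      proof (cases "n \<ge> 6")
        case True
        with less.IH[of "n - 6" "k - 12" H] H(1) less.prems show ?thesis by simp
      next
        case False
        then have "H q = 0" if "norm q < 1" for q
          using mform_neg_weight[OF H(1)] less.prems(1) that by simp
        then show ?thesis by (intro exI[of _ 0]) simp
      qed
      then obtain P :: "complex poly poly" where P: "\<And>q. norm q < 1 \<Longrightarrow> H q = poly (poly P [:E4Q q:]) (E6Q q)"
        by blast
      obtain c where c: "\<And>q. norm q < 1 \<Longrightarrow> DelQ q = c * (E4Q q ^ 3 - E6Q q ^ 2)"
        using DelQ_eq by blast
      define X Y :: "complex poly poly" where "X = [:0, 1:]" and "Y = [:[:0, 1:]:]"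
      define R where "R = [:[:G 0:]:] * (X ^ a * Y ^ b) + [:[:c:]:] * (X ^ 3 - Y ^ 2) * P"
      have "G q = poly (poly R [:E4Q q:]) (E6Q q)" if "norm q < 1" for q
      proof -
        have "poly (poly R [:E4Q q:]) (E6Q q) = G 0 * (E4Q q ^ a * E6Q q ^ b) + DelQ q * H q"
          by (simp add: R_def X_def Y_def c[OF that] P[OF that])
        with H(2)[OF that] show ?thesis by (simp add: algebra_simps)
      qed
      then show ?thesis by blast
    qed
  qed
qed

theorem mform_in_mod_ring:
  assumes "mform k G"
  shows "(\<lambda>\<tau>. G (ee \<tau>)) \<in> mod_ring"
proof -
  obtain P :: "complex poly poly" where P: "\<And>q. norm q < 1 \<Longrightarrow> G q = poly (poly P [:E4Q q:]) (E6Q q)"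
    using mform_polynomial[OF assms] by blast
  \<comment> \<open>One bound for both degrees, because \<open>mod_ring\<close> sums over a square
    of exponents.\<close>
  define N where "N = degree P + (\<Sum>i\<le>degree P. degree (coeff P i))"
  have bound: "degree (coeff P i) \<le> N" for i
  proof (cases "i \<le> degree P")
    case True
    then have "degree (coeff P i) \<le> (\<Sum>i\<le>degree P. degree (coeff P i))"
      by (intro member_le_sum) auto
    then show ?thesis by (simp add: N_def)
  qed (simp add: coeff_eq_0)
  have poly_le: "poly p x = (\<Sum>i\<le>N. coeff p i * x ^ i)" if "degree p \<le> N" for p :: "'a :: comm_ring_1 poly" and x
    unfolding poly_altdef using that by (intro sum.mono_neutral_left) (auto simp: coeff_eq_0)
  have "G (ee \<tau>) = (\<Sum>i\<le>N. \<Sum>j\<le>N. coeff (coeff P i) j * Eis4 \<tau> ^ i * Eis6 \<tau> ^ j)" if \<tau>: "\<tau> \<in> uhp" for \<tau>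
  proof -
    have "G (ee \<tau>) = poly (poly P [:Eis4 \<tau>:]) (Eis6 \<tau>)"
      using P[OF norm_ee_less_1[OF \<tau>]] \<tau> by (simp add: EisQ_ee)
    also have "\<dots> = poly (\<Sum>i\<le>N. coeff P i * [:Eis4 \<tau>:] ^ i) (Eis6 \<tau>)"
      by (subst poly_le) (simp_all add: N_def)
    also have "\<dots> = (\<Sum>i\<le>N. \<Sum>j\<le>N. coeff (coeff P i) j * Eis4 \<tau> ^ i * Eis6 \<tau> ^ j)"
      by (simp add: poly_sum poly_le[OF bound] sum_distrib_left mult_ac)
    finally show ?thesis .
  qed
  then show ?thesis
    unfolding mod_ring_def mem_Collect_eq
    by (intro exI[of _ N] exI[of _ "\<lambda>i j. coeff (coeff P i) j"]) blast
qed

section \<open>The theta function of one variable\<close>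

text \<open>The tails of the summable bounds \<open>M\<close> give the uniform estimate for the
  differentials that termwise differentiation requires.\<close>

lemma has_derivative_suminf:
  fixes f :: "nat \<Rightarrow> 'a::real_normed_vector \<Rightarrow> 'b::banach"
  assumes S: "convex S" "open S"
    and f: "\<And>n x. x \<in> S \<Longrightarrow> (f n has_derivative f' n x) (at x)"
    and bound: "\<And>n x h. x \<in> S \<Longrightarrow> norm (f' n x h) \<le> M n * norm h"
    and M: "summable M" and summ: "\<And>x. x \<in> S \<Longrightarrow> summable (\<lambda>n. f n x)" and x: "x \<in> S"
  shows "((\<lambda>x. \<Sum>n. f n x) has_derivative (\<lambda>h. \<Sum>n. f' n x h)) (at x)"
proof -
  have summ': "summable (\<lambda>n. f' n y h)" if "y \<in> S" for y h
    by (rule summable_comparison_test'[of "\<lambda>n. M n * norm h" 0]) (use M bound[OF that] in \<open>auto intro: summable_mult2\<close>)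
  have "\<exists>g. \<forall>x\<in>S. (\<lambda>n. f n x) sums g x \<and> (g has_derivative (\<lambda>h. \<Sum>n. f' n x h)) (at x within S)"
  proof (rule has_derivative_series[OF S(1)])
    show "(f n has_derivative f' n x) (at x within S)" if "x \<in> S" for n x
      using f[OF that] by (rule has_derivative_at_withinI)
    show "(\<lambda>n. f n x) sums (\<Sum>n. f n x)" using summ[OF x] by (rule summable_sums)
    fix e :: real assume e: "e > 0"
    obtain N where N: "\<And>n. n \<ge> N \<Longrightarrow> norm (\<Sum>i. M (i + n)) < e"
      using suminf_exist_split[OF e M] by blast
    show "\<forall>\<^sub>F n in sequentially. \<forall>x\<in>S. \<forall>h. norm ((\<Sum>i<n. f' i x h) - (\<Sum>i. f' i x h)) \<le> e * norm h"
      using eventually_ge_at_top[of N]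
    proof (eventually_elim, intro ballI allI)
      fix n y h assume n: "n \<ge> N" and y: "y \<in> S"
      have sM: "summable (\<lambda>i. M (i + n))" using M by (rule summable_ignore_initial_segment)
      have "norm ((\<Sum>i<n. f' i y h) - (\<Sum>i. f' i y h)) = norm (\<Sum>i. f' (i + n) y h)"
        using suminf_minus_initial_segment[OF summ'[OF y], of n h] by (simp add: norm_minus_commute)
      also have "\<dots> \<le> (\<Sum>i. M (i + n) * norm h)"
        using bound[OF y] summable_mult2[OF sM, of "norm h"] by (intro norm_suminf_le) auto
      also have "\<dots> = (\<Sum>i. M (i + n)) * norm h"
        using sM by (rule suminf_mult2[symmetric])
      also have "\<dots> \<le> e * norm h"
        using N[OF n] by (intro mult_right_mono) auto
      finally show "norm ((\<Sum>i<n. f' i y h) - (\<Sum>i. f' i y h)) \<le> e * norm h" .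
    qed
  qed (fact x)
  then obtain g where g: "\<And>x. x \<in> S \<Longrightarrow> (\<lambda>n. f n x) sums g x"
      "\<And>x. x \<in> S \<Longrightarrow> (g has_derivative (\<lambda>h. \<Sum>n. f' n x h)) (at x within S)"
    by blast
  have "(g has_derivative (\<lambda>h. \<Sum>n. f' n x h)) (at x)"
    using g(2)[OF x] unfolding at_within_open[OF x S(2)] .
  then show ?thesis
    by (rule has_derivative_transform_within_open[OF _ S(2) x]) (rule sums_unique[OF g(1)])
qed

lemma summable_on_int:
  fixes f :: "int \<Rightarrow> real"
  assumes "summable (\<lambda>n. f (int n))" "summable (\<lambda>n. f (- int n))" "\<And>n. f n \<ge> 0"
  shows "f summable_on UNIV"
proof -
  have "(\<lambda>n. f (int n)) summable_on UNIV" "(\<lambda>n. f (- int n)) summable_on UNIV"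
    using assms by (auto intro: summable_nonneg_imp_summable_on)
  then have "f summable_on range int" "f summable_on range (\<lambda>n. - int n)"
    by (subst summable_on_reindex; force simp: inj_def o_def)+
  then have "f summable_on (range int \<union> range (\<lambda>n. - int n))"
    by (rule summable_on_union)
  also have "range int \<union> range (\<lambda>n. - int n) = UNIV"
    by (auto simp: image_iff) (metis int_cases2)
  finally show ?thesis .
qed

text \<open>Completing the square bounds - delta x^2 + B x + x by a constant minus x, and the extra
  x absorbs the polynomial factor through x^p <= p! exp x.\<close>

lemma theta_majorant_summable:
  assumes \<delta>: "\<delta> > 0"
  shows "(\<lambda>n::int. \<bar>of_int n\<bar> ^ p * exp (- \<delta> * (of_int n)\<^sup>2 + B * \<bar>of_int n\<bar>) :: real) summable_on UNIV"
proof (rule summable_on_comparison_test)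
  define K where "K = exp ((B + 2)\<^sup>2 / (4 * \<delta>))"
  have "summable (\<lambda>n. exp (- 1 :: real) ^ n)" by (rule summable_geometric) simp
  then have s: "summable (\<lambda>n. exp (- real n))" by (simp add: exp_of_nat_mult[symmetric])
  have "(\<lambda>n::int. exp (- \<bar>of_int n\<bar>) :: real) summable_on UNIV"
    by (rule summable_on_int) (use s in auto)
  then show "(\<lambda>n::int. fact p * K * exp (- \<bar>of_int n\<bar>) :: real) summable_on UNIV"
    by (rule summable_on_cmult_right)
  fix n :: int
  define x where "x = \<bar>real_of_int n\<bar>"
  have x: "x \<ge> 0" by (simp add: x_def)
  have "x ^ p / fact p \<le> exp x"
  proof -
    have "x ^ p / fact p = (\<Sum>k\<in>{p}. x ^ k /\<^sub>R fact k)" by (simp add: divide_inverse mult.commute)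
    also have "\<dots> \<le> (\<Sum>k. x ^ k /\<^sub>R fact k)"
      using x by (intro sum_le_suminf summable_exp_generic) auto
    finally show ?thesis by (simp add: exp_def)
  qed
  then have p: "x ^ p \<le> fact p * exp x" by (simp add: field_simps)
  have "0 \<le> \<delta> * (x - (B + 2) / (2 * \<delta>))\<^sup>2" using \<delta> by simp
  also have "\<dots> = \<delta> * x\<^sup>2 - (B + 2) * x + (B + 2)\<^sup>2 / (4 * \<delta>)"
    using \<delta> by (simp add: power2_eq_square field_simps)
  finally have e: "- \<delta> * x\<^sup>2 + B * x + x \<le> (B + 2)\<^sup>2 / (4 * \<delta>) - x"
    by (simp add: algebra_simps)
  have "x ^ p * exp (- \<delta> * x\<^sup>2 + B * x) \<le> fact p * exp x * exp (- \<delta> * x\<^sup>2 + B * x)"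
    using p by (intro mult_right_mono) auto
  also have "\<dots> = fact p * exp (- \<delta> * x\<^sup>2 + B * x + x)"
    by (simp add: exp_add mult_ac)
  also have "\<dots> \<le> fact p * exp ((B + 2)\<^sup>2 / (4 * \<delta>) - x)"
    using e by (intro mult_left_mono) auto
  also have "\<dots> = fact p * K * exp (- x)"
    by (simp add: K_def exp_diff exp_minus field_simps)
  finally show "\<bar>of_int n\<bar> ^ p * exp (- \<delta> * (of_int n)\<^sup>2 + B * \<bar>of_int n\<bar>) \<le> fact p * K * exp (- \<bar>of_int n\<bar>)"
    by (simp add: x_def)
qed auto

text \<open>The factor n^p stands for derivatives: for p = 0 the sum is Jacobi's theta function,
  d/dz raises p by one and d/dtau raises it by two, up to constants. The heat equation is thus built
  in.\<close>

definition theta_term :: "nat \<Rightarrow> complex \<Rightarrow> complex \<Rightarrow> int \<Rightarrow> complex" where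
  "theta_term p \<tau> z n = of_int n ^ p * ee ((of_int n)\<^sup>2 * \<tau> / 2 + of_int n * z)"

definition th :: "nat \<Rightarrow> complex \<Rightarrow> complex \<Rightarrow> complex" where
  "th p \<tau> z = (\<Sum>\<^sub>\<infinity>n. theta_term p \<tau> z n)"

lemma norm_theta_term_le:
  assumes "Im \<tau> \<ge> \<delta>" "\<bar>Im z\<bar> \<le> B"
  shows "norm (theta_term p \<tau> z n) \<le> \<bar>of_int n\<bar> ^ p * exp (- (pi * \<delta>) * (of_int n)\<^sup>2 + (2 * pi * B) * \<bar>of_int n\<bar>)"
proof -
  have Im: "Im ((of_int n)\<^sup>2 * \<tau> / 2 + of_int n * z) = (of_int n)\<^sup>2 * Im \<tau> / 2 + of_int n * Im z"
    by (simp add: power2_eq_square)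
  have 1: "(of_int n)\<^sup>2 * \<delta> \<le> (of_int n)\<^sup>2 * Im \<tau>"
    using assms by (intro mult_left_mono) auto
  have "- (of_int n * Im z) \<le> \<bar>of_int n\<bar> * \<bar>Im z\<bar>"
    by (simp flip: abs_mult)
  also have "\<dots> \<le> \<bar>of_int n\<bar> * B"
    using assms by (intro mult_left_mono) auto
  finally have "- 2 * ((of_int n)\<^sup>2 * Im \<tau> / 2 + of_int n * Im z) \<le> - \<delta> * (of_int n)\<^sup>2 + 2 * B * \<bar>of_int n\<bar>"
    using 1 by (simp add: algebra_simps)
  then have "pi * (- 2 * ((of_int n)\<^sup>2 * Im \<tau> / 2 + of_int n * Im z)) \<le> pi * (- \<delta> * (of_int n)\<^sup>2 + 2 * B * \<bar>of_int n\<bar>)"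
    by (intro mult_left_mono) auto
  then have "norm (ee ((of_int n)\<^sup>2 * \<tau> / 2 + of_int n * z)) \<le> exp (- (pi * \<delta>) * (of_int n)\<^sup>2 + (2 * pi * B) * \<bar>of_int n\<bar>)"
    unfolding norm_ee Im by (simp add: algebra_simps)
  then show ?thesis
    by (simp add: theta_term_def norm_mult norm_power mult_left_mono)
qed

lemma theta_term_abs_summable:
  assumes "\<tau> \<in> uhp"
  shows "(\<lambda>n. norm (theta_term p \<tau> z n)) summable_on UNIV"
proof (rule Infinite_Sum.abs_summable_on_comparison_test'[OF theta_majorant_summable])
  show "0 < pi * Im \<tau>" using assms by (simp add: uhp_def)
  show "norm (theta_term p \<tau> z n) \<le> \<bar>of_int n\<bar> ^ p *
      exp (- (pi * Im \<tau>) * (of_int n)\<^sup>2 + (2 * pi * \<bar>Im z\<bar>) * \<bar>of_int n\<bar>)" for n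
    by (rule norm_theta_term_le) auto
qed

lemma theta_has_sum:
  assumes "\<tau> \<in> uhp"
  shows "(theta_term p \<tau> z has_sum th p \<tau> z) UNIV"
  unfolding th_def by (rule has_sum_infsum[OF abs_summable_summable[OF theta_term_abs_summable[OF assms]]])

text \<open>The enumeration \<open>int_decode\<close> turns the sum over the integers into a series
  over the naturals, the form in which it is differentiated termwise.\<close>

lemma th_eq_suminf:
  assumes "\<tau> \<in> uhp"
  shows "(\<lambda>n. theta_term p \<tau> z (int_decode n)) sums th p \<tau> z"
  by (rule has_sum_imp_sums, rule has_sum_reindex_bij_betw[OF bij_int_decode, THEN iffD2], rule theta_has_sum[OF assms])

lemma th_has_derivative:
  assumes \<tau>: "\<tau> \<in> uhp"
  shows "((\<lambda>(\<tau>, z). th p \<tau> z) has_derivative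
    (\<lambda>(v, w). complex_of_real pi * \<i> * th (p + 2) \<tau> z * v + 2 * complex_of_real pi * \<i> * th (p + 1) \<tau> z * w)) (at (\<tau>, z))"
proof -
  define \<delta> B where "\<delta> = Im \<tau> / 2" and "B = \<bar>Im z\<bar> + 1"
  have \<delta>: "\<delta> > 0" "\<delta> < Im \<tau>" using \<tau> by (auto simp: \<delta>_def uhp_def)
  \<comment> \<open>A convex open neighbourhood of the point on which a single majorant works for
    all terms.\<close>
  define S where "S = {s. Im s > \<delta>} \<times> ({z. Im z < B} \<inter> {z. Im z > - B})"
  have S: "convex S" "open S"
    unfolding S_def
    by (auto intro!: convex_Times convex_Int convex_halfspace_Im_gt convex_halfspace_Im_lt open_Times open_Int
        open_Collect_less continuous_intros)
  have x: "(\<tau>, z) \<in> S" using \<delta> by (auto simp: S_def B_def)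
  have Suhp: "s \<in> uhp" if "(s, w) \<in> S" for s w using that \<delta> by (auto simp: S_def uhp_def)
  define f where "f = (\<lambda>n (s, w). theta_term p s w (int_decode n))"
  define f' where "f' = (\<lambda>n (s, w) (v, u). complex_of_real pi * \<i> * theta_term (p + 2) s w (int_decode n) * v
      + 2 * complex_of_real pi * \<i> * theta_term (p + 1) s w (int_decode n) * u)"
  define m where "m = (\<lambda>p (n::int). \<bar>of_int n\<bar> ^ p * exp (- (pi * \<delta>) * (of_int n)\<^sup>2 + (2 * pi * B) * \<bar>of_int n\<bar>) :: real)"
  define M where "M = (\<lambda>n. pi * m (p + 2) (int_decode n) + 2 * pi * m (p + 1) (int_decode n))"
  have sm: "summable (\<lambda>n. m p (int_decode n))" for p
  proof -
    have "m p summable_on UNIV"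
      unfolding m_def using \<delta> by (intro theta_majorant_summable) auto
    then have "(\<lambda>n. m p (int_decode n)) summable_on UNIV"
      using summable_on_reindex_bij_betw[OF bij_int_decode, of "m p"] by simp
    then show ?thesis by (rule summable_on_imp_summable)
  qed
  have bnd: "norm (theta_term p s w n) \<le> m p n" if "(s, w) \<in> S" for p s w n
    unfolding m_def using that by (intro norm_theta_term_le) (auto simp: S_def)
  have "((\<lambda>x. \<Sum>n. f n x) has_derivative (\<lambda>h. \<Sum>n. f' n (\<tau>, z) h)) (at (\<tau>, z))"
  proof (rule has_derivative_suminf[OF S])
    show "summable M" unfolding M_def by (intro summable_add summable_mult sm)
    show "summable (\<lambda>n. f n x)" if "x \<in> S" for x
      using that th_eq_suminf[OF Suhp] by (cases x) (auto simp: f_def sums_iff)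
    show "norm (f' n x h) \<le> M n * norm h" if "x \<in> S" for n x h
    proof -
      obtain s w v u where xh: "x = (s, w)" "h = (v, u)" by (cases x; cases h) auto
      have "norm (f' n x h) \<le> pi * norm (theta_term (p + 2) s w (int_decode n)) * norm v +
          2 * pi * norm (theta_term (p + 1) s w (int_decode n)) * norm u"
        unfolding xh f'_def prod.case by (rule order_trans[OF norm_triangle_ineq]) (simp add: norm_mult)
      also have "\<dots> \<le> pi * m (p + 2) (int_decode n) * norm h + 2 * pi * m (p + 1) (int_decode n) * norm h"
      proof -
        have m0: "m p n \<ge> 0" for p n by (simp add: m_def)
        have "norm v \<le> norm h" "norm u \<le> norm h"
          unfolding xh by (rule norm_fst_le norm_snd_le)+
        with bnd[of s w] that m0 show ?thesis
          unfolding xh by (intro add_mono mult_mono mult_nonneg_nonneg) auto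
      qed
      finally show ?thesis by (simp add: M_def algebra_simps)
    qed
    show "(f n has_derivative f' n x) (at x)" for n x
    proof -
      obtain s w where xh: "x = (s, w)" by (cases x) auto
      define k where "k = (of_int (int_decode n) :: complex)"
      define c d where "c = complex_of_real pi * \<i> * k\<^sup>2" and "d = 2 * complex_of_real pi * \<i> * k"
      have "bounded_linear (\<lambda>y. c * fst y + d * snd y)"
        by (intro bounded_linear_add bounded_linear_const_mult bounded_linear_fst bounded_linear_snd)
      then have "((\<lambda>y. c * fst y + d * snd y) has_derivative (\<lambda>y. c * fst y + d * snd y)) (at x)"
        by (rule bounded_linear_imp_has_derivative)
      moreover have "(exp has_derivative (\<lambda>h. exp (c * fst x + d * snd x) * h)) (at (c * fst x + d * snd x))"
        using DERIV_exp[of "c * fst x + d * snd x"] by (simp add: has_field_derivative_def)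
      ultimately have "((\<lambda>y. exp (c * fst y + d * snd y)) has_derivative
          (\<lambda>h. exp (c * fst x + d * snd x) * (c * fst h + d * snd h))) (at x)"
        by (rule has_derivative_compose)
      then have "((\<lambda>y. k ^ p * exp (c * fst y + d * snd y)) has_derivative
          (\<lambda>h. k ^ p * (exp (c * fst x + d * snd x) * (c * fst h + d * snd h)))) (at x)"
        by (rule has_derivative_mult_right)
      moreover have "(\<lambda>y. k ^ p * exp (c * fst y + d * snd y)) = f n"
        by (auto simp: f_def theta_term_def ee_def k_def c_def d_def fun_eq_iff algebra_simps)
      moreover have "(\<lambda>h. k ^ p * (exp (c * fst x + d * snd x) * (c * fst h + d * snd h))) = f' n x"
        by (auto simp: f'_def theta_term_def ee_def k_def c_def d_def xh power_add power2_eq_square fun_eq_iff algebra_simps)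
      ultimately show ?thesis by simp
    qed
  qed (fact x)
  also have "(\<lambda>h. \<Sum>n. f' n (\<tau>, z) h) =
    (\<lambda>(v, w). complex_of_real pi * \<i> * th (p + 2) \<tau> z * v + 2 * complex_of_real pi * \<i> * th (p + 1) \<tau> z * w)"
  proof (intro ext)
    fix h :: "complex \<times> complex"
    obtain v w where h: "h = (v, w)" by (cases h) auto
    have "(\<lambda>n. f' n (\<tau>, z) h) sums (complex_of_real pi * \<i> * th (p + 2) \<tau> z * v + 2 * complex_of_real pi * \<i> * th (p + 1) \<tau> z * w)"
      unfolding f'_def h prod.case by (intro sums_add sums_mult sums_mult2 th_eq_suminf \<tau>)
    then show "(\<Sum>n. f' n (\<tau>, z) h) = (case h of (v, w) \<Rightarrow> complex_of_real pi * \<i> * th (p + 2) \<tau> z * v + 2 * complex_of_real pi * \<i> * th (p + 1) \<tau> z * w)"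
      by (simp add: h sums_iff)
  qed
  finally show ?thesis
    by (rule has_derivative_transform_within_open[OF _ S(2) x])
      (auto simp: f_def sums_iff dest!: Suhp th_eq_suminf[of _ p])
qed

lemma th_DERIV:
  assumes f: "(f has_field_derivative f') (at x)" and g: "(g has_field_derivative g') (at x)" and x: "f x \<in> uhp"
  shows "((\<lambda>x. th p (f x) (g x)) has_field_derivative
    complex_of_real pi * \<i> * th (p + 2) (f x) (g x) * f' + 2 * complex_of_real pi * \<i> * th (p + 1) (f x) (g x) * g') (at x)"
proof -
  have "((\<lambda>x. (f x, g x)) has_derivative (\<lambda>h. (f' * h, g' * h))) (at x)"
    using f g by (intro has_derivative_Pair) (auto simp: has_field_derivative_def)
  from has_derivative_compose[OF this th_has_derivative[OF x, of p "g x"]]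
  have "((\<lambda>x. th p (f x) (g x)) has_derivative (\<lambda>h. complex_of_real pi * \<i> * th (p + 2) (f x) (g x) * (f' * h) +
      2 * complex_of_real pi * \<i> * th (p + 1) (f x) (g x) * (g' * h))) (at x)"
    unfolding prod.case .
  then show ?thesis
    unfolding has_field_derivative_def
    by (rule has_derivative_eq_rhs) (simp add: fun_eq_iff algebra_simps)
qed

lemma th_add_1: "th 0 \<tau> (z + 1) = th 0 \<tau> z"
  unfolding th_def theta_term_def by (simp add: ring_distribs add.assoc[symmetric] ee_add[of "_ + _"])

lemma th_add_tau:
  assumes "\<tau> \<in> uhp"
  shows "th 0 \<tau> (z + \<tau>) = ee (- \<tau> / 2 - z) * th 0 \<tau> z"
proof -
  have "theta_term 0 \<tau> (z + \<tau>) n = ee (- \<tau> / 2 - z) * theta_term 0 \<tau> z (n + 1)" for n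
  proof -
    have "(of_int n)\<^sup>2 * \<tau> / 2 + of_int n * (z + \<tau>) =
        (- \<tau> / 2 - z) + ((of_int (n + 1))\<^sup>2 * \<tau> / 2 + of_int (n + 1) * z)"
      by (simp add: power2_eq_square ring_distribs add_divide_distrib)
    then show ?thesis
      unfolding theta_term_def by (simp only: ee_add[of "- \<tau> / 2 - z"] power_0 mult_1_left)
  qed
  then have "th 0 \<tau> (z + \<tau>) = (\<Sum>\<^sub>\<infinity>n. ee (- \<tau> / 2 - z) * theta_term 0 \<tau> z (n + 1))"
    by (simp add: th_def)
  also have "\<dots> = ee (- \<tau> / 2 - z) * (\<Sum>\<^sub>\<infinity>n. theta_term 0 \<tau> z (n + 1))"
    by (rule infsum_cmult_right')
  also have "(\<Sum>\<^sub>\<infinity>n. theta_term 0 \<tau> z (n + 1)) = th 0 \<tau> z"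
    unfolding th_def by (rule infsum_reindex_bij_witness[of _ "\<lambda>n. n - 1" "\<lambda>n. n + 1"]) auto
  finally show ?thesis .
qed

section \<open>Fourier coefficients of periodic entire functions\<close>

definition period_int :: "(complex \<Rightarrow> complex) \<Rightarrow> complex" where
  "period_int f = contour_integral (linepath 0 1) f"

lemma period_int_primitive:
  assumes "\<And>z. (F has_field_derivative f z) (at z)"
  shows "period_int f = F 1 - F 0"
proof -
  have "(f has_contour_integral (F (pathfinish (linepath 0 1)) - F (pathstart (linepath 0 1)))) (linepath 0 1)"
    by (rule contour_integral_primitive[OF _ valid_path_linepath, of UNIV]) (use assms in auto)
  then show ?thesis by (simp add: period_int_def contour_integral_unique)
qed

text \<open>For a primitive F of f, the difference F (z + 1) - F z has derivative 0, so the integral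
  from w to w + 1 does not depend on w.\<close>

lemma period_int_shift:
  assumes f: "f holomorphic_on UNIV" and per: "\<And>z. f (z + 1) = f z"
  shows "period_int (\<lambda>z. f (z + w)) = period_int f"
proof -
  obtain F where F: "\<And>z. (F has_field_derivative f z) (at z)"
    using holomorphic_convex_primitive'[of UNIV f] f by auto
  have Fs: "((\<lambda>z. F (z + a)) has_field_derivative f (z + a)) (at z)" for a z
    using F[of "z + a"] by (simp add: DERIV_shift)
  have "((\<lambda>z. F (z + 1) - F z) has_field_derivative 0) (at z)" for z
    using DERIV_diff[OF Fs[of 1 z] F[of z]] by (simp add: per)
  then obtain c where "\<And>z. F (z + 1) - F z = c"
    using has_field_derivative_zero_constant[of UNIV "\<lambda>z. F (z + 1) - F z"] by auto
  then have "F (1 + w) - F (0 + w) = F 1 - F 0"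
    by (metis add.commute add.left_neutral)
  then show ?thesis
    by (simp add: period_int_primitive[OF F] period_int_primitive[OF Fs])
qed

lemma period_int_bound:
  assumes "f holomorphic_on UNIV" "\<And>x. x \<in> {0..1} \<Longrightarrow> norm (f (complex_of_real x)) \<le> B"
  shows "norm (period_int f) \<le> B"
proof -
  have "norm (period_int f) \<le> B * norm (1 - 0 :: complex)"
    unfolding period_int_def
  proof (rule contour_integral_bound_linepath)
    show "f contour_integrable_on linepath 0 1"
      using assms(1) by (intro contour_integrable_continuous_linepath holomorphic_on_imp_continuous_on) (rule holomorphic_on_subset, auto)
    show "0 \<le> B" using assms(2)[of 0] norm_ge_zero[of "f 0"] by (simp del: norm_ge_zero)
    show "norm (f x) \<le> B" if "x \<in> closed_segment 0 1" for x
      using that assms(2) by (auto simp: closed_segment_def scaleR_conv_of_real)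
  qed
  then show ?thesis by simp
qed

lemma entire_contour_integrable:
  "f holomorphic_on UNIV \<Longrightarrow> f contour_integrable_on linepath a b"
  by (intro contour_integrable_continuous_linepath holomorphic_on_imp_continuous_on) (auto intro: holomorphic_on_subset)

lemma period_int_add:
  "f holomorphic_on UNIV \<Longrightarrow> g holomorphic_on UNIV \<Longrightarrow> period_int (\<lambda>z. f z + g z) = period_int f + period_int g"
  by (simp add: period_int_def contour_integral_add entire_contour_integrable)

lemma period_int_diff:
  "f holomorphic_on UNIV \<Longrightarrow> g holomorphic_on UNIV \<Longrightarrow> period_int (\<lambda>z. f z - g z) = period_int f - period_int g"
  by (simp add: period_int_def contour_integral_diff entire_contour_integrable)

lemma period_int_cmult:
  "f holomorphic_on UNIV \<Longrightarrow> period_int (\<lambda>z. c * f z) = c * period_int f"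
  by (simp add: period_int_def contour_integral_lmul entire_contour_integrable)

lemma period_int_ee: "period_int (\<lambda>z. ee (of_int n * z)) = (if n = 0 then 1 else 0)"
proof (cases "n = 0")
  case True
  then show ?thesis using period_int_primitive[of "\<lambda>z. z" "\<lambda>_. 1"] by simp
next
  case False
  have "((\<lambda>z. ee (of_int n * z) / (2 * complex_of_real pi * \<i> * of_int n)) has_field_derivative ee (of_int n * z)) (at z)" for z
    by (rule derivative_eq_intros refl)+ (use False in auto)
  from period_int_primitive[OF this] False show ?thesis by simp
qed

text \<open>Write h = h 0 + (\<open>ee z\<close> - 1) k with k entire and periodic. The Fourier
  coefficients kappa of k satisfy kappa (n - 1) = kappa n except at n = 0, where they differ by h 0.
  So they are constant for n >= 0 and for n <= -1; shifting the line of integration makes them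
  decay, and both constants are 0. No convergence of a Fourier series is involved.\<close>

lemma periodic_entire_zero_at_0:
  assumes h: "h holomorphic_on UNIV" and per: "\<And>z. h (z + 1) = h z"
    and coeff: "\<And>n::int. period_int (\<lambda>z. h z * ee (- of_int n * z)) = 0"
  shows "h 0 = 0"
proof -
  have per_int: "h (z + of_int m) = h z" for z and m :: int
  proof (induction m rule: int_induct[of _ 0])
    case (step1 i)
    with per[of "z + of_int i"] show ?case by (simp add: add_ac)
  next
    case (step2 i)
    with per[of "z + of_int (i - 1)"] show ?case by (simp add: algebra_simps)
  qed simp
  \<comment> \<open>At integers the removable value is the ratio of the derivatives at 0.\<close>
  define k where "k = (\<lambda>z. if z \<in> \<int> then deriv h 0 / deriv ee 0 else (h z - h 0) / (ee z - 1))"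
  have k_per: "k (z + of_int m) = k z" for z m
    using per_int[of z m] by (auto simp: k_def)
  have dee: "deriv ee 0 = 2 * complex_of_real pi * \<i>"
    using ee_has_field_derivative[OF DERIV_ident, of 0] by (intro DERIV_imp_deriv) simp
  have ee_hol: "ee holomorphic_on S" for S
    using holomorphic_on_ee[of "\<lambda>z. z" S] by simp
  have k_near: "k field_differentiable at 0"
  proof -
    define F where "F = (\<lambda>z. if z = 0 then deriv h 0 else (h z - h 0) / (z - 0))"
    define G where "G = (\<lambda>z. if z = 0 then deriv ee 0 else (ee z - ee 0) / (z - 0))"
    have "F holomorphic_on UNIV" "G holomorphic_on UNIV"
      unfolding F_def G_def using h ee_hol by (intro pole_lemma; auto)+
    then have FG: "F holomorphic_on ball 0 1" "G holomorphic_on ball 0 1"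
      by (auto intro: holomorphic_on_subset)
    have int0: "z = 0" if "z \<in> ball 0 1" "z \<in> \<int>" for z :: complex
      using that by (auto elim!: Ints_cases)
    have "G z \<noteq> 0" if "z \<in> ball 0 1" for z
      using int0[OF that] ee_eq_1_iff[of z] by (auto simp: G_def dee)
    with FG have "(\<lambda>z. F z / G z) holomorphic_on ball 0 1" by (intro holomorphic_intros) auto
    then have "k holomorphic_on ball 0 1"
    proof (rule holomorphic_transform)
      fix z :: complex assume "z \<in> ball 0 1"
      with int0[of z] show "F z / G z = k z" by (auto simp: F_def G_def k_def)
    qed
    then show ?thesis by (rule holomorphic_on_imp_differentiable_at) auto
  qed
  have k: "k holomorphic_on UNIV"
    unfolding holomorphic_on_def
  proof
    fix z :: complex
    show "k field_differentiable at z"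
    proof (cases "z \<in> \<int>")
      case False
      have "(\<lambda>z. (h z - h 0) / (ee z - 1)) holomorphic_on - \<int>"
        using ee_eq_1_iff h by (intro holomorphic_intros holomorphic_on_subset[OF h] ee_hol) auto
      then have "k holomorphic_on - \<int>" by (rule holomorphic_transform) (auto simp: k_def)
      then show ?thesis using False by (intro holomorphic_on_imp_differentiable_at[of k "- \<int>"]) (auto simp: open_Compl)
    next
      case True
      then obtain m where m: "z = of_int m" by (auto elim: Ints_cases)
      obtain D where "(k has_field_derivative D) (at (z - z))" using k_near by (auto simp: field_differentiable_def)
      then have "((\<lambda>x. k (x - z)) has_field_derivative D * 1) (at z)"
        by (rule DERIV_chain2) (auto intro!: derivative_eq_intros)
      moreover have "k (x - z) = k x" for x using k_per[of x "- m"] by (simp add: m)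
      ultimately show ?thesis by (auto simp: field_differentiable_def)
    qed
  qed
  have hk: "h z = h 0 + (ee z - 1) * k z" for z
    using ee_eq_1_iff[of z] per_int[of 0] by (auto simp: k_def elim!: Ints_cases)
  define \<kappa> where "\<kappa> = (\<lambda>n::int. period_int (\<lambda>z. k z * ee (- of_int n * z)))"
  have \<kappa>: "\<kappa> (n - 1) - \<kappa> n + (if n = 0 then h 0 else 0) = 0" for n
  proof -
    have hol: "(\<lambda>z. h 0 * ee (of_int (- n) * z)) holomorphic_on UNIV"
      "(\<lambda>z. k z * ee (- of_int (n - 1) * z)) holomorphic_on UNIV" "(\<lambda>z. k z * ee (- of_int n * z)) holomorphic_on UNIV"
      by (intro holomorphic_intros k)+
    have "(\<lambda>z. h z * ee (- of_int n * z)) =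
        (\<lambda>z. h 0 * ee (of_int (- n) * z) + (k z * ee (- of_int (n - 1) * z) - k z * ee (- of_int n * z)))"
    proof
      fix z :: complex
      have "- of_int (n - 1) * z = - of_int n * z + z" by (simp add: algebra_simps)
      then have "ee (- of_int (n - 1) * z) = ee (- of_int n * z) * ee z"
        by (simp only: ee_add)
      then show "h z * ee (- of_int n * z) =
        h 0 * ee (of_int (- n) * z) + (k z * ee (- of_int (n - 1) * z) - k z * ee (- of_int n * z))"
        by (subst hk) (simp add: algebra_simps)
    qed
    with coeff[of n] have "0 = period_int (\<lambda>z. h 0 * ee (of_int (- n) * z) + (k z * ee (- of_int (n - 1) * z) - k z * ee (- of_int n * z)))"
      by simp
    also have "\<dots> = h 0 * (if n = 0 then 1 else 0) + (\<kappa> (n - 1) - \<kappa> n)"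
    proof -
      have ee_hol: "(\<lambda>z. ee (of_int (- n) * z)) holomorphic_on UNIV" by (intro holomorphic_intros)
      show ?thesis
        unfolding \<kappa>_def period_int_add[OF hol(1) holomorphic_on_diff[OF hol(2,3)]]
          period_int_diff[OF hol(2,3)] period_int_cmult[OF ee_hol] period_int_ee
        by simp
    qed
    finally show ?thesis by (auto simp: algebra_simps split: if_splits)
  qed
  have shift: "\<kappa> n = period_int (\<lambda>z. k (z + w) * ee (- of_int n * (z + w)))" for n w
    unfolding \<kappa>_def
    by (rule period_int_shift[symmetric]) (use k_per[of _ 1] in \<open>auto intro!: holomorphic_intros k simp: ring_distribs ee_diff\<close>)
  \<comment> \<open>Integration along the line Im z = y. Below, y = -1 handles n going to infinity
    and y = 1 handles n going to minus infinity.\<close>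
  have bound: "\<exists>B. \<forall>n. norm (\<kappa> n) \<le> B * exp (2 * pi * y * of_int n)" for y :: real
  proof -
    define w where "w = Complex 0 y"
    have "continuous_on (closed_segment w (w + 1)) k"
      using k by (intro holomorphic_on_imp_continuous_on holomorphic_on_subset[OF k]) auto
    then have "bounded (k ` closed_segment w (w + 1))"
      by (intro compact_imp_bounded compact_continuous_image) auto
    then obtain B where B: "\<And>x. x \<in> closed_segment w (w + 1) \<Longrightarrow> norm (k x) \<le> B"
      by (auto simp: bounded_iff)
    have "norm (\<kappa> n) \<le> B * exp (2 * pi * y * of_int n)" for n
      unfolding shift[of n w]
    proof (rule period_int_bound)
      show "(\<lambda>z. k (z + w) * ee (- of_int n * (z + w))) holomorphic_on UNIV"
        by (intro holomorphic_intros holomorphic_on_compose_gen[of "\<lambda>z. z + w" UNIV k UNIV, unfolded o_def] k) auto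
      fix x :: real assume x: "x \<in> {0..1}"
      have "complex_of_real x + w \<in> closed_segment w (w + 1)"
        using x by (auto simp: closed_segment_def scaleR_conv_of_real algebra_simps intro!: exI[of _ x])
      from B[OF this] show "norm (k (complex_of_real x + w) * ee (- of_int n * (complex_of_real x + w))) \<le> B * exp (2 * pi * y * of_int n)"
        by (simp add: norm_mult norm_ee w_def mult_ac mult_left_mono)
    qed
    then show ?thesis by blast
  qed
  have lim: "(\<lambda>n. B * exp (- 2 * pi) ^ n) \<longlonglongrightarrow> 0" for B :: real
  proof -
    have "(\<lambda>n. B * exp (- 2 * pi) ^ n) \<longlonglongrightarrow> B * 0"
      by (intro tendsto_intros LIMSEQ_realpow_zero) auto
    then show ?thesis by simp
  qed
  have "\<kappa> 0 = 0"
  proof -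
    have const: "\<kappa> (int n) = \<kappa> 0" for n
    proof (induction n)
      case (Suc n)
      have e: "int (Suc n) - 1 = int n" by simp
      show ?case using \<kappa>[of "int (Suc n)"] Suc unfolding e by simp
    qed simp
    obtain B where "\<And>n. norm (\<kappa> n) \<le> B * exp (2 * pi * (- 1) * of_int n)" using bound[of "- 1"] by blast
    then have "norm (\<kappa> 0) \<le> B * exp (- 2 * pi) ^ n" for n
      using const[of n] by (metis exp_of_nat2_mult mult.commute mult.right_neutral mult_minus_left mult_minus_right of_int_of_nat_eq)
    then have "norm (\<kappa> 0) \<le> 0" by (intro LIMSEQ_le_const[OF lim[of B]]) auto
    then show ?thesis by simp
  qed
  moreover have "\<kappa> (- 1) = 0"
  proof -
    have const: "\<kappa> (- 1 - int n) = \<kappa> (- 1)" for n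
    proof (induction n)
      case (Suc n)
      have e: "- 1 - int n - 1 = - 1 - int (Suc n)" by simp
      show ?case using \<kappa>[of "- 1 - int n"] Suc unfolding e by (simp split: if_splits)
    qed simp
    obtain B where B: "\<And>n. norm (\<kappa> n) \<le> B * exp (2 * pi * 1 * of_int n)" using bound[of 1] by blast
    have "norm (\<kappa> (- 1)) \<le> B * exp (- 2 * pi) ^ Suc n" for n
    proof -
      have "exp (- 2 * pi) ^ Suc n = exp (of_nat (Suc n) * (- 2 * pi))"
        by (rule exp_of_nat_mult[symmetric])
      also have "of_nat (Suc n) * (- 2 * pi) = 2 * pi * 1 * of_int (- 1 - int n)"
        by (simp add: algebra_simps)
      finally show ?thesis using B[of "- 1 - int n"] const[of n] by simp
    qed
    then have "norm (\<kappa> (- 1)) \<le> 0" by (intro LIMSEQ_le_const[OF LIMSEQ_Suc[OF lim[of B]]]) auto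
    then show ?thesis by simp
  qed
  ultimately show ?thesis using \<kappa>[of 0] by simp
qed

text \<open>The quasi-period ties the n-th Fourier coefficient to the next one by a nonzero factor,
  so one vanishing coefficient kills all of them. In other words, functions with these periods form
  a space of dimension at most one, with \<open>period_int\<close> as coordinate.\<close>

lemma quasi_periodic_entire_zero:
  assumes h: "h holomorphic_on UNIV" and per: "\<And>z. h (z + 1) = h z"
    and quasi: "\<And>z. h (z + \<tau>) = ee (- \<tau> / 2 - z) * h z" and zero: "period_int h = 0"
  shows "h w = 0"
proof -
  define a where "a = (\<lambda>n::int. period_int (\<lambda>z. h z * ee (- of_int n * z)))"
  have hol: "(\<lambda>z. h z * ee (- of_int n * z)) holomorphic_on UNIV" for n :: int
    by (intro holomorphic_intros h)
  have per': "h (z + 1) * ee (- of_int n * (z + 1)) = h z * ee (- of_int n * z)" for n :: int and z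
    by (simp add: per ring_distribs ee_diff)
  have rec: "a n = ee (- \<tau> / 2 - of_int n * \<tau>) * a (n + 1)" for n
  proof -
    have "a n = period_int (\<lambda>z. h (z + \<tau>) * ee (- of_int n * (z + \<tau>)))"
      unfolding a_def by (rule period_int_shift[symmetric, OF hol per'])
    also have "(\<lambda>z. h (z + \<tau>) * ee (- of_int n * (z + \<tau>))) =
        (\<lambda>z. ee (- \<tau> / 2 - of_int n * \<tau>) * (h z * ee (- of_int (n + 1) * z)))"
    proof
      fix z :: complex
      have "(- \<tau> / 2 - z) + (- of_int n * (z + \<tau>)) = (- \<tau> / 2 - of_int n * \<tau>) + (- of_int (n + 1) * z)"
        by (simp add: algebra_simps)
      then have "ee (- \<tau> / 2 - z) * ee (- of_int n * (z + \<tau>)) = ee (- \<tau> / 2 - of_int n * \<tau>) * ee (- of_int (n + 1) * z)"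
        by (simp only: ee_add[symmetric])
      then show "h (z + \<tau>) * ee (- of_int n * (z + \<tau>)) = ee (- \<tau> / 2 - of_int n * \<tau>) * (h z * ee (- of_int (n + 1) * z))"
        by (simp add: quasi mult_ac)
    qed
    also have "period_int \<dots> = ee (- \<tau> / 2 - of_int n * \<tau>) * a (n + 1)"
      unfolding a_def by (rule period_int_cmult[OF hol])
    finally show ?thesis .
  qed
  have a: "a n = 0" for n
  proof (induction n rule: int_induct[of _ 0])
    case base
    then show ?case using zero by (simp add: a_def)
  next
    case (step1 i)
    then show ?case using rec[of i] by simp
  next
    case (step2 i)
    then show ?case using rec[of "i - 1"] by simp
  qed
  have "h (0 + w) = 0"
  proof (rule periodic_entire_zero_at_0)
    show hw: "(\<lambda>z. h (z + w)) holomorphic_on UNIV"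
      by (intro holomorphic_on_compose_gen[of "\<lambda>z. z + w" UNIV h UNIV, unfolded o_def] holomorphic_intros h) auto
    show "h (z + 1 + w) = h (z + w)" for z
      using per[of "z + w"] by (simp add: add_ac)
    show "period_int (\<lambda>z. h (z + w) * ee (- of_int n * z)) = 0" for n :: int
    proof -
      have eq: "(\<lambda>z. h (z + w) * ee (- of_int n * z)) = (\<lambda>z. ee (of_int n * w) * (h (z + w) * ee (- of_int n * (z + w))))"
      proof
        fix z :: complex
        have "- of_int n * z = of_int n * w + (- of_int n * (z + w))" by (simp add: algebra_simps)
        then have "ee (- of_int n * z) = ee (of_int n * w) * ee (- of_int n * (z + w))"
          by (simp only: ee_add)
        then show "h (z + w) * ee (- of_int n * z) = ee (of_int n * w) * (h (z + w) * ee (- of_int n * (z + w)))"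
          by simp
      qed
      have "period_int (\<lambda>z. h (z + w) * ee (- of_int n * z)) = ee (of_int n * w) * period_int (\<lambda>z. h (z + w) * ee (- of_int n * (z + w)))"
        unfolding eq by (rule period_int_cmult) (intro holomorphic_intros hw)
      also have "period_int (\<lambda>z. h (z + w) * ee (- of_int n * (z + w))) = a n"
        unfolding a_def by (rule period_int_shift[OF hol per'])
      finally show ?thesis by (simp add: a)
    qed
  qed
  then show ?thesis by simp
qed

section \<open>The inversion formula\<close>

lemma th_holomorphic:
  assumes "\<tau> \<in> uhp"
  shows "th p \<tau> holomorphic_on UNIV"
  unfolding holomorphic_on_def field_differentiable_def
  using th_DERIV[of "\<lambda>_. \<tau>" 0 _ "\<lambda>z. z" 1 p] assms by (auto intro: has_field_derivative_at_within)

lemma th_DERIV_z: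
  assumes "\<tau> \<in> uhp" "(g has_field_derivative g') (at x)"
  shows "((\<lambda>x. th p \<tau> (g x)) has_field_derivative 2 * complex_of_real pi * \<i> * th (p + 1) \<tau> (g x) * g') (at x)"
  using th_DERIV[of "\<lambda>_. \<tau>" 0 x g g' p] assms by simp

text \<open>The product \<open>g\<close> of a Gaussian and the inverted theta function has the same
  two periods as \<open>th 0 \<tau>\<close>, so it is a multiple of it. The nonzero value at 0 makes
  \<open>period_int\<close> nonzero and lets the factor be read off at z = 0.\<close>

lemma th_inversion_ratio:
  assumes \<tau>: "\<tau> \<in> uhp" and nz: "th 0 \<tau> 0 \<noteq> 0"
  shows "th 0 (- 1 / \<tau>) (z / \<tau>) = th 0 (- 1 / \<tau>) 0 / th 0 \<tau> 0 * ee (z\<^sup>2 / (2 * \<tau>)) * th 0 \<tau> z"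
proof -
  define \<tau>' where "\<tau>' = - 1 / \<tau>"
  have \<tau>': "\<tau>' \<in> uhp" and \<tau>0: "\<tau> \<noteq> 0" using \<tau> uhp_nonzero[OF \<tau>] by (auto simp: \<tau>'_def)
  define g where "g = (\<lambda>z. ee (- (z\<^sup>2) / (2 * \<tau>)) * th 0 \<tau>' (z / \<tau>))"
  have g: "g holomorphic_on UNIV"
  proof -
    have "(\<lambda>z. th 0 \<tau>' (z / \<tau>)) holomorphic_on UNIV"
      by (rule holomorphic_on_compose_gen[of "\<lambda>z. z / \<tau>" UNIV "th 0 \<tau>'" UNIV, unfolded o_def])
        (use \<tau>0 in \<open>auto intro!: holomorphic_intros th_holomorphic \<tau>'\<close>)
    then show ?thesis unfolding g_def using \<tau>0 by (intro holomorphic_intros) auto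
  qed
  have g1: "g (z + 1) = g z" for z
  proof -
    have "th 0 \<tau>' (z / \<tau>) = ee (- \<tau>' / 2 - (z + 1) / \<tau>) * th 0 \<tau>' ((z + 1) / \<tau>)"
      using th_add_tau[OF \<tau>', of "(z + 1) / \<tau>"] by (simp add: \<tau>'_def add_divide_distrib)
    moreover have "- (z\<^sup>2) / (2 * \<tau>) + (- \<tau>' / 2 - (z + 1) / \<tau>) = - ((z + 1)\<^sup>2) / (2 * \<tau>)"
      using \<tau>0 by (simp add: \<tau>'_def field_simps power2_eq_square)
    ultimately show ?thesis
      unfolding g_def by (simp only: mult.assoc[symmetric] ee_add[symmetric])
  qed
  have g\<tau>: "g (z + \<tau>) = ee (- \<tau> / 2 - z) * g z" for z
  proof -
    have "th 0 \<tau>' ((z + \<tau>) / \<tau>) = th 0 \<tau>' (z / \<tau>)"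
      using th_add_1[of \<tau>' "z / \<tau>"] \<tau>0 by (simp add: add_divide_distrib)
    moreover have "- ((z + \<tau>)\<^sup>2) / (2 * \<tau>) = (- \<tau> / 2 - z) + - (z\<^sup>2) / (2 * \<tau>)"
      using \<tau>0 by (simp add: field_simps power2_eq_square)
    ultimately show ?thesis
      unfolding g_def by (simp only: mult.assoc[symmetric] ee_add[symmetric])
  qed
  have hol: "th 0 \<tau> holomorphic_on UNIV" by (rule th_holomorphic[OF \<tau>])
  have "period_int (th 0 \<tau>) \<noteq> 0"
    using quasi_periodic_entire_zero[OF hol th_add_1 th_add_tau[OF \<tau>], of 0] nz by blast
  define c where "c = period_int g / period_int (th 0 \<tau>)"
  have "g z - c * th 0 \<tau> z = 0" for z
  proof (rule quasi_periodic_entire_zero[where h = "\<lambda>z. g z - c * th 0 \<tau> z" and \<tau> = \<tau>])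
    show "(\<lambda>z. g z - c * th 0 \<tau> z) holomorphic_on UNIV"
      by (intro holomorphic_intros g hol)
    show "g (z + 1) - c * th 0 \<tau> (z + 1) = g z - c * th 0 \<tau> z" for z
      by (simp add: g1 th_add_1)
    show "g (z + \<tau>) - c * th 0 \<tau> (z + \<tau>) = ee (- \<tau> / 2 - z) * (g z - c * th 0 \<tau> z)" for z
      unfolding g\<tau> th_add_tau[OF \<tau>] by (simp add: right_diff_distrib)
    have "period_int (\<lambda>z. g z - c * th 0 \<tau> z) = period_int g - c * period_int (th 0 \<tau>)"
      using hol g by (subst period_int_diff) (auto intro!: holomorphic_intros simp: period_int_cmult)
    also have "\<dots> = 0" using \<open>period_int (th 0 \<tau>) \<noteq> 0\<close> by (simp add: c_def)
    finally show "period_int (\<lambda>z. g z - c * th 0 \<tau> z) = 0" .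
  qed
  then have gc: "g z = c * th 0 \<tau> z" for z by simp
  have "g 0 = th 0 \<tau>' 0" by (simp add: g_def)
  with gc[of 0] nz have c: "c = th 0 \<tau>' 0 / th 0 \<tau> 0" by simp
  have "th 0 \<tau>' (z / \<tau>) = ee (z\<^sup>2 / (2 * \<tau>)) * g z"
    by (simp add: g_def ee_minus flip: mult.assoc)
  then show ?thesis
    unfolding gc c \<tau>'_def by (simp add: mult_ac)
qed

text \<open>The \<open>z\<^sup>2\<close>-coefficient of the inversion formula is, by the heat equation, a differential equation
  in \<open>\<tau>\<close> for the factor \<open>th 0 (- 1 / \<tau>) 0 / th 0 \<tau> 0\<close>.\<close>

lemma th_inversion_ratio_ODE:
  assumes \<tau>: "\<tau> \<in> uhp" and nz: "th 0 \<tau> 0 \<noteq> 0"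
  shows "th 2 (- 1 / \<tau>) 0 / \<tau>\<^sup>2 = th 0 (- 1 / \<tau>) 0 / th 0 \<tau> 0 * (th 0 \<tau> 0 / (2 * complex_of_real pi * \<i> * \<tau>) + th 2 \<tau> 0)"
proof -
  define \<tau>' c w where "\<tau>' = - 1 / \<tau>" and "c = th 0 (- 1 / \<tau>) 0 / th 0 \<tau> 0" and "w = 2 * complex_of_real pi * \<i>"
  have \<tau>': "\<tau>' \<in> uhp" and \<tau>0: "\<tau> \<noteq> 0" using \<tau> uhp_nonzero[OF \<tau>] by (auto simp: \<tau>'_def)
  have w: "w \<noteq> 0" by (simp add: w_def)
  have eq: "(\<lambda>z. th 0 \<tau>' (z / \<tau>)) = (\<lambda>z. c * ee (z\<^sup>2 / (2 * \<tau>)) * th 0 \<tau> z)"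
    using th_inversion_ratio[OF \<tau> nz] by (auto simp: \<tau>'_def c_def)
  have dd: "((\<lambda>z. z / \<tau>) has_field_derivative 1 / \<tau>) (at z)" for z
    using \<tau>0 by (auto intro!: derivative_eq_intros)
  have de: "((\<lambda>z. ee (z\<^sup>2 / (2 * \<tau>))) has_field_derivative w * (z / \<tau>) * ee (z\<^sup>2 / (2 * \<tau>))) (at z)" for z
    using \<tau>0 by (auto intro!: derivative_eq_intros simp: w_def field_simps)
  have dth: "(th p \<tau> has_field_derivative w * th (p + 1) \<tau> z) (at z)" for p z
    using th_DERIV_z[OF \<tau> DERIV_ident, of p z] by (simp add: w_def)
  have L1: "((\<lambda>z. th p \<tau>' (z / \<tau>)) has_field_derivative w * th (p + 1) \<tau>' (z / \<tau>) / \<tau>) (at z)" for p z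
    using th_DERIV_z[OF \<tau>' dd, of p z] by (simp add: w_def)
  have R1: "((\<lambda>z. c * ee (z\<^sup>2 / (2 * \<tau>)) * th 0 \<tau> z) has_field_derivative
      c * (w * (z / \<tau>) * ee (z\<^sup>2 / (2 * \<tau>)) * th 0 \<tau> z + ee (z\<^sup>2 / (2 * \<tau>)) * (w * th 1 \<tau> z))) (at z)" for z
    by (rule derivative_eq_intros de dth refl)+ (simp add: algebra_simps)
  have eq1: "(\<lambda>z. w * th 1 \<tau>' (z / \<tau>) / \<tau>) =
      (\<lambda>z. c * (w * (z / \<tau>) * ee (z\<^sup>2 / (2 * \<tau>)) * th 0 \<tau> z + ee (z\<^sup>2 / (2 * \<tau>)) * (w * th 1 \<tau> z)))"
    using DERIV_unique[OF L1[of 0, unfolded eq] R1] by auto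
  have "((\<lambda>z. w * th 1 \<tau>' (z / \<tau>) / \<tau>) has_field_derivative w * (w * th 2 \<tau>' (0 / \<tau>) / \<tau>) / \<tau>) (at 0)"
    using L1[of 1 0] \<tau>0 by (auto intro!: derivative_eq_intros simp: numeral_2_eq_2)
  moreover have "((\<lambda>z. c * (w * (z / \<tau>) * ee (z\<^sup>2 / (2 * \<tau>)) * th 0 \<tau> z + ee (z\<^sup>2 / (2 * \<tau>)) * (w * th 1 \<tau> z)))
      has_field_derivative c * (w * (1 / \<tau>) * th 0 \<tau> 0 + w * (w * th 2 \<tau> 0))) (at 0)"
    by (rule derivative_eq_intros de dth dd refl)+ (use \<tau>0 in \<open>simp add: numeral_2_eq_2\<close>)
  ultimately have "w * (w * th 2 \<tau>' (0 / \<tau>) / \<tau>) / \<tau> = c * (w * (1 / \<tau>) * th 0 \<tau> 0 + w * (w * th 2 \<tau> 0))"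
    unfolding eq1 by (rule DERIV_unique)
  then have "w * w * (th 2 \<tau>' 0 / \<tau>\<^sup>2) = w * w * (c * (th 0 \<tau> 0 / (w * \<tau>) + th 2 \<tau> 0))"
    using w \<tau>0 by (simp add: field_simps power2_eq_square)
  then have "th 2 \<tau>' 0 / \<tau>\<^sup>2 = c * (th 0 \<tau> 0 / (w * \<tau>) + th 2 \<tau> 0)"
    by (subst (asm) mult_left_cancel) (use w in auto)
  then show ?thesis by (simp add: w_def c_def \<tau>'_def)
qed

lemma th_DERIV_tau:
  assumes "\<tau> \<in> uhp"
  shows "((\<lambda>\<tau>. th p \<tau> z) has_field_derivative complex_of_real pi * \<i> * th (p + 2) \<tau> z) (at \<tau>)"
  using th_DERIV[of "\<lambda>\<tau>. \<tau>" 1 \<tau> "\<lambda>_. z" 0 p] assms by simp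

text \<open>At tau = i all summands are positive real numbers.\<close>

lemma th_at_ii: "th 0 \<i> 0 \<noteq> 0"
proof -
  have eq: "theta_term 0 \<i> 0 = (\<lambda>n. complex_of_real (exp (- pi * (of_int n)\<^sup>2)))"
    by (auto simp: theta_term_def ee_def exp_of_real[symmetric] fun_eq_iff field_simps)
  have s: "(\<lambda>n::int. exp (- pi * (of_int n)\<^sup>2)) summable_on UNIV"
    using theta_term_abs_summable[of \<i> 0 0] by (simp add: eq)
  have "th 0 \<i> 0 = complex_of_real (\<Sum>\<^sub>\<infinity>n::int. exp (- pi * (of_int n)\<^sup>2))"
    unfolding th_def eq by (intro infsumI has_sum_of_real has_sum_infsum s)
  moreover have "(\<Sum>\<^sub>\<infinity>n::int. exp (- pi * (of_int n)\<^sup>2)) \<ge> (\<Sum>n\<in>{0::int}. exp (- pi * (of_int n)\<^sup>2))"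
    by (rule finite_sum_le_infsum[OF s]) auto
  ultimately show ?thesis by auto
qed

text \<open>The eighth power avoids choosing a branch of the square root of tau / i. By the
  differential equation \<open>Q\<close> is constant near i, and at this fixed point it equals 1
  because i^4 = 1. The formula is first obtained on a ball where the theta constant does not vanish,
  and then extends to the half plane by analytic continuation.\<close>

theorem theta_product_inversion:
  assumes \<tau>: "\<tau> \<in> uhp"
  shows "(\<Prod>i\<in>UNIV. th 0 (- 1 / \<tau>) (z $ i / \<tau>)) =
    \<tau> ^ 4 * ee (cdot z z / (2 * \<tau>)) * (\<Prod>i\<in>UNIV. th 0 \<tau> (z $ i))"
proof -
  define A where "A = (\<lambda>\<tau>. th 0 \<tau> 0)"
  have A': "(A has_field_derivative complex_of_real pi * \<i> * th 2 s 0) (at s)" if "s \<in> uhp" for s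
    unfolding A_def using th_DERIV_tau[OF that, of 0 0] by (simp add: numeral_2_eq_2)
  have "A holomorphic_on uhp"
    unfolding holomorphic_on_def field_differentiable_def
    using A' by (auto intro: has_field_derivative_at_within)
  then have "continuous_on uhp A" by (rule holomorphic_on_imp_continuous_on)
  then have "open {s \<in> uhp. A s \<in> - {0}}"
    using continuous_open_preimage[of uhp A "- {0}"] open_uhp by (simp add: vimage_def Int_def open_Compl)
  moreover have "\<i> \<in> {s \<in> uhp. A s \<in> - {0}}" using th_at_ii by (simp add: A_def)
  ultimately obtain r where r: "r > 0" "ball \<i> r \<subseteq> {s \<in> uhp. A s \<in> - {0}}"
    by (meson openE)
  then have rb: "s \<in> uhp" "A s \<noteq> 0" if "s \<in> ball \<i> r" for s using that by auto
  define Q where "Q = (\<lambda>s. A (- 1 / s) ^ 8 / (s ^ 4 * A s ^ 8))"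
  have "(Q has_field_derivative 0) (at s within ball \<i> r)" if s: "s \<in> ball \<i> r" for s
  proof -
    note su = rb(1)[OF s] and nz = rb(2)[OF s]
    have s0: "s \<noteq> 0" using su by (rule uhp_nonzero)
    \<comment> \<open>\<open>d\<close> is the logarithmic derivative shared by the numerator and the
      denominator of \<open>Q\<close>.\<close>
    define a a' a1 d where "a = A s" and "a' = complex_of_real pi * \<i> * th 2 s 0" and "a1 = A (- 1 / s)"
      and "d = 4 / s + 8 * a' / a"
    have "((\<lambda>\<tau>. - 1 / \<tau>) has_field_derivative 1 / s\<^sup>2) (at s)"
      using s0 by (auto intro!: derivative_eq_intros simp: power2_eq_square field_simps)
    from DERIV_chain2[OF A'[OF inversion_in_uhp[OF su]] this]
    have "((\<lambda>s. A (- 1 / s)) has_field_derivative complex_of_real pi * \<i> * th 2 (- 1 / s) 0 * (1 / s\<^sup>2)) (at s)" .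
    also have "complex_of_real pi * \<i> * th 2 (- 1 / s) 0 * (1 / s\<^sup>2) = complex_of_real pi * \<i> * (th 2 (- 1 / s) 0 / s\<^sup>2)"
      by simp
    also have "\<dots> = a1 * (1 / (2 * s) + a' / a)"
      using th_inversion_ratio_ODE[OF su] nz s0
      by (simp add: a_def a'_def a1_def A_def field_simps)
    finally have 1: "((\<lambda>s. A (- 1 / s)) has_field_derivative a1 * (1 / (2 * s) + a' / a)) (at s)" .
    have n: "((\<lambda>s. A (- 1 / s) ^ 8) has_field_derivative d * a1 ^ 8) (at s)"
      by (rule derivative_eq_intros 1 refl)+ (simp add: a1_def d_def eval_nat_numeral ring_distribs)
    have m: "((\<lambda>s. s ^ 4 * A s ^ 8) has_field_derivative d * (s ^ 4 * a ^ 8)) (at s)"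
      by (rule derivative_eq_intros A'[OF su] refl)+
        (use s0 nz in \<open>simp add: a_def[symmetric] a'_def d_def eval_nat_numeral field_simps\<close>)
    have "(Q has_field_derivative (d * a1 ^ 8 * (s ^ 4 * a ^ 8) - a1 ^ 8 * (d * (s ^ 4 * a ^ 8))) / (s ^ 4 * a ^ 8 * (s ^ 4 * a ^ 8))) (at s)"
      unfolding Q_def using DERIV_divide[OF n m] s0 nz by (simp add: a_def a1_def)
    then show ?thesis by (simp add: algebra_simps has_field_derivative_at_within)
  qed
  then obtain c where c: "\<And>s. s \<in> ball \<i> r \<Longrightarrow> Q s = c"
    using has_field_derivative_zero_constant[OF convex_ball] by blast
  have "Q \<i> = 1" using th_at_ii by (simp add: Q_def A_def power_numeral_reduce)
  then have Q1: "Q s = 1" if "s \<in> ball \<i> r" for s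
    using c[OF that] c[of \<i>] r by simp
  have local: "(\<Prod>i\<in>UNIV. th 0 (- 1 / s) (z $ i / s)) =
    s ^ 4 * ee (cdot z z / (2 * s)) * (\<Prod>i\<in>UNIV. th 0 s (z $ i))" if s: "s \<in> ball \<i> r" for s
  proof -
    note su = rb(1)[OF s] and nz = rb(2)[OF s]
    have s0: "s \<noteq> 0" using su by (rule uhp_nonzero)
    have "(\<Prod>i\<in>UNIV. th 0 (- 1 / s) (z $ i / s)) =
      (\<Prod>i\<in>(UNIV :: 8 set). (A (- 1 / s) / A s) * (ee ((z $ i)\<^sup>2 / (2 * s)) * th 0 s (z $ i)))"
      using th_inversion_ratio[OF su] nz by (intro prod.cong) (auto simp: A_def)
    also have "\<dots> = (A (- 1 / s) / A s) ^ 8 * ((\<Prod>i\<in>UNIV. ee ((z $ i)\<^sup>2 / (2 * s))) * (\<Prod>i\<in>UNIV. th 0 s (z $ i)))"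
      by (simp only: prod.distrib prod_constant) simp
    also have "(A (- 1 / s) / A s) ^ 8 = s ^ 4"
      using Q1[OF s] s0 nz by (simp add: Q_def power_divide field_simps)
    also have "(\<Prod>i\<in>UNIV. ee ((z $ i)\<^sup>2 / (2 * s))) = ee (cdot z z / (2 * s))"
    proof -
      have "ee (\<Sum>i\<in>F. x i) = (\<Prod>i\<in>F. ee (x i))" if "finite F" for x :: "8 \<Rightarrow> complex" and F
        using that by (induction F) (auto simp: ee_add)
      then show ?thesis by (simp add: cdot_def sum_divide_distrib power2_eq_square)
    qed
    finally show ?thesis by (simp add: mult_ac)
  qed
  have hol1: "(\<lambda>s. \<Prod>i\<in>UNIV. th 0 (- 1 / s) (z $ i / s)) holomorphic_on uhp"
  proof (intro holomorphic_on_prod)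
    fix i
    show "(\<lambda>s. th 0 (- 1 / s) (z $ i / s)) holomorphic_on uhp"
      unfolding holomorphic_on_def field_differentiable_def
    proof
      fix s assume s: "s \<in> uhp"
      then have s0: "s \<noteq> 0" by (rule uhp_nonzero)
      have "((\<lambda>s. - 1 / s) has_field_derivative 1 / s\<^sup>2) (at s)"
        "((\<lambda>s. z $ i / s) has_field_derivative - (z $ i) / s\<^sup>2) (at s)"
        using s0 by (auto intro!: derivative_eq_intros simp: power2_eq_square field_simps)
      from th_DERIV[OF this inversion_in_uhp[OF s], of 0]
      show "\<exists>D. ((\<lambda>s. th 0 (- 1 / s) (z $ i / s)) has_field_derivative D) (at s within uhp)"
        by (blast intro: has_field_derivative_at_within)
    qed
  qed
  have hol2: "(\<lambda>s. s ^ 4 * ee (cdot z z / (2 * s)) * (\<Prod>i\<in>UNIV. th 0 s (z $ i))) holomorphic_on uhp"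
  proof (intro holomorphic_intros holomorphic_on_prod)
    fix i
    show "(\<lambda>s. th 0 s (z $ i)) holomorphic_on uhp"
      unfolding holomorphic_on_def field_differentiable_def
      using th_DERIV_tau[of _ 0 "z $ i"] by (blast intro: has_field_derivative_at_within)
  qed (auto dest: uhp_nonzero)
  show ?thesis
    by (rule analytic_continuation_open[of "ball \<i> r" uhp, OF _ open_uhp _ _ _ hol1 hol2])
      (use r rb local \<tau> convex_connected[OF convex_uhp] in auto)
qed

section \<open>The lattice\<close>

lemma exhaust_8: "x = 1 \<or> x = 2 \<or> x = 3 \<or> x = 4 \<or> x = 5 \<or> x = 6 \<or> x = 7 \<or> x = (8::8)"
proof (induct x)
  case (of_int z)
  then have "0 \<le> z" "z < 8" by simp_all
  then have "z = 0 \<or> z = 1 \<or> z = 2 \<or> z = 3 \<or> z = 4 \<or> z = 5 \<or> z = 6 \<or> z = 7" by arith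
  then show ?case by auto
qed

lemma forall_8: "(\<forall>i::8. P i) \<longleftrightarrow> P 1 \<and> P 2 \<and> P 3 \<and> P 4 \<and> P 5 \<and> P 6 \<and> P 7 \<and> P 8"
  by (metis exhaust_8)

lemma UNIV_8: "UNIV = {1, 2, 3, 4, 5, 6, 7, 8 :: 8}"
  using exhaust_8 by auto

lemma sum_8: "sum f (UNIV :: 8 set) = f 1 + f 2 + f 3 + f 4 + f 5 + f 6 + f 7 + f 8"
  unfolding UNIV_8 by (simp add: add_ac)

lemma exhaust_5: "x = 1 \<or> x = 2 \<or> x = 3 \<or> x = 4 \<or> x = (5::5)"
proof (induct x)
  case (of_int z)
  then have "0 \<le> z" "z < 5" by simp_all
  then have "z = 0 \<or> z = 1 \<or> z = 2 \<or> z = 3 \<or> z = 4" by arith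
  then show ?case by auto
qed

lemma forall_5: "(\<forall>i::5. P i) \<longleftrightarrow> P 1 \<and> P 2 \<and> P 3 \<and> P 4 \<and> P 5"
  by (metis exhaust_5)

lemma UNIV_5: "UNIV = {1, 2, 3, 4, 5 :: 5}"
  using exhaust_5 by auto

lemma sum_5: "sum f (UNIV :: 5 set) = f 1 + f 2 + f 3 + f 4 + f 5"
  unfolding UNIV_5 by (simp add: add_ac)

lemma E8_0 [simp]: "0 \<in> E8"
  by (auto simp: E8_def intro: exI[of _ 0])

lemma E8_add: "x \<in> E8 \<Longrightarrow> y \<in> E8 \<Longrightarrow> x + y \<in> E8"
proof -
  assume x: "x \<in> E8" and y: "y \<in> E8"
  obtain m n where mn: "(\<Sum>i\<in>UNIV. x $ i) = 2 * of_int m" "(\<Sum>i\<in>UNIV. y $ i) = 2 * of_int n"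
    using x y by (auto simp: E8_def)
  have "2 * (x + y) $ i \<in> \<int>" for i
    using Ints_add[of "2 * x $ i" "2 * y $ i"] x y by (simp add: E8_def ring_distribs)
  moreover have "(x + y) $ i - (x + y) $ j \<in> \<int>" for i j
    using Ints_add[of "x $ i - x $ j" "y $ i - y $ j"] x y by (simp add: E8_def algebra_simps)
  moreover have "(\<Sum>i\<in>UNIV. (x + y) $ i) = 2 * of_int (m + n)"
    using mn by (simp add: sum.distrib)
  ultimately show ?thesis unfolding E8_def by blast
qed

lemma E8_scaleR: "x \<in> E8 \<Longrightarrow> of_int n *\<^sub>R x \<in> E8"
proof -
  assume x: "x \<in> E8"
  obtain m where m: "(\<Sum>i\<in>UNIV. x $ i) = 2 * of_int m"
    using x by (auto simp: E8_def)
  have "2 * (of_int n *\<^sub>R x) $ i \<in> \<int>" for i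
    using Ints_mult[of "of_int n" "2 * x $ i"] x by (simp add: E8_def mult_ac)
  moreover have "(of_int n *\<^sub>R x) $ i - (of_int n *\<^sub>R x) $ j \<in> \<int>" for i j
    using Ints_mult[of "of_int n" "x $ i - x $ j"] x by (simp add: E8_def right_diff_distrib)
  moreover have "(\<Sum>i\<in>UNIV. (of_int n *\<^sub>R x) $ i) = 2 * of_int (n * m)"
    using m by (simp flip: sum_distrib_left)
  ultimately show ?thesis unfolding E8_def by blast
qed

lemma E8_minus: "x \<in> E8 \<Longrightarrow> - x \<in> E8"
  using E8_scaleR[of x "- 1"] by simp

lemma E8_diff: "x \<in> E8 \<Longrightarrow> y \<in> E8 \<Longrightarrow> x - y \<in> E8"
  using E8_add[of x "- y"] E8_minus by simp

lemma E8_scaleR_nat: "x \<in> E8 \<Longrightarrow> of_nat n *\<^sub>R x \<in> E8"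
  using E8_scaleR[of x "int n"] by simp

lemma E8_scaleR_numeral: "x \<in> E8 \<Longrightarrow> numeral n *\<^sub>R x \<in> E8"
  using E8_scaleR[of x "numeral n"] by simp

text \<open>Normal form: an integral vector u plus e times (1/2, ..., 1/2). The coordinate sum is
  the sum of u plus 4 e, so its parity is a condition on u alone.\<close>

lemma E8_cases:
  assumes x: "x \<in> E8"
  obtains u :: "8 \<Rightarrow> int" and e :: int
    where "e = 0 \<or> e = 1" "\<And>i. x $ i = of_int (u i) + of_int e / 2" "even (\<Sum>i\<in>UNIV. u i)"
proof -
  from x have "2 * x $ 1 \<in> \<int>" by (simp add: E8_def)
  then obtain k :: int where k: "2 * x $ 1 = of_int k" by (auto elim: Ints_cases)
  define e where "e = k mod 2"
  have x1: "x $ 1 = of_int (k div 2) + of_int e / 2"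
  proof -
    have "k = 2 * (k div 2) + e" by (simp add: e_def)
    then have "of_int k = 2 * real_of_int (k div 2) + of_int e"
      by (metis of_int_add of_int_mult of_int_numeral)
    with k show ?thesis by simp
  qed
  have "\<exists>d::int. x $ i - x $ 1 = of_int d" for i
    using x by (auto simp: E8_def elim!: Ints_cases) (metis Ints_cases)
  then obtain d :: "8 \<Rightarrow> int" where d: "\<And>i. x $ i - x $ 1 = of_int (d i)" by metis
  define u where "u = (\<lambda>i. d i + k div 2)"
  have xi: "x $ i = of_int (u i) + of_int e / 2" for i
    using d[of i] x1 by (simp add: u_def)
  obtain m where m: "(\<Sum>i\<in>UNIV. x $ i) = 2 * of_int m" using x by (auto simp: E8_def)
  have "real_of_int (\<Sum>i\<in>UNIV. u i) + 4 * of_int e = 2 * of_int m"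
    using m by (simp add: xi sum.distrib)
  then have "real_of_int ((\<Sum>i\<in>UNIV. u i) + 4 * e) = real_of_int (2 * m)" by simp
  then have "(\<Sum>i\<in>UNIV. u i) + 4 * e = 2 * m" by (simp only: of_int_eq_iff)
  then have "even (\<Sum>i\<in>UNIV. u i)" by presburger
  moreover have "e = 0 \<or> e = 1" by (auto simp: e_def)
  ultimately show ?thesis using that xi by blast
qed

lemma E8I:
  assumes "e = 0 \<or> e = 1" "\<And>i. x $ i = of_int (u i) + of_int e / 2" "even (\<Sum>i\<in>UNIV. u i)"
  shows "x \<in> E8"
proof -
  obtain m where m: "(\<Sum>i\<in>UNIV. u i) = 2 * m" using assms(3) by blast
  have "(\<Sum>i\<in>UNIV. x $ i) = of_int (\<Sum>i\<in>UNIV. u i) + 4 * of_int e"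
    by (simp add: assms(2) sum.distrib)
  also have "\<dots> = 2 * of_int (m + 2 * e)" by (simp add: m)
  finally have "\<exists>m::int. (\<Sum>i\<in>UNIV. x $ i) = 2 * of_int m" by blast
  moreover have "2 * x $ i = of_int (2 * u i + e)" for i by (simp add: assms(2))
  then have "2 * x $ i \<in> \<int>" for i by (metis Ints_of_int)
  moreover have "x $ i - x $ j = of_int (u i - u j)" for i j by (simp add: assms(2))
  then have "x $ i - x $ j \<in> \<int>" for i j by (metis Ints_of_int)
  ultimately show ?thesis by (simp add: E8_def)
qed

lemma E8_inner_Ints:
  assumes "x \<in> E8" "y \<in> E8"
  shows "x \<bullet> y \<in> \<int>"
proof -
  obtain u e where u: "e = 0 \<or> e = 1" "\<And>i. x $ i = of_int (u i) + of_int e / 2" "even (\<Sum>i\<in>UNIV. u i)"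
    by (rule E8_cases[OF assms(1)]) (rule that)
  obtain v d where v: "d = 0 \<or> d = 1" "\<And>i. y $ i = of_int (v i) + of_int d / 2" "even (\<Sum>i\<in>UNIV. v i)"
    by (rule E8_cases[OF assms(2)]) (rule that)
  obtain a b where ab: "(\<Sum>i\<in>UNIV. u i) = 2 * a" "(\<Sum>i\<in>UNIV. v i) = 2 * b" using u(3) v(3) by (auto elim!: evenE)
  have "x \<bullet> y = (\<Sum>i\<in>UNIV. of_int (u i * v i) + of_int d / 2 * of_int (u i) + of_int e / 2 * of_int (v i) + of_int (e * d) / 4)"
    by (simp add: inner_vec_def u(2) v(2) algebra_simps)
  also have "\<dots> = of_int (\<Sum>i\<in>UNIV. u i * v i) + of_int d / 2 * of_int (\<Sum>i\<in>UNIV. u i) + of_int e / 2 * of_int (\<Sum>i\<in>UNIV. v i) + 2 * of_int (e * d)"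
    by (simp add: sum.distrib sum_distrib_left)
  also have "\<dots> = of_int ((\<Sum>i\<in>UNIV. u i * v i) + d * a + e * b + 2 * (e * d))"
    by (simp add: ab)
  finally show ?thesis by (metis Ints_of_int)
qed

lemma E8_even:
  assumes "x \<in> E8"
  obtains n :: nat where "x \<bullet> x = 2 * real n"
proof -
  obtain u e where u: "e = 0 \<or> e = 1" "\<And>i. x $ i = of_int (u i) + of_int e / 2" "even (\<Sum>i\<in>UNIV. u i)"
    by (rule E8_cases[OF assms]) (rule that)
  have "x \<bullet> x = (\<Sum>i\<in>UNIV. of_int (u i * u i) + of_int e * of_int (u i) + of_int (e * e) / 4)"
    by (simp add: inner_vec_def u(2) algebra_simps)
  also have "\<dots> = of_int ((\<Sum>i\<in>UNIV. u i * u i) + e * (\<Sum>i\<in>UNIV. u i) + 2 * (e * e))"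
    by (simp add: sum.distrib sum_distrib_left)
  finally have xx: "x \<bullet> x = of_int ((\<Sum>i\<in>UNIV. u i * u i) + e * (\<Sum>i\<in>UNIV. u i) + 2 * (e * e))" .
  have "even (\<Sum>i\<in>UNIV. u i * u i - u i)" by (intro dvd_sum) auto
  then have "even (\<Sum>i\<in>UNIV. u i * u i)" using u(3) by (simp add: sum_subtractf)
  then have "even ((\<Sum>i\<in>UNIV. u i * u i) + e * (\<Sum>i\<in>UNIV. u i) + 2 * (e * e))" using u(3) by simp
  then obtain k where k: "(\<Sum>i\<in>UNIV. u i * u i) + e * (\<Sum>i\<in>UNIV. u i) + 2 * (e * e) = 2 * k" by blast
  have "x \<bullet> x = 2 * of_int k" unfolding xx k by simp
  moreover have "k \<ge> 0" using inner_ge_zero[of x] calculation by (simp del: inner_ge_zero)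
  ultimately have "x \<bullet> x = 2 * real (nat k)" by simp
  with that show ?thesis by blast
qed

definition half_norm :: "real ^ 8 \<Rightarrow> nat" where
  "half_norm x = nat \<lfloor>x \<bullet> x / 2\<rfloor>"

lemma half_norm: "x \<in> E8 \<Longrightarrow> x \<bullet> x = 2 * real (half_norm x)"
  by (erule E8_even) (simp add: half_norm_def)

lemma half_norm_eq_iff: "x \<in> E8 \<Longrightarrow> half_norm x = n \<longleftrightarrow> x \<bullet> x = 2 * real n"
  using half_norm[of x] by auto

lemma half_norm_eq_0: "x \<in> E8 \<Longrightarrow> half_norm x = 0 \<longleftrightarrow> x = 0"
  using half_norm[of x] by auto

text \<open>The reflection on real lattice vectors. It moves the indices of Fourier coefficients,
  where \<open>reflection\<close> moves the variable z.\<close>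

definition refl_E8 :: "real ^ 8 \<Rightarrow> real ^ 8 \<Rightarrow> real ^ 8" where
  "refl_E8 r x = x - (r \<bullet> x) *\<^sub>R r"

lemma refl_E8_in: "r \<in> E8 \<Longrightarrow> x \<in> E8 \<Longrightarrow> refl_E8 r x \<in> E8"
  unfolding refl_E8_def using E8_inner_Ints[of r x] by (auto elim!: Ints_cases intro!: E8_diff E8_scaleR)

lemma refl_E8_inner: "r \<bullet> r = 2 \<Longrightarrow> refl_E8 r x \<bullet> refl_E8 r y = x \<bullet> y"
  by (simp add: refl_E8_def inner_diff inner_commute)

lemma refl_E8_invol: "r \<bullet> r = 2 \<Longrightarrow> refl_E8 r (refl_E8 r x) = x"
  by (simp add: refl_E8_def inner_diff algebra_simps)

section \<open>Orbits modulo three\<close>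

definition vec8 :: "real \<Rightarrow> real \<Rightarrow> real \<Rightarrow> real \<Rightarrow> real \<Rightarrow> real \<Rightarrow> real \<Rightarrow> real \<Rightarrow> real ^ 8" where
  "vec8 a b c d e f g h = (\<chi> i. if i = 1 then a else if i = 2 then b else if i = 3 then c else if i = 4 then d
     else if i = 5 then e else if i = 6 then f else if i = 7 then g else h)"

lemma vec8_nth [simp]:
  "vec8 a b c d e f g h $ 1 = a" "vec8 a b c d e f g h $ 2 = b" "vec8 a b c d e f g h $ 3 = c"
  "vec8 a b c d e f g h $ 4 = d" "vec8 a b c d e f g h $ 5 = e" "vec8 a b c d e f g h $ 6 = f"
  "vec8 a b c d e f g h $ 7 = g" "vec8 a b c d e f g h $ 8 = h"
  by (simp_all add: vec8_def)

lemma inner_vec8: "vec8 a b c d e f g h \<bullet> x =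
    a * x $ 1 + b * x $ 2 + c * x $ 3 + d * x $ 4 + e * x $ 5 + f * x $ 6 + g * x $ 7 + h * x $ 8"
  by (simp add: inner_vec_def sum_8)

lemma vec8_in_E8:
  assumes "2 * a \<in> \<int>" "b - a \<in> \<int>" "c - a \<in> \<int>" "d - a \<in> \<int>" "e - a \<in> \<int>" "f - a \<in> \<int>" "g - a \<in> \<int>" "h - a \<in> \<int>"
    and "a + b + c + d + e + f + g + h = 2 * of_int m"
  shows "vec8 a b c d e f g h \<in> E8"
proof -
  let ?x = "vec8 a b c d e f g h"
  have d: "\<forall>i. ?x $ i - a \<in> \<int>" unfolding forall_8 using assms by simp
  have "2 * ?x $ i \<in> \<int>" for i
    using Ints_add[OF Ints_mult[OF Ints_numeral[of "num.Bit0 num.One"] d[rule_format, of i]] assms(1)] by (simp add: algebra_simps)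
  moreover have "?x $ i - ?x $ j \<in> \<int>" for i j
    using Ints_diff[OF d[rule_format, of i] d[rule_format, of j]] by simp
  moreover have "(\<Sum>i\<in>UNIV. ?x $ i) = 2 * of_int m"
    using assms(9) by (simp add: sum_8)
  ultimately show ?thesis unfolding E8_def by blast
qed

text \<open>Zero and the four fundamental weights whose mark is 2 or 3, in order of their norms 0,
  2, 4, 6, 8. They are the vectors that survive in \<open>dominant_small\<close>.\<close>

definition orbit_rep :: "5 \<Rightarrow> real ^ 8" where
  "orbit_rep j = (if j = 1 then 0 else if j = 2 then vec8 0 0 0 0 0 0 1 1 else if j = 3 then vec8 0 0 0 0 0 0 0 2
     else if j = 4 then vec8 0 0 0 0 0 1 1 2 else vec8 (1/2) (1/2) (1/2) (1/2) (1/2) (1/2) (1/2) (5/2))"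

lemma orbit_rep_simps:
  "orbit_rep 1 = 0" "orbit_rep 2 = vec8 0 0 0 0 0 0 1 1" "orbit_rep 3 = vec8 0 0 0 0 0 0 0 2"
  "orbit_rep 4 = vec8 0 0 0 0 0 1 1 2" "orbit_rep 5 = vec8 (1/2) (1/2) (1/2) (1/2) (1/2) (1/2) (1/2) (5/2)"
  by (simp_all add: orbit_rep_def)

lemma orbit_rep_in_E8: "orbit_rep j \<in> E8"
proof -
  have "\<forall>j. orbit_rep j \<in> E8"
    unfolding forall_5 orbit_rep_simps
    by (intro conjI E8_0 vec8_in_E8[where m = 1] vec8_in_E8[where m = 2] vec8_in_E8[where m = 3]; simp)
  then show ?thesis by blast
qed

lemma orbit_rep_norm:
  "orbit_rep 1 \<bullet> orbit_rep 1 = 0" "orbit_rep 2 \<bullet> orbit_rep 2 = 2" "orbit_rep 3 \<bullet> orbit_rep 3 = 4"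
  "orbit_rep 4 \<bullet> orbit_rep 4 = 6" "orbit_rep 5 \<bullet> orbit_rep 5 = 8"
  by (simp_all add: orbit_rep_simps inner_vec8)

text \<open>Orbits of the Weyl group on E8 modulo 3 are met only through functions constant on them,
  so no quotient has to be formed.\<close>

definition invariant_mod_3 :: "(real ^ 8 \<Rightarrow> complex) \<Rightarrow> bool" where
  "invariant_mod_3 h \<longleftrightarrow> (\<forall>r\<in>E8. \<forall>x\<in>E8. r \<bullet> r = 2 \<longrightarrow> h (refl_E8 r x) = h x) \<and>
     (\<forall>x\<in>E8. \<forall>y\<in>E8. h (x + 3 *\<^sub>R y) = h x)"

text \<open>The descent below moves a vector of minimal norm in its class into the dominant Weyl chamber of the
  simple roots of Bourbaki; \<open>orbit_rep 2\<close> is the highest root, and \<open>(x, orbit_rep 2) \<le> 3\<close> leaves only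
  the zero vector and the fundamental weights whose mark is at most three.\<close>

definition simple_root :: "nat \<Rightarrow> real ^ 8" where
  "simple_root k = [vec8 (1/2) (-1/2) (-1/2) (-1/2) (-1/2) (-1/2) (-1/2) (1/2), vec8 1 1 0 0 0 0 0 0,
     vec8 (-1) 1 0 0 0 0 0 0, vec8 0 (-1) 1 0 0 0 0 0, vec8 0 0 (-1) 1 0 0 0 0, vec8 0 0 0 (-1) 1 0 0 0,
     vec8 0 0 0 0 (-1) 1 0 0, vec8 0 0 0 0 0 (-1) 1 0] ! k"

text \<open>Since it pairs to 1 with every simple root, its product with x grows under each simple
  reflection that repairs a negative pairing.\<close>

definition weyl_vector :: "real ^ 8" where
  "weyl_vector = vec8 0 1 2 3 4 5 6 23"

lemma weyl_vector_in_E8: "weyl_vector \<in> E8"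
  unfolding weyl_vector_def by (rule vec8_in_E8[where m = 22]) simp_all

lemma simple_root_props:
  assumes "k < 8"
  shows "simple_root k \<in> E8" "simple_root k \<bullet> simple_root k = 2" "simple_root k \<bullet> weyl_vector = 1"
proof -
  have "k = 0 \<or> k = 1 \<or> k = 2 \<or> k = 3 \<or> k = 4 \<or> k = 5 \<or> k = 6 \<or> k = 7" using assms by arith
  then show "simple_root k \<in> E8"
    unfolding simple_root_def
    by (elim disjE; simp; intro vec8_in_E8[where m = 0] vec8_in_E8[where m = 1] vec8_in_E8[where m = "- 1"]; simp)
  from \<open>k = 0 \<or> k = 1 \<or> k = 2 \<or> k = 3 \<or> k = 4 \<or> k = 5 \<or> k = 6 \<or> k = 7\<close>
  show "simple_root k \<bullet> simple_root k = 2" "simple_root k \<bullet> weyl_vector = 1"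
    unfolding simple_root_def weyl_vector_def by (elim disjE; simp add: inner_vec8)+
qed

lemma dominant_small:
  assumes x: "x \<in> E8" and dom: "\<And>k. k < 8 \<Longrightarrow> simple_root k \<bullet> x \<ge> 0" and small: "orbit_rep 2 \<bullet> x \<le> 3"
  shows "\<exists>j. x = orbit_rep j"
proof -
  have "\<exists>n::int. simple_root k \<bullet> x = of_int n" if "k < 8" for k
    using E8_inner_Ints[OF simple_root_props(1)[OF that] x] by (auto elim: Ints_cases)
  then obtain n :: "nat \<Rightarrow> int" where n: "\<And>k. k < 8 \<Longrightarrow> simple_root k \<bullet> x = of_int (n k)" by metis
  define a where "a = (\<lambda>i. x $ i)"
  have e0: "(a 1 - a 2 - a 3 - a 4 - a 5 - a 6 - a 7 + a 8) / 2 = of_int (n 0)"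
    and e1: "a 1 + a 2 = of_int (n 1)" and e2: "a 2 - a 1 = of_int (n 2)" and e3: "a 3 - a 2 = of_int (n 3)"
    and e4: "a 4 - a 3 = of_int (n 4)" and e5: "a 5 - a 4 = of_int (n 5)" and e6: "a 6 - a 5 = of_int (n 6)"
    and e7: "a 7 - a 6 = of_int (n 7)" and s: "a 7 + a 8 \<le> 3"
    using n[of 0] n[of 1] n[of 2] n[of 3] n[of 4] n[of 5] n[of 6] n[of 7] small
    by (simp_all add: simple_root_def inner_vec8 a_def orbit_rep_simps)
  have pos: "n 0 \<ge> 0" "n 1 \<ge> 0" "n 2 \<ge> 0" "n 3 \<ge> 0" "n 4 \<ge> 0" "n 5 \<ge> 0" "n 6 \<ge> 0" "n 7 \<ge> 0"
    using dom n by (metis of_int_0_le_iff zero_less_numeral one_less_numeral_iff semiring_norm(76) numeral_less_iff semiring_norm(77) semiring_norm(78) semiring_norm(79) semiring_norm(80) semiring_norm(81) semiring_norm(75))+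
  \<comment> \<open>The coefficients are the marks, that is the coordinates of the highest root
    \<open>orbit_rep 2\<close> in the simple roots. Nodes with mark above 3 drop out below.\<close>
  have "of_int (2 * n 0 + 3 * n 1 + 4 * n 2 + 6 * n 3 + 5 * n 4 + 4 * n 5 + 3 * n 6 + 2 * n 7) = a 7 + a 8"
    unfolding of_int_add of_int_mult e0[symmetric] e1[symmetric] e2[symmetric] e3[symmetric] e4[symmetric] e5[symmetric] e6[symmetric] e7[symmetric]
    by (simp add: field_simps)
  then have "real_of_int (2 * n 0 + 3 * n 1 + 4 * n 2 + 6 * n 3 + 5 * n 4 + 4 * n 5 + 3 * n 6 + 2 * n 7) \<le> of_int 3" using s by simp
  then have le: "2 * n 0 + 3 * n 1 + 4 * n 2 + 6 * n 3 + 5 * n 4 + 4 * n 5 + 3 * n 6 + 2 * n 7 \<le> 3"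
    by (simp only: of_int_le_iff)
  then have z: "n 2 = 0" "n 3 = 0" "n 4 = 0" "n 5 = 0" using pos by linarith+
  have b: "a 1 = of_int (n 1) / 2" "a 2 = of_int (n 1) / 2" "a 3 = of_int (n 1) / 2" "a 4 = of_int (n 1) / 2"
    "a 5 = of_int (n 1) / 2" "a 6 = of_int (n 1) / 2 + of_int (n 6)" "a 7 = of_int (n 1) / 2 + of_int (n 6) + of_int (n 7)"
    "a 8 = 2 * of_int (n 0) + 5 * of_int (n 1) / 2 + 2 * of_int (n 6) + of_int (n 7)"
    using e0 e1 e2 e3 e4 e5 e6 e7 unfolding z by (simp_all add: field_simps)
  have "(n 0 = 0 \<and> n 1 = 0 \<and> n 6 = 0 \<and> n 7 = 0) \<or> (n 0 = 0 \<and> n 1 = 0 \<and> n 6 = 0 \<and> n 7 = 1) \<or>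
    (n 0 = 1 \<and> n 1 = 0 \<and> n 6 = 0 \<and> n 7 = 0) \<or> (n 0 = 0 \<and> n 1 = 0 \<and> n 6 = 1 \<and> n 7 = 0) \<or>
    (n 0 = 0 \<and> n 1 = 1 \<and> n 6 = 0 \<and> n 7 = 0)"
    using le pos unfolding z by presburger
  then consider "x = orbit_rep 1" | "x = orbit_rep 2" | "x = orbit_rep 3" | "x = orbit_rep 4" | "x = orbit_rep 5"
    using b by (auto simp: orbit_rep_simps vec_eq_iff forall_8 a_def)
  then show ?thesis by cases blast+
qed

text \<open>Descent in the lexicographic order of \<open>half_norm\<close> and \<open>\<mu>\<close>.
  If the pairing p of x with the highest root exceeds 3, subtracting three times that root changes
  the norm by 18 - 6 p < 0. A reflection in a simple root with negative pairing keeps the norm and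
  lowers \<open>\<mu>\<close>.\<close>

lemma orbit_representative:
  assumes "x \<in> E8"
  shows "\<exists>j. \<forall>h. invariant_mod_3 h \<longrightarrow> h x = h (orbit_rep j)"
proof -
  \<comment> \<open>With rho the Weyl vector, the summand (x, x) + (rho, rho) keeps the measure
    nonnegative, because 2 (rho, x) is at most that sum.\<close>
  define \<mu> where "\<mu> = (\<lambda>x. nat \<lfloor>x \<bullet> x + weyl_vector \<bullet> weyl_vector - weyl_vector \<bullet> x\<rfloor>)"
  have \<mu>: "real (\<mu> x) = x \<bullet> x + weyl_vector \<bullet> weyl_vector - weyl_vector \<bullet> x" if "x \<in> E8" for x
  proof -
    have "0 \<le> (x - weyl_vector) \<bullet> (x - weyl_vector)" by (rule inner_ge_zero)
    then have "2 * (weyl_vector \<bullet> x) \<le> x \<bullet> x + weyl_vector \<bullet> weyl_vector"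
      by (simp add: inner_diff inner_commute del: inner_ge_zero)
    moreover have "0 \<le> x \<bullet> x + weyl_vector \<bullet> weyl_vector" by simp
    ultimately have "0 \<le> x \<bullet> x + weyl_vector \<bullet> weyl_vector - weyl_vector \<bullet> x" by linarith
    moreover have "x \<bullet> x + weyl_vector \<bullet> weyl_vector - weyl_vector \<bullet> x \<in> \<int>"
      using that weyl_vector_in_E8 by (intro Ints_add Ints_diff E8_inner_Ints)
    ultimately show ?thesis by (auto simp: \<mu>_def elim!: Ints_cases)
  qed
  show ?thesis
    using assms
  proof (induction x rule: wf_induct_rule[OF wf_measures[of "[half_norm, \<mu>]"]])
    case (1 x)
    note x = \<open>x \<in> E8\<close>
    consider (shift) "orbit_rep 2 \<bullet> x > 3" | (reflect) k where "k < 8" "simple_root k \<bullet> x < 0"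
      | (dominant) "\<And>k. k < 8 \<Longrightarrow> simple_root k \<bullet> x \<ge> 0" "orbit_rep 2 \<bullet> x \<le> 3"
      by (meson not_less)
    then show ?case
    proof cases
      case shift
      define y where "y = x + 3 *\<^sub>R (- orbit_rep 2)"
      have y: "y \<in> E8" unfolding y_def using x orbit_rep_in_E8 by (intro E8_add E8_scaleR_numeral E8_minus)
      have "y \<bullet> y = x \<bullet> x - 6 * (orbit_rep 2 \<bullet> x) + 9 * (orbit_rep 2 \<bullet> orbit_rep 2)"
        by (simp add: y_def inner_diff inner_commute algebra_simps)
      then have "y \<bullet> y < x \<bullet> x" using shift by (simp add: orbit_rep_norm)
      then have "half_norm y < half_norm x" using half_norm[OF x] half_norm[OF y] by simp
      with "1.IH"[of y] y obtain j where "\<forall>h. invariant_mod_3 h \<longrightarrow> h y = h (orbit_rep j)" by auto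
      moreover have "h y = h x" if "invariant_mod_3 h" for h
        using that x E8_minus[OF orbit_rep_in_E8] by (auto simp: invariant_mod_3_def y_def simp del: scaleR_minus_right)
      ultimately show ?thesis by metis
    next
      case reflect
      note r = simple_root_props[OF reflect(1)]
      define y where "y = refl_E8 (simple_root k) x"
      have y: "y \<in> E8" unfolding y_def using x r by (intro refl_E8_in)
      have n: "y \<bullet> y = x \<bullet> x" unfolding y_def using r by (intro refl_E8_inner)
      have "weyl_vector \<bullet> y = weyl_vector \<bullet> x - simple_root k \<bullet> x"
        using r(3) by (simp add: y_def refl_E8_def inner_diff_right inner_commute)
      then have "\<mu> y < \<mu> x" using \<mu>[OF x] \<mu>[OF y] reflect(2) n by simp
      moreover have "half_norm y = half_norm x" by (simp add: half_norm_def n)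
      ultimately obtain j where "\<forall>h. invariant_mod_3 h \<longrightarrow> h y = h (orbit_rep j)"
        using "1.IH"[of y] y by auto
      moreover have "h y = h x" if "invariant_mod_3 h" for h
        using that x r by (auto simp: invariant_mod_3_def y_def)
      ultimately show ?thesis by metis
    next
      case dominant
      then show ?thesis using dominant_small[OF x] by blast
    qed
  qed
qed

lemma finite_E8_norm_le: "finite {x \<in> E8. x \<bullet> x \<le> B}"
proof -
  define g where "g = (\<lambda>x :: real ^ 8. \<lambda>i. \<lfloor>2 * x $ i\<rfloor>)"
  have g: "of_int (g x i) = 2 * x $ i" if "x \<in> E8" for x i
  proof -
    have "2 * x $ i \<in> \<int>" using that by (simp add: E8_def)
    then show ?thesis by (auto simp: g_def elim!: Ints_cases)
  qed
  have inj: "inj_on g {x \<in> E8. x \<bullet> x \<le> B}"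
  proof (rule inj_onI)
    fix x y assume "x \<in> {x \<in> E8. x \<bullet> x \<le> B}" "y \<in> {x \<in> E8. x \<bullet> x \<le> B}" "g x = g y"
    then show "x = y" using g[of x] g[of y] by (auto simp: vec_eq_iff)
  qed
  have "g ` {x \<in> E8. x \<bullet> x \<le> B} \<subseteq> (UNIV \<rightarrow>\<^sub>E {- \<lceil>2 * (B + 1)\<rceil>..\<lceil>2 * (B + 1)\<rceil>})"
  proof safe
    fix x i assume x: "x \<in> E8" "x \<bullet> x \<le> B"
    have "(x $ i)\<^sup>2 \<le> x \<bullet> x"
      unfolding inner_vec_def using member_le_sum[of i UNIV "\<lambda>i. x $ i \<bullet> x $ i"] by (simp add: power2_eq_square)
    then have "\<bar>x $ i\<bar>\<^sup>2 \<le> B" using x by simp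
    moreover have "B \<ge> 0" using x inner_ge_zero[of x] by linarith
    moreover have "B \<le> (B + 1)\<^sup>2"
      using \<open>B \<ge> 0\<close> by (simp add: power2_sum)
    ultimately have "\<bar>x $ i\<bar>\<^sup>2 \<le> (B + 1)\<^sup>2" by linarith
    then have "\<bar>x $ i\<bar> \<le> B + 1"
      by (rule power2_le_imp_le) (use \<open>B \<ge> 0\<close> in linarith)
    then have "\<bar>real_of_int (g x i)\<bar> \<le> 2 * (B + 1)" by (simp add: g[OF x(1)])
    then have "real_of_int (g x i) \<le> of_int \<lceil>2 * (B + 1)\<rceil>" "- of_int \<lceil>2 * (B + 1)\<rceil> \<le> real_of_int (g x i)"
      by linarith+
    then have "g x i \<le> \<lceil>2 * (B + 1)\<rceil>" "- \<lceil>2 * (B + 1)\<rceil> \<le> g x i"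
      by (simp_all only: of_int_le_iff flip: of_int_minus)
    then show "g x i \<in> {- \<lceil>2 * (B + 1)\<rceil>..\<lceil>2 * (B + 1)\<rceil>}" by simp
  qed auto
  then have "finite (g ` {x \<in> E8. x \<bullet> x \<le> B})"
    by (rule finite_subset) (intro finite_PiE; simp)
  with inj show ?thesis by (rule finite_imageD[rotated])
qed

section \<open>The theta function of the lattice\<close>

lemma ee_sum: "finite A \<Longrightarrow> ee (\<Sum>i\<in>A. f i) = (\<Prod>i\<in>A. ee (f i))"
  by (induction A rule: finite_induct) (auto simp: ee_add)

lemma cdot_cvec: "cdot (cvec x) (cvec y) = of_real (x \<bullet> y)"
  by (simp add: cdot_def cvec_def inner_vec_def)

lemma cdot_add_right: "cdot z (v + w) = cdot z v + cdot z w"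
  by (simp add: cdot_def ring_distribs sum.distrib)

lemma cdot_add_left: "cdot (v + w) z = cdot v z + cdot w z"
  by (simp add: cdot_def ring_distribs sum.distrib)

lemma cdot_diff_right: "cdot z (v - w) = cdot z v - cdot z w"
  by (simp add: cdot_def ring_distribs sum_subtractf)

lemma cdot_diff_left: "cdot (v - w) z = cdot v z - cdot w z"
  by (simp add: cdot_def ring_distribs sum_subtractf)

lemma cdot_scale_right: "cdot z (c *s w) = c * cdot z w"
  by (simp add: cdot_def sum_distrib_left mult_ac)

lemma cdot_scale_left: "cdot (c *s z) w = c * cdot z w"
  by (simp add: cdot_def sum_distrib_left mult_ac)

lemma cdot_commute: "cdot z w = cdot w z"
  by (simp add: cdot_def mult_ac)

lemma cdot_0 [simp]: "cdot z 0 = 0" "cdot 0 z = 0"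
  by (simp_all add: cdot_def)

lemma cvec_add: "cvec (x + y) = cvec x + cvec y"
  by (simp add: cvec_def vec_eq_iff)

lemma cvec_diff: "cvec (x - y) = cvec x - cvec y"
  by (simp add: cvec_def vec_eq_iff)

lemma cvec_scaleR: "cvec (c *\<^sub>R x) = of_real c *s cvec x"
  by (simp add: cvec_def vec_eq_iff)

lemma cvec_0 [simp]: "cvec 0 = 0"
  by (simp add: cvec_def vec_eq_iff)

lemmas cdot_simps = cdot_cvec cdot_add_right cdot_add_left cdot_diff_right cdot_diff_left
  cdot_scale_right cdot_scale_left cvec_add cvec_diff cvec_scaleR

lemma cdot_reflection: "cdot (cvec l) (reflection r z) = cdot (cvec (refl_E8 r l)) z"
  by (simp add: reflection_def refl_E8_def cdot_simps inner_commute mult.commute)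

definition theta_summand :: "complex \<Rightarrow> complex ^ 8 \<Rightarrow> real ^ 8 \<Rightarrow> complex" where
  "theta_summand \<tau> z l = ee (of_real (l \<bullet> l) * \<tau> / 2 + cdot (cvec l) z)"

lemma theta_E8_eq: "theta_E8 \<tau> z = (\<Sum>\<^sub>\<infinity>l\<in>E8. theta_summand \<tau> z l)"
  unfolding theta_E8_def theta_summand_def ee_def cdot_cvec
  by (intro infsum_cong) (simp add: algebra_simps)

text \<open>The product formula for \<open>infsum\<close> yields a value but no summability. As
  \<open>infsum\<close> of a family that is not summable is 0 by convention, a nonzero value proves
  summability; the nonvanishing terms make the product of the absolute sums nonzero.\<close>

lemma
  fixes t :: "'i::finite \<Rightarrow> int \<Rightarrow> complex"
  assumes t: "\<And>i. (\<lambda>n. norm (t i n)) summable_on UNIV" and nz: "\<And>i n. t i n \<noteq> 0"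
  shows summable_prod_functions: "(\<lambda>g. norm (\<Prod>i\<in>UNIV. t i (g i))) summable_on UNIV"
    and has_sum_prod_functions: "((\<lambda>g. \<Prod>i\<in>UNIV. t i (g i)) has_sum (\<Prod>i\<in>UNIV. \<Sum>\<^sub>\<infinity>n. t i n)) UNIV"
proof -
  have U: "PiE UNIV (\<lambda>_::'i. UNIV :: int set) = UNIV" by (simp add: PiE_UNIV_domain)
  have "infsum (\<lambda>g. \<Prod>i\<in>UNIV. norm (t i (g i))) (PiE UNIV (\<lambda>_::'i. UNIV :: int set)) = (\<Prod>i\<in>UNIV. \<Sum>\<^sub>\<infinity>n. norm (t i n))"
    by (rule infsum_prod_PiE_abs) (use t in auto)
  moreover have "(\<Sum>\<^sub>\<infinity>n. norm (t i n)) \<noteq> 0" for i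
  proof -
    have "(\<Sum>n\<in>{0}. norm (t i n)) \<le> (\<Sum>\<^sub>\<infinity>n. norm (t i n))"
      by (rule finite_sum_le_infsum[OF t]) auto
    then show ?thesis using nz[of i 0] by auto
  qed
  ultimately have "infsum (\<lambda>g. \<Prod>i\<in>UNIV. norm (t i (g i))) UNIV \<noteq> 0" by (simp add: U)
  then have "(\<lambda>g. \<Prod>i\<in>UNIV. norm (t i (g i))) summable_on UNIV" using infsum_not_exists by blast
  then show *: "(\<lambda>g. norm (\<Prod>i\<in>UNIV. t i (g i))) summable_on UNIV" by (simp add: prod_norm)
  have "infsum (\<lambda>g. \<Prod>i\<in>UNIV. t i (g i)) (PiE UNIV (\<lambda>_::'i. UNIV :: int set)) = (\<Prod>i\<in>UNIV. \<Sum>\<^sub>\<infinity>n. t i n)"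
    by (rule infsum_prod_PiE_abs) (use t in auto)
  with has_sum_infsum[OF abs_summable_summable[OF *]]
  show "((\<lambda>g. \<Prod>i\<in>UNIV. t i (g i)) has_sum (\<Prod>i\<in>UNIV. \<Sum>\<^sub>\<infinity>n. t i n)) UNIV" by (simp add: U)
qed

lemma theta_term_nonzero: "theta_term 0 \<tau> z n \<noteq> 0"
  by (simp add: theta_term_def)

text \<open>Doubling embeds E8 into the integral vectors, where the summand becomes a product of
  one-variable terms at tau / 4 and z / 2.\<close>

lemma theta_summand_abs_summable:
  assumes \<tau>: "\<tau> \<in> uhp"
  shows "(\<lambda>l. norm (theta_summand \<tau> z l)) summable_on E8"
proof -
  define g where "g = (\<lambda>x :: real ^ 8. \<lambda>i. \<lfloor>2 * x $ i\<rfloor>)"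
  have g: "of_int (g x i) = 2 * x $ i" if "x \<in> E8" for x i
  proof -
    have "2 * x $ i \<in> \<int>" using that by (simp add: E8_def)
    then show ?thesis by (auto simp: g_def elim!: Ints_cases)
  qed
  have inj: "inj_on g E8"
  proof (rule inj_onI)
    fix x y assume "x \<in> E8" "y \<in> E8" "g x = g y"
    then show "x = y" using g[of x] g[of y] by (auto simp: vec_eq_iff)
  qed
  have \<tau>4: "\<tau> / 4 \<in> uhp" using uhp_divide_of_nat[OF \<tau>, of 4] by simp
  have "(\<lambda>f. norm (\<Prod>i\<in>(UNIV :: 8 set). theta_term 0 (\<tau> / 4) (z $ i / 2) (f i))) summable_on UNIV"
    by (intro summable_prod_functions theta_term_abs_summable \<tau>4 theta_term_nonzero)
  then have "(\<lambda>f. norm (\<Prod>i\<in>(UNIV :: 8 set). theta_term 0 (\<tau> / 4) (z $ i / 2) (f i))) summable_on g ` E8"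
    by (rule summable_on_subset_banach) simp
  then have "(\<lambda>x. norm (\<Prod>i\<in>(UNIV :: 8 set). theta_term 0 (\<tau> / 4) (z $ i / 2) (g x i))) summable_on E8"
    by (subst (asm) summable_on_reindex[OF inj]) (simp add: o_def)
  moreover have "(\<Prod>i\<in>(UNIV :: 8 set). theta_term 0 (\<tau> / 4) (z $ i / 2) (g x i)) = theta_summand \<tau> z x" if "x \<in> E8" for x
  proof -
    have gi: "(of_int (g x i) :: complex) = 2 * of_real (x $ i)" for i
      using g[OF that, of i] by (metis of_real_mult of_real_numeral of_real_of_int_eq)
    have "(\<Prod>i\<in>(UNIV :: 8 set). theta_term 0 (\<tau> / 4) (z $ i / 2) (g x i)) = ee (\<Sum>i\<in>UNIV. (2 * of_real (x $ i))\<^sup>2 * (\<tau> / 4) / 2 + 2 * of_real (x $ i) * (z $ i / 2))"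
      by (simp add: theta_term_def ee_sum gi)
    also have "(\<Sum>i\<in>UNIV. (2 * of_real (x $ i))\<^sup>2 * (\<tau> / 4) / 2 + 2 * of_real (x $ i) * (z $ i / 2)) = of_real (x \<bullet> x) * \<tau> / 2 + cdot (cvec x) z"
      by (simp add: inner_vec_def cdot_def cvec_def sum.distrib power2_eq_square sum_distrib_right sum_divide_distrib mult.assoc)
    finally show ?thesis by (simp add: theta_summand_def)
  qed
  ultimately show ?thesis by (simp cong: summable_on_cong)
qed

lemma theta_E8_has_sum:
  assumes "\<tau> \<in> uhp"
  shows "(theta_summand \<tau> z has_sum theta_E8 \<tau> z) E8"
  unfolding theta_E8_eq by (rule has_sum_infsum[OF abs_summable_summable[OF theta_summand_abs_summable[OF assms]]])

text \<open>\<open>E8\<close> is the union over \<open>a \<in> {0, 1}\<close> of the vectors of \<open>\<int>\<^sup>8 + a (1/2, \<dots>, 1/2)\<close> with even coordinate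
  sum; the parity condition is detected by the character \<open>(1 + (- 1)\<^sup>b) / 2\<close>.\<close>

definition theta_char :: "nat \<Rightarrow> nat \<Rightarrow> complex \<Rightarrow> complex ^ 8 \<Rightarrow> complex" where
  "theta_char a b \<tau> z = ee (of_nat a * \<tau> + of_nat a / 2 * (\<Sum>i\<in>UNIV. z $ i)) *
     (\<Prod>i\<in>UNIV. th 0 \<tau> (z $ i + of_nat a * \<tau> / 2 + of_nat b / 2))"

definition half_shift :: "nat \<Rightarrow> (8 \<Rightarrow> int) \<Rightarrow> real ^ 8" where
  "half_shift a u = (\<chi> i. of_int (u i) + of_nat a / 2)"

lemma theta_char_has_sum:
  assumes \<tau>: "\<tau> \<in> uhp" and a: "a = 0 \<or> a = 1"
  shows "((\<lambda>u. theta_summand \<tau> z (half_shift a u) * ee (of_nat b / 2 * of_int (\<Sum>i\<in>UNIV. u i)))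
    has_sum theta_char a b \<tau> z) UNIV"
proof -
  have "((\<lambda>u. \<Prod>i\<in>(UNIV :: 8 set). theta_term 0 \<tau> (z $ i + of_nat a * \<tau> / 2 + of_nat b / 2) (u i)) has_sum
      (\<Prod>i\<in>(UNIV :: 8 set). \<Sum>\<^sub>\<infinity>n. theta_term 0 \<tau> (z $ i + of_nat a * \<tau> / 2 + of_nat b / 2) n)) UNIV"
    by (rule has_sum_prod_functions) (use theta_term_abs_summable[OF \<tau>] theta_term_nonzero in auto)
  then have "((\<lambda>u. \<Prod>i\<in>(UNIV :: 8 set). theta_term 0 \<tau> (z $ i + of_nat a * \<tau> / 2 + of_nat b / 2) (u i)) has_sum
      (\<Prod>i\<in>(UNIV :: 8 set). th 0 \<tau> (z $ i + of_nat a * \<tau> / 2 + of_nat b / 2))) UNIV"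
    by (simp add: th_def)
  from has_sum_cmult_right[OF this, of "ee (of_nat a * \<tau> + of_nat a / 2 * (\<Sum>i\<in>UNIV. z $ i))"]
  have "((\<lambda>u. ee (of_nat a * \<tau> + of_nat a / 2 * (\<Sum>i\<in>UNIV. z $ i)) *
      (\<Prod>i\<in>(UNIV :: 8 set). theta_term 0 \<tau> (z $ i + of_nat a * \<tau> / 2 + of_nat b / 2) (u i))) has_sum theta_char a b \<tau> z) UNIV"
    by (simp add: theta_char_def)
  moreover have "ee (of_nat a * \<tau> + of_nat a / 2 * (\<Sum>i\<in>UNIV. z $ i)) *
      (\<Prod>i\<in>(UNIV :: 8 set). theta_term 0 \<tau> (z $ i + of_nat a * \<tau> / 2 + of_nat b / 2) (u i)) =
      theta_summand \<tau> z (half_shift a u) * ee (of_nat b / 2 * of_int (\<Sum>i\<in>UNIV. u i))" for u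
  proof -
    define A B where "A = (of_nat a :: complex)" and "B = (of_nat b :: complex)"
    \<comment> \<open>Each of the eight coordinates contributes a^2 tau / 8; as a is 0 or 1, they
      add up to the summand a tau in \<open>theta_char\<close>.\<close>
    have AA: "A * A = A" using a by (auto simp: A_def)
    have "(\<Prod>i\<in>(UNIV :: 8 set). theta_term 0 \<tau> (z $ i + A * \<tau> / 2 + B / 2) (u i)) =
        ee (\<Sum>i\<in>UNIV. (of_int (u i))\<^sup>2 * \<tau> / 2 + of_int (u i) * (z $ i + A * \<tau> / 2 + B / 2))"
      by (simp add: theta_term_def ee_sum)
    then have "ee (A * \<tau> + A / 2 * (\<Sum>i\<in>UNIV. z $ i)) * (\<Prod>i\<in>(UNIV :: 8 set). theta_term 0 \<tau> (z $ i + A * \<tau> / 2 + B / 2) (u i)) =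
        ee (A * \<tau> + A / 2 * (\<Sum>i\<in>UNIV. z $ i) + (\<Sum>i\<in>UNIV. (of_int (u i))\<^sup>2 * \<tau> / 2 + of_int (u i) * (z $ i + A * \<tau> / 2 + B / 2)))"
      by (simp add: ee_add)
    also have "A * \<tau> + A / 2 * (\<Sum>i\<in>UNIV. z $ i) + (\<Sum>i\<in>UNIV. (of_int (u i))\<^sup>2 * \<tau> / 2 + of_int (u i) * (z $ i + A * \<tau> / 2 + B / 2)) =
        (\<Sum>i\<in>UNIV. (A * A) * \<tau> / 8 + A / 2 * z $ i + ((of_int (u i))\<^sup>2 * \<tau> / 2 + of_int (u i) * (z $ i + A * \<tau> / 2 + B / 2)))"
      unfolding AA by (simp add: sum.distrib sum_distrib_left)
    also have "\<dots> = (\<Sum>i\<in>UNIV. (of_int (u i) + A / 2) * (of_int (u i) + A / 2) * \<tau> / 2 + (of_int (u i) + A / 2) * z $ i + B / 2 * of_int (u i))"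
      by (intro sum.cong) (auto simp: power2_eq_square field_simps)
    also have "\<dots> = of_real (half_shift a u \<bullet> half_shift a u) * \<tau> / 2 + cdot (cvec (half_shift a u)) z + B / 2 * of_int (\<Sum>i\<in>UNIV. u i)"
      by (simp add: inner_vec_def cdot_def cvec_def half_shift_def A_def sum.distrib sum_distrib_left sum_distrib_right sum_divide_distrib)
    finally show ?thesis
      by (simp add: theta_summand_def ee_add A_def B_def)
  qed
  ultimately show ?thesis by simp
qed

lemma theta_E8_eq_chars:
  assumes \<tau>: "\<tau> \<in> uhp"
  shows "theta_E8 \<tau> z = (theta_char 0 0 \<tau> z + theta_char 0 1 \<tau> z + theta_char 1 0 \<tau> z + theta_char 1 1 \<tau> z) / 2"
proof -
  have half: "(theta_summand \<tau> z has_sum (theta_char a 0 \<tau> z + theta_char a 1 \<tau> z) / 2) (half_shift a ` {u. even (\<Sum>i\<in>UNIV. u i)})"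
    if a: "a = 0 \<or> a = 1" for a
  proof -
    have sgn: "ee (of_int n / 2) = (if even n then 1 else - 1)" for n :: int
    proof (cases "even n")
      case True
      then obtain k where k: "n = 2 * k" by blast
      have "ee (of_int n / 2) = ee (of_int k)" by (simp add: k)
      with True show ?thesis by simp
    next
      case False
      then obtain k where k: "n = 2 * k + 1" by (elim oddE)
      have "ee (of_int n / 2) = ee (1 / 2 + of_int k)" by (simp add: k add_divide_distrib add_ac)
      with False show ?thesis by (simp add: ee_half del: ee_add_int) (simp add: ee_half)
    qed
    have "((\<lambda>u. theta_summand \<tau> z (half_shift a u) * ee (of_nat 0 / 2 * of_int (\<Sum>i\<in>UNIV. u i)) +
        theta_summand \<tau> z (half_shift a u) * ee (of_nat 1 / 2 * of_int (\<Sum>i\<in>UNIV. u i)))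
        has_sum (theta_char a 0 \<tau> z + theta_char a 1 \<tau> z)) UNIV"
      by (intro has_sum_add theta_char_has_sum \<tau> a)
    from has_sum_cmult_left[OF this, of "1 / 2"]
    have "((\<lambda>u. (theta_summand \<tau> z (half_shift a u) * ee (of_nat 0 / 2 * of_int (\<Sum>i\<in>UNIV. u i)) +
        theta_summand \<tau> z (half_shift a u) * ee (of_nat 1 / 2 * of_int (\<Sum>i\<in>UNIV. u i))) * (1 / 2))
        has_sum (theta_char a 0 \<tau> z + theta_char a 1 \<tau> z) / 2) UNIV" by simp
    also have "(\<lambda>u. (theta_summand \<tau> z (half_shift a u) * ee (of_nat 0 / 2 * of_int (\<Sum>i\<in>UNIV. u i)) +
        theta_summand \<tau> z (half_shift a u) * ee (of_nat 1 / 2 * of_int (\<Sum>i\<in>UNIV. u i))) * (1 / 2)) =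
        (\<lambda>u. if even (\<Sum>i\<in>UNIV. u i) then theta_summand \<tau> z (half_shift a u) else 0)"
    proof
      fix u :: "8 \<Rightarrow> int"
      have "ee (of_nat 1 / 2 * of_int (\<Sum>i\<in>UNIV. u i)) = (if even (\<Sum>i\<in>UNIV. u i) then 1 else - 1)"
        using sgn[of "\<Sum>i\<in>UNIV. u i"] by simp
      then show "(theta_summand \<tau> z (half_shift a u) * ee (of_nat 0 / 2 * of_int (\<Sum>i\<in>UNIV. u i)) +
        theta_summand \<tau> z (half_shift a u) * ee (of_nat 1 / 2 * of_int (\<Sum>i\<in>UNIV. u i))) * (1 / 2) =
        (if even (\<Sum>i\<in>UNIV. u i) then theta_summand \<tau> z (half_shift a u) else 0)"
        by (simp only: of_nat_0 div_0 mult_zero_left ee_0) simp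
    qed
    finally have "((\<lambda>u. if even (\<Sum>i\<in>UNIV. u i) then theta_summand \<tau> z (half_shift a u) else 0)
        has_sum (theta_char a 0 \<tau> z + theta_char a 1 \<tau> z) / 2) UNIV" .
    then have "((\<lambda>u. theta_summand \<tau> z (half_shift a u)) has_sum (theta_char a 0 \<tau> z + theta_char a 1 \<tau> z) / 2) {u. even (\<Sum>i\<in>UNIV. u i)}"
      by (rule has_sum_cong_neutral[THEN iffD1, rotated -1]) auto
    moreover have "inj_on (half_shift a) {u. even (\<Sum>i\<in>UNIV. u i)}"
      by (auto simp: inj_on_def half_shift_def vec_eq_iff)
    ultimately show ?thesis
      by (subst has_sum_reindex) (auto simp: o_def)
  qed
  have E8: "E8 = half_shift 0 ` {u. even (\<Sum>i\<in>UNIV. u i)} \<union> half_shift 1 ` {u. even (\<Sum>i\<in>UNIV. u i)}" (is "_ = ?A \<union> ?B")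
  proof safe
    fix x assume x: "x \<in> E8" "x \<notin> half_shift 1 ` {u. even (\<Sum>i\<in>UNIV. u i)}"
    obtain u e where u: "e = 0 \<or> e = 1" "\<And>i. x $ i = of_int (u i) + of_int e / 2" "even (\<Sum>i\<in>UNIV. u i)"
      by (rule E8_cases[OF x(1)]) (rule that)
    have "x = half_shift (nat e) u" using u by (auto simp: half_shift_def vec_eq_iff)
    with u x show "x \<in> half_shift 0 ` {u. even (\<Sum>i\<in>UNIV. u i)}" by auto
  next
    fix u :: "8 \<Rightarrow> int" assume "even (\<Sum>i\<in>UNIV. u i)"
    then show "half_shift 0 u \<in> E8"
      by (intro E8I[of 0 _ u]) (auto simp: half_shift_def)
  next
    fix u :: "8 \<Rightarrow> int" assume "even (\<Sum>i\<in>UNIV. u i)"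
    then show "half_shift 1 u \<in> E8"
      by (intro E8I[of 1 _ u]) (auto simp: half_shift_def)
  qed
  have disj: "?A \<inter> ?B = {}"
  proof -
    have "half_shift 0 u \<noteq> half_shift 1 v" for u v
    proof
      assume "half_shift 0 u = half_shift 1 v"
      then have "half_shift 0 u $ 1 = half_shift 1 v $ 1" by simp
      then have "real_of_int (2 * (u 1 - v 1)) = of_int 1" by (simp add: half_shift_def)
      then have "2 * (u 1 - v 1) = 1" by (simp only: of_int_eq_iff)
      then show False by presburger
    qed
    then show ?thesis by auto
  qed
  have "(theta_summand \<tau> z has_sum ((theta_char 0 0 \<tau> z + theta_char 0 1 \<tau> z) / 2 + (theta_char 1 0 \<tau> z + theta_char 1 1 \<tau> z) / 2)) E8"
    unfolding E8 by (intro has_sum_Un_disjoint half disj) auto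
  with theta_E8_has_sum[OF \<tau>, of z] have "theta_E8 \<tau> z = (theta_char 0 0 \<tau> z + theta_char 0 1 \<tau> z) / 2 + (theta_char 1 0 \<tau> z + theta_char 1 1 \<tau> z) / 2"
    by (rule has_sum_unique)
  then show ?thesis by (simp add: add_divide_distrib)
qed

text \<open>With tau' = -1 / tau, a shift of z / tau by a tau' / 2 is a shift of z by - a / 2, so
  the two characteristics exchange their roles. The sum of all four functions is symmetric in
  them.\<close>

lemma theta_char_inversion:
  assumes \<tau>: "\<tau> \<in> uhp" and a: "a = 0 \<or> a = 1" and b: "b = 0 \<or> b = 1"
  shows "theta_char a b (- 1 / \<tau>) ((1 / \<tau>) *s z) = \<tau> ^ 4 * ee (cdot z z / (2 * \<tau>)) * theta_char b a \<tau> z"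
proof -
  have \<tau>0: "\<tau> \<noteq> 0" using \<tau> by (rule uhp_nonzero)
  define A B where "A = (of_nat a :: complex)" and "B = (of_nat b :: complex)"
  have AA: "A * A = A" and BB: "B * B = B" using a b by (auto simp: A_def B_def)
  define w :: "complex ^ 8" where "w = (\<chi> i. z $ i + B * \<tau> / 2 - A / 2)"
  define s where "s = (\<Sum>i\<in>UNIV. z $ i)"
  have "theta_char a b (- 1 / \<tau>) ((1 / \<tau>) *s z) = ee (A * (- 1 / \<tau>) + A / 2 * (s / \<tau>)) *
      (\<Prod>i\<in>UNIV. th 0 (- 1 / \<tau>) (w $ i / \<tau>))"
    using \<tau>0 by (simp add: theta_char_def A_def B_def w_def s_def sum_divide_distrib diff_divide_distrib add_divide_distrib algebra_simps)
  also have "(\<Prod>i\<in>UNIV. th 0 (- 1 / \<tau>) (w $ i / \<tau>)) = \<tau> ^ 4 * ee (cdot w w / (2 * \<tau>)) * (\<Prod>i\<in>UNIV. th 0 \<tau> (w $ i))"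
    by (rule theta_product_inversion[OF \<tau>])
  also have "(\<Prod>i\<in>UNIV. th 0 \<tau> (w $ i)) = (\<Prod>i\<in>UNIV. th 0 \<tau> (z $ i + of_nat b * \<tau> / 2 + of_nat a / 2))"
  proof (intro prod.cong refl)
    fix i
    from a show "th 0 \<tau> (w $ i) = th 0 \<tau> (z $ i + of_nat b * \<tau> / 2 + of_nat a / 2)"
    proof
      assume "a = 1"
      then show ?thesis using th_add_1[of \<tau> "w $ i"] by (simp add: w_def A_def B_def algebra_simps)
    qed (simp add: w_def A_def B_def)
  qed
  also have "ee (A * (- 1 / \<tau>) + A / 2 * (s / \<tau>)) * (\<tau> ^ 4 * ee (cdot w w / (2 * \<tau>)) * (\<Prod>i\<in>UNIV. th 0 \<tau> (z $ i + of_nat b * \<tau> / 2 + of_nat a / 2)))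
      = \<tau> ^ 4 * ee (A * (- 1 / \<tau>) + A / 2 * (s / \<tau>) + cdot w w / (2 * \<tau>)) * (\<Prod>i\<in>UNIV. th 0 \<tau> (z $ i + of_nat b * \<tau> / 2 + of_nat a / 2))"
    by (simp add: ee_add mult_ac)
  also have "A * (- 1 / \<tau>) + A / 2 * (s / \<tau>) + cdot w w / (2 * \<tau>) = cdot z z / (2 * \<tau>) + (B * \<tau> + B / 2 * s) - 2 * (A * B)"
  proof -
    define c where "c = B * \<tau> / 2 - A / 2"
    have "cdot w w = (\<Sum>i\<in>UNIV. z $ i * z $ i + 2 * c * z $ i + c * c)"
      unfolding cdot_def by (intro sum.cong) (auto simp: w_def c_def algebra_simps)
    also have "\<dots> = cdot z z + 2 * c * s + 8 * (c * c)"
      by (simp add: sum.distrib cdot_def s_def sum_distrib_left)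
    finally have "cdot w w = cdot z z + 2 * c * s + 2 * ((B * B) * \<tau>\<^sup>2 - 2 * A * B * \<tau> + A * A)"
      by (simp add: c_def power2_eq_square algebra_simps)
    then have "cdot w w = cdot z z + B * \<tau> * s - A * s + 2 * B * \<tau>\<^sup>2 - 4 * A * B * \<tau> + 2 * A"
      unfolding AA BB by (simp add: c_def algebra_simps)
    then show ?thesis
      using \<tau>0 by (simp add: power2_eq_square field_simps)
  qed
  also have "ee (cdot z z / (2 * \<tau>) + (B * \<tau> + B / 2 * s) - 2 * (A * B)) = ee (cdot z z / (2 * \<tau>)) * ee (B * \<tau> + B / 2 * s)"
  proof -
    have "ee (2 * (A * B)) = 1" using a b by (intro ee_Ints) (auto simp: A_def B_def)
    then show ?thesis by (simp add: ee_diff ee_add)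
  qed
  finally show ?thesis by (simp add: theta_char_def B_def s_def mult_ac)
qed

theorem theta_E8_inversion:
  assumes \<tau>: "\<tau> \<in> uhp"
  shows "theta_E8 (- 1 / \<tau>) ((1 / \<tau>) *s z) = \<tau> ^ 4 * ee (cdot z z / (2 * \<tau>)) * theta_E8 \<tau> z"
  using \<tau> by (simp add: theta_E8_eq_chars theta_char_inversion algebra_simps del: minus_divide_left[symmetric])

lemma theta_E8_T:
  assumes \<tau>: "\<tau> \<in> uhp"
  shows "theta_E8 (\<tau> + 1) z = theta_E8 \<tau> z"
proof -
  have "theta_summand (\<tau> + 1) z l = theta_summand \<tau> z l" if "l \<in> E8" for l
  proof -
    have "of_real (l \<bullet> l) * (\<tau> + 1) / 2 + cdot (cvec l) z = (of_real (l \<bullet> l) * \<tau> / 2 + cdot (cvec l) z) + of_nat (half_norm l)"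
      using half_norm[OF that] by (simp add: ring_distribs add_divide_distrib)
    then show ?thesis unfolding theta_summand_def by (simp only: ee_add ee_of_nat mult_1_right)
  qed
  then show ?thesis unfolding theta_E8_eq by (intro infsum_cong)
qed

lemma theta_E8_quasi_period:
  assumes \<tau>: "\<tau> \<in> uhp" and x: "x \<in> E8" and y: "y \<in> E8"
  shows "theta_E8 \<tau> (z + \<tau> *s cvec x + cvec y) = ee (- (of_real (x \<bullet> x) * \<tau> / 2 + cdot (cvec x) z)) * theta_E8 \<tau> z"
proof -
  have "theta_summand \<tau> (z + \<tau> *s cvec x + cvec y) l = ee (- (of_real (x \<bullet> x) * \<tau> / 2 + cdot (cvec x) z)) * theta_summand \<tau> z (l + x)"
    if l: "l \<in> E8" for l
  proof -
    have "l \<bullet> y \<in> \<int>" using l y by (rule E8_inner_Ints)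
    then have 1: "ee (of_real (l \<bullet> y)) = 1" by (intro ee_Ints) (auto elim!: Ints_cases)
    have "of_real (l \<bullet> l) * \<tau> / 2 + cdot (cvec l) (z + \<tau> *s cvec x + cvec y) =
        (- (of_real (x \<bullet> x) * \<tau> / 2 + cdot (cvec x) z)) + (of_real ((l + x) \<bullet> (l + x)) * \<tau> / 2 + cdot (cvec (l + x)) z) + of_real (l \<bullet> y)"
      by (simp add: cdot_simps inner_add inner_commute add_divide_distrib algebra_simps)
    then show ?thesis unfolding theta_summand_def by (simp only: ee_add 1 mult_1_right)
  qed
  then have "theta_E8 \<tau> (z + \<tau> *s cvec x + cvec y) = (\<Sum>\<^sub>\<infinity>l\<in>E8. ee (- (of_real (x \<bullet> x) * \<tau> / 2 + cdot (cvec x) z)) * theta_summand \<tau> z (l + x))"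
    unfolding theta_E8_eq by (intro infsum_cong)
  also have "\<dots> = ee (- (of_real (x \<bullet> x) * \<tau> / 2 + cdot (cvec x) z)) * (\<Sum>\<^sub>\<infinity>l\<in>E8. theta_summand \<tau> z (l + x))"
    by (rule infsum_cmult_right')
  also have "(\<Sum>\<^sub>\<infinity>l\<in>E8. theta_summand \<tau> z (l + x)) = theta_E8 \<tau> z"
    unfolding theta_E8_eq
    by (rule infsum_reindex_bij_witness[of _ "\<lambda>l. l - x" "\<lambda>l. l + x"]) (use x in \<open>auto intro: E8_add E8_diff\<close>)
  finally show ?thesis .
qed

lemma theta_E8_reflection:
  assumes r: "r \<in> E8" "r \<bullet> r = 2"
  shows "theta_E8 \<tau> (reflection r z) = theta_E8 \<tau> z"
  unfolding theta_E8_eq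
  by (rule infsum_reindex_bij_witness[of _ "refl_E8 r" "refl_E8 r"])
    (use r in \<open>auto simp: refl_E8_invol refl_E8_in theta_summand_def cdot_reflection refl_E8_inner\<close>)

lemma weyl_E8_invariant:
  assumes "\<sigma> \<in> weyl_E8" and "\<And>r z. r \<in> E8 \<Longrightarrow> r \<bullet> r = 2 \<Longrightarrow> f (reflection r z) = f z"
  shows "f (\<sigma> z) = f z"
  using assms(1) by induction (auto simp: assms(2))

section \<open>Complex differentiability in nine variables\<close>

text \<open>The condition of \<open>jholomorphic\<close> at a single point, so that closure
  properties can be proved pointwise.\<close>

definition cdiff :: "jfun \<Rightarrow> complex \<Rightarrow> complex ^ 8 \<Rightarrow> bool" where
  "cdiff \<phi> \<tau> z \<longleftrightarrow> (\<exists>D. ((\<lambda>(\<tau>, z). \<phi> \<tau> z) has_derivative D) (at (\<tau>, z)) \<and>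
     (\<forall>c v w. D (c * v, c *s w) = c * D (v, w)))"

lemma jholomorphic_cdiff: "jholomorphic \<phi> \<longleftrightarrow> (\<forall>\<tau>\<in>uhp. \<forall>z. cdiff \<phi> \<tau> z)"
  by (simp add: jholomorphic_def cdiff_def)

lemma cdiffI:
  assumes "((\<lambda>p. \<phi> (fst p) (snd p)) has_derivative D) (at (\<tau>, z))" "\<And>c v w. D (c * v, c *s w) = c * D (v, w)"
  shows "cdiff \<phi> \<tau> z"
  using assms unfolding cdiff_def by (intro exI[of _ D]) (simp add: case_prod_unfold)

lemma cdiffE:
  assumes "cdiff \<phi> \<tau> z"
  obtains D where "((\<lambda>p. \<phi> (fst p) (snd p)) has_derivative D) (at (\<tau>, z))" "\<And>c v w. D (c * v, c *s w) = c * D (v, w)"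
  using assms unfolding cdiff_def by (auto simp: case_prod_unfold)

lemma cdiff_coord: "cdiff (\<lambda>\<tau> z. z $ i) \<tau> z"
proof (rule cdiffI)
  have "bounded_linear (\<lambda>p :: complex \<times> (complex ^ 8). snd p $ i)"
    by (rule bounded_linear_compose[OF bounded_linear_vec_nth bounded_linear_snd])
  then show "((\<lambda>p. snd p $ i) has_derivative (\<lambda>p. snd p $ i)) (at (\<tau>, z))"
    by (rule bounded_linear_imp_has_derivative)
qed simp

lemma cdiff_fst: "(f has_field_derivative f') (at \<tau>) \<Longrightarrow> cdiff (\<lambda>\<tau> z. f \<tau>) \<tau> z"
proof (rule cdiffI)
  assume "(f has_field_derivative f') (at \<tau>)"
  then have "(f has_derivative (*) f') (at (fst (\<tau>, z)))" by (simp add: has_field_derivative_def)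
  from has_derivative_compose[OF has_derivative_fst[OF has_derivative_ident] this]
  show "((\<lambda>p. f (fst p)) has_derivative (\<lambda>p. f' * fst p)) (at (\<tau>, z))" .
qed simp

lemma cdiff_const: "cdiff (\<lambda>\<tau> z. c) \<tau> z"
  by (rule cdiff_fst[OF DERIV_const])

lemma cdiff_add: "cdiff \<phi> \<tau> z \<Longrightarrow> cdiff \<psi> \<tau> z \<Longrightarrow> cdiff (\<lambda>\<tau> z. \<phi> \<tau> z + \<psi> \<tau> z) \<tau> z"
  by (elim cdiffE, rule cdiffI, erule (1) has_derivative_add) (simp add: ring_distribs)

lemma cdiff_mult: "cdiff \<phi> \<tau> z \<Longrightarrow> cdiff \<psi> \<tau> z \<Longrightarrow> cdiff (\<lambda>\<tau> z. \<phi> \<tau> z * \<psi> \<tau> z) \<tau> z"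
  by (elim cdiffE, rule cdiffI, erule (1) has_derivative_mult) (simp add: ring_distribs)

lemma cdiff_sum: "finite A \<Longrightarrow> (\<And>i. i \<in> A \<Longrightarrow> cdiff (\<phi> i) \<tau> z) \<Longrightarrow> cdiff (\<lambda>\<tau> z. \<Sum>i\<in>A. \<phi> i \<tau> z) \<tau> z"
  by (induction A rule: finite_induct) (auto intro: cdiff_const cdiff_add)

lemma cdiff_prod: "finite A \<Longrightarrow> (\<And>i. i \<in> A \<Longrightarrow> cdiff (\<phi> i) \<tau> z) \<Longrightarrow> cdiff (\<lambda>\<tau> z. \<Prod>i\<in>A. \<phi> i \<tau> z) \<tau> z"
  by (induction A rule: finite_induct) (auto intro: cdiff_const cdiff_mult)

lemma cdiff_compose:
  assumes "cdiff \<phi> \<tau> z" "(f has_field_derivative f') (at (\<phi> \<tau> z))"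
  shows "cdiff (\<lambda>\<tau> z. f (\<phi> \<tau> z)) \<tau> z"
proof -
  obtain D where D: "((\<lambda>p. \<phi> (fst p) (snd p)) has_derivative D) (at (\<tau>, z))" "\<And>c v w. D (c * v, c *s w) = c * D (v, w)"
    by (rule cdiffE[OF assms(1)]) (rule that)
  have "(f has_derivative (*) f') (at (\<phi> (fst (\<tau>, z)) (snd (\<tau>, z))))"
    using assms(2) by (simp add: has_field_derivative_def)
  from has_derivative_compose[OF D(1) this] show ?thesis
    by (rule cdiffI) (simp add: D(2))
qed

lemma cdiff_th:
  assumes "cdiff \<phi> \<tau> z" "cdiff \<psi> \<tau> z" "\<phi> \<tau> z \<in> uhp"
  shows "cdiff (\<lambda>\<tau> z. th p (\<phi> \<tau> z) (\<psi> \<tau> z)) \<tau> z"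
proof -
  obtain D where D: "((\<lambda>p. \<phi> (fst p) (snd p)) has_derivative D) (at (\<tau>, z))" "\<And>c v w. D (c * v, c *s w) = c * D (v, w)"
    by (rule cdiffE[OF assms(1)]) (rule that)
  obtain E where E: "((\<lambda>p. \<psi> (fst p) (snd p)) has_derivative E) (at (\<tau>, z))" "\<And>c v w. E (c * v, c *s w) = c * E (v, w)"
    by (rule cdiffE[OF assms(2)]) (rule that)
  have "((\<lambda>(\<tau>, z). th p \<tau> z) has_derivative
    (\<lambda>(v, w). complex_of_real pi * \<i> * th (p + 2) (\<phi> \<tau> z) (\<psi> \<tau> z) * v + 2 * complex_of_real pi * \<i> * th (p + 1) (\<phi> \<tau> z) (\<psi> \<tau> z) * w))
    (at (\<phi> (fst (\<tau>, z)) (snd (\<tau>, z)), \<psi> (fst (\<tau>, z)) (snd (\<tau>, z))))"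
    using th_has_derivative[OF assms(3)] by simp
  from has_derivative_compose[OF has_derivative_Pair[OF D(1) E(1)] this]
  show ?thesis
    unfolding prod.case by (rule cdiffI) (simp add: D(2) E(2) algebra_simps)
qed

lemma cdiff_subst:
  assumes "cdiff \<phi> (a * \<tau> + b) (c *s z)"
  shows "cdiff (\<lambda>\<tau> z. \<phi> (a * \<tau> + b) (c *s z)) \<tau> z"
proof -
  obtain D where D: "((\<lambda>p. \<phi> (fst p) (snd p)) has_derivative D) (at (a * \<tau> + b, c *s z))" "\<And>c v w. D (c * v, c *s w) = c * D (v, w)"
    by (rule cdiffE[OF assms]) (rule that)
  have "bounded_linear (\<lambda>w :: complex ^ 8. c *s w)"
    by (rule linear_conv_bounded_linear[THEN iffD1]) (auto intro!: linearI simp: vec_eq_iff algebra_simps scaleR_conv_of_real)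
  then have "bounded_linear (\<lambda>p :: complex \<times> (complex ^ 8). c *s snd p)"
    by (rule bounded_linear_compose[OF _ bounded_linear_snd])
  then have "((\<lambda>p :: complex \<times> (complex ^ 8). c *s snd p) has_derivative (\<lambda>p. c *s snd p)) (at (\<tau>, z))"
    by (rule bounded_linear_imp_has_derivative)
  moreover have "((\<lambda>p :: complex \<times> (complex ^ 8). a * fst p + b) has_derivative (\<lambda>p. a * fst p)) (at (\<tau>, z))"
    by (auto intro!: derivative_eq_intros)
  ultimately have "((\<lambda>p :: complex \<times> (complex ^ 8). (a * fst p + b, c *s snd p)) has_derivative (\<lambda>p. (a * fst p, c *s snd p))) (at (\<tau>, z))"
    by (rule has_derivative_Pair[rotated])
  moreover have "((\<lambda>p. \<phi> (fst p) (snd p)) has_derivative D) (at (a * fst (\<tau>, z) + b, c *s snd (\<tau>, z)))"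
    using D(1) by simp
  ultimately have "((\<lambda>p. \<phi> (a * fst p + b) (c *s snd p)) has_derivative (\<lambda>p. D (a * fst p, c *s snd p))) (at (\<tau>, z))"
    using has_derivative_compose[of "\<lambda>p. (a * fst p + b, c *s snd p)"] by fastforce
  then show ?thesis
  proof (rule cdiffI)
    fix e v and w :: "complex ^ 8"
    have "D (a * (e * v), c *s (e *s w)) = D (e * (a * v), e *s (c *s w))"
      by (simp add: mult_ac vector_smult_assoc)
    also have "\<dots> = e * D (a * v, c *s w)" by (rule D(2))
    finally show "D (a * fst (e * v, e *s w), c *s snd (e * v, e *s w)) = e * D (a * fst (v, w), c *s snd (v, w))"
      by (simp only: fst_conv snd_conv)
  qed
qed

lemma cdiff_transform:
  assumes "cdiff \<phi> \<tau> z" "\<tau> \<in> uhp" "\<And>\<tau> z. \<tau> \<in> uhp \<Longrightarrow> \<phi> \<tau> z = \<psi> \<tau> z"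
  shows "cdiff \<psi> \<tau> z"
proof -
  obtain D where D: "((\<lambda>p. \<phi> (fst p) (snd p)) has_derivative D) (at (\<tau>, z))" "\<And>c v w. D (c * v, c *s w) = c * D (v, w)"
    by (rule cdiffE[OF assms(1)]) (rule that)
  have "((\<lambda>p. \<psi> (fst p) (snd p)) has_derivative D) (at (\<tau>, z))"
    by (rule has_derivative_transform_within_open[OF D(1), of "uhp \<times> UNIV"]) (use assms open_uhp in \<open>auto intro: open_Times\<close>)
  then show ?thesis by (rule cdiffI) (rule D(2))
qed

text \<open>On the half plane \<open>theta_E8\<close> is a finite combination of products of
  one-variable theta functions, so no eight-fold series has to be differentiated.\<close>

lemma theta_E8_jholomorphic: "jholomorphic theta_E8"
  unfolding jholomorphic_cdiff
proof (intro ballI allI)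
  fix \<tau> z assume \<tau>: "\<tau> \<in> uhp"
  have char: "cdiff (theta_char a b) \<tau> z" for a b
  proof -
    have ee: "(ee has_field_derivative 2 * complex_of_real pi * \<i> * ee x) (at x)" for x
      using ee_has_field_derivative[OF DERIV_ident, of x] by simp
    have lin: "cdiff (\<lambda>\<tau> z. of_nat a * \<tau> + of_nat a / 2 * (\<Sum>i\<in>UNIV. z $ i)) \<tau> z"
      by (intro cdiff_add cdiff_mult cdiff_sum cdiff_coord cdiff_const cdiff_fst[OF DERIV_cmult_Id]) auto
    have arg: "cdiff (\<lambda>\<tau> z. z $ i + of_nat a * \<tau> / 2 + of_nat b / 2) \<tau> z" for i
    proof -
      have "((\<lambda>\<tau>. of_nat a * \<tau> / 2) has_field_derivative of_nat a / 2) (at \<tau>)"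
        by (auto intro!: derivative_eq_intros)
      then show ?thesis by (intro cdiff_add cdiff_coord cdiff_const cdiff_fst)
    qed
    have "cdiff (\<lambda>\<tau> z. th 0 \<tau> (z $ i + of_nat a * \<tau> / 2 + of_nat b / 2)) \<tau> z" for i
      by (rule cdiff_th[OF cdiff_fst[OF DERIV_ident] arg \<tau>])
    then show ?thesis
      unfolding theta_char_def
      by (intro cdiff_mult cdiff_prod cdiff_compose[OF lin ee]) auto
  qed
  show "cdiff theta_E8 \<tau> z"
  proof (rule cdiff_transform[OF _ \<tau>])
    show "cdiff (\<lambda>\<tau> z. (theta_char 0 0 \<tau> z + theta_char 0 1 \<tau> z + theta_char 1 0 \<tau> z + theta_char 1 1 \<tau> z) * (1 / 2)) \<tau> z"
      by (intro cdiff_mult cdiff_add char cdiff_const)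
  qed (simp add: theta_E8_eq_chars)
qed

section \<open>The modular group\<close>

definition mat2 :: "int \<Rightarrow> int \<Rightarrow> int \<Rightarrow> int \<Rightarrow> int ^ 2 ^ 2" where
  "mat2 a b c d = (\<chi> i j. if i = 1 then (if j = 1 then a else b) else (if j = 1 then c else d))"

lemma mat2_nth [simp]:
  "mat2 a b c d $ 1 $ 1 = a" "mat2 a b c d $ 1 $ 2 = b" "mat2 a b c d $ 2 $ 1 = c" "mat2 a b c d $ 2 $ 2 = d"
  by (simp_all add: mat2_def)

lemma mat2_eqI: "\<gamma> $ 1 $ 1 = a \<Longrightarrow> \<gamma> $ 1 $ 2 = b \<Longrightarrow> \<gamma> $ 2 $ 1 = c \<Longrightarrow> \<gamma> $ 2 $ 2 = d \<Longrightarrow> \<gamma> = mat2 a b c d"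
  unfolding vec_eq_iff forall_2 by simp

lemma mat2_cases: obtains a b c d where "\<gamma> = mat2 a b c d"
  using mat2_eqI by blast

lemma mat2_mult: "mat2 a b c d ** mat2 a' b' c' d' = mat2 (a * a' + b * c') (a * b' + b * d') (c * a' + d * c') (c * b' + d * d')"
  by (rule mat2_eqI) (simp_all add: matrix_matrix_mult_def sum_2)

lemma mat2_SL2Z: "mat2 a b c d \<in> SL2Z \<longleftrightarrow> a * d - b * c = 1"
  by (simp add: SL2Z_def det_2)

lemma SL2Z_mult: "\<gamma> \<in> SL2Z \<Longrightarrow> \<delta> \<in> SL2Z \<Longrightarrow> \<gamma> ** \<delta> \<in> SL2Z"
  by (simp add: SL2Z_def det_mul)

lemma SL2Z_inverse:
  assumes "\<gamma> \<in> SL2Z"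
  obtains \<delta> where "\<delta> \<in> SL2Z" "\<gamma> ** \<delta> = mat2 1 0 0 1" "\<delta> ** \<gamma> = mat2 1 0 0 1"
proof -
  obtain a b c d where g: "\<gamma> = mat2 a b c d" by (rule mat2_cases)
  have "a * d - b * c = 1" using assms by (simp add: g mat2_SL2Z)
  then show ?thesis
    by (intro that[of "mat2 d (- b) (- c) a"]) (auto simp: g mat2_SL2Z mat2_mult algebra_simps)
qed

lemma mat2_1: "mat2 1 0 0 1 = mat 1"
  by (rule mat2_eqI[symmetric]) (simp_all add: mat_def)

text \<open>Euclid's algorithm on the lower left entry. Closure under inverses is not assumed: the
  inverse of S is S^3, and the inverse of T is a case of its own.\<close>

lemma SL2Z_induct [consumes 1, case_names mult S T Tinv]:
  assumes "\<gamma> \<in> SL2Z"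
    and mult: "\<And>\<gamma> \<delta>. \<gamma> \<in> SL2Z \<Longrightarrow> \<delta> \<in> SL2Z \<Longrightarrow> P \<gamma> \<Longrightarrow> P \<delta> \<Longrightarrow> P (\<gamma> ** \<delta>)"
    and S: "P (mat2 0 (- 1) 1 0)" and T: "P (mat2 1 1 0 1)" and T': "P (mat2 1 (- 1) 0 1)"
  shows "P \<gamma>"
proof -
  have in_S: "mat2 0 (- 1) 1 0 \<in> SL2Z" and in_T: "mat2 1 n 0 1 \<in> SL2Z" for n by (simp_all add: mat2_SL2Z)
  have S2: "P (mat2 (- 1) 0 0 (- 1))" using mult[OF in_S in_S S S] by (simp add: mat2_mult)
  have in_S2: "mat2 (- 1) 0 0 (- 1) \<in> SL2Z" by (simp add: mat2_SL2Z)
  have S3: "P (mat2 0 1 (- 1) 0)" using mult[OF in_S2 in_S S2 S] by (simp add: mat2_mult)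
  have in_S3: "mat2 0 1 (- 1) 0 \<in> SL2Z" by (simp add: mat2_SL2Z)
  have I: "P (mat2 1 0 0 1)" using mult[OF in_S2 in_S2 S2 S2] by (simp add: mat2_mult)
  have Tn: "P (mat2 1 n 0 1)" for n
  proof (induction n rule: int_induct[of _ 0])
    case base
    then show ?case by (rule I)
  next
    case (step1 i)
    then show ?case using mult[OF in_T in_T _ T, of i] by (simp add: mat2_mult add.commute)
  next
    case (step2 i)
    then show ?case using mult[OF in_T in_T _ T', of i] by (simp add: mat2_mult add.commute)
  qed
  obtain a b c d where g: "\<gamma> = mat2 a b c d" by (rule mat2_cases)
  have "a * d - b * c = 1" using assms(1) by (simp add: g mat2_SL2Z)
  then have "P (mat2 a b c d)"
  proof (induction "nat \<bar>c\<bar>" arbitrary: a b c d rule: less_induct)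
    case less
    show ?case
    proof (cases "c = 0")
      case True
      with less.prems have ad: "a * d = 1" by simp
      then consider "a = 1" "d = 1" | "a = - 1" "d = - 1" by (auto simp: zmult_eq_1_iff)
      then show ?thesis
      proof cases
        case 1
        then show ?thesis using Tn[of b] True by simp
      next
        case 2
        then show ?thesis using mult[OF in_S2 in_T S2 Tn, of "- b"] True by (simp add: mat2_mult)
      qed
    next
      case False
      \<comment> \<open>T^q splits off the quotient from the upper row; S^3 then exchanges the rows
        up to sign, so the lower left entry drops to a mod c.\<close>
      define q where "q = a div c"
      define a' b' where "a' = a - q * c" and "b' = b - q * d"
      have a': "a' = a mod c" by (simp add: a'_def q_def minus_div_mult_eq_mod)
      have "nat \<bar>a'\<bar> < nat \<bar>c\<bar>" using False unfolding a' by (simp add: abs_mod_less)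
      moreover have det: "- c * b' - - d * a' = 1" using less.prems by (simp add: a'_def b'_def algebra_simps)
      ultimately have P1: "P (mat2 (- c) (- d) a' b')" by (intro less.hyps) auto
      have in1: "mat2 (- c) (- d) a' b' \<in> SL2Z" using det by (simp add: mat2_SL2Z)
      have P2: "P (mat2 a' b' c d)" using mult[OF in_S3 in1 S3 P1] by (simp add: mat2_mult)
      have in2: "mat2 a' b' c d \<in> SL2Z" using det by (simp add: mat2_SL2Z algebra_simps)
      show ?thesis using mult[OF in_T in2 Tn P2, of q] by (simp add: mat2_mult a'_def b'_def)
    qed
  qed
  then show ?thesis by (simp add: g)
qed

lemma autfac_mat2: "autfac (mat2 a b c d) \<tau> = of_int c * \<tau> + of_int d"
  by (simp add: autfac_def)

lemma moeb_mat2: "moeb (mat2 a b c d) \<tau> = (of_int a * \<tau> + of_int b) / (of_int c * \<tau> + of_int d)"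
  by (simp add: moeb_def)

lemma autfac_nonzero:
  assumes "\<gamma> \<in> SL2Z" "\<tau> \<in> uhp"
  shows "autfac \<gamma> \<tau> \<noteq> 0"
proof
  assume 0: "autfac \<gamma> \<tau> = 0"
  obtain a b c d where g: "\<gamma> = mat2 a b c d" by (rule mat2_cases)
  have "Im (of_int c * \<tau> + of_int d) = 0" using 0 by (simp add: g autfac_mat2)
  then have "c = 0" using assms(2) by (simp add: uhp_def)
  moreover have "d = 0" using 0 \<open>c = 0\<close> by (simp add: g autfac_mat2)
  ultimately show False using assms(1) by (simp add: g mat2_SL2Z)
qed

lemma moeb_in_uhp:
  assumes "\<gamma> \<in> SL2Z" "\<tau> \<in> uhp"
  shows "moeb \<gamma> \<tau> \<in> uhp"
proof -
  obtain a b c d where g: "\<gamma> = mat2 a b c d" by (rule mat2_cases)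
  have nz: "of_int c * \<tau> + of_int d \<noteq> 0" using autfac_nonzero[OF assms] by (simp add: g autfac_mat2)
  have det: "real_of_int a * real_of_int d - real_of_int b * real_of_int c = 1"
    using assms(1) unfolding g mat2_SL2Z by (metis of_int_1 of_int_diff of_int_mult)
  have "Im (moeb \<gamma> \<tau>) = (real_of_int a * real_of_int d - real_of_int b * real_of_int c) * Im \<tau> / (norm (of_int c * \<tau> + of_int d))\<^sup>2"
    by (simp add: g moeb_mat2 Im_divide cmod_power2 algebra_simps)
  also have "\<dots> > 0" using assms(2) nz by (simp add: det uhp_def)
  finally show ?thesis by (simp add: uhp_def)
qed

lemma autfac_mult:
  assumes "\<delta> \<in> SL2Z" "\<tau> \<in> uhp"
  shows "autfac (\<gamma> ** \<delta>) \<tau> = autfac \<gamma> (moeb \<delta> \<tau>) * autfac \<delta> \<tau>"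
proof -
  obtain a b c d where g: "\<gamma> = mat2 a b c d" by (rule mat2_cases)
  obtain a' b' c' d' where d: "\<delta> = mat2 a' b' c' d'" by (rule mat2_cases)
  have nz: "of_int c' * \<tau> + of_int d' \<noteq> 0" using autfac_nonzero[OF assms] by (simp add: d autfac_mat2)
  then show ?thesis by (simp add: g d mat2_mult autfac_mat2 moeb_mat2 field_simps)
qed

lemma moeb_mult:
  assumes "\<gamma> \<in> SL2Z" "\<delta> \<in> SL2Z" "\<tau> \<in> uhp"
  shows "moeb (\<gamma> ** \<delta>) \<tau> = moeb \<gamma> (moeb \<delta> \<tau>)"
proof -
  obtain a b c d where g: "\<gamma> = mat2 a b c d" by (rule mat2_cases)
  obtain a' b' c' d' where d: "\<delta> = mat2 a' b' c' d'" by (rule mat2_cases)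
  define j where "j = of_int c' * \<tau> + of_int d'"
  define n where "n = of_int a' * \<tau> + of_int b'"
  have nz: "j \<noteq> 0" using autfac_nonzero[OF assms(2,3)] by (simp add: d autfac_mat2 j_def)
  have "moeb \<gamma> (moeb \<delta> \<tau>) = (of_int a * (n / j) + of_int b) / (of_int c * (n / j) + of_int d)"
    by (simp add: g d moeb_mat2 n_def j_def)
  also have "\<dots> = ((of_int a * n + of_int b * j) / j) / ((of_int c * n + of_int d * j) / j)"
    using nz by (simp add: field_simps)
  also have "\<dots> = (of_int a * n + of_int b * j) / (of_int c * n + of_int d * j)"
    using nz by simp
  also have "\<dots> = moeb (\<gamma> ** \<delta>) \<tau>"
    by (simp add: g d mat2_mult moeb_mat2 n_def j_def algebra_simps)
  finally show ?thesis by simp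
qed

text \<open>Division gives c3 / j3 = c2 / j2 + c1 / (j2 j3), where c and j are the lower left entry
  and the automorphy factor of gamma, delta and their product. This additive cocycle governs both
  the exponential factor of \<open>slash\<close> and the anomaly of \<open>Eis2\<close>.\<close>

lemma autfac_cocycle:
  assumes "\<delta> \<in> SL2Z" "\<tau> \<in> uhp"
  shows "of_int ((\<gamma> ** \<delta>) $ 2 $ 1) * autfac \<delta> \<tau> = of_int (\<delta> $ 2 $ 1) * autfac (\<gamma> ** \<delta>) \<tau> + of_int (\<gamma> $ 2 $ 1)"
proof -
  obtain a b c d where g: "\<gamma> = mat2 a b c d" by (rule mat2_cases)
  obtain a' b' c' d' where d: "\<delta> = mat2 a' b' c' d'" by (rule mat2_cases)
  have det: "complex_of_int a' * complex_of_int d' - complex_of_int b' * complex_of_int c' = 1"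
    using assms(1) unfolding d mat2_SL2Z by (metis of_int_1 of_int_diff of_int_mult)
  have "of_int ((\<gamma> ** \<delta>) $ 2 $ 1) * autfac \<delta> \<tau> - of_int (\<delta> $ 2 $ 1) * autfac (\<gamma> ** \<delta>) \<tau> =
      of_int c * (complex_of_int a' * complex_of_int d' - complex_of_int b' * complex_of_int c')"
    by (simp add: g d mat2_mult autfac_mat2 algebra_simps)
  then show ?thesis unfolding det by (simp add: g algebra_simps)
qed

lemma slash_ee:
  "slash k t \<phi> \<gamma> \<tau> z = autfac \<gamma> \<tau> powi (- k) * ee (- (of_nat t * (of_int (\<gamma> $ 2 $ 1) * cdot z z / autfac \<gamma> \<tau>) / 2)) *
     \<phi> (moeb \<gamma> \<tau>) (inverse (autfac \<gamma> \<tau>) *s z)"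
  by (simp add: slash_def ee_def algebra_simps)

lemma slash_slash:
  assumes "\<gamma> \<in> SL2Z" "\<delta> \<in> SL2Z" "\<tau> \<in> uhp"
  shows "slash k t (slash k t \<phi> \<gamma>) \<delta> \<tau> z = slash k t \<phi> (\<gamma> ** \<delta>) \<tau> z"
proof -
  define j1 j2 c1 c2 c3 w T where "j1 = autfac \<gamma> (moeb \<delta> \<tau>)" and "j2 = autfac \<delta> \<tau>"
    and "c1 = (of_int (\<gamma> $ 2 $ 1) :: complex)" and "c2 = (of_int (\<delta> $ 2 $ 1) :: complex)"
    and "c3 = (of_int ((\<gamma> ** \<delta>) $ 2 $ 1) :: complex)" and "w = cdot z z" and "T = (of_nat t :: complex)"
  have j1: "j1 \<noteq> 0" and j2: "j2 \<noteq> 0"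
    using autfac_nonzero assms moeb_in_uhp by (auto simp: j1_def j2_def)
  have j3: "autfac (\<gamma> ** \<delta>) \<tau> = j1 * j2" using autfac_mult[OF assms(2,3)] by (simp add: j1_def j2_def)
  have coc: "c3 * j2 = c2 * (j1 * j2) + c1"
    using autfac_cocycle[OF assms(2,3), of \<gamma>] j3 by (simp add: c1_def c2_def c3_def j2_def)
  have "c3 * w / (j1 * j2) = (c3 * j2) * w / (j1 * j2 * j2)" using j2 by simp
  also have "\<dots> = c2 * w / j2 + c1 * (inverse j2 * (inverse j2 * w)) / j1"
    unfolding coc using j1 j2 by (simp add: field_simps)
  finally have e: "- (T * (c3 * w / (j1 * j2)) / 2) = - (T * (c2 * w / j2) / 2) + - (T * (c1 * (inverse j2 * (inverse j2 * w)) / j1) / 2)"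
    by (simp add: algebra_simps)
  have "slash k t (slash k t \<phi> \<gamma>) \<delta> \<tau> z = j2 powi (- k) * ee (- (T * (c2 * w / j2) / 2)) *
      (j1 powi (- k) * ee (- (T * (c1 * (inverse j2 * (inverse j2 * w)) / j1) / 2)) *
        \<phi> (moeb \<gamma> (moeb \<delta> \<tau>)) (inverse j1 *s (inverse j2 *s z)))"
    unfolding slash_ee j1_def j2_def c1_def c2_def w_def T_def cdot_scale_left cdot_scale_right ..
  also have "\<dots> = (j1 * j2) powi (- k) * ee (- (T * (c3 * w / (j1 * j2)) / 2)) *
      \<phi> (moeb (\<gamma> ** \<delta>) \<tau>) (inverse (j1 * j2) *s z)"
    unfolding e ee_add moeb_mult[OF assms] by (simp add: power_int_mult_distrib vector_smult_assoc mult_ac)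
  also have "\<dots> = slash k t \<phi> (\<gamma> ** \<delta>) \<tau> z"
    unfolding slash_ee j3 c3_def w_def T_def ..
  finally show ?thesis .
qed

lemma slash_cong:
  assumes "\<gamma> \<in> SL2Z" "\<tau> \<in> uhp" "\<And>\<tau> z. \<tau> \<in> uhp \<Longrightarrow> \<phi> \<tau> z = \<psi> \<tau> z"
  shows "slash k t \<phi> \<gamma> \<tau> z = slash k t \<psi> \<gamma> \<tau> z"
  unfolding slash_def assms(3)[OF moeb_in_uhp[OF assms(1,2)]] ..

lemma slash_one [simp]: "slash k t \<phi> (mat2 1 0 0 1) \<tau> z = \<phi> \<tau> z"
  by (simp add: slash_def autfac_mat2 moeb_mat2)

lemma slash_S: "slash k t \<phi> (mat2 0 (- 1) 1 0) \<tau> z = \<tau> powi (- k) * ee (- (of_nat t * cdot z z / (2 * \<tau>))) * \<phi> (- 1 / \<tau>) ((1 / \<tau>) *s z)"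
  by (simp add: slash_ee autfac_mat2 moeb_mat2 inverse_eq_divide mult.commute)

lemma slash_T: "slash k t \<phi> (mat2 1 n 0 1) \<tau> z = \<phi> (\<tau> + of_int n) z"
  by (simp add: slash_ee autfac_mat2 moeb_mat2)

lemma move_factors:
  fixes J E X Y :: complex
  assumes "J \<noteq> 0" "E \<noteq> 0"
  shows "inverse J * inverse E * X = Y \<longleftrightarrow> X = J * E * Y"
proof -
  have "inverse J * inverse E * X = X / (J * E)" by (simp add: divide_inverse)
  moreover have "X / (J * E) = Y \<longleftrightarrow> X = Y * (J * E)"
    using assms by (intro nonzero_divide_eq_eq) simp
  ultimately show ?thesis by (simp only: mult.commute)
qed

lemma slash_invariant_iff:
  assumes "\<gamma> \<in> SL2Z" "\<tau> \<in> uhp"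
  shows "slash k t \<phi> \<gamma> \<tau> z = \<phi> \<tau> z \<longleftrightarrow> \<phi> (moeb \<gamma> \<tau>) (inverse (autfac \<gamma> \<tau>) *s z) =
          autfac \<gamma> \<tau> powi k *
          exp (of_nat t * complex_of_real pi * \<i> * (of_int (\<gamma> $ 2 $ 1) * cdot z z / autfac \<gamma> \<tau>)) * \<phi> \<tau> z"
proof -
  have "autfac \<gamma> \<tau> powi k \<noteq> 0"
    using autfac_nonzero[OF assms] by (simp add: power_int_eq_0_iff)
  from move_factors[OF this exp_not_eq_zero]
  show ?thesis unfolding slash_def power_int_minus[of _ k] exp_minus .
qed

lemma slash_invariant_SL2Z:
  assumes S: "\<And>\<tau> z. \<tau> \<in> uhp \<Longrightarrow> \<phi> (- 1 / \<tau>) ((1 / \<tau>) *s z) = \<tau> powi k * ee (of_nat t * cdot z z / (2 * \<tau>)) * \<phi> \<tau> z"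
    and T: "\<And>\<tau> z. \<tau> \<in> uhp \<Longrightarrow> \<phi> (\<tau> + 1) z = \<phi> \<tau> z"
    and \<gamma>: "\<gamma> \<in> SL2Z"
  shows "\<forall>\<tau>\<in>uhp. \<forall>z. slash k t \<phi> \<gamma> \<tau> z = \<phi> \<tau> z"
  using \<gamma>
proof (induction rule: SL2Z_induct)
  case (mult \<gamma> \<delta>)
  show ?case
  proof (intro ballI allI)
    fix \<tau> z assume \<tau>: "\<tau> \<in> uhp"
    have "slash k t \<phi> (\<gamma> ** \<delta>) \<tau> z = slash k t (slash k t \<phi> \<gamma>) \<delta> \<tau> z"
      using slash_slash[OF mult(1,2) \<tau>] by simp
    also have "\<dots> = slash k t \<phi> \<delta> \<tau> z" using mult(2,3) \<tau> by (intro slash_cong) auto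
    also have "\<dots> = \<phi> \<tau> z" using mult(4) \<tau> by blast
    finally show "slash k t \<phi> (\<gamma> ** \<delta>) \<tau> z = \<phi> \<tau> z" .
  qed
next
  case S
  show ?case using assms(1) uhp_nonzero by (auto simp: slash_S power_int_minus ee_minus field_simps)
next
  case T
  show ?case using slash_T[of k t \<phi> 1] assms(2) by simp
next
  case Tinv
  show ?case
  proof (intro ballI allI)
    fix \<tau> z assume "\<tau> \<in> uhp"
    then have "\<tau> + of_int (- 1) \<in> uhp" by (rule uhp_add_int)
    from assms(2)[OF this] show "slash k t \<phi> (mat2 1 (- 1) 0 1) \<tau> z = \<phi> \<tau> z"
      by (simp add: slash_T)
  qed
qed

section \<open>Jacobi forms\<close>

text \<open>The coefficients become a parameter because they are computed with later;
  \<open>jacobi_forms\<close> only asserts that some exist.\<close>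

definition has_expansion :: "nat \<Rightarrow> jfun \<Rightarrow> (nat \<Rightarrow> real ^ 8 \<Rightarrow> complex) \<Rightarrow> bool" where
  "has_expansion t \<phi> f \<longleftrightarrow> (\<forall>n. \<forall>l\<in>E8. f n l \<noteq> 0 \<longrightarrow> l \<bullet> l \<le> 2 * real n * real t) \<and>
     (\<forall>\<tau>\<in>uhp. \<forall>z. ((\<lambda>(n, l). f n l * ee \<tau> ^ n * ee (cdot (cvec l) z)) has_sum \<phi> \<tau> z) (UNIV \<times> E8))"

lemma has_expansion_alt:
  "has_expansion t \<phi> f \<longleftrightarrow> (\<forall>n. \<forall>l\<in>E8. f n l \<noteq> 0 \<longrightarrow> 2 * real n * real t - l \<bullet> l \<ge> 0) \<and>
          (\<forall>\<tau>\<in>uhp. \<forall>z. (fourier_term f \<tau> z has_sum \<phi> \<tau> z) (UNIV \<times> E8))"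
  by (simp add: has_expansion_def fourier_term_def ee_def)

lemma quasi_period_factor:
  "exp (- (of_nat t * complex_of_real pi * \<i> * (cdot (cvec x) (cvec x) * \<tau> + 2 * c))) =
    ee (- (of_nat t * (of_real (x \<bullet> x) * \<tau> / 2 + c)))"
proof -
  have "- (of_nat t * complex_of_real pi * \<i> * (cdot (cvec x) (cvec x) * \<tau> + 2 * c)) =
      2 * complex_of_real pi * \<i> * (- (of_nat t * (of_real (x \<bullet> x) * \<tau> / 2 + c)))"
    by (simp add: cdot_cvec algebra_simps)
  then show ?thesis unfolding ee_def by (rule arg_cong)
qed

lemma jacobi_formsI:
  assumes hol: "jholomorphic \<phi>"
    and refl: "\<And>r \<tau> z. r \<in> E8 \<Longrightarrow> r \<bullet> r = 2 \<Longrightarrow> \<tau> \<in> uhp \<Longrightarrow> \<phi> \<tau> (reflection r z) = \<phi> \<tau> z"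
    and quasi: "\<And>x y \<tau> z. x \<in> E8 \<Longrightarrow> y \<in> E8 \<Longrightarrow> \<tau> \<in> uhp \<Longrightarrow> \<phi> \<tau> (z + \<tau> *s cvec x + cvec y) =
      ee (- (of_nat t * (of_real (x \<bullet> x) * \<tau> / 2 + cdot (cvec x) z))) * \<phi> \<tau> z"
    and slash: "\<And>\<gamma> \<tau> z. \<gamma> \<in> SL2Z \<Longrightarrow> \<tau> \<in> uhp \<Longrightarrow> slash k t \<phi> \<gamma> \<tau> z = \<phi> \<tau> z"
    and exp: "has_expansion t \<phi> f"
  shows "\<phi> \<in> jacobi_forms k t"
  unfolding jacobi_forms_def mem_Collect_eq has_expansion_alt[symmetric] quasi_period_factor
proof (intro conjI ballI allI)
  show "jholomorphic \<phi>" by (rule hol)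
  show "\<exists>f. has_expansion t \<phi> f" using exp by blast
  show "\<phi> \<tau> (\<sigma> z) = \<phi> \<tau> z" if "\<sigma> \<in> weyl_E8" "\<tau> \<in> uhp" for \<sigma> \<tau> z
    by (rule weyl_E8_invariant[OF that(1)]) (rule refl[OF _ _ that(2)])
  show "\<phi> \<tau> (z + \<tau> *s cvec x + cvec y) =
      ee (- (of_nat t * (of_real (x \<bullet> x) * \<tau> / 2 + cdot (cvec x) z))) * \<phi> \<tau> z"
    if "x \<in> E8" "y \<in> E8" "\<tau> \<in> uhp" for x y \<tau> z
    using that by (rule quasi)
  show "\<phi> (moeb \<gamma> \<tau>) (inverse (autfac \<gamma> \<tau>) *s z) = autfac \<gamma> \<tau> powi k *
      exp (of_nat t * complex_of_real pi * \<i> * (of_int (\<gamma> $ 2 $ 1) * cdot z z / autfac \<gamma> \<tau>)) * \<phi> \<tau> z"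
    if "\<gamma> \<in> SL2Z" "\<tau> \<in> uhp" for \<gamma> \<tau> z
    using slash[OF that] slash_invariant_iff[OF that] by blast
qed

lemma jacobi_formsD:
  assumes "\<phi> \<in> jacobi_forms k t"
  shows "jholomorphic \<phi>"
    and "r \<in> E8 \<Longrightarrow> r \<bullet> r = 2 \<Longrightarrow> \<tau> \<in> uhp \<Longrightarrow> \<phi> \<tau> (reflection r z) = \<phi> \<tau> z"
    and "x \<in> E8 \<Longrightarrow> y \<in> E8 \<Longrightarrow> \<tau> \<in> uhp \<Longrightarrow> \<phi> \<tau> (z + \<tau> *s cvec x + cvec y) =
      ee (- (of_nat t * (of_real (x \<bullet> x) * \<tau> / 2 + cdot (cvec x) z))) * \<phi> \<tau> z"
    and "\<gamma> \<in> SL2Z \<Longrightarrow> \<tau> \<in> uhp \<Longrightarrow> slash k t \<phi> \<gamma> \<tau> z = \<phi> \<tau> z"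
    and "\<exists>f. has_expansion t \<phi> f"
proof -
  note A = assms[unfolded jacobi_forms_def mem_Collect_eq has_expansion_alt[symmetric] quasi_period_factor]
  show "jholomorphic \<phi>" "\<exists>f. has_expansion t \<phi> f"
    using A by blast+
  show "\<phi> \<tau> (reflection r z) = \<phi> \<tau> z" if "r \<in> E8" "r \<bullet> r = 2" "\<tau> \<in> uhp"
    using weyl_step[OF that(1,2) weyl_id] A that(3) by simp
  show "\<phi> \<tau> (z + \<tau> *s cvec x + cvec y) =
      ee (- (of_nat t * (of_real (x \<bullet> x) * \<tau> / 2 + cdot (cvec x) z))) * \<phi> \<tau> z" if "x \<in> E8" "y \<in> E8" "\<tau> \<in> uhp"
    using A that by blast
  show "slash k t \<phi> \<gamma> \<tau> z = \<phi> \<tau> z" if "\<gamma> \<in> SL2Z" "\<tau> \<in> uhp"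
    unfolding slash_invariant_iff[OF that] using A that by blast
qed

lemma jacobi_forms_S:
  assumes "\<phi> \<in> jacobi_forms k t" "\<tau> \<in> uhp"
  shows "\<phi> (- 1 / \<tau>) ((1 / \<tau>) *s z) = \<tau> powi k * ee (of_nat t * cdot z z / (2 * \<tau>)) * \<phi> \<tau> z"
proof -
  have "slash k t \<phi> (mat2 0 (- 1) 1 0) \<tau> z = \<phi> \<tau> z"
    using assms by (intro jacobi_formsD(4)) (auto simp: mat2_SL2Z)
  then show ?thesis
    using uhp_nonzero[OF assms(2)] by (simp add: slash_S power_int_minus ee_minus field_simps)
qed

lemma theta_E8_power_has_sum:
  assumes "\<tau> \<in> uhp"
  shows "((\<lambda>l. ee \<tau> ^ half_norm l * ee (cdot (cvec l) z)) has_sum theta_E8 \<tau> z) E8"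
proof -
  have "theta_summand \<tau> z l = ee \<tau> ^ half_norm l * ee (cdot (cvec l) z)" if "l \<in> E8" for l
  proof -
    have "complex_of_real (l \<bullet> l) = 2 * of_nat (half_norm l)" by (simp add: half_norm[OF that])
    then show ?thesis unfolding theta_summand_def by (simp add: ee_add ee_power)
  qed
  then show ?thesis using theta_E8_has_sum[OF assms, of z] by (simp cong: has_sum_cong)
qed

definition theta_coeff :: "nat \<Rightarrow> real ^ 8 \<Rightarrow> complex" where
  "theta_coeff n l = (if half_norm l = n then 1 else 0)"

lemma theta_E8_expansion: "has_expansion 1 theta_E8 theta_coeff"
  unfolding has_expansion_def
proof (intro conjI allI ballI impI)
  fix n l assume "l \<in> E8" "theta_coeff n l \<noteq> 0"
  then show "l \<bullet> l \<le> 2 * real n * real 1" using half_norm[of l] by (auto simp: theta_coeff_def split: if_splits)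
next
  fix \<tau> z assume \<tau>: "\<tau> \<in> uhp"
  define F where "F = (\<lambda>(n, l). theta_coeff n l * ee \<tau> ^ n * ee (cdot (cvec l) z))"
  have "((\<lambda>l. F (half_norm l, l)) has_sum theta_E8 \<tau> z) E8"
    using theta_E8_power_has_sum[OF \<tau>, of z] by (simp add: F_def theta_coeff_def)
  then have "(F has_sum theta_E8 \<tau> z) ((\<lambda>l. (half_norm l, l)) ` E8)"
    by (subst has_sum_reindex) (auto simp: inj_on_def o_def)
  then show "(F has_sum theta_E8 \<tau> z) (UNIV \<times> E8)"
    by (rule has_sum_cong_neutral[THEN iffD1, rotated -1]) (auto simp: F_def theta_coeff_def)
qed

theorem theta_E8_jacobi_form: "theta_E8 \<in> jacobi_forms 4 1"
proof (rule jacobi_formsI[OF theta_E8_jholomorphic theta_E8_reflection _ _ theta_E8_expansion])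
  show "slash 4 1 theta_E8 \<gamma> \<tau> z = theta_E8 \<tau> z" if "\<gamma> \<in> SL2Z" "\<tau> \<in> uhp" for \<gamma> \<tau> z
  proof -
    have "\<forall>\<tau>\<in>uhp. \<forall>z. slash 4 1 theta_E8 \<gamma> \<tau> z = theta_E8 \<tau> z"
      by (rule slash_invariant_SL2Z) (simp_all add: theta_E8_inversion theta_E8_T that power_int_def del: divide_minus_left)
    with that show ?thesis by blast
  qed
  show "theta_E8 \<tau> (z + \<tau> *s cvec x + cvec y) =
      ee (- (of_nat 1 * (of_real (x \<bullet> x) * \<tau> / 2 + cdot (cvec x) z))) * theta_E8 \<tau> z"
    if "x \<in> E8" "y \<in> E8" "\<tau> \<in> uhp" for x y \<tau> z
    using theta_E8_quasi_period[OF that(3,1,2)] by simp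
qed

section \<open>Sums and products of Jacobi forms\<close>

lemma has_expansionI:
  assumes "\<And>n l. l \<in> E8 \<Longrightarrow> f n l \<noteq> 0 \<Longrightarrow> l \<bullet> l \<le> 2 * real n * real t"
    and "\<And>\<tau> z. \<tau> \<in> uhp \<Longrightarrow> ((\<lambda>(n, l). f n l * ee \<tau> ^ n * ee (cdot (cvec l) z)) has_sum \<phi> \<tau> z) (UNIV \<times> E8)"
  shows "has_expansion t \<phi> f"
  using assms unfolding has_expansion_def by blast

lemma has_expansionD:
  assumes "has_expansion t \<phi> f"
  shows "l \<in> E8 \<Longrightarrow> f n l \<noteq> 0 \<Longrightarrow> l \<bullet> l \<le> 2 * real n * real t"
    and "\<tau> \<in> uhp \<Longrightarrow> ((\<lambda>(n, l). f n l * ee \<tau> ^ n * ee (cdot (cvec l) z)) has_sum \<phi> \<tau> z) (UNIV \<times> E8)"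
  using assms unfolding has_expansion_def by blast+

lemma has_expansion_add:
  assumes "has_expansion t \<phi> f" "has_expansion t \<psi> g"
  shows "has_expansion t (\<lambda>\<tau> z. \<phi> \<tau> z + \<psi> \<tau> z) (\<lambda>n l. f n l + g n l)"
proof (rule has_expansionI)
  show "l \<bullet> l \<le> 2 * real n * real t" if "l \<in> E8" "f n l + g n l \<noteq> 0" for n l
    using that has_expansionD(1)[OF assms(1) that(1)] has_expansionD(1)[OF assms(2) that(1)]
    by (cases "f n l = 0") auto
  show "((\<lambda>(n, l). (f n l + g n l) * ee \<tau> ^ n * ee (cdot (cvec l) z)) has_sum \<phi> \<tau> z + \<psi> \<tau> z) (UNIV \<times> E8)"
    if "\<tau> \<in> uhp" for \<tau> z
    using has_sum_add[OF has_expansionD(2)[OF assms(1) that, of z] has_expansionD(2)[OF assms(2) that, of z]]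
    by (simp add: case_prod_unfold ring_distribs)
qed

lemma has_expansion_cmult:
  assumes "has_expansion t \<phi> f"
  shows "has_expansion t (\<lambda>\<tau> z. c * \<phi> \<tau> z) (\<lambda>n l. c * f n l)"
proof (rule has_expansionI)
  show "l \<bullet> l \<le> 2 * real n * real t" if "l \<in> E8" "c * f n l \<noteq> 0" for n l
    using that has_expansionD(1)[OF assms that(1)] by simp
  show "((\<lambda>(n, l). c * f n l * ee \<tau> ^ n * ee (cdot (cvec l) z)) has_sum c * \<phi> \<tau> z) (UNIV \<times> E8)"
    if "\<tau> \<in> uhp" for \<tau> z
    using has_sum_cmult_right[OF has_expansionD(2)[OF assms that, of z], of c]
    by (simp add: case_prod_unfold mult.assoc)
qed

lemma jacobi_forms_add:
  assumes "\<phi> \<in> jacobi_forms k t" "\<psi> \<in> jacobi_forms k t"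
  shows "(\<lambda>\<tau> z. \<phi> \<tau> z + \<psi> \<tau> z) \<in> jacobi_forms k t"
proof -
  obtain f g where "has_expansion t \<phi> f" "has_expansion t \<psi> g" using assms jacobi_formsD(5) by metis
  then have "has_expansion t (\<lambda>\<tau> z. \<phi> \<tau> z + \<psi> \<tau> z) (\<lambda>n l. f n l + g n l)" by (rule has_expansion_add)
  moreover have "slash k t (\<lambda>\<tau> z. \<phi> \<tau> z + \<psi> \<tau> z) \<gamma> \<tau> z = slash k t \<phi> \<gamma> \<tau> z + slash k t \<psi> \<gamma> \<tau> z" for \<gamma> \<tau> z
    by (simp add: slash_def ring_distribs)
  moreover have "jholomorphic (\<lambda>\<tau> z. \<phi> \<tau> z + \<psi> \<tau> z)"
    using jacobi_formsD(1)[OF assms(1)] jacobi_formsD(1)[OF assms(2)] by (simp add: jholomorphic_cdiff cdiff_add)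
  ultimately show ?thesis
    by (intro jacobi_formsI)
      (simp_all add: jacobi_formsD(2-4)[OF assms(1)] jacobi_formsD(2-4)[OF assms(2)] ring_distribs)
qed

lemma jacobi_forms_cmult:
  assumes "\<phi> \<in> jacobi_forms k t"
  shows "(\<lambda>\<tau> z. c * \<phi> \<tau> z) \<in> jacobi_forms k t"
proof -
  obtain f where "has_expansion t \<phi> f" using assms jacobi_formsD(5) by metis
  then have "has_expansion t (\<lambda>\<tau> z. c * \<phi> \<tau> z) (\<lambda>n l. c * f n l)" by (rule has_expansion_cmult)
  moreover have "slash k t (\<lambda>\<tau> z. c * \<phi> \<tau> z) \<gamma> \<tau> z = c * slash k t \<phi> \<gamma> \<tau> z" for \<gamma> \<tau> z
    by (simp add: slash_def)
  moreover have "jholomorphic (\<lambda>\<tau> z. c * \<phi> \<tau> z)"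
    using jacobi_formsD(1)[OF assms] by (simp add: jholomorphic_cdiff cdiff_mult cdiff_const)
  ultimately show ?thesis
    by (intro jacobi_formsI) (simp_all add: jacobi_formsD(2-4)[OF assms])
qed

text \<open>Only finitely many summands are nonzero, since the coefficients of an expansion have bounded support for each \<open>n\<close>.\<close>

definition conv :: "(nat \<Rightarrow> real ^ 8 \<Rightarrow> complex) \<Rightarrow> (nat \<Rightarrow> real ^ 8 \<Rightarrow> complex) \<Rightarrow> nat \<Rightarrow> real ^ 8 \<Rightarrow> complex" where
  "conv f g n l = (\<Sum>\<^sub>\<infinity>(m, x)\<in>{..n} \<times> E8. f m x * g (n - m) (l - x))"

lemma has_sum_mult:
  fixes a :: "'a \<Rightarrow> complex" and b :: "'b \<Rightarrow> complex"
  assumes "(a has_sum A) X" "(b has_sum B) Y"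
  shows "((\<lambda>(x, y). a x * b y) has_sum A * B) (X \<times> Y)"
proof (rule has_sum_SigmaI)
  show "((\<lambda>y. case (x, y) of (x, y) \<Rightarrow> a x * b y) has_sum a x * B) Y" for x
    unfolding prod.case by (rule has_sum_cmult_right[OF assms(2)])
  show "((\<lambda>x. a x * B) has_sum A * B) X"
    by (rule has_sum_cmult_left[OF assms(1)])
  have na: "(\<lambda>x. norm (a x)) summable_on X" and nb: "(\<lambda>y. norm (b y)) summable_on Y"
    using assms has_sum_imp_summable summable_on_iff_abs_summable_on_complex by blast+
  have "(\<lambda>p. norm (case p of (x, y) \<Rightarrow> a x * b y)) summable_on (X \<times> Y)"
  proof (rule summable_on_SigmaI)
    show "((\<lambda>y. norm (case (x, y) of (x, y) \<Rightarrow> a x * b y)) has_sum norm (a x) * (\<Sum>\<^sub>\<infinity>y\<in>Y. norm (b y))) Y" for x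
      unfolding prod.case norm_mult by (rule has_sum_cmult_right[OF has_sum_infsum[OF nb]])
    show "(\<lambda>x. norm (a x) * (\<Sum>\<^sub>\<infinity>y\<in>Y. norm (b y))) summable_on X"
      by (rule summable_on_cmult_left[OF na])
  qed auto
  then show "(\<lambda>(x, y). a x * b y) summable_on (X \<times> Y)" by (rule abs_summable_summable)
qed

text \<open>The inequality of arithmetic and geometric means for 2 a d and 2 c b. Through it the
  support bounds of two factors combine to the bound for the sum of their indices.\<close>

lemma sum_sqrt_squared_le:
  fixes a b c d :: real
  assumes "a \<ge> 0" "b \<ge> 0" "c \<ge> 0" "d \<ge> 0"
  shows "(sqrt (2 * a * b) + sqrt (2 * c * d))\<^sup>2 \<le> 2 * (a + c) * (b + d)"
proof -
  have "sqrt (2 * a * b) * sqrt (2 * c * d) = sqrt ((2 * a * d) * (2 * c * b))"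
    by (simp add: real_sqrt_mult[symmetric] mult_ac)
  also have "\<dots> \<le> (2 * a * d + 2 * c * b) / 2"
    using assms by (intro arith_geo_mean_sqrt) auto
  finally have "2 * (sqrt (2 * a * b) * sqrt (2 * c * d)) \<le> 2 * a * d + 2 * c * b" by simp
  moreover have "(sqrt (2 * a * b) + sqrt (2 * c * d))\<^sup>2 = 2 * a * b + 2 * c * d + 2 * (sqrt (2 * a * b) * sqrt (2 * c * d))"
    using assms by (simp add: power2_sum del: real_sqrt_mult)
  ultimately show ?thesis by (simp add: algebra_simps)
qed

lemma has_expansion_mult:
  assumes f: "has_expansion s \<phi> f" and g: "has_expansion t \<psi> g"
  shows "has_expansion (s + t) (\<lambda>\<tau> z. \<phi> \<tau> z * \<psi> \<tau> z) (conv f g)"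
  unfolding has_expansion_def
proof (intro conjI allI ballI impI)
  fix n l assume l: "l \<in> E8" and nz: "conv f g n l \<noteq> 0"
  have "\<exists>m x. m \<le> n \<and> x \<in> E8 \<and> f m x * g (n - m) (l - x) \<noteq> 0"
  proof (rule ccontr)
    assume "\<not> ?thesis"
    then have "conv f g n l = (\<Sum>\<^sub>\<infinity>(m, x)\<in>{..n} \<times> E8. 0)"
      unfolding conv_def by (intro infsum_cong) auto
    with nz show False by (simp add: case_prod_unfold)
  qed
  then obtain m x where mx: "m \<le> n" "x \<in> E8" "f m x \<noteq> 0" "g (n - m) (l - x) \<noteq> 0" by auto
  have 1: "x \<bullet> x \<le> 2 * real m * real s" and 2: "(l - x) \<bullet> (l - x) \<le> 2 * real (n - m) * real t"
    using f g mx E8_diff[OF l mx(2)] unfolding has_expansion_def by blast+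
  have "norm x \<le> sqrt (2 * real m * real s)" "norm (l - x) \<le> sqrt (2 * real (n - m) * real t)"
    using 1 2 by (auto simp: norm_eq_sqrt_inner)
  then have "norm l \<le> sqrt (2 * real m * real s) + sqrt (2 * real (n - m) * real t)"
    using norm_triangle_ineq[of x "l - x"] by simp
  then have "(norm l)\<^sup>2 \<le> (sqrt (2 * real m * real s) + sqrt (2 * real (n - m) * real t))\<^sup>2"
    by (intro power_mono) auto
  also have "\<dots> \<le> 2 * (real m + real (n - m)) * (real s + real t)"
    by (rule sum_sqrt_squared_le) auto
  also have "\<dots> = 2 * real n * real (s + t)"
    using mx(1) by (simp add: of_nat_diff)
  finally show "l \<bullet> l \<le> 2 * real n * real (s + t)" by (simp add: power2_norm_eq_inner)
next
  fix \<tau> z assume \<tau>: "\<tau> \<in> uhp"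
  define F G where "F = (\<lambda>(n, l). f n l * ee \<tau> ^ n * ee (cdot (cvec l) z))"
    and "G = (\<lambda>(n, l). g n l * ee \<tau> ^ n * ee (cdot (cvec l) z))"
  have "(F has_sum \<phi> \<tau> z) (UNIV \<times> E8)" "(G has_sum \<psi> \<tau> z) (UNIV \<times> E8)"
    using f g \<tau> unfolding has_expansion_def F_def G_def by blast+
  then have "((\<lambda>(p, r). F p * G r) has_sum \<phi> \<tau> z * \<psi> \<tau> z) ((UNIV \<times> E8) \<times> (UNIV \<times> E8))"
    by (rule has_sum_mult)
  \<comment> \<open>Reindexing by the total exponent (n, l) and the share (m, x) of the first
    factor.\<close>
  also have "?this \<longleftrightarrow> ((\<lambda>((n, l), (m, x)). F (m, x) * G (n - m, l - x)) has_sum \<phi> \<tau> z * \<psi> \<tau> z)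
      (SIGMA (n, l):UNIV \<times> E8. {..n} \<times> E8)"
    by (rule has_sum_reindex_bij_witness[of _ "\<lambda>((n, l), (m, x)). ((m, x), (n - m, l - x))"
        "\<lambda>((m, x), (k, y)). ((m + k, x + y), (m, x))"]) (auto intro: E8_add E8_diff)
  finally have sum: "((\<lambda>((n, l), (m, x)). F (m, x) * G (n - m, l - x)) has_sum \<phi> \<tau> z * \<psi> \<tau> z)
      (SIGMA (n, l):UNIV \<times> E8. {..n} \<times> E8)" .
  show "((\<lambda>(n, l). conv f g n l * ee \<tau> ^ n * ee (cdot (cvec l) z)) has_sum \<phi> \<tau> z * \<psi> \<tau> z) (UNIV \<times> E8)"
  proof (rule has_sum_SigmaD[OF sum], goal_cases)
    case (1 nl)
    obtain n l where [simp]: "nl = (n, l)" and l: "l \<in> E8" using 1 by auto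
    define e where "e = ee \<tau> ^ n * ee (cdot (cvec l) z)"
    have FG: "F (m, x) * G (n - m, l - x) = f m x * g (n - m) (l - x) * e" if "m \<le> n" for m x
    proof -
      have "ee \<tau> ^ n = ee \<tau> ^ m * ee \<tau> ^ (n - m)" using that by (simp flip: power_add)
      moreover have "ee (cdot (cvec l) z) = ee (cdot (cvec x) z) * ee (cdot (cvec (l - x)) z)"
        unfolding ee_add[symmetric] by (simp add: cdot_simps)
      ultimately show ?thesis by (simp add: F_def G_def e_def mult_ac)
    qed
    have "(\<lambda>((n, l), (m, x)). F (m, x) * G (n - m, l - x)) summable_on (SIGMA (n, l):UNIV \<times> E8. {..n} \<times> E8)"
      using sum by (rule has_sum_imp_summable)
    then have "(\<lambda>((n, l), (m, x)). F (m, x) * G (n - m, l - x)) summable_on ({(n, l)} \<times> ({..n} \<times> E8))"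
      by (rule summable_on_subset_banach) (use l in auto)
    also have "?this \<longleftrightarrow> (\<lambda>(m, x). f m x * g (n - m) (l - x) * e) summable_on ({..n} \<times> E8)"
      by (rule summable_on_reindex_bij_witness[of _ "\<lambda>p. ((n, l), p)" snd]) (auto simp: FG)
    finally have "((\<lambda>(m, x). f m x * g (n - m) (l - x) * e) has_sum (\<Sum>\<^sub>\<infinity>(m, x)\<in>{..n} \<times> E8. f m x * g (n - m) (l - x) * e)) ({..n} \<times> E8)"
      by (rule has_sum_infsum)
    also have "(\<Sum>\<^sub>\<infinity>(m, x)\<in>{..n} \<times> E8. f m x * g (n - m) (l - x) * e) = conv f g n l * e"
      unfolding conv_def case_prod_unfold by (rule infsum_cmult_left')
    finally have "((\<lambda>(m, x). f m x * g (n - m) (l - x) * e) has_sum conv f g n l * e) ({..n} \<times> E8)" .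
    then have "((\<lambda>(m, x). F (m, x) * G (n - m, l - x)) has_sum conv f g n l * e) ({..n} \<times> E8)"
      by (rule has_sum_cong[THEN iffD1, rotated]) (auto simp: FG)
    then show ?case
      by (simp add: e_def mult.assoc)
  qed
qed

lemma slash_mult:
  assumes "\<gamma> \<in> SL2Z" "\<tau> \<in> uhp"
  shows "slash (k + l) (s + t) (\<lambda>\<tau> z. \<phi> \<tau> z * \<psi> \<tau> z) \<gamma> \<tau> z = slash k s \<phi> \<gamma> \<tau> z * slash l t \<psi> \<gamma> \<tau> z"
proof -
  define j X where "j = autfac \<gamma> \<tau>" and "X = of_int (\<gamma> $ 2 $ 1) * cdot z z / j"
  have "j \<noteq> 0" using autfac_nonzero[OF assms] by (simp add: j_def)
  then have 1: "j powi (- (k + l)) = j powi (- k) * j powi (- l)"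
    by (simp flip: power_int_add)
  have 2: "- (of_nat (s + t) * X / 2) = - (of_nat s * X / 2) + - (of_nat t * X / 2)"
    by (simp add: ring_distribs add_divide_distrib)
  show ?thesis
    unfolding slash_ee j_def[symmetric] X_def[symmetric] 1 2 ee_add by (simp add: mult_ac)
qed

lemma jacobi_forms_mult:
  assumes "\<phi> \<in> jacobi_forms k s" "\<psi> \<in> jacobi_forms l t"
  shows "(\<lambda>\<tau> z. \<phi> \<tau> z * \<psi> \<tau> z) \<in> jacobi_forms (k + l) (s + t)"
proof -
  obtain f g where "has_expansion s \<phi> f" "has_expansion t \<psi> g" using assms jacobi_formsD(5) by metis
  then have "has_expansion (s + t) (\<lambda>\<tau> z. \<phi> \<tau> z * \<psi> \<tau> z) (conv f g)" by (rule has_expansion_mult)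
  then show ?thesis
  proof (rule jacobi_formsI[rotated -1])
    show "jholomorphic (\<lambda>\<tau> z. \<phi> \<tau> z * \<psi> \<tau> z)"
      using jacobi_formsD(1)[OF assms(1)] jacobi_formsD(1)[OF assms(2)] by (simp add: jholomorphic_cdiff cdiff_mult)
    fix x y \<tau> z assume "x \<in> E8" "y \<in> E8" "\<tau> \<in> uhp"
    moreover have "- (of_nat (s + t) * (of_real (x \<bullet> x) * \<tau> / 2 + cdot (cvec x) z)) =
        - (of_nat s * (of_real (x \<bullet> x) * \<tau> / 2 + cdot (cvec x) z)) + - (of_nat t * (of_real (x \<bullet> x) * \<tau> / 2 + cdot (cvec x) z))"
      by (simp add: algebra_simps)
    ultimately show "\<phi> \<tau> (z + \<tau> *s cvec x + cvec y) * \<psi> \<tau> (z + \<tau> *s cvec x + cvec y) =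
        ee (- (of_nat (s + t) * (of_real (x \<bullet> x) * \<tau> / 2 + cdot (cvec x) z))) * (\<phi> \<tau> z * \<psi> \<tau> z)"
      by (simp only: ee_add jacobi_formsD(3)[OF assms(1)] jacobi_formsD(3)[OF assms(2)]) (simp add: mult_ac)
  qed (simp_all add: slash_mult jacobi_formsD(2,4)[OF assms(1)] jacobi_formsD(2,4)[OF assms(2)])
qed

lemma jacobi_forms_cong:
  assumes "\<phi> \<in> jacobi_forms k t" "\<And>\<tau> z. \<tau> \<in> uhp \<Longrightarrow> \<psi> \<tau> z = \<phi> \<tau> z"
  shows "\<psi> \<in> jacobi_forms k t"
proof -
  obtain f where f: "has_expansion t \<phi> f" using assms jacobi_formsD(5) by metis
  have "has_expansion t \<psi> f"
    by (rule has_expansionI) (use has_expansionD[OF f] assms(2) in auto)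
  then show ?thesis
  proof (rule jacobi_formsI[rotated -1])
    show "jholomorphic \<psi>"
      unfolding jholomorphic_cdiff
    proof (intro ballI allI)
      fix \<tau> z assume \<tau>: "\<tau> \<in> uhp"
      then have "cdiff \<phi> \<tau> z" using jacobi_formsD(1)[OF assms(1)] by (simp add: jholomorphic_cdiff)
      then show "cdiff \<psi> \<tau> z" by (rule cdiff_transform[OF _ \<tau>]) (simp add: assms(2))
    qed
    show "slash k t \<psi> \<gamma> \<tau> z = \<psi> \<tau> z" if "\<gamma> \<in> SL2Z" "\<tau> \<in> uhp" for \<gamma> \<tau> z
      using slash_cong[OF that assms(2)] jacobi_formsD(4)[OF assms(1) that] assms(2)[OF that(2)] by simp
  qed (simp_all add: assms(2) jacobi_formsD(2,3)[OF assms(1)])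
qed

text \<open>Index 0 forces l = 0, so a modular form is a Jacobi form constant in z. Multiplication
  by \<open>Eis4\<close> and \<open>Eis6\<close> thereby becomes an instance of
  \<open>jacobi_forms_mult\<close>.\<close>

lemma mform_jacobi_form:
  assumes U: "mform k U" and u: "\<And>q. norm q < 1 \<Longrightarrow> ((\<lambda>n. u n * q ^ n) has_sum U q) UNIV"
  shows "(\<lambda>\<tau> z. U (ee \<tau>)) \<in> jacobi_forms k 0"
proof (rule jacobi_formsI)
  show "jholomorphic (\<lambda>\<tau> z. U (ee \<tau>))"
    unfolding jholomorphic_cdiff
  proof (intro ballI allI)
    fix \<tau> and z :: "complex ^ 8" assume \<tau>: "\<tau> \<in> uhp"
    have "U field_differentiable at (ee \<tau>)"
      using mform_holomorphic[OF U] \<tau> by (intro holomorphic_on_imp_differentiable_at[of U "ball 0 1"]) (auto simp: norm_ee_less_1)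
    then obtain D where "(U has_field_derivative D) (at (ee \<tau>))" by (auto simp: field_differentiable_def)
    from cdiff_fst[OF DERIV_chain2[OF this ee_has_field_derivative[OF DERIV_ident]]]
    show "cdiff (\<lambda>\<tau> z. U (ee \<tau>)) \<tau> z" .
  qed
  show "slash k 0 (\<lambda>\<tau> z. U (ee \<tau>)) \<gamma> \<tau> z = U (ee \<tau>)" if "\<gamma> \<in> SL2Z" "\<tau> \<in> uhp" for \<gamma> \<tau> and z :: "complex ^ 8"
  proof -
    have "\<forall>\<tau>\<in>uhp. \<forall>z. slash k 0 (\<lambda>\<tau> z. U (ee \<tau>)) \<gamma> \<tau> z = U (ee \<tau>)"
      by (rule slash_invariant_SL2Z) (use U that in \<open>auto simp: mform_def ee_add\<close>)
    with that show ?thesis by blast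
  qed
  show "has_expansion 0 (\<lambda>\<tau> z. U (ee \<tau>)) (\<lambda>n l. if l = 0 then u n else 0)"
  proof (rule has_expansionI)
    fix \<tau> z assume \<tau>: "\<tau> \<in> uhp"
    define F where "F = (\<lambda>(n, l). (if l = 0 then u n else 0) * ee \<tau> ^ n * ee (cdot (cvec l) z))"
    have "((\<lambda>n. F (n, 0)) has_sum U (ee \<tau>)) UNIV"
      using u[OF norm_ee_less_1[OF \<tau>]] by (simp add: F_def)
    then have "(F has_sum U (ee \<tau>)) ((\<lambda>n. (n, 0)) ` UNIV)"
      by (subst has_sum_reindex) (auto simp: inj_on_def o_def)
    then show "(F has_sum U (ee \<tau>)) (UNIV \<times> E8)"
      by (rule has_sum_cong_neutral[THEN iffD1, rotated -1]) (auto simp: F_def)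
  qed (auto split: if_splits)
qed auto

lemma const_plus_lamQ_has_sum:
  fixes q :: complex
  assumes "norm q < 1"
  shows "((\<lambda>n. ((if n = 0 then a else 0) + c * of_nat (sig k n)) * q ^ n) has_sum a + c * lamQ k q) UNIV"
proof -
  have "((\<lambda>n. (if n = 0 then a else 0) * q ^ n) has_sum a) UNIV"
    by (rule has_sum_finite_neutralI[of "{0}"]) auto
  from has_sum_add[OF this has_sum_cmult_right[OF lamQ_has_sum[OF assms, of k], of c]]
  show ?thesis by (simp add: ring_distribs mult.assoc)
qed

lemma E4Q_has_sum: "norm q < 1 \<Longrightarrow> ((\<lambda>n. ((if n = 0 then 1 else 0) + 240 * of_nat (sig 3 n)) * q ^ n) has_sum E4Q q) UNIV"
  unfolding E4Q_def by (rule const_plus_lamQ_has_sum)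

lemma E6Q_has_sum: "norm q < 1 \<Longrightarrow> ((\<lambda>n. ((if n = 0 then 1 else 0) + (- 504) * of_nat (sig 5 n)) * q ^ n) has_sum E6Q q) UNIV"
  using const_plus_lamQ_has_sum[of q 1 "- 504" 5] by (simp add: E6Q_def)

lemma Eis4_jacobi_form: "(\<lambda>\<tau> z. Eis4 \<tau>) \<in> jacobi_forms 4 0"
  by (rule jacobi_forms_cong[OF mform_jacobi_form[OF mform_E4Q E4Q_has_sum]]) (auto simp: EisQ_ee)

lemma Eis6_jacobi_form: "(\<lambda>\<tau> z. Eis6 \<tau>) \<in> jacobi_forms 6 0"
  by (rule jacobi_forms_cong[OF mform_jacobi_form[OF mform_E6Q E6Q_has_sum]]) (auto simp: EisQ_ee)

lemma jacobi_forms_Eis_powers: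
  assumes "\<phi> \<in> jacobi_forms k t"
  shows "(\<lambda>\<tau> z. Eis4 \<tau> ^ i * Eis6 \<tau> ^ j * \<phi> \<tau> z) \<in> jacobi_forms (k + 4 * int i + 6 * int j) t"
proof (induction i)
  case 0
  show ?case
  proof (induction j)
    case 0
    show ?case using assms by simp
  next
    case (Suc j)
    from jacobi_forms_mult[OF Eis6_jacobi_form Suc] show ?case by (simp add: algebra_simps)
  qed
next
  case (Suc i)
  from jacobi_forms_mult[OF Eis4_jacobi_form Suc] show ?case by (simp add: algebra_simps)
qed

section \<open>The graded module of Jacobi forms\<close>

lemma jacobi_forms_zero: "(\<lambda>\<tau> z. 0) \<in> jacobi_forms k t"
proof (rule jacobi_formsI)
  show "has_expansion t (\<lambda>\<tau> z. 0) (\<lambda>n l. 0)"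
    by (rule has_expansionI) (simp_all add: case_prod_unfold)
qed (simp_all add: jholomorphic_cdiff cdiff_const slash_def)

lemma jacobi_forms_graded_incl: "\<phi> \<in> jacobi_forms k t \<Longrightarrow> \<phi> \<in> jacobi_forms_graded t"
  unfolding jacobi_forms_graded_def mem_Collect_eq
  by (intro exI[of _ "{k}"] exI[of _ "\<lambda>_. \<phi>"]) simp

lemma jacobi_forms_graded_add:
  assumes "\<phi> \<in> jacobi_forms_graded t" "\<psi> \<in> jacobi_forms_graded t"
  shows "(\<lambda>\<tau> z. \<phi> \<tau> z + \<psi> \<tau> z) \<in> jacobi_forms_graded t"
proof -
  obtain K \<Phi> where K: "finite K" "\<forall>k\<in>K. \<Phi> k \<in> jacobi_forms k t" "\<forall>\<tau>\<in>uhp. \<forall>z. \<phi> \<tau> z = (\<Sum>k\<in>K. \<Phi> k \<tau> z)"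
    using assms(1) unfolding jacobi_forms_graded_def by blast
  obtain L \<Psi> where L: "finite L" "\<forall>k\<in>L. \<Psi> k \<in> jacobi_forms k t" "\<forall>\<tau>\<in>uhp. \<forall>z. \<psi> \<tau> z = (\<Sum>k\<in>L. \<Psi> k \<tau> z)"
    using assms(2) unfolding jacobi_forms_graded_def by blast
  define \<Phi>' where "\<Phi>' = (\<lambda>k. if k \<in> K then \<Phi> k else (\<lambda>\<tau> z. 0))"
  define \<Psi>' where "\<Psi>' = (\<lambda>k. if k \<in> L then \<Psi> k else (\<lambda>\<tau> z. 0))"
  define X where "X = (\<lambda>k \<tau> z. \<Phi>' k \<tau> z + \<Psi>' k \<tau> z)"
  have "X k \<in> jacobi_forms k t" for k
    unfolding X_def by (rule jacobi_forms_add) (use K L in \<open>auto simp: \<Phi>'_def \<Psi>'_def jacobi_forms_zero\<close>)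
  moreover have "\<phi> \<tau> z + \<psi> \<tau> z = (\<Sum>k\<in>K \<union> L. X k \<tau> z)" if "\<tau> \<in> uhp" for \<tau> z
  proof -
    have "\<phi> \<tau> z = (\<Sum>k\<in>K. \<Phi> k \<tau> z)" "\<psi> \<tau> z = (\<Sum>k\<in>L. \<Psi> k \<tau> z)" using K(3) L(3) that by blast+
    moreover have "(\<Sum>k\<in>K. \<Phi> k \<tau> z) = (\<Sum>k\<in>K \<union> L. \<Phi>' k \<tau> z)"
      using K(1) L(1) by (intro sum.mono_neutral_cong_left) (auto simp: \<Phi>'_def)
    moreover have "(\<Sum>k\<in>L. \<Psi> k \<tau> z) = (\<Sum>k\<in>K \<union> L. \<Psi>' k \<tau> z)"
      using K(1) L(1) by (intro sum.mono_neutral_cong_left) (auto simp: \<Psi>'_def)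
    ultimately show ?thesis by (simp add: X_def sum.distrib)
  qed
  ultimately show ?thesis
    unfolding jacobi_forms_graded_def mem_Collect_eq using K(1) L(1)
    by (intro exI[of _ "K \<union> L"] exI[of _ X]) simp
qed

lemma jacobi_forms_graded_sum:
  assumes "finite A" "\<And>i. i \<in> A \<Longrightarrow> \<phi> i \<in> jacobi_forms_graded t"
  shows "(\<lambda>\<tau> z. \<Sum>i\<in>A. \<phi> i \<tau> z) \<in> jacobi_forms_graded t"
  using assms
proof (induction A rule: finite_induct)
  case empty
  then show ?case using jacobi_forms_graded_incl[OF jacobi_forms_zero[of 0]] by simp
next
  case (insert x F)
  then show ?case using jacobi_forms_graded_add[of "\<phi> x" t "\<lambda>\<tau> z. \<Sum>i\<in>F. \<phi> i \<tau> z"] by simp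
qed

lemma jacobi_forms_graded_cong:
  "\<phi> \<in> jacobi_forms_graded t \<Longrightarrow> (\<And>\<tau> z. \<tau> \<in> uhp \<Longrightarrow> \<psi> \<tau> z = \<phi> \<tau> z) \<Longrightarrow> \<psi> \<in> jacobi_forms_graded t"
  unfolding jacobi_forms_graded_def by auto

lemma mod_ring_mult_graded:
  assumes "m \<in> mod_ring" "\<phi> \<in> jacobi_forms k t"
  shows "(\<lambda>\<tau> z. m \<tau> * \<phi> \<tau> z) \<in> jacobi_forms_graded t"
proof -
  obtain N c where m: "\<And>\<tau>. \<tau> \<in> uhp \<Longrightarrow> m \<tau> = (\<Sum>i\<le>N. \<Sum>j\<le>N. c i j * Eis4 \<tau> ^ i * Eis6 \<tau> ^ j)"
    using assms(1) unfolding mod_ring_def by blast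
  have "(\<lambda>\<tau> z. \<Sum>i\<le>N. \<Sum>j\<le>N. c i j * (Eis4 \<tau> ^ i * Eis6 \<tau> ^ j * \<phi> \<tau> z)) \<in> jacobi_forms_graded t"
    by (intro jacobi_forms_graded_sum jacobi_forms_graded_incl[OF jacobi_forms_cmult[OF jacobi_forms_Eis_powers[OF assms(2)]]]) auto
  then show ?thesis
    by (rule jacobi_forms_graded_cong) (simp add: m sum_distrib_right mult.assoc)
qed

section \<open>Sums over cosets of the Hecke congruence subgroup\<close>

lemma Gamma0_SL2Z: "\<gamma> \<in> Gamma0 t \<Longrightarrow> \<gamma> \<in> SL2Z"
  by (simp add: Gamma0_def)

lemma mat2_Gamma0: "mat2 a b c d \<in> Gamma0 t \<longleftrightarrow> a * d - b * c = 1 \<and> int t dvd c"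
  by (simp add: Gamma0_def mat2_SL2Z)

lemma Gamma0_mult:
  assumes "\<gamma> \<in> Gamma0 t" "\<delta> \<in> Gamma0 t"
  shows "\<gamma> ** \<delta> \<in> Gamma0 t"
proof -
  obtain a b c d where g: "\<gamma> = mat2 a b c d" by (rule mat2_cases)
  obtain a' b' c' d' where d: "\<delta> = mat2 a' b' c' d'" by (rule mat2_cases)
  show ?thesis
    using assms SL2Z_mult[of \<gamma> \<delta>] by (simp add: Gamma0_def g d mat2_mult)
qed

lemma Gamma0_inverse:
  assumes "\<gamma> \<in> Gamma0 t"
  obtains \<delta> where "\<delta> \<in> Gamma0 t" "\<gamma> ** \<delta> = mat 1" "\<delta> ** \<gamma> = mat 1"
proof -
  obtain a b c d where g: "\<gamma> = mat2 a b c d" by (rule mat2_cases)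
  have "a * d - b * c = 1" "int t dvd c" using assms by (auto simp: g mat2_Gamma0)
  then show ?thesis
    by (intro that[of "mat2 d (- b) (- c) a"]) (auto simp: g mat2_Gamma0 mat2_mult mat2_1[symmetric] algebra_simps)
qed

definition coset :: "nat \<Rightarrow> int ^ 2 ^ 2 \<Rightarrow> (int ^ 2 ^ 2) set" where
  "coset t \<gamma> = (\<lambda>g. g ** \<gamma>) ` Gamma0 t"

lemma Gamma0_cosets_eq: "Gamma0_cosets t = coset t ` SL2Z"
  by (simp add: Gamma0_cosets_def coset_def)

lemma one_in_Gamma0: "mat 1 \<in> Gamma0 t"
  unfolding mat2_1[symmetric] by (simp add: mat2_Gamma0)

lemma in_own_coset: "\<gamma> \<in> coset t \<gamma>"
  unfolding coset_def using one_in_Gamma0 by (auto intro: image_eqI[of _ _ "mat 1"])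

lemma coset_eq_iff: "coset t \<gamma> = coset t \<delta> \<longleftrightarrow> \<gamma> \<in> coset t \<delta>"
proof
  assume "\<gamma> \<in> coset t \<delta>"
  then obtain g where g: "g \<in> Gamma0 t" "\<gamma> = g ** \<delta>" by (auto simp: coset_def)
  obtain h where h: "h \<in> Gamma0 t" "h ** g = mat 1" using Gamma0_inverse[OF g(1)] by metis
  have "\<delta> = h ** \<gamma>" using h by (simp add: g(2) matrix_mul_assoc)
  have 1: "coset t (g ** \<delta>) \<subseteq> coset t \<delta>" if "g \<in> Gamma0 t" for g \<delta>
  proof
    fix x assume "x \<in> coset t (g ** \<delta>)"
    then obtain f where f: "f \<in> Gamma0 t" "x = f ** (g ** \<delta>)" unfolding coset_def by (rule imageE)
    show "x \<in> coset t \<delta>"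
      unfolding coset_def f(2) matrix_mul_assoc by (rule imageI[OF Gamma0_mult[OF f(1) that]])
  qed
  show "coset t \<gamma> = coset t \<delta>"
    using 1[OF g(1), of \<delta>] 1[OF h(1), of \<gamma>] unfolding g(2)[symmetric] \<open>\<delta> = h ** \<gamma>\<close>[symmetric] by (rule equalityI)
qed (use in_own_coset in auto)

lemma coset_mult: "(\<lambda>g. g ** \<delta>) ` coset t \<gamma> = coset t (\<gamma> ** \<delta>)"
  by (simp add: coset_def image_image matrix_mul_assoc)

text \<open>The representative is picked as in \<open>B_form\<close>. That the choice is immaterial
  for a \<open>Gamma0 t\<close>-invariant function is \<open>slash_some_coset\<close>.\<close>

definition coset_sum :: "int \<Rightarrow> nat \<Rightarrow> jfun \<Rightarrow> jfun" where
  "coset_sum k t F \<tau> z = (\<Sum>C\<in>Gamma0_cosets t. slash k t F (SOME \<gamma>. \<gamma> \<in> C) \<tau> z)"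

context
  fixes k :: int and t :: nat and F :: jfun
  assumes F: "\<And>\<gamma> \<tau> z. \<gamma> \<in> Gamma0 t \<Longrightarrow> \<tau> \<in> uhp \<Longrightarrow> slash k t F \<gamma> \<tau> z = F \<tau> z"
begin

lemma slash_coset:
  assumes "\<delta> \<in> coset t \<gamma>" "\<gamma> \<in> SL2Z" "\<tau> \<in> uhp"
  shows "slash k t F \<delta> \<tau> z = slash k t F \<gamma> \<tau> z"
proof -
  obtain g where g: "g \<in> Gamma0 t" "\<delta> = g ** \<gamma>" using assms(1) by (auto simp: coset_def)
  have "slash k t F \<delta> \<tau> z = slash k t (slash k t F g) \<gamma> \<tau> z"
    unfolding g(2) using slash_slash[OF Gamma0_SL2Z[OF g(1)] assms(2,3)] by simp
  also have "\<dots> = slash k t F \<gamma> \<tau> z"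
    using F[OF g(1)] by (intro slash_cong[OF assms(2,3)]) auto
  finally show ?thesis .
qed

lemma slash_some_coset:
  assumes "\<gamma> \<in> SL2Z" "\<tau> \<in> uhp"
  shows "slash k t F (SOME \<delta>. \<delta> \<in> coset t \<gamma>) \<tau> z = slash k t F \<gamma> \<tau> z"
proof -
  have "(SOME \<delta>. \<delta> \<in> coset t \<gamma>) \<in> coset t \<gamma>"
    by (rule someI_ex) (use in_own_coset in blast)
  then show ?thesis by (rule slash_coset[OF _ assms])
qed

text \<open>Right multiplication by delta permutes the cosets; the inverse matrix gives the inverse
  permutation.\<close>

lemma coset_sum_slash:
  assumes \<delta>: "\<delta> \<in> SL2Z" and \<tau>: "\<tau> \<in> uhp"
  shows "slash k t (coset_sum k t F) \<delta> \<tau> z = coset_sum k t F \<tau> z"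
proof -
  obtain \<delta>' where \<delta>': "\<delta>' \<in> SL2Z" "\<delta> ** \<delta>' = mat 1" "\<delta>' ** \<delta> = mat 1"
    using SL2Z_inverse[OF \<delta>] unfolding mat2_1 by metis
  define R where "R \<delta> C = (\<lambda>g. g ** \<delta>) ` C" for \<delta> :: "int ^ 2 ^ 2" and C :: "(int ^ 2 ^ 2) set"
  have R: "R \<delta> C \<in> Gamma0_cosets t" if "\<delta> \<in> SL2Z" "C \<in> Gamma0_cosets t" for \<delta> C
    using that by (auto simp: R_def Gamma0_cosets_eq coset_mult intro!: imageI SL2Z_mult)
  have RR: "R \<delta> (R \<delta>' C) = R (\<delta>' ** \<delta>) C" for \<delta> \<delta>' C
    by (simp add: R_def image_image matrix_mul_assoc)
  have R1: "R (mat 1) C = C" for C by (simp add: R_def)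
  have "slash k t (coset_sum k t F) \<delta> \<tau> z =
      (\<Sum>C\<in>Gamma0_cosets t. slash k t (slash k t F (SOME \<gamma>. \<gamma> \<in> C)) \<delta> \<tau> z)"
    unfolding coset_sum_def slash_def[of _ _ _ \<delta>] sum_distrib_left ..
  also have "\<dots> = (\<Sum>C\<in>Gamma0_cosets t. slash k t F (SOME \<gamma>. \<gamma> \<in> R \<delta> C) \<tau> z)"
  proof (rule sum.cong[OF HOL.refl])
    fix C assume "C \<in> Gamma0_cosets t"
    then obtain \<gamma> where \<gamma>: "\<gamma> \<in> SL2Z" "C = coset t \<gamma>" by (auto simp: Gamma0_cosets_eq)
    have "slash k t (slash k t F (SOME \<gamma>. \<gamma> \<in> C)) \<delta> \<tau> z = slash k t (slash k t F \<gamma>) \<delta> \<tau> z"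
      by (rule slash_cong[OF \<delta> \<tau>]) (simp only: \<gamma>(2) slash_some_coset[OF \<gamma>(1)])
    also have "\<dots> = slash k t F (\<gamma> ** \<delta>) \<tau> z" by (rule slash_slash[OF \<gamma>(1) \<delta> \<tau>])
    also have "\<dots> = slash k t F (SOME \<gamma>. \<gamma> \<in> R \<delta> C) \<tau> z"
      unfolding R_def \<gamma>(2) coset_mult by (rule slash_some_coset[OF SL2Z_mult[OF \<gamma>(1) \<delta>] \<tau>, symmetric])
    finally show "slash k t (slash k t F (SOME \<gamma>. \<gamma> \<in> C)) \<delta> \<tau> z = slash k t F (SOME \<gamma>. \<gamma> \<in> R \<delta> C) \<tau> z" .
  qed
  also have "\<dots> = coset_sum k t F \<tau> z"
    unfolding coset_sum_def
    by (rule sum.reindex_bij_witness[of _ "R \<delta>'" "R \<delta>"]) (simp_all add: R RR R1 \<delta> \<delta>')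
  finally show ?thesis .
qed

text \<open>For prime t the cosets correspond to points of the projective line over F_t through the
  bottom row (c : d). The identity represents c = 0, and S T^b represents the points with c
  invertible, where b = d / c.\<close>

lemma coset_sum_prime:
  assumes t: "prime t" and \<tau>: "\<tau> \<in> uhp"
  shows "coset_sum k t F \<tau> z = F \<tau> z + (\<Sum>b<t. slash k t F (mat2 0 (- 1) 1 (int b)) \<tau> z)"
proof -
  define g where "g b = mat2 0 (- 1) 1 (int b)" for b :: nat
  have g: "g b \<in> SL2Z" for b by (simp add: g_def mat2_SL2Z)
  have one: "(mat 1 :: int ^ 2 ^ 2) \<in> SL2Z" using Gamma0_SL2Z[OF one_in_Gamma0] .
  have coset_g: "\<gamma> \<in> coset t (g b)" if "\<gamma> = mat2 p q c d" "p * d - q * c = 1" "int t dvd c * int b - d" for \<gamma> p q c d b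
  proof -
    have "mat2 (p * int b - q) p (c * int b - d) c \<in> Gamma0 t"
      using that by (simp add: mat2_Gamma0 algebra_simps)
    moreover have "\<gamma> = mat2 (p * int b - q) p (c * int b - d) c ** g b"
      by (simp add: that(1) g_def mat2_mult)
    ultimately show ?thesis unfolding coset_def by blast
  qed
  have cosets: "Gamma0_cosets t = insert (coset t (mat 1)) ((\<lambda>b. coset t (g b)) ` {..<t})"
  proof (intro equalityI subsetI)
    fix C assume "C \<in> Gamma0_cosets t"
    then obtain \<gamma> where \<gamma>: "\<gamma> \<in> SL2Z" "C = coset t \<gamma>" by (auto simp: Gamma0_cosets_eq)
    obtain p q c d where m: "\<gamma> = mat2 p q c d" by (rule mat2_cases)
    have det: "p * d - q * c = 1" using \<gamma>(1) by (simp add: m mat2_SL2Z)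
    show "C \<in> insert (coset t (mat 1)) ((\<lambda>b. coset t (g b)) ` {..<t})"
    proof (cases "int t dvd c")
      case True
      then have "\<gamma> \<in> coset t (mat 1)" using det by (simp add: coset_def m mat2_Gamma0)
      then show ?thesis by (simp add: \<gamma>(2) coset_eq_iff)
    next
      case False
      have "prime (int t)" using t by simp
      then have "gcd (int t) c = 1" using False by (simp add: prime_imp_coprime)
      \<comment> \<open>\<open>x\<close> inverts c modulo t, so d x solves c b = d modulo t.\<close>
      then obtain u x where x: "u * int t + x * c = 1" using bezout_int[of "int t" c] by metis
      define b where "b = nat ((d * x) mod int t)"
      have t0: "int t > 0" using prime_gt_0_nat[OF t] by simp
      then have b: "int b = (d * x) mod int t" by (simp add: b_def)
      define y where "y = (d * x) div int t"
      have by': "int b = d * x - int t * y"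
        unfolding b y_def by (simp add: minus_mult_div_eq_mod)
      have "c * int b - d = d * (u * int t + x * c) - d + int t * (- c * y - d * u)"
        unfolding by' by (simp add: algebra_simps)
      then have "int t dvd c * int b - d" unfolding x by simp
      then have "\<gamma> \<in> coset t (g b)" by (rule coset_g[OF m det])
      moreover have "b < t" using t0 b by (metis of_nat_less_iff pos_mod_bound)
      ultimately show ?thesis by (auto simp: \<gamma>(2) coset_eq_iff)
    qed
  qed (use g one in \<open>auto simp: Gamma0_cosets_eq\<close>)
  have c1: "int t dvd c" if "mat2 p q c d \<in> coset t (mat 1)" for p q c d
    using that by (simp add: coset_def mat2_Gamma0)
  have notin: "coset t (mat 1) \<noteq> coset t (g b)" for b
  proof
    assume "coset t (mat 1) = coset t (g b)"
    then have "g b \<in> coset t (mat 1)" using in_own_coset by simp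
    then have "int t dvd 1" unfolding g_def by (rule c1)
    then show False using prime_gt_1_nat[OF t] by simp
  qed
  have inj: "inj_on (\<lambda>b. coset t (g b)) {..<t}"
  proof (rule inj_onI)
    fix b b' assume bb: "b \<in> {..<t}" "b' \<in> {..<t}" and "coset t (g b) = coset t (g b')"
    then have "g b \<in> coset t (g b')" by (simp only: coset_eq_iff)
    then obtain h where h: "h \<in> Gamma0 t" "g b = h ** g b'" by (auto simp: coset_def)
    obtain p q c d where m: "h = mat2 p q c d" by (rule mat2_cases)
    have "int t dvd c" using h(1) by (simp add: m mat2_Gamma0)
    moreover have eqs: "g b $ 2 $ 1 = (h ** g b') $ 2 $ 1" "g b $ 2 $ 2 = (h ** g b') $ 2 $ 2" using h(2) by simp_all
    from eqs have "d = 1" "int b = - c + int b'" by (auto simp: g_def m mat2_mult)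
    ultimately have "int b mod int t = int b' mod int t"
      by (simp add: mod_eq_dvd_iff)
    then show "b = b'" using bb by (simp flip: zmod_int)
  qed
  have "coset_sum k t F \<tau> z = slash k t F (SOME \<gamma>. \<gamma> \<in> coset t (mat 1)) \<tau> z +
      (\<Sum>b<t. slash k t F (SOME \<gamma>. \<gamma> \<in> coset t (g b)) \<tau> z)"
    unfolding coset_sum_def cosets
    by (subst sum.insert) (use notin in \<open>auto simp: sum.reindex[OF inj]\<close>)
  also have "\<dots> = F \<tau> z + (\<Sum>b<t. slash k t F (g b) \<tau> z)"
    using slash_some_coset[OF g \<tau>] slash_some_coset[OF one \<tau>] slash_one[of k t F \<tau> z] by (simp add: mat2_1)
  finally show ?thesis by (simp add: g_def)
qed

end

section \<open>The Eisenstein series of weight 2 and level t\<close>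

lemma Eis2_add_1: "\<tau> \<in> uhp \<Longrightarrow> Eis2 (\<tau> + 1) = Eis2 \<tau>"
  using EisQ_ee(1)[of \<tau>] EisQ_ee(1)[of "\<tau> + 1"] by (simp add: ee_add)

text \<open>By \<open>autfac_cocycle\<close> the anomaly is compatible with products, and among the
  generators only S contributes one.\<close>

lemma Eis2_moeb:
  assumes "\<gamma> \<in> SL2Z"
  shows "\<forall>\<tau>\<in>uhp. Eis2 (moeb \<gamma> \<tau>) =
    autfac \<gamma> \<tau> ^ 2 * Eis2 \<tau> + 6 / (complex_of_real pi * \<i>) * of_int (\<gamma> $ 2 $ 1) * autfac \<gamma> \<tau>"
  using assms
proof (induction rule: SL2Z_induct)
  case (mult \<gamma> \<delta>)
  show ?case
  proof
    fix \<tau> assume \<tau>: "\<tau> \<in> uhp"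
    define j1 j2 c1 c2 c3 K where "j1 = autfac \<gamma> (moeb \<delta> \<tau>)" and "j2 = autfac \<delta> \<tau>"
      and "c1 = complex_of_int (\<gamma> $ 2 $ 1)" and "c2 = complex_of_int (\<delta> $ 2 $ 1)"
      and "c3 = complex_of_int ((\<gamma> ** \<delta>) $ 2 $ 1)" and "K = 6 / (complex_of_real pi * \<i>)"
    have j3: "autfac (\<gamma> ** \<delta>) \<tau> = j1 * j2" using autfac_mult[OF mult(2) \<tau>] by (simp add: j1_def j2_def)
    have coc: "c3 * j2 = c2 * (j1 * j2) + c1"
      using autfac_cocycle[OF mult(2) \<tau>, of \<gamma>] j3 by (simp add: c1_def c2_def c3_def j2_def)
    have "Eis2 (moeb (\<gamma> ** \<delta>) \<tau>) = j1 ^ 2 * Eis2 (moeb \<delta> \<tau>) + K * c1 * j1"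
      using mult(3) moeb_in_uhp[OF mult(2) \<tau>] unfolding moeb_mult[OF mult(1,2) \<tau>] j1_def c1_def K_def by blast
    also have "Eis2 (moeb \<delta> \<tau>) = j2 ^ 2 * Eis2 \<tau> + K * c2 * j2"
      using mult(4) \<tau> unfolding j2_def c2_def K_def by blast
    also have "j1 ^ 2 * (j2 ^ 2 * Eis2 \<tau> + K * c2 * j2) + K * c1 * j1 =
        (j1 * j2) ^ 2 * Eis2 \<tau> + K * j1 * (c2 * (j1 * j2) + c1)"
      by (simp add: algebra_simps power2_eq_square)
    also have "\<dots> = (j1 * j2) ^ 2 * Eis2 \<tau> + K * c3 * (j1 * j2)"
      unfolding coc[symmetric] by (simp add: algebra_simps)
    finally show "Eis2 (moeb (\<gamma> ** \<delta>) \<tau>) = autfac (\<gamma> ** \<delta>) \<tau> ^ 2 * Eis2 \<tau> +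
        6 / (complex_of_real pi * \<i>) * of_int ((\<gamma> ** \<delta>) $ 2 $ 1) * autfac (\<gamma> ** \<delta>) \<tau>"
      unfolding j3 c3_def K_def .
  qed
next
  case S
  show ?case using Eis2_inversion by (simp add: autfac_mat2 moeb_mat2)
next
  case T
  show ?case using Eis2_add_1 by (simp add: autfac_mat2 moeb_mat2)
next
  case Tinv
  show ?case
  proof
    fix \<tau> assume "\<tau> \<in> uhp"
    then have "\<tau> + of_int (- 1) \<in> uhp" by (rule uhp_add_int)
    from Eis2_add_1[OF this]
    show "Eis2 (moeb (mat2 1 (- 1) 0 1) \<tau>) = autfac (mat2 1 (- 1) 0 1) \<tau> ^ 2 * Eis2 \<tau> +
        6 / (complex_of_real pi * \<i>) * of_int (mat2 1 (- 1) 0 1 $ 2 $ 1) * autfac (mat2 1 (- 1) 0 1) \<tau>"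
      by (simp add: autfac_mat2 moeb_mat2)
  qed
qed

text \<open>Conjugation by diag (t, 1): the matrix with rows (a, t b) and (c / t, d).\<close>

lemma Gamma0_conjugate:
  fixes \<gamma> :: "int ^ 2 ^ 2"
  assumes "\<gamma> \<in> Gamma0 t" "t > 0"
  obtains \<delta> :: "int ^ 2 ^ 2" where "\<delta> \<in> SL2Z" "\<And>\<tau>. moeb \<delta> (of_nat t * \<tau>) = of_nat t * moeb \<gamma> \<tau>"
    "\<And>\<tau>. autfac \<delta> (of_nat t * \<tau>) = autfac \<gamma> \<tau>" "of_nat t * of_int (\<delta> $ 2 $ 1) = (of_int (\<gamma> $ 2 $ 1) :: complex)"
proof -
  obtain a b c d where g: "\<gamma> = mat2 a b c d" by (rule mat2_cases)
  have det: "a * d - b * c = 1" and "int t dvd c" using assms by (auto simp: g mat2_Gamma0)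
  then obtain e where c: "c = int t * e" by (auto elim: dvdE)
  show ?thesis
    by (rule that[of "mat2 a (int t * b) e d"])
      (use det in \<open>simp_all add: c g mat2_SL2Z moeb_mat2 autfac_mat2 algebra_simps\<close>)
qed

definition E2Q_raised :: "nat \<Rightarrow> complex \<Rightarrow> complex" where
  "E2Q_raised t q = of_nat t * E2Q (q ^ t) - E2Q q"

lemma E2Q_raised_ee:
  assumes "\<tau> \<in> uhp" "t > 0"
  shows "E2Q_raised t (ee \<tau>) = of_nat t * Eis2 (of_nat t * \<tau>) - Eis2 \<tau>"
  using EisQ_ee(1)[OF assms(1)] EisQ_ee(1)[OF uhp_mult_of_nat[OF assms]] by (simp add: E2Q_raised_def ee_power)

text \<open>The anomalies of the two terms cancel, as t times the lower left entry c / t of the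
  conjugated matrix is c.\<close>

lemma E2Q_raised_Gamma0:
  assumes \<gamma>: "\<gamma> \<in> Gamma0 t" and t: "t > 0" and \<tau>: "\<tau> \<in> uhp"
  shows "E2Q_raised t (ee (moeb \<gamma> \<tau>)) = autfac \<gamma> \<tau> ^ 2 * E2Q_raised t (ee \<tau>)"
proof -
  obtain \<delta> where \<delta>: "\<delta> \<in> SL2Z" "\<And>\<tau>. moeb \<delta> (of_nat t * \<tau>) = of_nat t * moeb \<gamma> \<tau>"
    "\<And>\<tau>. autfac \<delta> (of_nat t * \<tau>) = autfac \<gamma> \<tau>" "of_nat t * of_int (\<delta> $ 2 $ 1) = (of_int (\<gamma> $ 2 $ 1) :: complex)"
    by (rule Gamma0_conjugate[OF \<gamma> t]) (rule that)
  note S = Gamma0_SL2Z[OF \<gamma>]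
  define K j where "K = 6 / (complex_of_real pi * \<i>)" and "j = autfac \<gamma> \<tau>"
  have "Eis2 (of_nat t * moeb \<gamma> \<tau>) = j ^ 2 * Eis2 (of_nat t * \<tau>) + K * of_int (\<delta> $ 2 $ 1) * j"
    using bspec[OF Eis2_moeb[OF \<delta>(1)] uhp_mult_of_nat[OF \<tau> t]] unfolding K_def j_def \<delta>(2,3) .
  then have "of_nat t * Eis2 (of_nat t * moeb \<gamma> \<tau>) = of_nat t * j ^ 2 * Eis2 (of_nat t * \<tau>) + K * (of_nat t * of_int (\<delta> $ 2 $ 1)) * j"
    by (simp add: algebra_simps)
  moreover have "Eis2 (moeb \<gamma> \<tau>) = j ^ 2 * Eis2 \<tau> + K * of_int (\<gamma> $ 2 $ 1) * j"
    using Eis2_moeb[OF S] \<tau> unfolding K_def j_def by simp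
  ultimately show ?thesis
    unfolding E2Q_raised_ee[OF moeb_in_uhp[OF S \<tau>] t] E2Q_raised_ee[OF \<tau> t] \<delta>(4) j_def[symmetric]
    by (simp add: algebra_simps)
qed

text \<open>Up to scaling, inversion exchanges the arguments tau and t tau, so the two terms change
  places with opposite signs. This is the origin of kappa = - 1 / t in
  \<open>B_coeff\<close>.\<close>

lemma E2Q_raised_inversion:
  assumes t: "t > 0" and \<tau>: "\<tau> \<in> uhp"
  shows "E2Q_raised t (ee (- 1 / \<tau>)) = - 1 / of_nat t * \<tau> ^ 2 * E2Q_raised t (ee (\<tau> / of_nat t))"
proof -
  have \<tau>': "\<tau> / of_nat t \<in> uhp" using \<tau> t by (rule uhp_divide_of_nat)
  have "E2Q_raised t (ee (- 1 / \<tau>)) = of_nat t * Eis2 (- 1 / (\<tau> / of_nat t)) - Eis2 (- 1 / \<tau>)"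
    using E2Q_raised_ee[OF inversion_in_uhp[OF \<tau>] t] by simp
  also have "\<dots> = of_nat t * ((\<tau> / of_nat t) ^ 2 * Eis2 (\<tau> / of_nat t) + 6 * (\<tau> / of_nat t) / (complex_of_real pi * \<i>)) -
      (\<tau> ^ 2 * Eis2 \<tau> + 6 * \<tau> / (complex_of_real pi * \<i>))"
    unfolding Eis2_inversion[OF \<tau>] Eis2_inversion[OF \<tau>'] ..
  also have "\<dots> = - 1 / of_nat t * \<tau> ^ 2 * (of_nat t * Eis2 \<tau> - Eis2 (\<tau> / of_nat t))"
    using t by (simp add: field_simps power2_eq_square)
  also have "of_nat t * Eis2 \<tau> - Eis2 (\<tau> / of_nat t) = E2Q_raised t (ee (\<tau> / of_nat t))"
    using E2Q_raised_ee[OF \<tau>' t] t by simp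
  finally show ?thesis .
qed

definition raised :: "nat \<Rightarrow> (complex \<Rightarrow> complex) \<Rightarrow> jfun" where
  "raised t U \<tau> z = U (ee \<tau>) * theta_E8 (of_nat t * \<tau>) (of_nat t *s z)"

definition lowered :: "nat \<Rightarrow> (complex \<Rightarrow> complex) \<Rightarrow> nat \<Rightarrow> jfun" where
  "lowered t U b \<tau> z = U (ee ((\<tau> + of_nat b) / of_nat t)) * theta_E8 ((\<tau> + of_nat b) / of_nat t) z"

text \<open>The coset sum in closed form, covering both families of generators: U = 1 with kappa = 1
  leads to A_t, and U = \<open>E2Q_raised t\<close> with kappa = - 1 / t to B_t.
  \<open>raised\<close> is the summand of the identity coset; \<open>lowered\<close> comes from S
  T^b, and t^(-4) from theta inversion at argument tau / t.\<close>

definition level_sum :: "nat \<Rightarrow> complex \<Rightarrow> (complex \<Rightarrow> complex) \<Rightarrow> jfun" where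
  "level_sum t \<kappa> U \<tau> z = raised t U \<tau> z + \<kappa> / of_nat t ^ 4 * (\<Sum>b<t. lowered t U b \<tau> z)"

lemma raised_Gamma0:
  assumes t: "t > 0" and U: "\<And>\<gamma> \<tau>. \<gamma> \<in> Gamma0 t \<Longrightarrow> \<tau> \<in> uhp \<Longrightarrow> U (ee (moeb \<gamma> \<tau>)) = autfac \<gamma> \<tau> ^ w * U (ee \<tau>)"
    and \<gamma>: "\<gamma> \<in> Gamma0 t" and \<tau>: "\<tau> \<in> uhp"
  shows "slash (4 + int w) t (raised t U) \<gamma> \<tau> z = raised t U \<tau> z"
proof -
  obtain \<delta> where \<delta>: "\<delta> \<in> SL2Z" "\<And>\<tau>. moeb \<delta> (of_nat t * \<tau>) = of_nat t * moeb \<gamma> \<tau>"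
    "\<And>\<tau>. autfac \<delta> (of_nat t * \<tau>) = autfac \<gamma> \<tau>" "of_nat t * of_int (\<delta> $ 2 $ 1) = (of_int (\<gamma> $ 2 $ 1) :: complex)"
    by (rule Gamma0_conjugate[OF \<gamma> t]) (rule that)
  define j where "j = autfac \<gamma> \<tau>"
  have j: "j \<noteq> 0" using autfac_nonzero[OF Gamma0_SL2Z[OF \<gamma>] \<tau>] by (simp add: j_def)
  have "slash 4 1 theta_E8 \<delta> (of_nat t * \<tau>) (of_nat t *s z) = theta_E8 (of_nat t * \<tau>) (of_nat t *s z)"
    using jacobi_formsD(4)[OF theta_E8_jacobi_form \<delta>(1) uhp_mult_of_nat[OF \<tau> t]] .
  moreover have "- (of_nat 1 * (of_int (\<delta> $ 2 $ 1) * cdot (of_nat t *s z) (of_nat t *s z) / j) / 2) =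
      - (of_nat t * (of_int (\<gamma> $ 2 $ 1) * cdot z z / j) / 2)"
    unfolding \<delta>(4)[symmetric] by (simp add: cdot_simps)
  moreover have "inverse j *s (of_nat t *s z) = of_nat t *s (inverse j *s z)"
    by (simp add: vector_smult_assoc mult.commute)
  ultimately have th: "j powi (- 4) * ee (- (of_nat t * (of_int (\<gamma> $ 2 $ 1) * cdot z z / j) / 2)) *
      theta_E8 (of_nat t * moeb \<gamma> \<tau>) (of_nat t *s (inverse j *s z)) = theta_E8 (of_nat t * \<tau>) (of_nat t *s z)"
    unfolding slash_ee \<delta>(2,3) j_def[symmetric] by (simp only:)
  have "slash (4 + int w) t (raised t U) \<gamma> \<tau> z = (j powi (- (4 + int w)) * j ^ w) *
      ee (- (of_nat t * (of_int (\<gamma> $ 2 $ 1) * cdot z z / j) / 2)) *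
      (U (ee \<tau>) * theta_E8 (of_nat t * moeb \<gamma> \<tau>) (of_nat t *s (inverse j *s z)))"
    unfolding slash_ee raised_def j_def[symmetric] U[OF \<gamma> \<tau>] by (simp add: mult_ac)
  also have "j powi (- (4 + int w)) * j ^ w = j powi (- 4)"
    using j by (simp flip: power_int_of_nat power_int_add)
  finally have "slash (4 + int w) t (raised t U) \<gamma> \<tau> z = j powi (- 4) *
      ee (- (of_nat t * (of_int (\<gamma> $ 2 $ 1) * cdot z z / j) / 2)) *
      (U (ee \<tau>) * theta_E8 (of_nat t * moeb \<gamma> \<tau>) (of_nat t *s (inverse j *s z)))" .
  also have "\<dots> = raised t U \<tau> z"
    unfolding raised_def th[symmetric] by (simp only: mult_ac)
  finally show ?thesis .
qed

lemma raised_inversion: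
  assumes t: "t > 0" and U: "\<And>\<tau>. \<tau> \<in> uhp \<Longrightarrow> U (ee (- 1 / \<tau>)) = \<kappa> * \<tau> ^ w * U (ee (\<tau> / of_nat t))"
    and \<tau>: "\<tau> \<in> uhp"
  shows "slash (4 + int w) t (raised t U) (mat2 0 (- 1) 1 (int b)) \<tau> z = \<kappa> / of_nat t ^ 4 * lowered t U b \<tau> z"
proof -
  define s where "s = \<tau> + of_nat b"
  have s: "s \<in> uhp" "s \<noteq> 0" using \<tau> uhp_nonzero by (auto simp: s_def)
  have st: "s / of_nat t \<in> uhp" by (rule uhp_divide_of_nat[OF s(1) t])
  have "theta_E8 (of_nat t * (- 1 / s)) (of_nat t *s (inverse s *s z)) = theta_E8 (- 1 / (s / of_nat t)) ((1 / (s / of_nat t)) *s z)"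
    by (simp add: vector_smult_assoc inverse_eq_divide)
  also have "\<dots> = (s / of_nat t) ^ 4 * ee (cdot z z / (2 * (s / of_nat t))) * theta_E8 (s / of_nat t) z"
    by (rule theta_E8_inversion[OF st])
  finally have th: "theta_E8 (of_nat t * (- 1 / s)) (of_nat t *s (inverse s *s z)) =
      (s / of_nat t) ^ 4 * ee (of_nat t * (cdot z z / s) / 2) * theta_E8 (s / of_nat t) z" by (simp add: mult.commute)
  have "slash (4 + int w) t (raised t U) (mat2 0 (- 1) 1 (int b)) \<tau> z =
      s powi (- (4 + int w)) * ee (- (of_nat t * (cdot z z / s) / 2)) * raised t U (- 1 / s) (inverse s *s z)"
    by (simp add: slash_ee autfac_mat2 moeb_mat2 s_def)
  also have "\<dots> = (s powi (- (4 + int w)) * s ^ w * s ^ 4) * (ee (- (of_nat t * (cdot z z / s) / 2)) * ee (of_nat t * (cdot z z / s) / 2)) *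
      (\<kappa> / of_nat t ^ 4 * U (ee (s / of_nat t)) * theta_E8 (s / of_nat t) z)"
    unfolding raised_def U[OF s(1)] th by (simp add: power_divide)
  also have "s powi (- (4 + int w)) * s ^ w * s ^ 4 = 1"
  proof -
    have "s powi (- (4 + int w)) = inverse (s ^ (4 + w))"
      unfolding power_int_minus by (simp flip: power_int_of_nat)
    then show ?thesis using s(2) by (simp add: power_add field_simps)
  qed
  also have "ee (- (of_nat t * (cdot z z / s) / 2)) * ee (of_nat t * (cdot z z / s) / 2) = 1"
    unfolding ee_add[symmetric] by simp
  finally show ?thesis by (simp add: lowered_def s_def)
qed

section \<open>Fourier expansion and transformation laws of level sums\<close>

lemma reflection_scale: "reflection r (c *s z) = c *s reflection r z"
  by (simp add: reflection_def cdot_simps vector_smult_assoc vector_ssub_ldistrib)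

lemma sum_roots_of_unity:
  assumes t: "t > 0"
  shows "(\<Sum>b<t. ee (of_int n * of_nat b / of_nat t)) = (if int t dvd n then of_nat t else 0)"
proof (cases "int t dvd n")
  case True
  then obtain m where m: "n = int t * m" by (auto elim: dvdE)
  have "ee (of_int n * of_nat b / of_nat t) = 1" for b :: nat
  proof -
    have "of_int n * of_nat b / of_nat t = (of_int (m * int b) :: complex)" using t by (simp add: m)
    then show ?thesis by (simp only: ee_of_int)
  qed
  then show ?thesis using True by simp
next
  case False
  define x where "x = ee (of_int n / of_nat t)"
  have "x \<noteq> 1"
  proof
    assume "x = 1"
    then obtain m where "of_int n / of_nat t = (of_int m :: complex)" unfolding x_def ee_eq_1_iff by (auto elim: Ints_cases)
    then have "complex_of_int n = of_int (m * int t)" using t by (simp add: field_simps)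
    then have "n = m * int t" by (simp only: of_int_eq_iff)
    with False show False by simp
  qed
  moreover have "x ^ t = 1"
  proof -
    have "x ^ t = ee (of_int n)" using t by (simp add: x_def ee_power)
    then show ?thesis by simp
  qed
  moreover have "(\<Sum>b<t. x ^ b) = (x ^ t - 1) / (x - 1)" using \<open>x \<noteq> 1\<close> by (rule geometric_sum)
  moreover have "ee (of_int n * of_nat b / of_nat t) = x ^ b" for b :: nat
    by (simp add: x_def ee_power mult.commute)
  ultimately show ?thesis using False by simp
qed

text \<open>The guard puts 0 where truncated subtraction would give u 0.\<close>

definition shifted :: "(nat \<Rightarrow> complex) \<Rightarrow> nat \<Rightarrow> nat \<Rightarrow> complex" where
  "shifted u n m = (if m \<le> n then u (n - m) else 0)"

text \<open>First summand: \<open>theta_E8\<close> at (t tau, t z) contributes at l = t x with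
  q-exponent t times the half norm of x, which is the half norm of l divided by t. Second summand:
  summing over b keeps the exponents divisible by t and gains a factor t, which turns t^(-4) into
  t^(-3).\<close>

definition level_coeff :: "nat \<Rightarrow> complex \<Rightarrow> (nat \<Rightarrow> complex) \<Rightarrow> nat \<Rightarrow> real ^ 8 \<Rightarrow> complex" where
  "level_coeff t \<kappa> u n l = (if (1 / real t) *\<^sub>R l \<in> E8 then shifted u n (half_norm l div t) else 0) +
     \<kappa> / of_nat t ^ 3 * shifted u (t * n) (half_norm l)"

lemma half_norm_scale:
  assumes "l \<in> E8"
  shows "half_norm (real t *\<^sub>R l) = t ^ 2 * half_norm l"
proof -
  have "real t *\<^sub>R l \<in> E8" using E8_scaleR_nat[OF assms, of t] by simp
  then show ?thesis by (simp add: half_norm_eq_iff half_norm[OF assms] power2_eq_square)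
qed

lemma raised_has_sum:
  assumes t: "t > 0" and u: "\<And>q. norm q < 1 \<Longrightarrow> ((\<lambda>n. u n * q ^ n) has_sum U q) UNIV" and \<tau>: "\<tau> \<in> uhp"
  shows "((\<lambda>(n, l). (if (1 / real t) *\<^sub>R l \<in> E8 then shifted u n (half_norm l div t) else 0) *
    ee \<tau> ^ n * ee (cdot (cvec l) z)) has_sum raised t U \<tau> z) (UNIV \<times> E8)"
proof -
  define D where "D = {(n :: nat, l). (1 / real t) *\<^sub>R l \<in> E8 \<and> half_norm l div t \<le> n}"
  define G where "G = (\<lambda>(n, l). shifted u n (half_norm l div t) * ee \<tau> ^ n * ee (cdot (cvec l) z))"
  define i where "i = (\<lambda>(n, l :: real ^ 8). (n - half_norm l div t, (1 / real t) *\<^sub>R l))"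
  define j where "j = (\<lambda>(n, l :: real ^ 8). (n + t * half_norm l, real t *\<^sub>R l))"
  have mem: "real t *\<^sub>R l \<in> E8" if "l \<in> E8" for l using E8_scaleR_nat[OF that, of t] by simp
  have div: "half_norm (real t *\<^sub>R l) div t = t * half_norm l" if "l \<in> E8" for l
    using t by (simp add: half_norm_scale[OF that] power2_eq_square)
  have DE: "l \<in> E8" if "(n, l) \<in> D" for n l
    using mem[of "(1 / real t) *\<^sub>R l"] that t by (simp add: D_def)
  have "((\<lambda>(n, l). (u n * ee \<tau> ^ n) * (ee (of_nat t * \<tau>) ^ half_norm l * ee (cdot (cvec l) (of_nat t *s z))))
      has_sum raised t U \<tau> z) (UNIV \<times> E8)"
    unfolding raised_def
    by (rule has_sum_mult[OF u[OF norm_ee_less_1[OF \<tau>]] theta_E8_power_has_sum[OF uhp_mult_of_nat[OF \<tau> t]]])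
  also have "?this \<longleftrightarrow> (G has_sum raised t U \<tau> z) D"
  proof (rule has_sum_reindex_bij_witness[of _ i j])
    fix p :: "nat \<times> (real ^ 8)" assume p: "p \<in> UNIV \<times> E8"
    obtain n l where nl: "p = (n, l)" by (cases p)
    have l: "l \<in> E8" using p nl by simp
    show "i (j p) = p" "j p \<in> D"
      using t l by (auto simp: nl div D_def i_def j_def)
    have tpow: "ee (of_nat t * \<tau>) = ee \<tau> ^ t" "ee (\<tau> * of_nat t) = ee \<tau> ^ t" by (simp_all add: ee_power mult.commute)
    have "of_real (real t) *s cvec l = of_nat t *s cvec l" by simp
    then show "G (j p) = (case p of (n, l) \<Rightarrow> (u n * ee \<tau> ^ n) *
        (ee (of_nat t * \<tau>) ^ half_norm l * ee (cdot (cvec l) (of_nat t *s z))))"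
      by (simp add: nl G_def j_def div[OF l] shifted_def cdot_scale_left cdot_scale_right cvec_scaleR power_add power_mult tpow mult_ac)
  next
    fix p assume p: "p \<in> D"
    obtain n l where nl: "p = (n, l)" by (cases p)
    have l: "(1 / real t) *\<^sub>R l \<in> E8" "half_norm l div t \<le> n" using p by (auto simp: nl D_def)
    have "t * half_norm ((1 / real t) *\<^sub>R l) = half_norm l div t"
      using div[OF l(1)] t by simp
    then show "j (i p) = p" "i p \<in> UNIV \<times> E8"
      using t l by (auto simp: nl i_def j_def)
  qed simp_all
  finally show ?thesis
  proof (rule has_sum_cong_neutral[THEN iffD1, rotated -1])
    fix p assume "p \<in> UNIV \<times> E8 - D"
    then show "(case p of (n, l) \<Rightarrow> (if (1 / real t) *\<^sub>R l \<in> E8 then shifted u n (half_norm l div t) else 0) *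
        ee \<tau> ^ n * ee (cdot (cvec l) z)) = 0"
      by (auto simp: D_def shifted_def split: if_splits)
  next
    fix p assume "p \<in> D - UNIV \<times> E8"
    then show "G p = 0" using DE by (cases p) auto
  next
    fix p assume "p \<in> D \<inter> UNIV \<times> E8"
    then show "G p = (case p of (n, l) \<Rightarrow> (if (1 / real t) *\<^sub>R l \<in> E8 then shifted u n (half_norm l div t) else 0) *
        ee \<tau> ^ n * ee (cdot (cvec l) z))"
      by (auto simp: D_def G_def)
  qed
qed

lemma has_sum_finite_sum:
  fixes f :: "'b \<Rightarrow> 'a \<Rightarrow> complex"
  assumes "finite B" "\<And>b. b \<in> B \<Longrightarrow> (f b has_sum s b) A"
  shows "((\<lambda>x. \<Sum>b\<in>B. f b x) has_sum (\<Sum>b\<in>B. s b)) A"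
  using assms by (induction B rule: finite_induct) (auto intro!: has_sum_add)

text \<open>The sum over b of roots of unity is t if t divides n plus the half norm of l, and 0
  otherwise; only integral powers of q remain.\<close>

lemma lowered_has_sum:
  assumes t: "t > 0" and u: "\<And>q. norm q < 1 \<Longrightarrow> ((\<lambda>n. u n * q ^ n) has_sum U q) UNIV" and \<tau>: "\<tau> \<in> uhp"
  shows "((\<lambda>(n, l). of_nat t * shifted u (t * n) (half_norm l) * ee \<tau> ^ n * ee (cdot (cvec l) z))
    has_sum (\<Sum>b<t. lowered t U b \<tau> z)) (UNIV \<times> E8)"
proof -
  define s where "s b = (\<tau> + of_nat b) / of_nat t" for b :: nat
  have s: "s b \<in> uhp" for b unfolding s_def by (intro uhp_divide_of_nat uhp_add_int \<tau> t)
  define D where "D = {(n, l). l \<in> E8 \<and> t dvd n + half_norm l}"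
  define D' where "D' = {(n, l). l \<in> E8 \<and> half_norm l \<le> t * n}"
  define F where "F b = (\<lambda>(n, l). (u n * ee (s b) ^ n) * (ee (s b) ^ half_norm l * ee (cdot (cvec l) z)))" for b
  define G where "G = (\<lambda>(n, l). of_nat t * u n * ee \<tau> ^ ((n + half_norm l) div t) * ee (cdot (cvec l) z))"
  define H where "H = (\<lambda>(n, l). of_nat t * shifted u (t * n) (half_norm l) * ee \<tau> ^ n * ee (cdot (cvec l) z))"
  have "(F b has_sum lowered t U b \<tau> z) (UNIV \<times> E8)" for b
    unfolding lowered_def s_def[symmetric] F_def
    by (rule has_sum_mult[OF u[OF norm_ee_less_1[OF s]] theta_E8_power_has_sum[OF s]])
  then have "((\<lambda>p. \<Sum>b<t. F b p) has_sum (\<Sum>b<t. lowered t U b \<tau> z)) (UNIV \<times> E8)"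
    by (intro has_sum_finite_sum) auto
  then have "(G has_sum (\<Sum>b<t. lowered t U b \<tau> z)) D"
  proof (rule has_sum_cong_neutral[THEN iffD1, rotated -1])
    have F: "(\<Sum>b<t. F b (n, l)) = u n * ee (of_nat (n + half_norm l) * \<tau> / of_nat t) *
        (if t dvd n + half_norm l then of_nat t else 0) * ee (cdot (cvec l) z)" for n l
    proof -
      have "F b (n, l) = u n * ee (of_nat (n + half_norm l) * \<tau> / of_nat t) * ee (cdot (cvec l) z) *
          ee (of_nat (n + half_norm l) * of_nat b / of_nat t)" for b
      proof -
        have "of_nat n * s b + of_nat (half_norm l) * s b =
            of_nat (n + half_norm l) * \<tau> / of_nat t + of_nat (n + half_norm l) * of_nat b / of_nat t"
          using t by (simp add: s_def field_simps)
        then have "ee (s b) ^ n * ee (s b) ^ half_norm l =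
            ee (of_nat (n + half_norm l) * \<tau> / of_nat t) * ee (of_nat (n + half_norm l) * of_nat b / of_nat t)"
          by (simp only: ee_power ee_add[symmetric])
        then show ?thesis by (simp add: F_def mult_ac)
      qed
      then show ?thesis
        using sum_roots_of_unity[OF t, of "int (n + half_norm l)"]
        by (simp only: sum_distrib_left[symmetric] of_int_of_nat_eq of_nat_dvd_iff) (simp only: mult_ac)
    qed
    show "(\<Sum>b<t. F b p) = G p" if "p \<in> UNIV \<times> E8 \<inter> D" for p
    proof -
      obtain n l where p: "p = (n, l)" by (cases p)
      then have "t dvd n + half_norm l" using that by (simp add: D_def)
      then obtain m where m: "n + half_norm l = t * m" by (rule dvdE)
      have "of_nat (t * m) * \<tau> / of_nat t = of_nat m * \<tau>" using t by simp
      then show ?thesis using t unfolding p F m by (simp add: G_def m ee_power)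
    qed
    show "(\<Sum>b<t. F b p) = 0" if "p \<in> UNIV \<times> E8 - D" for p
      using that by (cases p) (auto simp: F D_def)
  qed (auto simp: D_def)
  also have "?this \<longleftrightarrow> (H has_sum (\<Sum>b<t. lowered t U b \<tau> z)) D'"
    by (rule has_sum_reindex_bij_witness[of _ "\<lambda>(n, l). (t * n - half_norm l, l)" "\<lambda>(n, l). ((n + half_norm l) div t, l)"])
      ((use t in \<open>auto simp: D_def D'_def G_def H_def shifted_def elim!: dvdE\<close>), metis add_diff_cancel_right')
  finally have "(H has_sum (\<Sum>b<t. lowered t U b \<tau> z)) (UNIV \<times> E8)"
    by (rule has_sum_cong_neutral[THEN iffD1, rotated -1]) (auto simp: D'_def H_def shifted_def split: if_splits)
  then show ?thesis by (simp only: H_def)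
qed

lemma level_sum_expansion:
  assumes t: "t > 0" and u: "\<And>q. norm q < 1 \<Longrightarrow> ((\<lambda>n. u n * q ^ n) has_sum U q) UNIV"
  shows "has_expansion t (level_sum t \<kappa> U) (level_coeff t \<kappa> u)"
proof (rule has_expansionI)
  fix n l assume l: "l \<in> E8" and nz: "level_coeff t \<kappa> u n l \<noteq> 0"
  have "half_norm l \<le> t * n"
  proof (rule ccontr)
    assume less: "\<not> half_norm l \<le> t * n"
    have "\<not> half_norm l div t \<le> n" if "(1 / real t) *\<^sub>R l \<in> E8"
    proof -
      have "half_norm l = t ^ 2 * half_norm ((1 / real t) *\<^sub>R l)"
        using half_norm_scale[OF that, of t] t by simp
      then have "half_norm l = t * (half_norm l div t)" using t by (simp add: power2_eq_square)
      with less show ?thesis using t by (metis mult_le_cancel1)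
    qed
    with less nz show False by (cases "(1 / real t) *\<^sub>R l \<in> E8") (auto simp: level_coeff_def shifted_def)
  qed
  then have "2 * real (half_norm l) \<le> 2 * (real t * real n)" by (simp flip: of_nat_mult)
  then show "l \<bullet> l \<le> 2 * real n * real t" using half_norm[OF l] by (simp add: mult_ac)
next
  fix \<tau> z assume \<tau>: "\<tau> \<in> uhp"
  have "\<kappa> / of_nat t ^ 4 * (of_nat t * a) = \<kappa> / of_nat t ^ 3 * a" for a
    using t by (simp add: power_eq_if)
  then show "((\<lambda>(n, l). level_coeff t \<kappa> u n l * ee \<tau> ^ n * ee (cdot (cvec l) z)) has_sum level_sum t \<kappa> U \<tau> z) (UNIV \<times> E8)"
    using has_sum_add[OF raised_has_sum[OF assms \<tau>, of z] has_sum_cmult_right[OF lowered_has_sum[OF assms \<tau>, of z], of "\<kappa> / of_nat t ^ 4"]]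
    by (simp add: case_prod_unfold level_coeff_def level_sum_def ring_distribs mult.assoc)
qed

lemma level_sum_jholomorphic:
  assumes t: "t > 0" and U: "U holomorphic_on ball 0 1"
  shows "jholomorphic (level_sum t \<kappa> U)"
  unfolding jholomorphic_cdiff
proof (intro ballI allI)
  fix \<tau> z assume \<tau>: "\<tau> \<in> uhp"
  have U': "cdiff (\<lambda>\<tau> z. U (ee (a * \<tau> + b))) \<tau> z" if ab: "a * \<tau> + b \<in> uhp" for a b and z :: "complex ^ 8"
  proof -
    have "U field_differentiable at (ee (a * \<tau> + b))"
      using U ab by (intro holomorphic_on_imp_differentiable_at[of U "ball 0 1"]) (auto simp: norm_ee_less_1)
    then obtain D where D: "(U has_field_derivative D) (at (ee (a * \<tau> + b)))" by (auto simp: field_differentiable_def)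
    have "((\<lambda>\<tau>. a * \<tau> + b) has_field_derivative a) (at \<tau>)" by (auto intro!: derivative_eq_intros)
    from cdiff_fst[OF DERIV_chain2[OF D ee_has_field_derivative[OF this]]] show ?thesis .
  qed
  have th: "cdiff (\<lambda>\<tau> z. theta_E8 (a * \<tau> + b) (c *s z)) \<tau> z" if "a * \<tau> + b \<in> uhp" for a b c z
    by (rule cdiff_subst) (use theta_E8_jholomorphic that in \<open>simp add: jholomorphic_cdiff\<close>)
  have R: "cdiff (raised t U) \<tau> z"
    using cdiff_mult[OF U'[of "of_nat t" 0 z] th[of "of_nat t" 0 "of_nat t" z]] cdiff_mult[OF U'[of 1 0 z] th[of "of_nat t" 0 "of_nat t" z]]
      uhp_mult_of_nat[OF \<tau> t] \<tau> by (simp add: raised_def[abs_def])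
  have L: "cdiff (lowered t U b) \<tau> z" for b
  proof -
    have eq: "1 / of_nat t * \<tau> + of_nat b / of_nat t = (\<tau> + of_nat b) / of_nat t" for \<tau> :: complex
      by (simp add: add_divide_distrib)
    have "(\<tau> + of_nat b) / of_nat t \<in> uhp" by (intro uhp_divide_of_nat uhp_add_int \<tau> t)
    then have "1 / of_nat t * \<tau> + of_nat b / of_nat t \<in> uhp" unfolding eq .
    from cdiff_mult[OF U'[OF this, of z] th[OF this, of 1 z]] show ?thesis
      unfolding lowered_def[abs_def] eq by simp
  qed
  show "cdiff (level_sum t \<kappa> U) \<tau> z"
    unfolding level_sum_def[abs_def]
    by (intro cdiff_add cdiff_mult cdiff_const cdiff_sum R L) auto
qed

lemma level_sum_reflection:
  assumes "r \<in> E8" "r \<bullet> r = 2"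
  shows "level_sum t \<kappa> U \<tau> (reflection r z) = level_sum t \<kappa> U \<tau> z"
  by (simp add: level_sum_def raised_def lowered_def theta_E8_reflection[OF assms] flip: reflection_scale)

lemma level_sum_quasi_period:
  assumes t: "t > 0" and x: "x \<in> E8" and y: "y \<in> E8" and \<tau>: "\<tau> \<in> uhp"
  shows "level_sum t \<kappa> U \<tau> (z + \<tau> *s cvec x + cvec y) =
    ee (- (of_nat t * (of_real (x \<bullet> x) * \<tau> / 2 + cdot (cvec x) z))) * level_sum t \<kappa> U \<tau> z"
proof -
  define e where "e = ee (- (of_nat t * (of_real (x \<bullet> x) * \<tau> / 2 + cdot (cvec x) z)))"
  have e: "ee (- (of_real (x \<bullet> x) * (of_nat t * \<tau>) / 2 + cdot (cvec x) (of_nat t *s z))) = e"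
    unfolding e_def cdot_scale_right by (rule arg_cong[of _ _ ee]) (simp add: algebra_simps)
  have tx: "real t *\<^sub>R v \<in> E8" if "v \<in> E8" for v using E8_scaleR_nat[OF that, of t] by simp
  have cv: "cvec (real t *\<^sub>R v) = of_nat t *s cvec v" for v by (simp add: cvec_scaleR)
  have sh: "of_nat t *s (z + \<tau> *s cvec x + cvec y) = of_nat t *s z + (of_nat t * \<tau>) *s cvec x + cvec (real t *\<^sub>R y)"
    by (simp add: cv vector_add_ldistrib vector_smult_assoc)
  have th: "theta_E8 (of_nat t * \<tau>) (of_nat t *s (z + \<tau> *s cvec x + cvec y)) = e * theta_E8 (of_nat t * \<tau>) (of_nat t *s z)"
    unfolding sh e[symmetric] by (rule theta_E8_quasi_period[OF uhp_mult_of_nat[OF \<tau> t] x tx[OF y]])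
  have R: "raised t U \<tau> (z + \<tau> *s cvec x + cvec y) = e * raised t U \<tau> z"
    unfolding raised_def th by (simp only: mult_ac)
  have L: "lowered t U b \<tau> (z + \<tau> *s cvec x + cvec y) = e * lowered t U b \<tau> z" for b
  proof -
    define s where "s = (\<tau> + of_nat b) / of_nat t"
    have s: "s \<in> uhp" unfolding s_def by (intro uhp_divide_of_nat uhp_add_int \<tau> t)
    have \<tau>s: "\<tau> = of_nat t * s - of_nat b" using t by (simp add: s_def)
    \<comment> \<open>Since tau = t s - b, the shift by tau x is the shift by s (t x) together with
      - b x, which is absorbed into y.\<close>
    define y' where "y' = y - real b *\<^sub>R x"
    have y': "y' \<in> E8" using E8_diff[OF y E8_scaleR_nat[OF x, of b]] by (simp add: y'_def)
    have "z + \<tau> *s cvec x + cvec y = z + s *s cvec (real t *\<^sub>R x) + cvec y'"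
      by (simp add: \<tau>s y'_def cv cvec_diff cvec_scaleR vector_smult_assoc vector_sub_rdistrib mult.commute)
    moreover have "ee (- (of_real ((real t *\<^sub>R x) \<bullet> (real t *\<^sub>R x)) * s / 2 + cdot (cvec (real t *\<^sub>R x)) z)) = e"
    proof -
      have xx: "complex_of_real (x \<bullet> x) = 2 * of_nat (half_norm x)" by (simp add: half_norm[OF x])
      \<comment> \<open>The two exponents differ by t b (x, x) / 2, an integer because the lattice
        is even.\<close>
      have "- (of_real ((real t *\<^sub>R x) \<bullet> (real t *\<^sub>R x)) * s / 2 + cdot (cvec (real t *\<^sub>R x)) z) =
          - (of_nat t * (of_real (x \<bullet> x) * \<tau> / 2 + cdot (cvec x) z)) - of_nat (t * b * half_norm x)"
        unfolding \<tau>s inner_scaleR_left inner_scaleR_right of_real_mult xx cv cdot_scale_left by (simp add: field_simps)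
      then show ?thesis unfolding e_def by (simp only: ee_diff ee_of_nat div_by_1)
    qed
    ultimately show ?thesis
      unfolding lowered_def s_def[symmetric] by (simp only: theta_E8_quasi_period[OF s tx[OF x] y'] mult_ac)
  qed
  show ?thesis unfolding level_sum_def R L e_def[symmetric] sum_distrib_left[symmetric] by (simp add: algebra_simps)
qed

lemma level_sum_eq_coset_sum:
  assumes t: "prime t"
    and G: "\<And>\<gamma> \<tau>. \<gamma> \<in> Gamma0 t \<Longrightarrow> \<tau> \<in> uhp \<Longrightarrow> U (ee (moeb \<gamma> \<tau>)) = autfac \<gamma> \<tau> ^ w * U (ee \<tau>)"
    and S: "\<And>\<tau>. \<tau> \<in> uhp \<Longrightarrow> U (ee (- 1 / \<tau>)) = \<kappa> * \<tau> ^ w * U (ee (\<tau> / of_nat t))"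
    and \<tau>: "\<tau> \<in> uhp"
  shows "coset_sum (4 + int w) t (raised t U) \<tau> z = level_sum t \<kappa> U \<tau> z"
proof -
  note t0 = prime_gt_0_nat[OF t]
  have 1: "coset_sum (4 + int w) t (raised t U) \<tau> z =
      raised t U \<tau> z + (\<Sum>b<t. slash (4 + int w) t (raised t U) (mat2 0 (- 1) 1 (int b)) \<tau> z)"
    by (rule coset_sum_prime[OF raised_Gamma0[OF t0 G] t \<tau>])
  have 2: "slash (4 + int w) t (raised t U) (mat2 0 (- 1) 1 (int b)) \<tau> z = \<kappa> / of_nat t ^ 4 * lowered t U b \<tau> z" for b
    by (rule raised_inversion[OF t0 S \<tau>])
  show ?thesis unfolding 1 2 level_sum_def sum_distrib_left ..
qed

text \<open>Modularity is taken from the coset sum, holomorphy and the Fourier expansion from the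
  closed form.\<close>

lemma level_sum_jacobi_form:
  assumes t: "prime t" and U: "U holomorphic_on ball 0 1"
    and u: "\<And>q. norm q < 1 \<Longrightarrow> ((\<lambda>n. u n * q ^ n) has_sum U q) UNIV"
    and G: "\<And>\<gamma> \<tau>. \<gamma> \<in> Gamma0 t \<Longrightarrow> \<tau> \<in> uhp \<Longrightarrow> U (ee (moeb \<gamma> \<tau>)) = autfac \<gamma> \<tau> ^ w * U (ee \<tau>)"
    and S: "\<And>\<tau>. \<tau> \<in> uhp \<Longrightarrow> U (ee (- 1 / \<tau>)) = \<kappa> * \<tau> ^ w * U (ee (\<tau> / of_nat t))"
  shows "level_sum t \<kappa> U \<in> jacobi_forms (4 + int w) t"
proof (rule jacobi_formsI[OF _ _ _ _ level_sum_expansion[OF _ u]])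
  note t0 = prime_gt_0_nat[OF t]
  show "jholomorphic (level_sum t \<kappa> U)" by (rule level_sum_jholomorphic[OF t0 U])
  show "slash (4 + int w) t (level_sum t \<kappa> U) \<gamma> \<tau> z = level_sum t \<kappa> U \<tau> z" if "\<gamma> \<in> SL2Z" "\<tau> \<in> uhp" for \<gamma> \<tau> z
  proof -
    have "slash (4 + int w) t (level_sum t \<kappa> U) \<gamma> \<tau> z = slash (4 + int w) t (coset_sum (4 + int w) t (raised t U)) \<gamma> \<tau> z"
      by (rule slash_cong[OF that level_sum_eq_coset_sum[OF t G S, symmetric]])
    also have "\<dots> = coset_sum (4 + int w) t (raised t U) \<tau> z"
      by (rule coset_sum_slash[OF raised_Gamma0[OF t0 G] that])
    also have "\<dots> = level_sum t \<kappa> U \<tau> z" by (rule level_sum_eq_coset_sum[OF t G S that(2)])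
    finally show ?thesis .
  qed
qed (use prime_gt_0_nat[OF t] level_sum_reflection level_sum_quasi_period in \<open>simp_all add: reflection_def\<close>)

section \<open>Restriction to z = 0 and the forms A_t, B_t\<close>

lemma jacobi_form_at_0:
  assumes \<phi>: "\<phi> \<in> jacobi_forms k t" and f: "has_expansion t \<phi> f"
  obtains G where "mform k G" "\<And>\<tau>. \<tau> \<in> uhp \<Longrightarrow> \<phi> \<tau> 0 = G (ee \<tau>)" "G 0 = f 0 0"
proof -
  define g where "g n = (\<Sum>\<^sub>\<infinity>l\<in>E8. f n l)" for n
  have g: "((\<lambda>n. g n * ee \<tau> ^ n) has_sum \<phi> \<tau> 0) UNIV" if \<tau>: "\<tau> \<in> uhp" for \<tau>
  proof (rule has_sum_SigmaD)
    show sum: "((\<lambda>(n, l). f n l * ee \<tau> ^ n) has_sum \<phi> \<tau> 0) (UNIV \<times> E8)"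
      using has_expansionD(2)[OF f \<tau>, of 0] by simp
    show "((\<lambda>l. case (n, l) of (n, l) \<Rightarrow> f n l * ee \<tau> ^ n) has_sum g n * ee \<tau> ^ n) E8" for n
    proof -
      have "finite {l \<in> E8. f n l \<noteq> 0}"
        by (rule finite_subset[OF _ finite_E8_norm_le[of "2 * real n * real t"]]) (use has_expansionD(1)[OF f] in auto)
      then have "(f n has_sum (\<Sum>l | l \<in> E8 \<and> f n l \<noteq> 0. f n l)) E8"
        by (intro has_sum_finite_neutralI) auto
      then have "(f n has_sum g n) E8" unfolding g_def by (intro has_sum_infsum has_sum_imp_summable)
      then show ?thesis unfolding prod.case by (rule has_sum_cmult_left)
    qed
  qed
  define G where "G = (\<lambda>q. \<Sum>n. g n * q ^ n)"
  have summable: "summable (\<lambda>n. g n * q ^ n)" if q: "norm q < 1" for q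
  proof (cases "q = 0")
    case False
    obtain \<tau> where "\<tau> \<in> uhp" "ee \<tau> = q" by (rule ee_surj_uhp[OF False q])
    then show ?thesis using has_sum_imp_sums[OF g] by (auto simp: sums_iff)
  qed simp
  have G: "\<phi> \<tau> 0 = G (ee \<tau>)" if "\<tau> \<in> uhp" for \<tau>
    unfolding G_def using has_sum_imp_sums[OF g[OF that]] by (simp add: sums_iff)
  have "mform k G"
    unfolding mform_def
  proof (intro conjI ballI)
    show "G holomorphic_on ball 0 1" unfolding G_def by (rule holomorphic_on_power_series[OF summable])
    show "G (ee (- 1 / \<tau>)) = \<tau> powi k * G (ee \<tau>)" if "\<tau> \<in> uhp" for \<tau>
      using jacobi_forms_S[OF \<phi> that, of 0] by (simp add: G[OF that] G[OF inversion_in_uhp[OF that]] del: divide_minus_left)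
  qed
  moreover have "G 0 = f 0 0"
  proof -
    have "G 0 = g 0" by (simp add: G_def)
    \<comment> \<open>At n = 0 the support condition leaves only l = 0.\<close>
    also have "g 0 = (\<Sum>\<^sub>\<infinity>l\<in>{0}. f 0 l)"
      unfolding g_def using has_expansionD(1)[OF f, of _ 0] by (intro infsum_cong_neutral) (auto, metis inner_gt_zero_iff not_less)
    finally show ?thesis by simp
  qed
  ultimately show ?thesis using G that by blast
qed

text \<open>In weight k < 12 the restriction of phi to z = 0 is \<open>f 0 0\<close> times E, so the
  normalising constant exists; it is unique because E does not vanish identically. The factor c
  cancels, so psi may be given up to a scalar.\<close>

lemma normalize_at_0_eq:
  assumes \<phi>: "\<phi> \<in> jacobi_forms k t" and f: "has_expansion t \<phi> f" and f0: "f 0 0 \<noteq> 0"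
    and E: "mform k E" "E 0 = 1" and k: "k < 12"
    and e: "\<And>\<tau>. \<tau> \<in> uhp \<Longrightarrow> e \<tau> = E (ee \<tau>)"
    and \<psi>: "\<And>\<tau> z. \<tau> \<in> uhp \<Longrightarrow> \<psi> \<tau> z = c * \<phi> \<tau> z" and c: "c \<noteq> 0" and \<tau>: "\<tau> \<in> uhp"
  shows "normalize_at_0 e \<psi> \<tau> z = 1 / f 0 0 * \<phi> \<tau> z"
proof -
  obtain G where G: "mform k G" "\<And>\<tau>. \<tau> \<in> uhp \<Longrightarrow> \<phi> \<tau> 0 = G (ee \<tau>)" "G 0 = f 0 0"
    by (rule jacobi_form_at_0[OF \<phi> f]) (rule that)
  have \<psi>0: "\<psi> \<tau> 0 = c * f 0 0 * E (ee \<tau>)" if "\<tau> \<in> uhp" for \<tau>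
    using mform_one_dim[OF G(1) E k norm_ee_less_1[OF that]] by (simp add: \<psi>[OF that] G that)
  obtain \<sigma> where \<sigma>: "\<sigma> \<in> uhp" "E (ee \<sigma>) \<noteq> 0"
    using holomorphic_zero_at_0[OF mform_holomorphic[OF E(1)]] E(2) ee_surj_uhp by (metis zero_neq_one)
  have "(THE b. \<forall>\<tau>\<in>uhp. b * \<psi> \<tau> 0 = e \<tau>) = 1 / (c * f 0 0)"
  proof (rule the_equality)
    show "\<forall>\<tau>\<in>uhp. 1 / (c * f 0 0) * \<psi> \<tau> 0 = e \<tau>" using c f0 by (simp add: \<psi>0 e)
    fix b assume "\<forall>\<tau>\<in>uhp. b * \<psi> \<tau> 0 = e \<tau>"
    then have "b * (c * f 0 0 * E (ee \<sigma>)) = E (ee \<sigma>)" using \<sigma>(1) \<psi>0 e by metis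
    then show "b = 1 / (c * f 0 0)" using \<sigma>(2) c f0 by (simp add: field_simps)
  qed
  then show ?thesis unfolding normalize_at_0_def using c by (simp add: \<psi>[OF \<tau>])
qed

text \<open>For prime t the pairs (a, d) are (t, 1) and (1, t); they contribute t^4 / t times the
  raised part and 1 / t times the lowered parts.\<close>

lemma hecke_minus_prime:
  assumes t: "prime t"
  shows "hecke_minus 4 t theta_E8 \<tau> z = of_nat t ^ 3 * level_sum t 1 (\<lambda>_. 1) \<tau> z"
proof -
  have t0: "t > 1" using prime_gt_1_nat[OF t] .
  have "{(a, d). a * d = t \<and> a > 0 \<and> d > 0} = {(t, 1), (1, t)}"
    using t t0 by (auto dest!: prime_product)
  then show ?thesis
    using t0 by (simp add: hecke_minus_def level_sum_def raised_def lowered_def power_int_def case_prod_unfold field_simps power_eq_if)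
qed

definition A_coeff :: "nat \<Rightarrow> nat \<Rightarrow> real ^ 8 \<Rightarrow> complex" where
  "A_coeff t n l = 1 / (1 + 1 / of_nat t ^ 3) * level_coeff t 1 (\<lambda>n. if n = 0 then 1 else 0) n l"

lemma level_coeff_0: "level_coeff t \<kappa> u 0 0 = (1 + \<kappa> / of_nat t ^ 3) * u 0"
  by (simp add: level_coeff_def shifted_def half_norm_def ring_distribs)

lemma
  assumes t: "prime t"
  shows A_form_jacobi_form: "A_form t \<in> jacobi_forms 4 t"
    and A_form_expansion: "has_expansion t (A_form t) (A_coeff t)"
proof -
  note t0 = prime_gt_0_nat[OF t]
  define X where "X = level_sum t 1 (\<lambda>_. 1)"
  define f where "f = level_coeff t 1 (\<lambda>n. if n = 0 then 1 else 0)"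
  have u: "((\<lambda>n. (if n = 0 then 1 else 0) * q ^ n) has_sum 1) UNIV" for q :: complex
    by (rule has_sum_finite_neutralI[of "{0}"]) auto
  have X: "X \<in> jacobi_forms 4 t"
    using level_sum_jacobi_form[OF t, of "\<lambda>_. 1" "\<lambda>n. if n = 0 then 1 else 0" 0 1, OF _ u] by (simp add: X_def)
  have f: "has_expansion t X f" unfolding X_def f_def by (rule level_sum_expansion[OF t0 u])
  have f0: "f 0 0 = 1 + 1 / of_nat t ^ 3" by (simp add: f_def level_coeff_0)
  have "complex_of_real (1 + 1 / of_nat t ^ 3) \<noteq> 0"
    using t0 unfolding of_real_eq_0_iff by (intro less_imp_neq[symmetric] add_pos_pos) auto
  then have f0': "f 0 0 \<noteq> 0" by (simp add: f0)
  have A: "A_form t \<tau> z = 1 / f 0 0 * X \<tau> z" if "\<tau> \<in> uhp" for \<tau> z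
    unfolding A_form_def
    by (rule normalize_at_0_eq[OF X f f0' mform_E4Q EisQ_0(2) _ _ _ _ that, where c = "of_nat t ^ 3"])
      (use t0 in \<open>simp_all add: EisQ_ee hecke_minus_prime[OF t] X_def\<close>)
  show "A_form t \<in> jacobi_forms 4 t"
    by (rule jacobi_forms_cong[OF jacobi_forms_cmult[OF X] A])
  show "has_expansion t (A_form t) (A_coeff t)"
    using has_expansion_cmult[OF f, of "1 / f 0 0"] A unfolding has_expansion_def A_coeff_def f0 f_def[symmetric] by simp
qed

definition E2_raised_coeff :: "nat \<Rightarrow> nat \<Rightarrow> complex" where
  "E2_raised_coeff t n = (if n = 0 then of_nat t - 1 else 0) +
     24 * (of_nat (sig 1 n) - of_nat t * (if t dvd n then of_nat (sig 1 (n div t)) else 0))"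

lemma E2Q_raised_has_sum:
  assumes t: "t > 0" and q: "norm q < 1"
  shows "((\<lambda>n. E2_raised_coeff t n * q ^ n) has_sum E2Q_raised t q) UNIV"
proof -
  have qt: "norm (q ^ t) < 1" using q t by (simp add: norm_power power_less_one_iff)
  define F where "F n = (if t dvd n then of_nat (sig 1 (n div t)) else 0) * q ^ n" for n
  have "((\<lambda>n. F (t * n)) has_sum lamQ 1 (q ^ t)) UNIV"
    using lamQ_has_sum[OF qt, of 1] t by (simp add: F_def power_mult)
  then have "(F has_sum lamQ 1 (q ^ t)) (range (\<lambda>n. t * n))"
    by (subst has_sum_reindex) (use t in \<open>auto simp: inj_on_def o_def\<close>)
  then have "(F has_sum lamQ 1 (q ^ t)) UNIV"
    by (rule has_sum_cong_neutral[THEN iffD1, rotated -1]) (auto simp: F_def elim!: dvdE)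
  from has_sum_add[OF const_plus_lamQ_has_sum[OF q, of "of_nat t - 1" 24 1] has_sum_cmult_right[OF this, of "- 24 * of_nat t"]]
  have "((\<lambda>n. E2_raised_coeff t n * q ^ n) has_sum of_nat t - 1 + 24 * lamQ 1 q + - 24 * of_nat t * lamQ 1 (q ^ t)) UNIV"
    by (rule has_sum_cong[THEN iffD1, rotated]) (simp add: E2_raised_coeff_def F_def algebra_simps)
  then show ?thesis by (simp add: E2Q_raised_def E2Q_def algebra_simps)
qed

text \<open>The denominator is the constant term: 1 + kappa / t^3 with kappa = - 1 / t, times the
  value t - 1 of \<open>E2Q_raised t\<close> at the cusp.\<close>

definition B_coeff :: "nat \<Rightarrow> nat \<Rightarrow> real ^ 8 \<Rightarrow> complex" where
  "B_coeff t n l = 1 / ((1 - 1 / of_nat t ^ 4) * (of_nat t - 1)) * level_coeff t (- 1 / of_nat t) (E2_raised_coeff t) n l"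

lemma
  assumes t: "prime t"
  shows B_form_jacobi_form: "B_form t \<in> jacobi_forms 6 t"
    and B_form_expansion: "has_expansion t (B_form t) (B_coeff t)"
proof -
  note t0 = prime_gt_0_nat[OF t]
  define X where "X = level_sum t (- 1 / of_nat t) (E2Q_raised t)"
  define f where "f = level_coeff t (- 1 / of_nat t) (E2_raised_coeff t)"
  note u = E2Q_raised_has_sum[OF t0]
  have hol: "E2Q_raised t holomorphic_on ball 0 1"
  proof -
    have "(\<lambda>q. E2Q (q ^ t)) holomorphic_on ball 0 1"
      by (rule holomorphic_on_compose_gen[OF _ EisQ_holomorphic(1), unfolded o_def])
        (use t0 in \<open>auto intro!: holomorphic_intros simp: norm_power power_less_one_iff\<close>)
    then show ?thesis unfolding E2Q_raised_def[abs_def] by (intro holomorphic_intros EisQ_holomorphic)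
  qed
  have X: "X \<in> jacobi_forms 6 t"
    using level_sum_jacobi_form[OF t hol u, of 2 "- 1 / of_nat t"] E2Q_raised_Gamma0[OF _ t0] E2Q_raised_inversion[OF t0]
    by (simp add: X_def)
  have f: "has_expansion t X f" unfolding X_def f_def by (rule level_sum_expansion[OF t0 u])
  have f0: "f 0 0 = (1 - 1 / of_nat t ^ 4) * (of_nat t - 1)"
    by (simp add: f_def level_coeff_0 E2_raised_coeff_def sig_def power_eq_if)
  have "real t > 1" using prime_gt_1_nat[OF t] by simp
  then have "(1 - 1 / real t ^ 4) * (real t - 1) > 0"
    using one_less_power[of "real t" 4] by (intro mult_pos_pos) auto
  then have "complex_of_real ((1 - 1 / real t ^ 4) * (real t - 1)) \<noteq> 0"
    unfolding of_real_eq_0_iff by (rule less_imp_neq[symmetric])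
  then have f0': "f 0 0 \<noteq> 0" by (simp add: f0)
  have B: "B_form t \<tau> z = 1 / f 0 0 * X \<tau> z" if "\<tau> \<in> uhp" for \<tau> z
    unfolding B_form_def
  proof (rule normalize_at_0_eq[OF X f f0' mform_E6Q EisQ_0(3) _ _ _ _ that, where c = 1])
    fix \<tau> z assume \<tau>: "\<tau> \<in> uhp"
    define R where "R = (\<lambda>\<tau> z. (of_nat t * Eis2 (of_nat t * \<tau>) - Eis2 \<tau>) * theta_E8 (of_nat t * \<tau>) (of_nat t *s z))"
    \<comment> \<open>\<open>B_form\<close> is written in tau and \<open>raised\<close> in q; the
      two agree on \<open>uhp\<close>, which every matrix in \<open>SL2Z\<close> preserves.\<close>
    have R: "slash 6 t R (SOME \<gamma>. \<gamma> \<in> C) \<tau> z = slash 6 t (raised t (E2Q_raised t)) (SOME \<gamma>. \<gamma> \<in> C) \<tau> z"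
      if C: "C \<in> Gamma0_cosets t" for C
    proof (rule slash_cong[OF _ \<tau>])
      obtain \<gamma> where \<gamma>: "\<gamma> \<in> SL2Z" "C = coset t \<gamma>" using C by (auto simp: Gamma0_cosets_eq)
      have "(SOME \<gamma>. \<gamma> \<in> C) \<in> C" by (rule someI_ex) (use \<gamma> in_own_coset in blast)
      then show "(SOME \<gamma>. \<gamma> \<in> C) \<in> SL2Z"
        unfolding \<gamma>(2) using \<gamma>(1) by (auto simp: coset_def dest!: Gamma0_SL2Z intro: SL2Z_mult)
    qed (simp add: R_def raised_def E2Q_raised_ee[OF _ t0])
    have "(\<Sum>C\<in>Gamma0_cosets t. slash 6 t R (SOME \<gamma>. \<gamma> \<in> C) \<tau> z) = coset_sum 6 t (raised t (E2Q_raised t)) \<tau> z"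
      unfolding coset_sum_def by (rule sum.cong[OF HOL.refl R])
    also have "\<dots> = X \<tau> z"
      using level_sum_eq_coset_sum[OF t E2Q_raised_Gamma0[OF _ t0] E2Q_raised_inversion[OF t0] \<tau>, of z] by (simp add: X_def)
    finally show "(\<Sum>C\<in>Gamma0_cosets t. slash 6 t R (SOME \<gamma>. \<gamma> \<in> C) \<tau> z) = 1 * X \<tau> z" by simp
  qed (simp_all add: EisQ_ee)
  show "B_form t \<in> jacobi_forms 6 t"
    by (rule jacobi_forms_cong[OF jacobi_forms_cmult[OF X] B])
  show "has_expansion t (B_form t) (B_coeff t)"
    using has_expansion_cmult[OF f, of "1 / f 0 0"] B unfolding has_expansion_def B_coeff_def f0 f_def[symmetric] by simp
qed

section \<open>Uniqueness of Fourier coefficients\<close>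

lemma E8_double_int:
  assumes "l \<in> E8"
  obtains m :: "8 \<Rightarrow> int" where "\<And>i. 2 * l $ i = of_int (m i)"
proof -
  have "\<forall>i. \<exists>m :: int. 2 * l $ i = of_int m" using assms by (auto simp: E8_def elim!: Ints_cases)
  then show ?thesis using that by metis
qed

text \<open>Averaging over the points \<open>2 k / N\<close> of the torus isolates the coefficients in a coset of
  \<open>(N/2) \<int>\<^sup>8\<close>; for large \<open>N\<close> all but one of them lie in the tail of the series.\<close>

lemma fourier_coefficient_zero:
  assumes d: "\<And>z. ((\<lambda>l. d l * ee (cdot (cvec l) z)) has_sum 0) E8" and l0: "l0 \<in> E8"
  shows "d l0 = 0"
proof (rule ccontr)
  assume nz: "d l0 \<noteq> 0"
  have nd: "(\<lambda>l. norm (d l)) summable_on E8"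
    using d[of 0] summable_on_iff_abs_summable_on_complex by (auto dest: has_sum_imp_summable)
  define S where "S = (\<Sum>\<^sub>\<infinity>l\<in>E8. norm (d l))"
  have S: "((\<lambda>l. norm (d l)) has_sum S) E8" unfolding S_def by (rule has_sum_infsum[OF nd])
  \<comment> \<open>The coefficients outside this finite set have total modulus at most half of that
    of \<open>d l0\<close>; the averaging below would need the full modulus there.\<close>
  obtain F0 where F0: "finite F0" "F0 \<subseteq> E8" "dist (\<Sum>l\<in>F0. norm (d l)) S \<le> norm (d l0) / 2"
    using has_sum_finite_approximation[OF S, of "norm (d l0) / 2"] nz by auto
  define F where "F = insert l0 F0"
  have F: "finite F" "F \<subseteq> E8" "l0 \<in> F" using F0 l0 by (auto simp: F_def)
  have "(\<Sum>l\<in>F0. norm (d l)) \<le> (\<Sum>l\<in>F. norm (d l))"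
    using F by (intro sum_mono2) (auto simp: F_def)
  then have tail: "S - (\<Sum>l\<in>F. norm (d l)) \<le> norm (d l0) / 2"
    using F0(3) unfolding dist_real_def by linarith
  have "\<forall>l. \<exists>m :: 8 \<Rightarrow> int. l \<in> E8 \<longrightarrow> (\<forall>i. 2 * (l - l0) $ i = of_int (m i))"
  proof
    fix l show "\<exists>m :: 8 \<Rightarrow> int. l \<in> E8 \<longrightarrow> (\<forall>i. 2 * (l - l0) $ i = of_int (m i))"
    proof (cases "l \<in> E8")
      case True
      obtain m :: "8 \<Rightarrow> int" where "\<And>i. 2 * (l - l0) $ i = of_int (m i)"
        by (rule E8_double_int[OF E8_diff[OF True l0]]) (rule that)
      then show ?thesis by blast
    qed simp
  qed
  then obtain m :: "real ^ 8 \<Rightarrow> 8 \<Rightarrow> int" where m: "\<And>l i. l \<in> E8 \<Longrightarrow> 2 * (l - l0) $ i = of_int (m l i)"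
    by metis
  \<comment> \<open>\<open>N\<close> exceeds all coordinates of 2 (l - l0) for l in
    \<open>F\<close>, so among these vectors only 0 is divisible by \<open>N\<close>.\<close>
  define N where "N = Suc (\<Sum>l\<in>F. \<Sum>i\<in>UNIV. nat \<bar>m l i\<bar>)"
  have N0: "N > 0" by (simp add: N_def)
  have bound: "nat \<bar>m l i\<bar> < N" if "l \<in> F" for l i
  proof -
    have "nat \<bar>m l i\<bar> \<le> (\<Sum>i\<in>UNIV. nat \<bar>m l i\<bar>)" by (intro member_le_sum) auto
    also have "\<dots> \<le> (\<Sum>l\<in>F. \<Sum>i\<in>UNIV. nat \<bar>m l i\<bar>)" using F(1) that by (intro member_le_sum) auto
    finally show ?thesis by (simp add: N_def)
  qed
  define P where "P l \<longleftrightarrow> (\<forall>i. int N dvd m l i)" for l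
  have P_F: "\<not> P l" if "l \<in> F" "l \<noteq> l0" for l
  proof
    assume P: "P l"
    have "m l i = 0" for i
    proof (rule ccontr)
      assume "m l i \<noteq> 0"
      moreover have "int N dvd m l i" using P by (simp add: P_def)
      ultimately have "int N \<le> \<bar>m l i\<bar>" by (metis dvd_imp_le_int abs_of_nat)
      with bound[OF that(1), of i] show False by linarith
    qed
    then have "l = l0" using m[of l] F(2) that(1) by (auto simp: vec_eq_iff)
    with that show False by simp
  qed
  have "P l0" using m[OF l0] by (simp add: P_def)
  define z where "z k = cvec (\<chi> i. 2 * real (k i) / real N)" for k :: "8 \<Rightarrow> nat"
  define K where "K = (PiE UNIV (\<lambda>_. {..<N}) :: (8 \<Rightarrow> nat) set)"
  have K: "finite K" unfolding K_def by (intro finite_PiE) auto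
  have avg: "(\<Sum>k\<in>K. ee (cdot (cvec (l - l0)) (z k))) = (if P l then of_nat N ^ 8 else 0)" if "l \<in> E8" for l
  proof -
    have "cdot (cvec (l - l0)) (z k) = (\<Sum>i\<in>UNIV. of_int (m l i) * of_nat (k i) / of_nat N)" for k
    proof -
      have "(l - l0) $ i * (2 * real (k i) / real N) = of_int (m l i) * real (k i) / real N" for i
        using m[OF that, of i] by (simp add: field_simps)
      then have "complex_of_real ((l - l0) $ i) * complex_of_real (2 * real (k i) / real N) = of_int (m l i) * of_nat (k i) / of_nat N" for i
        by (metis of_real_mult of_real_divide of_real_of_int_eq of_real_of_nat_eq)
      then show ?thesis unfolding z_def cdot_def cvec_def vec_lambda_beta by (simp only:)
    qed
    then have "(\<Sum>k\<in>K. ee (cdot (cvec (l - l0)) (z k))) = (\<Sum>k\<in>K. \<Prod>i\<in>UNIV. ee (of_int (m l i) * of_nat (k i) / of_nat N))"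
      by (simp add: ee_sum)
    also have "\<dots> = (\<Prod>i\<in>UNIV. \<Sum>b<N. ee (of_int (m l i) * of_nat b / of_nat N))"
      unfolding K_def by (rule prod_sum_PiE[symmetric]) auto
    also have "\<dots> = (\<Prod>i\<in>(UNIV :: 8 set). if int N dvd m l i then of_nat N else 0)"
      by (simp only: sum_roots_of_unity[OF N0])
    also have "\<dots> = (if P l then of_nat N ^ 8 else 0)"
      by (auto simp: P_def)
    finally show ?thesis .
  qed
  have zero: "0 = (\<Sum>k\<in>K. ee (- cdot (cvec l0) (z k)) * 0)" by simp
  have "((\<lambda>l. \<Sum>k\<in>K. ee (- cdot (cvec l0) (z k)) * (d l * ee (cdot (cvec l) (z k)))) has_sum 0) E8"
    by (subst zero) (intro has_sum_finite_sum[OF K] has_sum_cmult_right d)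
  moreover have "(\<Sum>k\<in>K. ee (- cdot (cvec l0) (z k)) * (d l * ee (cdot (cvec l) (z k)))) = (if P l then d l else 0) * of_nat N ^ 8" if "l \<in> E8" for l
  proof -
    have "ee (- cdot (cvec l0) (z k)) * (d l * ee (cdot (cvec l) (z k))) = d l * ee (cdot (cvec (l - l0)) (z k))" for k
    proof -
      have "cdot (cvec (l - l0)) (z k) = - cdot (cvec l0) (z k) + cdot (cvec l) (z k)" by (simp add: cdot_diff_left cvec_diff)
      then show ?thesis by (simp only: ee_add mult_ac)
    qed
    then show ?thesis by (simp only: sum_distrib_left[symmetric] avg[OF that]) simp
  qed
  ultimately have "((\<lambda>l. (if P l then d l else 0) * of_nat N ^ 8) has_sum 0) E8"
    by (simp cong: has_sum_cong)
  from has_sum_cmult_left[OF this, of "1 / of_nat N ^ 8"]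
  have sum0: "((\<lambda>l. if P l then d l else 0) has_sum 0) E8" using N0 by simp
  have "(\<Sum>l\<in>F. if P l then d l else 0) = (\<Sum>l\<in>F. if l = l0 then d l0 else 0)"
    using P_F \<open>P l0\<close> by (intro sum.cong) auto
  then have "(\<Sum>l\<in>F. if P l then d l else 0) = d l0" using F by simp
  then have "((\<lambda>l. if P l then d l else 0) has_sum (0 - d l0)) (E8 - F)"
    using has_sum_Diff[OF sum0 has_sum_finite[OF F(1)] F(2)] by simp
  moreover have rest: "((\<lambda>l. norm (d l)) has_sum (S - (\<Sum>l\<in>F. norm (d l)))) (E8 - F)"
    by (rule has_sum_Diff[OF S has_sum_finite[OF F(1)] F(2)])
  moreover have "norm (if P l then d l else 0) \<le> norm (d l)" for l by simp
  ultimately have "norm (0 - d l0) \<le> S - (\<Sum>l\<in>F. norm (d l))"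
    by (rule norm_infsum_le)
  moreover have "norm (d l0) > 0" using nz by simp
  ultimately show False using tail unfolding diff_0 norm_minus_cancel by linarith
qed

lemma fourier_coefficients_unique:
  assumes "\<And>z. ((\<lambda>l. a l * ee (cdot (cvec l) z)) has_sum \<Phi> z) E8"
    and "\<And>z. ((\<lambda>l. b l * ee (cdot (cvec l) z)) has_sum \<Phi> z) E8" and "l \<in> E8"
  shows "a l = b l"
proof -
  have "((\<lambda>l. (a l - b l) * ee (cdot (cvec l) z)) has_sum 0) E8" for z
    using has_sum_diff[OF assms(1)[of z] assms(2)[of z]] by (simp add: left_diff_distrib)
  from fourier_coefficient_zero[OF this assms(3)] show ?thesis by simp
qed

section \<open>The theta decomposition in index 3\<close>

definition coeff_series :: "(nat \<Rightarrow> real ^ 8 \<Rightarrow> complex) \<Rightarrow> real ^ 8 \<Rightarrow> complex \<Rightarrow> complex" where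
  "coeff_series f l q = (\<Sum>n. f n l * q ^ n)"

lemma coeff_series_has_sum:
  assumes f: "has_expansion t \<phi> f" and l: "l \<in> E8" and \<tau>: "\<tau> \<in> uhp"
  shows "((\<lambda>n. f n l * ee \<tau> ^ n) has_sum coeff_series f l (ee \<tau>)) UNIV"
proof -
  have "(\<lambda>(n, l). f n l * ee \<tau> ^ n) summable_on (UNIV \<times> E8)"
    using has_expansionD(2)[OF f \<tau>, of 0] by (auto dest: has_sum_imp_summable)
  then have "(\<lambda>(n, l). f n l * ee \<tau> ^ n) summable_on (UNIV \<times> {l})"
    by (rule summable_on_subset_banach) (use l in auto)
  also have "?this \<longleftrightarrow> (\<lambda>n. f n l * ee \<tau> ^ n) summable_on UNIV"
    by (rule summable_on_reindex_bij_witness[of _ "\<lambda>n. (n, l)" fst]) auto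
  finally have "((\<lambda>n. f n l * ee \<tau> ^ n) has_sum infsum (\<lambda>n. f n l * ee \<tau> ^ n) UNIV) UNIV"
    by (rule has_sum_infsum)
  then show ?thesis
    using has_sum_imp_sums by (fastforce simp: coeff_series_def sums_iff)
qed

lemma summable_coeff_series:
  assumes f: "has_expansion t \<phi> f" and l: "l \<in> E8" and q: "norm q < 1"
  shows "summable (\<lambda>n. f n l * q ^ n)"
proof (cases "q = 0")
  case False
  obtain \<tau> where "\<tau> \<in> uhp" "ee \<tau> = q" by (rule ee_surj_uhp[OF False q])
  then show ?thesis using has_sum_imp_sums[OF coeff_series_has_sum[OF f l]] by (auto simp: sums_iff)
qed simp

lemma coeff_series_expansion:
  assumes f: "has_expansion t \<phi> f" and \<tau>: "\<tau> \<in> uhp"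
  shows "((\<lambda>l. coeff_series f l (ee \<tau>) * ee (cdot (cvec l) z)) has_sum \<phi> \<tau> z) E8"
proof (rule has_sum_SigmaD)
  have "((\<lambda>(n, l). f n l * ee \<tau> ^ n * ee (cdot (cvec l) z)) has_sum \<phi> \<tau> z) (UNIV \<times> E8)"
    by (rule has_expansionD(2)[OF f \<tau>])
  also have "?this \<longleftrightarrow> ((\<lambda>(l, n). f n l * ee \<tau> ^ n * ee (cdot (cvec l) z)) has_sum \<phi> \<tau> z) (E8 \<times> UNIV)"
    by (rule has_sum_reindex_bij_witness[of _ prod.swap prod.swap]) auto
  finally show "((\<lambda>(l, n). f n l * ee \<tau> ^ n * ee (cdot (cvec l) z)) has_sum \<phi> \<tau> z) (E8 \<times> UNIV)" .
  show "((\<lambda>n. case (l, n) of (l, n) \<Rightarrow> f n l * ee \<tau> ^ n * ee (cdot (cvec l) z)) has_sum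
      coeff_series f l (ee \<tau>) * ee (cdot (cvec l) z)) UNIV" if "l \<in> E8" for l
    unfolding prod.case by (rule has_sum_cmult_left[OF coeff_series_has_sum[OF f that \<tau>]])
qed

text \<open>The function h_l of the theta decomposition. The exponent (l, l) / 6 is (l, l) / (2 t)
  at index t = 3; removing it leaves a function of the class of l modulo 3.\<close>

definition theta_comp :: "(nat \<Rightarrow> real ^ 8 \<Rightarrow> complex) \<Rightarrow> real ^ 8 \<Rightarrow> complex \<Rightarrow> complex" where
  "theta_comp f l \<tau> = coeff_series f l (ee \<tau>) * ee (- (of_real (l \<bullet> l) * \<tau> / 6))"

lemma coeff_series_theta_comp: "coeff_series f l (ee \<tau>) = theta_comp f l \<tau> * ee (of_real (l \<bullet> l) * \<tau> / 6)"
  by (simp add: theta_comp_def mult.assoc flip: ee_add)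

lemma theta_comp_has_sum:
  assumes f: "has_expansion t \<phi> f" and \<tau>: "\<tau> \<in> uhp"
  shows "((\<lambda>l. theta_comp f l \<tau> * ee (of_real (l \<bullet> l) * \<tau> / 6 + cdot (cvec l) z)) has_sum \<phi> \<tau> z) E8"
  using coeff_series_expansion[OF assms, of z] by (simp only: coeff_series_theta_comp ee_add mult.assoc)

text \<open>Substituting a reflection of z, or z + tau x, into the expansion permutes the indices l,
  and Fourier coefficients can be compared. In the second case the change of (l, l) / 6 matches the
  quasi-period factor.\<close>

lemma theta_comp_invariant:
  assumes \<phi>: "\<phi> \<in> jacobi_forms k 3" and f: "has_expansion 3 \<phi> f" and \<tau>: "\<tau> \<in> uhp"
  shows "invariant_mod_3 (\<lambda>l. theta_comp f l \<tau>)"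
  unfolding invariant_mod_3_def
proof (intro conjI ballI impI)
  fix r l assume r: "r \<in> E8" "r \<bullet> r = 2" and l: "l \<in> E8"
  have "((\<lambda>l. coeff_series f (refl_E8 r l) (ee \<tau>) * ee (cdot (cvec l) z)) has_sum \<phi> \<tau> z) E8" for z
  proof -
    have "((\<lambda>l. coeff_series f l (ee \<tau>) * ee (cdot (cvec l) (reflection r z))) has_sum \<phi> \<tau> z) E8"
      using coeff_series_expansion[OF f \<tau>, of "reflection r z"] by (simp only: jacobi_formsD(2)[OF \<phi> r \<tau>])
    also have "?this \<longleftrightarrow> ?thesis"
      by (rule has_sum_reindex_bij_witness[of _ "refl_E8 r" "refl_E8 r"])
        (auto simp: refl_E8_in[OF r(1)] refl_E8_invol[OF r(2)] cdot_reflection)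
    finally show ?thesis .
  qed
  then have "coeff_series f (refl_E8 r l) (ee \<tau>) = coeff_series f l (ee \<tau>)"
    by (rule fourier_coefficients_unique[OF _ coeff_series_expansion[OF f \<tau>] l])
  then show "theta_comp f (refl_E8 r l) \<tau> = theta_comp f l \<tau>"
    by (simp add: theta_comp_def refl_E8_inner[OF r(2)])
next
  fix l x assume l: "l \<in> E8" and x: "x \<in> E8"
  define e where "e = of_real (x \<bullet> x) * \<tau> * 3 / 2"
  have x3: "3 *\<^sub>R x \<in> E8" using E8_scaleR_numeral[OF x] .
  have "coeff_series f (l + 3 *\<^sub>R x) (ee \<tau>) * ee (- e) = coeff_series f l (ee \<tau>) * ee (of_real (l \<bullet> x) * \<tau>)"
  proof (rule fourier_coefficients_unique[OF _ _ l])
    fix z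
    have "((\<lambda>l. coeff_series f l (ee \<tau>) * ee (cdot (cvec l) (z + \<tau> *s cvec x))) has_sum ee (- (e + 3 * cdot (cvec x) z)) * \<phi> \<tau> z) E8"
      using coeff_series_expansion[OF f \<tau>, of "z + \<tau> *s cvec x"] jacobi_formsD(3)[OF \<phi> x E8_0 \<tau>, of z]
      by (simp add: e_def algebra_simps)
    then show "((\<lambda>l. coeff_series f l (ee \<tau>) * ee (of_real (l \<bullet> x) * \<tau>) * ee (cdot (cvec l) z)) has_sum ee (- (e + 3 * cdot (cvec x) z)) * \<phi> \<tau> z) E8"
      by (simp add: cdot_simps ee_add mult_ac)
    have "((\<lambda>l. ee (- (e + 3 * cdot (cvec x) z)) * (coeff_series f l (ee \<tau>) * ee (cdot (cvec l) z))) has_sum ee (- (e + 3 * cdot (cvec x) z)) * \<phi> \<tau> z) E8"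
      by (rule has_sum_cmult_right[OF coeff_series_expansion[OF f \<tau>]])
    also have "?this \<longleftrightarrow> ((\<lambda>l. coeff_series f (l + 3 *\<^sub>R x) (ee \<tau>) * ee (- e) * ee (cdot (cvec l) z)) has_sum ee (- (e + 3 * cdot (cvec x) z)) * \<phi> \<tau> z) E8"
    proof (rule has_sum_reindex_bij_witness[of _ "\<lambda>l. l + 3 *\<^sub>R x" "\<lambda>l. l - 3 *\<^sub>R x"])
      fix l assume "l \<in> E8"
      have "- (e + 3 * cdot (cvec x) z) + cdot (cvec l) z = - e + cdot (cvec (l - 3 *\<^sub>R x)) z" by (simp add: cdot_simps)
      then have "ee (- (e + 3 * cdot (cvec x) z)) * ee (cdot (cvec l) z) = ee (- e) * ee (cdot (cvec (l - 3 *\<^sub>R x)) z)"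
        unfolding ee_add[symmetric] by (rule arg_cong)
      then show "coeff_series f (l - 3 *\<^sub>R x + 3 *\<^sub>R x) (ee \<tau>) * ee (- e) * ee (cdot (cvec (l - 3 *\<^sub>R x)) z) =
          ee (- (e + 3 * cdot (cvec x) z)) * (coeff_series f l (ee \<tau>) * ee (cdot (cvec l) z))"
        by simp
    qed (auto intro: E8_add E8_diff x3)
    finally show "((\<lambda>l. coeff_series f (l + 3 *\<^sub>R x) (ee \<tau>) * ee (- e) * ee (cdot (cvec l) z)) has_sum ee (- (e + 3 * cdot (cvec x) z)) * \<phi> \<tau> z) E8" .
  qed
  then have "coeff_series f (l + 3 *\<^sub>R x) (ee \<tau>) = coeff_series f l (ee \<tau>) * (ee (of_real (l \<bullet> x) * \<tau>) * ee e)"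
    by (simp add: ee_minus field_simps)
  moreover have norm: "of_real ((l + 3 *\<^sub>R x) \<bullet> (l + 3 *\<^sub>R x)) * \<tau> / 6 = of_real (l \<bullet> l) * \<tau> / 6 + (of_real (l \<bullet> x) * \<tau> + e)"
    by (simp add: inner_add_left inner_add_right inner_commute[of x l] e_def field_simps)
  ultimately show "theta_comp f (l + 3 *\<^sub>R x) \<tau> = theta_comp f l \<tau>"
    unfolding theta_comp_def ee_minus norm ee_add by (simp add: field_simps)
qed

text \<open>Finiteness comes from residues: if 2 gamma and 2 gamma' agree modulo 12, then (gamma -
  gamma') / 3 has even integral coordinates and so lies in E8.\<close>

lemma E8_mod_3_representatives:
  obtains R where "finite R" "R \<subseteq> E8" "bij_betw (\<lambda>(\<gamma>, x). \<gamma> + 3 *\<^sub>R x) (R \<times> E8) E8"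
proof -
  define cong where "cong l \<gamma> \<longleftrightarrow> \<gamma> \<in> E8 \<and> (1 / 3) *\<^sub>R (l - \<gamma>) \<in> E8" for l \<gamma> :: "real ^ 8"
  define rep where "rep l = (SOME \<gamma>. cong l \<gamma>)" for l
  have refl: "cong l l" if "l \<in> E8" for l using that by (simp add: cong_def)
  have trans: "cong l \<gamma>'" if "cong l \<gamma>" "cong \<gamma> \<gamma>'" for l \<gamma> \<gamma>'
  proof -
    have "(1 / 3) *\<^sub>R (l - \<gamma>) + (1 / 3) *\<^sub>R (\<gamma> - \<gamma>') = (1 / 3) *\<^sub>R (l - \<gamma>')" by (simp add: algebra_simps)
    then show ?thesis using that E8_add unfolding cong_def by metis
  qed
  have sym: "cong \<gamma> l" if "l \<in> E8" "cong l \<gamma>" for l \<gamma>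
  proof -
    have "- ((1 / 3) *\<^sub>R (l - \<gamma>)) = (1 / 3) *\<^sub>R (\<gamma> - l)" by (simp add: algebra_simps)
    then show ?thesis using that E8_minus unfolding cong_def by metis
  qed
  have cong_rep: "cong l (rep l)" if "l \<in> E8" for l
    unfolding rep_def by (rule someI[of "cong l", OF refl[OF that]])
  have rep_eq: "rep l = rep l'" if "l \<in> E8" "cong l l'" for l l'
  proof -
    have "cong l = cong l'" using trans sym[OF that] that(2) by blast
    then show ?thesis by (simp add: rep_def)
  qed
  define R where "R = rep ` E8"
  have RE: "R \<subseteq> E8" using cong_rep by (auto simp: R_def cong_def)
  have rep_R: "rep \<gamma> = \<gamma>" if "\<gamma> \<in> R" for \<gamma>
    using that rep_eq[OF _ cong_rep, symmetric] by (auto simp: R_def)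
  define key where "key l = (\<lambda>i. \<lfloor>2 * l $ i\<rfloor> mod 12)" for l :: "real ^ 8"
  have "finite (key ` R)"
  proof (rule finite_subset)
    show "key ` R \<subseteq> PiE UNIV (\<lambda>_. {0..<12})" by (auto simp: key_def)
    show "finite (PiE (UNIV :: 8 set) (\<lambda>_. {0..<12 :: int}))" by (intro finite_PiE) auto
  qed
  moreover have "inj_on key R"
  proof (rule inj_onI)
    fix \<gamma> \<gamma>' assume g: "\<gamma> \<in> R" "\<gamma>' \<in> R" and key: "key \<gamma> = key \<gamma>'"
    obtain m :: "8 \<Rightarrow> int" where m: "\<And>i. 2 * \<gamma> $ i = of_int (m i)" using E8_double_int RE g by blast
    obtain m' :: "8 \<Rightarrow> int" where m': "\<And>i. 2 * \<gamma>' $ i = of_int (m' i)" using E8_double_int RE g by blast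
    have "\<forall>i. \<exists>k. m i - m' i = 12 * k"
    proof
      fix i have "m i mod 12 = m' i mod 12" using fun_cong[OF key, of i] by (simp add: key_def m m')
      then show "\<exists>k. m i - m' i = 12 * k" by (auto simp: mod_eq_dvd_iff dvd_def)
    qed
    then obtain k where k: "\<And>i. m i - m' i = 12 * k i" by metis
    have "((1 / 3) *\<^sub>R (\<gamma> - \<gamma>')) $ i = of_int (2 * k i) + of_int 0 / 2" for i
    proof -
      have "of_int (m i) - of_int (m' i) = (12 * of_int (k i) :: real)" using k[of i] by (metis of_int_diff of_int_mult of_int_numeral)
      then show ?thesis using m[of i] m'[of i] by simp
    qed
    then have "(1 / 3) *\<^sub>R (\<gamma> - \<gamma>') \<in> E8"
      by (rule E8I[rotated]) (auto simp: sum_distrib_left[symmetric])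
    then have "cong \<gamma> \<gamma>'" using RE g by (auto simp: cong_def)
    then show "\<gamma> = \<gamma>'" using rep_eq rep_R RE g by (metis subsetD)
  qed
  ultimately have "finite R" by (rule finite_imageD)
  moreover have "bij_betw (\<lambda>(\<gamma>, x). \<gamma> + 3 *\<^sub>R x) (R \<times> E8) E8"
  proof (rule bij_betwI[where g = "\<lambda>l. (rep l, (1 / 3) *\<^sub>R (l - rep l))"])
    show "(\<lambda>(\<gamma>, x). \<gamma> + 3 *\<^sub>R x) \<in> R \<times> E8 \<rightarrow> E8"
      using RE by (auto intro: E8_add E8_scaleR_numeral)
    show "(\<lambda>l. (rep l, (1 / 3) *\<^sub>R (l - rep l))) \<in> E8 \<rightarrow> R \<times> E8"
      using cong_rep by (auto simp: R_def cong_def)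
    show "(\<lambda>l. (rep l, (1 / 3) *\<^sub>R (l - rep l))) ((\<lambda>(\<gamma>, x). \<gamma> + 3 *\<^sub>R x) p) = p" if "p \<in> R \<times> E8" for p
    proof -
      obtain \<gamma> x where p: "p = (\<gamma>, x)" "\<gamma> \<in> R" "x \<in> E8" using \<open>p \<in> R \<times> E8\<close> by (rule SigmaE)
      have "cong \<gamma> (\<gamma> + 3 *\<^sub>R x)"
        using p RE E8_minus[OF p(3)] by (auto simp: cong_def intro: E8_add E8_scaleR_numeral)
      then have "rep (\<gamma> + 3 *\<^sub>R x) = \<gamma>" using rep_eq rep_R[OF p(2)] RE p(2) by (metis subsetD)
      then show ?thesis by (simp add: p(1))
    qed
  qed simp
  ultimately show ?thesis using RE that by blast
qed

text \<open>On a class gamma + 3 E8 the expansion at -1/tau sums to \<open>theta_E8\<close> at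
  -3/tau. Its inversion lives at tau / 3, where the Fourier coefficients in z can be compared with
  those of phi at tau. The constant 81 = 3^4 comes from (tau / 3)^4.\<close>

theorem theta_comp_inversion:
  assumes \<phi>: "\<phi> \<in> jacobi_forms k 3" and f: "has_expansion 3 \<phi> f" and \<tau>: "\<tau> \<in> uhp" and l: "l \<in> E8"
    and R: "finite R" "R \<subseteq> E8" "bij_betw (\<lambda>(\<gamma>, x). \<gamma> + 3 *\<^sub>R x) (R \<times> E8) E8"
  shows "\<tau> powi k * theta_comp f l \<tau> =
    \<tau> ^ 4 / 81 * (\<Sum>\<gamma>\<in>R. theta_comp f \<gamma> (- 1 / \<tau>) * ee (- (of_real (l \<bullet> \<gamma>) / 3)))"
proof -
  define \<sigma> where "\<sigma> = - 1 / \<tau>"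
  have \<sigma>: "\<sigma> \<in> uhp" using \<tau> unfolding \<sigma>_def by (rule inversion_in_uhp)
  have \<tau>0: "\<tau> \<noteq> 0" using \<tau> by (rule uhp_nonzero)
  have \<tau>3: "\<tau> / 3 \<in> uhp" using uhp_divide_of_nat[OF \<tau>, of 3] by simp
  define E where "E z = ee (3 * cdot z z / (2 * \<tau>))" for z
  define h where "h \<gamma> = theta_comp f \<gamma> \<sigma>" for \<gamma>
  have theta: "((\<lambda>x. ee (of_real ((\<gamma> + 3 *\<^sub>R x) \<bullet> (\<gamma> + 3 *\<^sub>R x)) * \<sigma> / 6 + cdot (cvec (\<gamma> + 3 *\<^sub>R x)) ((1 / \<tau>) *s z))) has_sum
      \<tau> ^ 4 / 81 * E z * theta_E8 (\<tau> / 3) (z - (1 / 3) *s cvec \<gamma>)) E8" for \<gamma> z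
  proof -
    define c where "c = of_real (\<gamma> \<bullet> \<gamma>) * \<sigma> / 6 + cdot (cvec \<gamma>) ((1 / \<tau>) *s z)"
    define w where "w = \<sigma> *s cvec \<gamma> + (3 / \<tau>) *s z"
    have "of_real ((\<gamma> + 3 *\<^sub>R x) \<bullet> (\<gamma> + 3 *\<^sub>R x)) * \<sigma> / 6 + cdot (cvec (\<gamma> + 3 *\<^sub>R x)) ((1 / \<tau>) *s z) =
        c + (of_real (x \<bullet> x) * (3 * \<sigma>) / 2 + cdot (cvec x) w)" for x
      by (simp add: c_def w_def cdot_simps inner_add_left inner_add_right inner_commute[of \<gamma> x] field_simps, simp add: add_divide_distrib)
    then have sum: "((\<lambda>x. ee (of_real ((\<gamma> + 3 *\<^sub>R x) \<bullet> (\<gamma> + 3 *\<^sub>R x)) * \<sigma> / 6 + cdot (cvec (\<gamma> + 3 *\<^sub>R x)) ((1 / \<tau>) *s z))) has_sum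
        ee c * theta_E8 (3 * \<sigma>) w) E8"
      using has_sum_cmult_right[OF theta_E8_has_sum[of "3 * \<sigma>" w], of "ee c"] uhp_mult_of_nat[OF \<sigma>, of 3]
      by (simp add: theta_summand_def ee_add)
    have "theta_E8 (3 * \<sigma>) w = theta_E8 (- 1 / (\<tau> / 3)) ((1 / (\<tau> / 3)) *s (z - (1 / 3) *s cvec \<gamma>))"
    proof -
      have "w = (1 / (\<tau> / 3)) *s (z - (1 / 3) *s cvec \<gamma>)"
        using \<tau>0 by (simp add: w_def \<sigma>_def vec_eq_iff field_simps)
      moreover have "3 * \<sigma> = - 1 / (\<tau> / 3)" by (simp add: \<sigma>_def)
      ultimately show ?thesis by (simp only:)
    qed
    also have "\<dots> = (\<tau> / 3) ^ 4 * ee (cdot (z - (1 / 3) *s cvec \<gamma>) (z - (1 / 3) *s cvec \<gamma>) / (2 * (\<tau> / 3))) * theta_E8 (\<tau> / 3) (z - (1 / 3) *s cvec \<gamma>)"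
      by (rule theta_E8_inversion[OF \<tau>3])
    finally have "ee c * theta_E8 (3 * \<sigma>) w = \<tau> ^ 4 / 81 * (ee c * ee (cdot (z - (1 / 3) *s cvec \<gamma>) (z - (1 / 3) *s cvec \<gamma>) / (2 * (\<tau> / 3)))) * theta_E8 (\<tau> / 3) (z - (1 / 3) *s cvec \<gamma>)"
      by (simp add: power_divide)
    moreover have "c + cdot (z - (1 / 3) *s cvec \<gamma>) (z - (1 / 3) *s cvec \<gamma>) / (2 * (\<tau> / 3)) = 3 * cdot z z / (2 * \<tau>)"
      using \<tau>0 by (simp add: c_def \<sigma>_def cdot_simps cdot_commute[of z "cvec \<gamma>"] field_simps)
    ultimately have "ee c * theta_E8 (3 * \<sigma>) w = \<tau> ^ 4 / 81 * E z * theta_E8 (\<tau> / 3) (z - (1 / 3) *s cvec \<gamma>)"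
      unfolding E_def ee_add[symmetric] by (simp only:)
    then show ?thesis using sum by (simp only:)
  qed
  have "((\<lambda>\<gamma>. h \<gamma> * (\<tau> ^ 4 / 81 * E z * theta_E8 (\<tau> / 3) (z - (1 / 3) *s cvec \<gamma>))) has_sum \<phi> \<sigma> ((1 / \<tau>) *s z)) R" for z
  proof (rule has_sum_SigmaD)
    define F where "F l = theta_comp f l \<sigma> * ee (of_real (l \<bullet> l) * \<sigma> / 6 + cdot (cvec l) ((1 / \<tau>) *s z))" for l
    have "(F has_sum \<phi> \<sigma> ((1 / \<tau>) *s z)) E8"
      unfolding F_def by (rule theta_comp_has_sum[OF f \<sigma>])
    then show "((\<lambda>p. F (case p of (\<gamma>, x) \<Rightarrow> \<gamma> + 3 *\<^sub>R x)) has_sum \<phi> \<sigma> ((1 / \<tau>) *s z)) (R \<times> E8)"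
      using has_sum_reindex_bij_betw[OF R(3)] by blast
    fix \<gamma> assume "\<gamma> \<in> R"
    then have "theta_comp f (\<gamma> + 3 *\<^sub>R x) \<sigma> = h \<gamma>" if "x \<in> E8" for x
      using theta_comp_invariant[OF \<phi> f \<sigma>] R(2) that by (auto simp: invariant_mod_3_def h_def)
    then show "((\<lambda>x. F (case (\<gamma>, x) of (\<gamma>, x) \<Rightarrow> \<gamma> + 3 *\<^sub>R x)) has_sum
        h \<gamma> * (\<tau> ^ 4 / 81 * E z * theta_E8 (\<tau> / 3) (z - (1 / 3) *s cvec \<gamma>))) E8"
      using has_sum_cmult_right[OF theta[of \<gamma> z], of "h \<gamma>"] by (simp add: F_def cong: has_sum_cong)
  qed
  from has_sum_unique[OF this has_sum_finite[OF R(1)]]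
  have \<phi>\<sigma>: "\<phi> \<sigma> ((1 / \<tau>) *s z) = E z * (\<tau> ^ 4 / 81 * (\<Sum>\<gamma>\<in>R. h \<gamma> * theta_E8 (\<tau> / 3) (z - (1 / 3) *s cvec \<gamma>)))" for z
    by (simp add: sum_distrib_left mult_ac)
  have \<phi>\<tau>: "\<tau> powi k * \<phi> \<tau> z = \<tau> ^ 4 / 81 * (\<Sum>\<gamma>\<in>R. h \<gamma> * theta_E8 (\<tau> / 3) (z - (1 / 3) *s cvec \<gamma>))" for z
    using jacobi_forms_S[OF \<phi> \<tau>, of z] \<phi>\<sigma>[of z] by (simp add: \<sigma>_def E_def mult.assoc)
  have "\<tau> powi k * coeff_series f l (ee \<tau>) = \<tau> ^ 4 / 81 * (\<Sum>\<gamma>\<in>R. h \<gamma> * ee (of_real (l \<bullet> l) * \<tau> / 6 - of_real (l \<bullet> \<gamma>) / 3))"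
  proof (rule fourier_coefficients_unique[OF _ _ l])
    fix z
    show "((\<lambda>l. \<tau> powi k * coeff_series f l (ee \<tau>) * ee (cdot (cvec l) z)) has_sum \<tau> powi k * \<phi> \<tau> z) E8"
      using has_sum_cmult_right[OF coeff_series_expansion[OF f \<tau>, of z], of "\<tau> powi k"] by (simp add: mult.assoc)
    have summand: "theta_summand (\<tau> / 3) (z - (1 / 3) *s cvec \<gamma>) l = ee (of_real (l \<bullet> l) * \<tau> / 6 - of_real (l \<bullet> \<gamma>) / 3) * ee (cdot (cvec l) z)" for \<gamma> l
      unfolding theta_summand_def ee_add[symmetric] by (rule arg_cong[of _ _ ee]) (simp add: cdot_simps)
    have "((\<lambda>l. ee (of_real (l \<bullet> l) * \<tau> / 6 - of_real (l \<bullet> \<gamma>) / 3) * ee (cdot (cvec l) z)) has_sum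
        theta_E8 (\<tau> / 3) (z - (1 / 3) *s cvec \<gamma>)) E8" for \<gamma>
      using theta_E8_has_sum[OF \<tau>3] by (rule has_sum_cong[THEN iffD1, rotated]) (rule summand)
    then have "((\<lambda>l. \<tau> ^ 4 / 81 * (\<Sum>\<gamma>\<in>R. h \<gamma> * (ee (of_real (l \<bullet> l) * \<tau> / 6 - of_real (l \<bullet> \<gamma>) / 3) * ee (cdot (cvec l) z)))) has_sum \<tau> powi k * \<phi> \<tau> z) E8"
      unfolding \<phi>\<tau> by (intro has_sum_cmult_right has_sum_finite_sum[OF R(1)])
    then show "((\<lambda>l. \<tau> ^ 4 / 81 * (\<Sum>\<gamma>\<in>R. h \<gamma> * ee (of_real (l \<bullet> l) * \<tau> / 6 - of_real (l \<bullet> \<gamma>) / 3)) * ee (cdot (cvec l) z)) has_sum \<tau> powi k * \<phi> \<tau> z) E8"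
      by (simp add: sum_distrib_right mult.assoc)
  qed
  also have "\<dots> = \<tau> ^ 4 / 81 * (\<Sum>\<gamma>\<in>R. h \<gamma> * ee (- (of_real (l \<bullet> \<gamma>) / 3))) * ee (of_real (l \<bullet> l) * \<tau> / 6)"
  proof -
    have "ee (of_real (l \<bullet> l) * \<tau> / 6 - of_real (l \<bullet> \<gamma>) / 3) = ee (- (of_real (l \<bullet> \<gamma>) / 3)) * ee (of_real (l \<bullet> l) * \<tau> / 6)" for \<gamma>
      unfolding ee_add[symmetric] by (rule arg_cong[of _ _ ee]) simp
    then show ?thesis by (simp only: sum_distrib_right mult.assoc)
  qed
  finally have "(\<tau> powi k * theta_comp f l \<tau>) * ee (of_real (l \<bullet> l) * \<tau> / 6) =
      (\<tau> ^ 4 / 81 * (\<Sum>\<gamma>\<in>R. h \<gamma> * ee (- (of_real (l \<bullet> \<gamma>) / 3)))) * ee (of_real (l \<bullet> l) * \<tau> / 6)"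
    by (simp only: coeff_series_theta_comp mult.assoc)
  then show ?thesis
    unfolding h_def \<sigma>_def by (rule mult_right_cancel[OF ee_nonzero, THEN iffD1])
qed

section \<open>Leading coefficients of the generators\<close>

lemma half_norm_0 [simp]: "half_norm 0 = 0"
  by (simp add: half_norm_def)

lemma finite_half_norm_le: "finite {y \<in> E8. half_norm y \<le> n}"
  by (rule finite_subset[OF _ finite_E8_norm_le[of "2 * real n"]]) (auto simp: half_norm)

text \<open>\<open>theta_coeff\<close> is 1 exactly when its exponent is the half norm of its
  vector, so only the vector y = l - x remains free.\<close>

lemma conv_theta_coeff:
  assumes "l \<in> E8"
  shows "conv f theta_coeff n l = (\<Sum>y | y \<in> E8 \<and> half_norm y \<le> n. f (n - half_norm y) (l - y))"
proof -
  define S where "S = {y \<in> E8. half_norm y \<le> n}"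
  define i where "i y = (n - half_norm y, l - y)" for y
  have inj: "inj_on i S" by (auto simp: inj_on_def i_def)
  have fin: "finite S" unfolding S_def by (rule finite_half_norm_le)
  have "conv f theta_coeff n l = (\<Sum>\<^sub>\<infinity>(m, x)\<in>i ` S. f m x)"
    unfolding conv_def
  proof (rule infsum_cong_neutral)
    fix p assume "p \<in> i ` S - {..n} \<times> E8"
    then show "(case p of (m, x) \<Rightarrow> f m x) = 0" using assms by (auto simp: i_def S_def intro: E8_diff)
  next
    fix p assume p: "p \<in> {..n} \<times> E8 - i ` S"
    obtain m x where mx: "p = (m, x)" "m \<le> n" "x \<in> E8" using p by auto
    have "half_norm (l - x) \<noteq> n - m"
    proof
      assume "half_norm (l - x) = n - m"
      then have "p = i (l - x)" "l - x \<in> S" using mx assms by (auto simp: i_def S_def E8_diff)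
      with p show False by blast
    qed
    then show "(case p of (m, x) \<Rightarrow> f m x * theta_coeff (n - m) (l - x)) = 0" by (simp add: mx theta_coeff_def)
  qed (auto simp: i_def S_def theta_coeff_def)
  also have "\<dots> = (\<Sum>(m, x)\<in>i ` S. f m x)" using fin by simp
  also have "\<dots> = (\<Sum>y\<in>S. f (n - half_norm y) (l - y))"
    by (subst sum.reindex[OF inj]) (simp add: i_def)
  finally show ?thesis by (simp add: S_def)
qed

lemma conv_theta_0: "l \<in> E8 \<Longrightarrow> conv f theta_coeff 0 l = f 0 l"
proof -
  assume l: "l \<in> E8"
  have "{y \<in> E8. half_norm y \<le> 0} = {0}" using half_norm_eq_0 by auto
  then show ?thesis unfolding conv_theta_coeff[OF l] by (simp add: half_norm_def)
qed

lemma conv_theta_1: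
  assumes l: "l \<in> E8" and f: "\<And>x. x \<in> E8 \<Longrightarrow> f 0 x \<noteq> 0 \<Longrightarrow> x = 0"
  shows "conv f theta_coeff 1 l = f 1 l + (if half_norm l = 1 then f 0 0 else 0)"
proof -
  have "(\<Sum>y | y \<in> E8 \<and> half_norm y \<le> 1. f (1 - half_norm y) (l - y)) =
      (\<Sum>y | y \<in> E8 \<and> half_norm y \<le> 1. (if y = 0 then f 1 l else 0) + (if y = l then (if half_norm l = 1 then f 0 0 else 0) else 0))"
  proof (rule sum.cong[OF HOL.refl])
    fix y assume y: "y \<in> {y \<in> E8. half_norm y \<le> 1}"
    consider "y = 0" | "half_norm y = 1" "y \<noteq> 0" using y half_norm_eq_0[of y] by fastforce
    then show "f (1 - half_norm y) (l - y) = (if y = 0 then f 1 l else 0) + (if y = l then (if half_norm l = 1 then f 0 0 else 0) else 0)"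
    proof cases
      case 1
      then show ?thesis by (auto simp: half_norm_def)
    next
      case 2
      then show ?thesis using f[of "l - y"] E8_diff[OF l] y by (cases "y = l") auto
    qed
  qed
  also have "\<dots> = f 1 l + (if half_norm l = 1 then f 0 0 else 0)"
    using finite_half_norm_le[of 1] l half_norm_eq_0[of 0] by (simp add: sum.distrib)
  finally show ?thesis unfolding conv_theta_coeff[OF l] .
qed

text \<open>The condition on the half norm of l excludes y = l, where \<open>f 0 0\<close> would
  enter.\<close>

lemma conv_theta_2:
  assumes l: "l \<in> E8" and f: "\<And>x. x \<in> E8 \<Longrightarrow> f 0 x \<noteq> 0 \<Longrightarrow> x = 0" and nl: "half_norm l \<noteq> 2"
  shows "conv f theta_coeff 2 l = f 2 l + (\<Sum>y | y \<in> E8 \<and> half_norm y = 1. f 1 (l - y))"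
proof -
  let ?S = "{y \<in> E8. half_norm y \<le> 2}"
  have "(\<Sum>y\<in>?S. f (2 - half_norm y) (l - y)) =
      (\<Sum>y\<in>?S. (if y = 0 then f 2 l else 0) + (if half_norm y = 1 then f 1 (l - y) else 0))"
  proof (rule sum.cong[OF HOL.refl])
    fix y assume y: "y \<in> ?S"
    consider "y = 0" | "half_norm y = 1" "y \<noteq> 0" | "half_norm y = 2" "y \<noteq> 0" "y \<noteq> l"
      using y half_norm_eq_0[of y] nl by fastforce
    then show "f (2 - half_norm y) (l - y) = (if y = 0 then f 2 l else 0) + (if half_norm y = 1 then f 1 (l - y) else 0)"
    proof cases
      case 3
      then show ?thesis using f[of "l - y"] E8_diff[OF l] y by auto
    qed (simp_all add: numeral_2_eq_2)
  qed
  also have "\<dots> = f 2 l + (\<Sum>y\<in>?S. if half_norm y = 1 then f 1 (l - y) else 0)"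
    using finite_half_norm_le[of 2] by (simp add: sum.distrib)
  also have "(\<Sum>y\<in>?S. if half_norm y = 1 then f 1 (l - y) else 0) = (\<Sum>y | y \<in> ?S \<and> half_norm y = 1. f 1 (l - y))"
    by (rule sum.inter_filter[symmetric, OF finite_half_norm_le])
  also have "{y. y \<in> ?S \<and> half_norm y = 1} = {y. y \<in> E8 \<and> half_norm y = 1}" by auto
  finally show ?thesis unfolding conv_theta_coeff[OF l] .
qed

text \<open>The least n with (l, l) <= 6 n for l = \<open>orbit_rep j\<close>, that is the first
  exponent allowed by the support condition.\<close>

definition min_exp :: "5 \<Rightarrow> nat" where
  "min_exp j = (if j = 1 then 0 else if j = 5 then 2 else 1)"

lemma half_norm_orbit_rep:
  "half_norm (orbit_rep 1) = 0" "half_norm (orbit_rep 2) = 1" "half_norm (orbit_rep 3) = 2"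
  "half_norm (orbit_rep 4) = 3" "half_norm (orbit_rep 5) = 4"
  by (simp_all add: half_norm_eq_iff[OF orbit_rep_in_E8] orbit_rep_norm)

lemma scaled_not_in_E8:
  assumes "t > 0" "\<not> t ^ 2 dvd half_norm l"
  shows "(1 / real t) *\<^sub>R l \<notin> E8"
proof
  assume "(1 / real t) *\<^sub>R l \<in> E8"
  from half_norm_scale[OF this, of t] assms show False by simp
qed

lemma half_orbit_rep_5: "(1 / 2) *\<^sub>R orbit_rep 5 \<notin> E8"
proof
  assume "(1 / 2) *\<^sub>R orbit_rep 5 \<in> E8"
  then obtain m :: "8 \<Rightarrow> int" where "\<And>i. 2 * ((1 / 2) *\<^sub>R orbit_rep 5) $ i = of_int (m i)"
    by (rule E8_double_int) (rule that)
  from this[of 1] have "1 / 2 = (of_int (m 1) :: real)" by (simp add: orbit_rep_simps)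
  then have "real_of_int 1 = of_int (2 * m 1)" by simp
  then have "1 = 2 * m 1" by (simp only: of_int_eq_iff)
  then show False by presburger
qed

text \<open>By \<open>half_norm_orbit_rep_5_minus_root\<close> these are the roots y for which
  \<open>orbit_rep 5 - y\<close> has norm 4. They count the decompositions that reach the last orbit
  in the products with \<open>theta_E8\<close>.\<close>

definition root_count :: nat where
  "root_count = card {y \<in> E8. half_norm y = 1 \<and> orbit_rep 5 \<bullet> y = 3}"

text \<open>The value 2 is the one that \<open>lead_independent\<close> must exclude; three explicit
  roots exceed it.\<close>

lemma root_count_neq_2: "root_count \<noteq> 2"
proof -
  define S where "S = {y \<in> E8. half_norm y = 1 \<and> orbit_rep 5 \<bullet> y = 3}"
  define T where "T = {vec8 1 0 0 0 0 0 0 1, vec8 0 1 0 0 0 0 0 1, vec8 0 0 1 0 0 0 0 1}"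
  have "vec8 1 0 0 0 0 0 0 1 \<noteq> vec8 0 1 0 0 0 0 0 1" "vec8 1 0 0 0 0 0 0 1 \<noteq> vec8 0 0 1 0 0 0 0 1"
    "vec8 0 1 0 0 0 0 0 1 \<noteq> vec8 0 0 1 0 0 0 0 1"
    by (auto simp: vec_eq_iff forall_8)
  then have "card T = 3" by (simp add: T_def)
  have E8: "vec8 1 0 0 0 0 0 0 1 \<in> E8" "vec8 0 1 0 0 0 0 0 1 \<in> E8" "vec8 0 0 1 0 0 0 0 1 \<in> E8"
    by (rule vec8_in_E8[where m = 1]; simp)+
  have "T \<subseteq> S"
    by (auto simp: T_def S_def E8 half_norm_eq_iff inner_vec8 orbit_rep_simps)
  moreover have "finite S"
    unfolding S_def by (rule finite_subset[OF _ finite_half_norm_le[of 1]]) auto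
  ultimately have "card T \<le> card S" by (intro card_mono)
  then show ?thesis using \<open>card T = 3\<close> by (simp add: root_count_def S_def)
qed

text \<open>If \<open>y\<close> is a root with \<open>(orbit_rep 5, y) \<ge> 4\<close>, equality holds in the Cauchy-Schwarz inequality and
  \<open>orbit_rep 5 = 2 y\<close>.\<close>

lemma half_norm_orbit_rep_5_minus_root:
  assumes y: "y \<in> E8" "half_norm y = 1"
  shows "half_norm (orbit_rep 5 - y) \<ge> 2" "half_norm (orbit_rep 5 - y) = 2 \<longleftrightarrow> orbit_rep 5 \<bullet> y = 3"
proof -
  let ?w = "orbit_rep 5"
  have d: "?w - y \<in> E8" by (rule E8_diff[OF orbit_rep_in_E8 y(1)])
  have yy: "y \<bullet> y = 2" using half_norm[OF y(1)] y(2) by simp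
  have "(?w - y) \<bullet> (?w - y) = 10 - 2 * (?w \<bullet> y)"
    by (simp add: inner_diff_left inner_diff_right orbit_rep_norm yy inner_commute[of y ?w])
  then have n: "2 * real (half_norm (?w - y)) = 10 - 2 * (?w \<bullet> y)" using half_norm[OF d] by simp
  then show "half_norm (?w - y) = 2 \<longleftrightarrow> ?w \<bullet> y = 3" by auto
  have "?w - 2 *\<^sub>R y \<noteq> 0"
  proof
    assume "?w - 2 *\<^sub>R y = 0"
    then have "(1 / 2) *\<^sub>R ?w = y" by simp
    with half_orbit_rep_5 y(1) show False by simp
  qed
  then have "0 < (?w - 2 *\<^sub>R y) \<bullet> (?w - 2 *\<^sub>R y)" by simp
  also have "\<dots> = 16 - 4 * (?w \<bullet> y)"
    by (simp add: inner_diff_left inner_diff_right orbit_rep_norm yy inner_commute[of y ?w])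
  finally show "half_norm (?w - y) \<ge> 2" using n by linarith
qed

text \<open>At n = 1 the lowered part sees only half norms up to 2, and half norm 2 means pairing 3
  with y. The raised part is absent: if half of the vector lies in E8, its half norm is a multiple
  of 4, too large for n = 1.\<close>

lemma level_2_half_orbit_rep_5:
  assumes y: "y \<in> E8" "half_norm y = 1"
  shows "level_coeff 2 \<kappa> u 1 (orbit_rep 5 - y) = (if orbit_rep 5 \<bullet> y = 3 then \<kappa> / 8 * u 0 else 0)"
proof -
  define x where "x = orbit_rep 5 - y"
  have n: "half_norm x \<ge> 2" "half_norm x = 2 \<longleftrightarrow> orbit_rep 5 \<bullet> y = 3"
    using half_norm_orbit_rep_5_minus_root[OF y] by (simp_all add: x_def)
  have "shifted u 1 (half_norm x div 2) = 0" if "(1 / 2) *\<^sub>R x \<in> E8"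
  proof -
    have "half_norm x = 4 * half_norm ((1 / 2) *\<^sub>R x)" using half_norm_scale[OF that, of 2] by simp
    then show ?thesis using n(1) by (auto simp: shifted_def)
  qed
  then show ?thesis
    using n unfolding x_def[symmetric] by (auto simp: level_coeff_def shifted_def)
qed

lemma level_coeff_support:
  assumes "x \<in> E8" "level_coeff t \<kappa> u 0 x \<noteq> 0" "t > 0"
  shows "x = 0"
proof -
  have "half_norm x = 0"
  proof (rule ccontr)
    assume nz: "half_norm x \<noteq> 0"
    have "half_norm x div t \<noteq> 0" if "(1 / real t) *\<^sub>R x \<in> E8"
      using half_norm_scale[OF that, of t] nz assms(3) by (simp add: power2_eq_square)
    with nz assms(2) show False by (cases "(1 / real t) *\<^sub>R x \<in> E8") (auto simp: level_coeff_def shifted_def)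
  qed
  then show ?thesis using half_norm_eq_0[OF assms(1)] by simp
qed

lemma sum_root_count:
  "(\<Sum>y | y \<in> E8 \<and> half_norm y = 1. if orbit_rep 5 \<bullet> y = 3 then c else 0) = of_nat root_count * (c :: complex)"
proof -
  have fin: "finite {y \<in> E8. half_norm y = 1}" by (rule finite_subset[OF _ finite_half_norm_le[of 1]]) auto
  show ?thesis
    unfolding sum.inter_filter[OF fin, symmetric] root_count_def by (simp add: conj_assoc)
qed

definition basis_form :: "5 \<Rightarrow> jfun" where
  "basis_form i = (if i = 1 then A_form 3 else if i = 2 then B_form 3
     else if i = 3 then (\<lambda>\<tau> z. A_form 2 \<tau> z * theta_E8 \<tau> z) else if i = 4 then (\<lambda>\<tau> z. B_form 2 \<tau> z * theta_E8 \<tau> z)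
     else (\<lambda>\<tau> z. theta_E8 \<tau> z ^ 3))"

definition basis_coeff :: "5 \<Rightarrow> nat \<Rightarrow> real ^ 8 \<Rightarrow> complex" where
  "basis_coeff i = (if i = 1 then A_coeff 3 else if i = 2 then B_coeff 3
     else if i = 3 then conv (A_coeff 2) theta_coeff else if i = 4 then conv (B_coeff 2) theta_coeff
     else conv (conv theta_coeff theta_coeff) theta_coeff)"

definition basis_weight :: "5 \<Rightarrow> int" where
  "basis_weight i = (if i = 1 then 4 else if i = 2 then 6 else if i = 3 then 8 else if i = 4 then 10 else 12)"

lemma basis_form_jacobi_form: "basis_form i \<in> jacobi_forms (basis_weight i) 3"
proof -
  have p: "prime (2 :: nat)" "prime (3 :: nat)" by simp_all
  note th = theta_E8_jacobi_form
  have 5: "(\<lambda>\<tau> z. theta_E8 \<tau> z ^ 3) \<in> jacobi_forms 12 3"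
    using jacobi_forms_mult[OF jacobi_forms_mult[OF th th] th] by (simp add: numeral_3_eq_3 mult.assoc)
  show ?thesis
    using exhaust_5[of i] A_form_jacobi_form[OF p(2)] B_form_jacobi_form[OF p(2)]
      jacobi_forms_mult[OF A_form_jacobi_form[OF p(1)] th] jacobi_forms_mult[OF B_form_jacobi_form[OF p(1)] th] 5
    by (auto simp: basis_form_def basis_weight_def)
qed

lemma basis_form_expansion: "has_expansion 3 (basis_form i) (basis_coeff i)"
proof -
  have p: "prime (2 :: nat)" "prime (3 :: nat)" by simp_all
  note th = theta_E8_expansion
  have 5: "has_expansion 3 (\<lambda>\<tau> z. theta_E8 \<tau> z ^ 3) (conv (conv theta_coeff theta_coeff) theta_coeff)"
    using has_expansion_mult[OF has_expansion_mult[OF th th] th] by (simp add: numeral_3_eq_3 mult.assoc)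
  show ?thesis
    using exhaust_5[of i] A_form_expansion[OF p(2)] B_form_expansion[OF p(2)]
      has_expansion_mult[OF A_form_expansion[OF p(1)] th] has_expansion_mult[OF B_form_expansion[OF p(1)] th] 5
    by (auto simp: basis_form_def basis_coeff_def)
qed

text \<open>The value at the cusp of the entry in row j and column i of
  \<open>basis_matrix\<close>.\<close>

definition lead :: "5 \<Rightarrow> 5 \<Rightarrow> complex" where
  "lead i j = basis_coeff i (min_exp j) (orbit_rep j)"

lemma sig_prime: "prime p \<Longrightarrow> sig 1 p = p + 1"
proof -
  assume p: "prime p"
  then have "{d. d dvd p} = {1, p}" by (auto simp: prime_nat_iff)
  then show ?thesis using p prime_gt_1_nat[OF p] by (simp add: sig_def divisor_sum_def)
qed

lemma sig_values: "sig 1 0 = 0" "sig 1 1 = 1" "sig 1 2 = 3"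
  using sig_prime[of 2] by (simp_all add: sig_def divisor_sum_def)

lemma E2_raised_coeff_values:
  "E2_raised_coeff 2 0 = 1" "E2_raised_coeff 2 1 = 24" "E2_raised_coeff 3 0 = 2" "E2_raised_coeff 3 1 = 24" "E2_raised_coeff 3 2 = 72"
  by (simp_all add: E2_raised_coeff_def sig_values del: One_nat_def)

text \<open>A vector divisible by t in E8 has half norm divisible by t^2. This leaves only
  \<open>orbit_rep 5\<close> with t = 2, and half of it has coordinates 1/4.\<close>

lemma scaled_orbit_rep_notin:
  assumes "j \<noteq> 1"
  shows "(1 / 3) *\<^sub>R orbit_rep j \<notin> E8" "(1 / 2) *\<^sub>R orbit_rep j \<notin> E8"
proof -
  have "half_norm (orbit_rep j) \<in> {1, 2, 3, 4}" using assms exhaust_5[of j] half_norm_orbit_rep by auto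
  then show "(1 / 3) *\<^sub>R orbit_rep j \<notin> E8" using scaled_not_in_E8[of 3 "orbit_rep j"] by auto
  show "(1 / 2) *\<^sub>R orbit_rep j \<notin> E8"
  proof (cases "j = 5")
    case False
    then have "half_norm (orbit_rep j) \<in> {1, 2, 3}" using assms exhaust_5[of j] half_norm_orbit_rep by auto
    then show ?thesis using scaled_not_in_E8[of 2 "orbit_rep j"] by auto
  qed (simp add: half_orbit_rep_5)
qed

text \<open>The raised part drops out, so the leading coefficients reduce to single coefficients of
  u.\<close>

lemma level_coeff_orbit_rep:
  assumes "j \<noteq> 1"
  shows "level_coeff 2 \<kappa> u n (orbit_rep j) = \<kappa> / 8 * shifted u (2 * n) (half_norm (orbit_rep j))"
    "level_coeff 3 \<kappa> u n (orbit_rep j) = \<kappa> / 27 * shifted u (3 * n) (half_norm (orbit_rep j))"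
  using scaled_orbit_rep_notin[OF assms] by (simp_all add: level_coeff_def)

text \<open>As u is 1 at 0 and 0 elsewhere, an entry beyond the first is nonzero only where 3 n
  equals the half norm. This happens for the fourth orbit, with value (1/27) / (1 + 1/27) =
  1/28.\<close>

lemma lead_A3: "lead 1 1 = 1" "lead 1 2 = 0" "lead 1 3 = 0" "lead 1 4 = 1 / 28" "lead 1 5 = 0"
  by (simp_all add: lead_def basis_coeff_def A_coeff_def min_exp_def level_coeff_orbit_rep half_norm_orbit_rep shifted_def
    orbit_rep_simps(1) level_coeff_0)

text \<open>With kappa = - 1/3 the normalised factor is (- 1/81) / (160/81) = - 1/160. Beyond the
  first orbit it multiplies the coefficients 72, 24, 2, 72 of
  \<open>E2_raised_coeff 3\<close>.\<close>

lemma lead_B3: "lead 2 1 = 1" "lead 2 2 = - 9 / 20" "lead 2 3 = - 3 / 20" "lead 2 4 = - 1 / 80" "lead 2 5 = - 9 / 20"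
  by (simp_all add: lead_def basis_coeff_def B_coeff_def min_exp_def level_coeff_orbit_rep half_norm_orbit_rep shifted_def
    orbit_rep_simps(1) level_coeff_0 E2_raised_coeff_values E2_raised_coeff_values(4)[unfolded One_nat_def])

text \<open>The product with \<open>theta_E8\<close> distributes n and l over the two factors. At
  the second orbit, (1 + kappa / 8) u 0 is the contribution of a root supplied by theta alone; at
  the fifth, \<open>root_count\<close> counts the roots that theta can supply.\<close>

lemma conv_level_coeff:
  assumes "\<And>n l. f n l = c * level_coeff 2 \<kappa> u n l"
  shows "conv f theta_coeff 0 (orbit_rep 1) = c * (1 + \<kappa> / 8) * u 0"
    "conv f theta_coeff 1 (orbit_rep 2) = c * (\<kappa> / 8 * u 1 + (1 + \<kappa> / 8) * u 0)"
    "conv f theta_coeff 1 (orbit_rep 3) = c * (\<kappa> / 8 * u 0)"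
    "conv f theta_coeff 1 (orbit_rep 4) = 0"
    "conv f theta_coeff 2 (orbit_rep 5) = c * (1 + of_nat root_count) * (\<kappa> / 8 * u 0)"
proof -
  have f0: "x = 0" if "x \<in> E8" "f 0 x \<noteq> 0" for x
    using level_coeff_support[OF that(1)] that(2) assms by fastforce
  note 1 = conv_theta_1[of _ f, OF orbit_rep_in_E8 f0]
  note 2 = conv_theta_2[of _ f, OF orbit_rep_in_E8 f0]
  have f00: "f 0 0 = c * (1 + \<kappa> / 8) * u 0" by (simp add: assms level_coeff_0)
  show "conv f theta_coeff 0 (orbit_rep 1) = c * (1 + \<kappa> / 8) * u 0"
    by (simp add: conv_theta_0[OF orbit_rep_in_E8]) (simp add: orbit_rep_simps(1) f00)
  show "conv f theta_coeff 1 (orbit_rep 2) = c * (\<kappa> / 8 * u 1 + (1 + \<kappa> / 8) * u 0)"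
    by (subst 1) (simp_all add: level_coeff_0 half_norm_orbit_rep assms level_coeff_orbit_rep shifted_def ring_distribs)
  show "conv f theta_coeff 1 (orbit_rep 3) = c * (\<kappa> / 8 * u 0)" "conv f theta_coeff 1 (orbit_rep 4) = 0"
    by (subst 1; simp add: half_norm_orbit_rep assms level_coeff_orbit_rep shifted_def)+
  have "(\<Sum>y | y \<in> E8 \<and> half_norm y = 1. f 1 (orbit_rep 5 - y)) =
      (\<Sum>y | y \<in> E8 \<and> half_norm y = 1. if orbit_rep 5 \<bullet> y = 3 then c * (\<kappa> / 8 * u 0) else 0)"
    by (intro sum.cong) (auto simp: assms level_2_half_orbit_rep_5 simp del: One_nat_def)
  also have "\<dots> = of_nat root_count * (c * (\<kappa> / 8 * u 0))" by (rule sum_root_count)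
  finally show "conv f theta_coeff 2 (orbit_rep 5) = c * (1 + of_nat root_count) * (\<kappa> / 8 * u 0)"
    by (subst 2) (simp_all add: half_norm_orbit_rep assms level_coeff_orbit_rep shifted_def ring_distribs)
qed

text \<open>The normalised factor is (1/8) / (9/8) = 1/9; for B_2 in the next lemma it is (- 1/16) /
  (15/16) = - 1/15.\<close>

lemma lead_A2: "lead 3 1 = 1" "lead 3 2 = 1" "lead 3 3 = 1 / 9" "lead 3 4 = 0" "lead 3 5 = (1 + of_nat root_count) / 9"
  unfolding lead_def
  by (simp_all add: basis_coeff_def min_exp_def conv_level_coeff[OF A_coeff_def] del: One_nat_def)

lemma lead_B2: "lead 4 1 = 1" "lead 4 2 = - 3 / 5" "lead 4 3 = - 1 / 15" "lead 4 4 = 0" "lead 4 5 = - (1 + of_nat root_count) / 15"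
  unfolding lead_def
  by (simp_all add: basis_coeff_def min_exp_def conv_level_coeff[OF B_coeff_def] E2_raised_coeff_values field_simps del: One_nat_def)

text \<open>A coefficient counts the ways of writing l as a sum of three vectors whose half norms
  add up to n. A root with n = 1 has three. The third and fourth representatives are not roots, and
  the fifth is not a sum of two roots: two roots have a sum of norm 8 only if they are equal, and it
  is not twice a root.\<close>

lemma lead_theta: "lead 5 1 = 1" "lead 5 2 = 3" "lead 5 3 = 0" "lead 5 4 = 0" "lead 5 5 = 0"
proof -
  define g where "g = conv theta_coeff theta_coeff"
  have th0: "x = 0" if "x \<in> E8" "theta_coeff 0 x \<noteq> 0" for x
    using that half_norm_eq_0[of x] by (auto simp: theta_coeff_def split: if_splits)
  have g0: "g 0 x = theta_coeff 0 x" if "x \<in> E8" for x unfolding g_def by (rule conv_theta_0[OF that])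
  have g00: "x = 0" if "x \<in> E8" "g 0 x \<noteq> 0" for x
    using th0 that by (simp add: g0)
  have g1: "g 1 x = (if half_norm x = 1 then 2 else 0)" if "x \<in> E8" for x
    unfolding g_def by (subst conv_theta_1[OF that th0]) (auto simp: theta_coeff_def)
  note 1 = conv_theta_1[of _ g, OF orbit_rep_in_E8 g00]
  have g2: "g 2 (orbit_rep 5) = 0"
  proof -
    have "theta_coeff 1 (orbit_rep 5 - y) = 0" if "y \<in> E8" "half_norm y = 1" for y
      using half_norm_orbit_rep_5_minus_root(1)[OF that] by (simp add: theta_coeff_def)
    then show ?thesis
      unfolding g_def by (subst conv_theta_2[OF orbit_rep_in_E8 th0]) (auto simp: half_norm_orbit_rep theta_coeff_def)
  qed
  have 2: "conv g theta_coeff 2 (orbit_rep 5) = 0"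
  proof -
    have "g 1 (orbit_rep 5 - y) = 0" if "y \<in> E8" "half_norm y = 1" for y
      using half_norm_orbit_rep_5_minus_root(1)[OF that] g1[OF E8_diff[OF orbit_rep_in_E8 that(1)]] by simp
    then show ?thesis
      by (subst conv_theta_2[OF orbit_rep_in_E8 g00]) (auto simp: half_norm_orbit_rep g2)
  qed
  have 0: "conv g theta_coeff 0 (orbit_rep 1) = 1"
    by (simp add: conv_theta_0[OF orbit_rep_in_E8] g0[OF orbit_rep_in_E8] half_norm_orbit_rep theta_coeff_def)
  have b: "basis_coeff 5 = conv g theta_coeff" by (simp add: basis_coeff_def g_def)
  show "lead 5 1 = 1" "lead 5 2 = 3" "lead 5 3 = 0" "lead 5 4 = 0" "lead 5 5 = 0"
    unfolding lead_def b
    using 0 1[of 2] 1[of 3] 1[of 4] 2 g0[OF E8_0] by (simp_all add: min_exp_def g1[OF orbit_rep_in_E8] half_norm_orbit_rep theta_coeff_def del: One_nat_def)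
qed

text \<open>The fifth equation minus 1 + N times the third leaves a 2 * (N - 2) * (3/20) = 0. The
  other unknowns then follow by elimination.\<close>

lemma lead_independent:
  assumes "\<And>j. (\<Sum>i\<in>UNIV. a i * lead i j) = 0"
  shows "a i = 0"
proof -
  define N where "N = complex_of_nat root_count"
  have N: "N \<noteq> 2" using root_count_neq_2 unfolding N_def by (metis of_nat_eq_iff of_nat_numeral)
  note A = assms[unfolded sum_5]
  have e1: "a 1 + a 2 + a 3 + a 4 + a 5 = 0"
    using A[of 1] by (simp add: lead_A3 lead_B3 lead_A2 lead_B2 lead_theta)
  have e2: "a 2 * (- 9 / 20) + a 3 + a 4 * (- 3 / 5) + a 5 * 3 = 0"
    using A[of 2] by (simp add: lead_A3 lead_B3 lead_A2 lead_B2 lead_theta)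
  have e3: "a 2 * (- 3 / 20) + a 3 / 9 + a 4 * (- 1 / 15) = 0"
    using A[of 3] by (simp add: lead_A3 lead_B3 lead_A2 lead_B2 lead_theta)
  have e4: "a 1 / 28 + a 2 * (- 1 / 80) = 0"
    using A[of 4] by (simp add: lead_A3 lead_B3 lead_A2 lead_B2 lead_theta)
  have e5: "a 2 * (- 9 / 20) + a 3 * (1 + N) / 9 + a 4 * (- (1 + N) / 15) = 0"
    using A[of 5] by (simp add: lead_A3 lead_B3 lead_A2 lead_B2 lead_theta N_def)
  have "a 2 * (N - 2) * (3 / 20) = (a 2 * (- 9 / 20) + a 3 * (1 + N) / 9 + a 4 * (- (1 + N) / 15)) -
      (1 + N) * (a 2 * (- 3 / 20) + a 3 / 9 + a 4 * (- 1 / 15))" by (simp add: field_simps)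
  then have "a 2 * (N - 2) * (3 / 20) = 0" unfolding e3 e5 by simp
  then have a2: "a 2 = 0" using N by simp
  have a1: "a 1 = 0" using e4 a2 by simp
  have "a 5 * 3 = (a 2 * (- 9 / 20) + a 3 + a 4 * (- 3 / 5) + a 5 * 3) - 9 * (a 2 * (- 3 / 20) + a 3 / 9 + a 4 * (- 1 / 15))"
    by (simp add: a2 field_simps)
  then have a5: "a 5 = 0" unfolding e2 e3 by simp
  have "a 4 * (8 / 5) = (a 1 + a 2 + a 3 + a 4 + a 5) - 9 * (a 2 * (- 3 / 20) + a 3 / 9 + a 4 * (- 1 / 15))"
    by (simp add: a1 a2 a5 field_simps)
  then have a4: "a 4 = 0" unfolding e1 e3 by simp
  have a3: "a 3 = 0" using e1 a1 a2 a4 a5 by simp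
  show ?thesis using exhaust_5[of i] a1 a2 a3 a4 a5 by auto
qed

section \<open>The determinant of the generators\<close>

text \<open>The series with its forced power of q removed, so that the leading coefficient becomes
  the value at 0.\<close>

definition reduced_series :: "(nat \<Rightarrow> real ^ 8 \<Rightarrow> complex) \<Rightarrow> 5 \<Rightarrow> complex \<Rightarrow> complex" where
  "reduced_series f j q = (\<Sum>n. f (n + min_exp j) (orbit_rep j) * q ^ n)"

lemma reduced_series_0: "reduced_series f j 0 = f (min_exp j) (orbit_rep j)"
  by (simp add: reduced_series_def)

lemma summable_reduced_series:
  assumes f: "has_expansion t \<phi> f" and q: "norm q < 1"
  shows "summable (\<lambda>n. f (n + min_exp j) (orbit_rep j) * q ^ n)"
proof (cases "q = 0")
  case False
  have "summable (\<lambda>n. f n (orbit_rep j) * q ^ n)" by (rule summable_coeff_series[OF f orbit_rep_in_E8 q])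
  then have "summable (\<lambda>n. f (n + min_exp j) (orbit_rep j) * q ^ (n + min_exp j))"
    by (subst summable_iff_shift)
  from summable_mult2[OF this, of "inverse (q ^ min_exp j)"] show ?thesis
    using False by (simp add: power_add mult.assoc)
qed simp

lemma reduced_series_holomorphic:
  assumes "has_expansion t \<phi> f"
  shows "reduced_series f j holomorphic_on ball 0 1"
proof -
  have "(\<lambda>q. \<Sum>n. f (n + min_exp j) (orbit_rep j) * q ^ n) holomorphic_on ball 0 1"
    by (rule holomorphic_on_power_series) (rule summable_reduced_series[OF assms])
  then show ?thesis by (simp add: reduced_series_def[abs_def])
qed

lemma coeff_series_orbit_rep:
  assumes f: "has_expansion 3 \<phi> f" and q: "norm q < 1"
  shows "coeff_series f (orbit_rep j) q = q ^ min_exp j * reduced_series f j q"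
proof -
  have zero: "f n (orbit_rep j) = 0" if "n < min_exp j" for n
  proof (rule ccontr)
    assume "f n (orbit_rep j) \<noteq> 0"
    then have "orbit_rep j \<bullet> orbit_rep j \<le> 2 * real n * real 3" by (rule has_expansionD(1)[OF f orbit_rep_in_E8])
    then show False using that exhaust_5[of j] by (auto simp: orbit_rep_norm min_exp_def)
  qed
  have "coeff_series f (orbit_rep j) q = (\<Sum>n. f (n + min_exp j) (orbit_rep j) * q ^ (n + min_exp j)) + (\<Sum>n<min_exp j. f n (orbit_rep j) * q ^ n)"
    unfolding coeff_series_def by (rule suminf_split_initial_segment[OF summable_coeff_series[OF f orbit_rep_in_E8 q]])
  also have "(\<Sum>n<min_exp j. f n (orbit_rep j) * q ^ n) = 0" using zero by simp
  also have "(\<Sum>n. f (n + min_exp j) (orbit_rep j) * q ^ (n + min_exp j)) = (\<Sum>n. q ^ min_exp j * (f (n + min_exp j) (orbit_rep j) * q ^ n))"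
    by (simp add: power_add mult_ac)
  also have "\<dots> = q ^ min_exp j * reduced_series f j q"
    unfolding reduced_series_def by (rule suminf_mult[OF summable_reduced_series[OF f q]])
  finally show ?thesis by simp
qed

text \<open>The values are 0, 2/3, 1/3, 0, 2/3. Their sum 5/3 is the order of the determinant at the
  cusp.\<close>

definition theta_exponent :: "5 \<Rightarrow> complex" where
  "theta_exponent j = of_nat (min_exp j) - of_real (orbit_rep j \<bullet> orbit_rep j) / 6"

lemma theta_comp_orbit_rep:
  assumes f: "has_expansion 3 \<phi> f" and \<tau>: "\<tau> \<in> uhp"
  shows "theta_comp f (orbit_rep j) \<tau> = ee (theta_exponent j * \<tau>) * reduced_series f j (ee \<tau>)"
proof -
  have "theta_exponent j * \<tau> = of_nat (min_exp j) * \<tau> + - (of_real (orbit_rep j \<bullet> orbit_rep j) * \<tau> / 6)"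
    by (simp add: theta_exponent_def algebra_simps)
  then show ?thesis
    unfolding theta_comp_def coeff_series_orbit_rep[OF f norm_ee_less_1[OF \<tau>]] by (simp only: ee_add ee_power mult_ac)
qed

definition basis_matrix :: "complex \<Rightarrow> complex ^ 5 ^ 5" where
  "basis_matrix q = (\<chi> j i. reduced_series (basis_coeff i) j q)"

lemma det_neq_0_iff:
  fixes A :: "complex ^ 'n ^ 'n"
  shows "det A \<noteq> 0 \<longleftrightarrow> (\<forall>x. A *v x = 0 \<longrightarrow> x = 0)"
  unfolding invertible_det_nz[symmetric] invertible_left_inverse matrix_left_invertible_ker ..

lemma det_basis_matrix_0: "det (basis_matrix 0) \<noteq> 0"
  unfolding det_neq_0_iff
proof (intro allI impI)
  fix x :: "complex ^ 5" assume "basis_matrix 0 *v x = 0"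
  then have "(\<Sum>i\<in>UNIV. x $ i * lead i j) = 0" for j
    by (simp add: vec_eq_iff matrix_vector_mult_def basis_matrix_def reduced_series_0 lead_def mult.commute)
  then show "x = 0" using lead_independent[of "\<lambda>i. x $ i"] by (simp add: vec_eq_iff)
qed

lemma det_holomorphic:
  fixes A :: "complex \<Rightarrow> complex ^ 'n ^ 'n"
  assumes "\<And>i j. (\<lambda>q. A q $ i $ j) holomorphic_on S"
  shows "(\<lambda>q. det (A q)) holomorphic_on S"
proof -
  have "(\<lambda>q. of_int (sign p) * (\<Prod>i\<in>UNIV. A q $ i $ p i)) holomorphic_on S" for p
    by (rule holomorphic_on_mult[OF holomorphic_on_const holomorphic_on_prod]) (rule assms)
  then show ?thesis unfolding det_def by (rule holomorphic_on_sum)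
qed

lemma basis_matrix_holomorphic: "(\<lambda>q. basis_matrix q $ j $ i) holomorphic_on ball 0 1"
proof -
  have "(\<lambda>q. basis_matrix q $ j $ i) = reduced_series (basis_coeff i) j" by (simp add: basis_matrix_def fun_eq_iff)
  then show ?thesis using reduced_series_holomorphic[OF basis_form_expansion] by simp
qed

text \<open>The matrix \<open>C\<close> is the Weil representation of \<open>S\<close>, restricted to the invariants of \<open>W(E\<^sub>8)\<close>.\<close>

lemma theta_comp_matrix_inversion:
  obtains C :: "complex ^ 5 ^ 5" where "\<And>\<phi> k f \<tau> j. \<phi> \<in> jacobi_forms k 3 \<Longrightarrow> has_expansion 3 \<phi> f \<Longrightarrow> \<tau> \<in> uhp \<Longrightarrow>
    \<tau> powi k * theta_comp f (orbit_rep j) \<tau> = \<tau> ^ 4 * (\<Sum>i\<in>UNIV. C $ j $ i * theta_comp f (orbit_rep i) (- 1 / \<tau>))"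
proof -
  obtain R where R: "finite R" "R \<subseteq> E8" "bij_betw (\<lambda>(\<gamma>, x). \<gamma> + 3 *\<^sub>R x) (R \<times> E8) E8"
    by (rule E8_mod_3_representatives) (rule that)
  have "\<forall>\<gamma>. \<exists>j. \<gamma> \<in> E8 \<longrightarrow> (\<forall>h. invariant_mod_3 h \<longrightarrow> h \<gamma> = h (orbit_rep j))"
    using orbit_representative by blast
  then obtain cls where cls: "\<And>\<gamma> h. \<gamma> \<in> E8 \<Longrightarrow> invariant_mod_3 h \<Longrightarrow> h \<gamma> = h (orbit_rep (cls \<gamma>))" by metis
  define C :: "complex ^ 5 ^ 5" where
    "C = (\<chi> j i. (\<Sum>\<gamma> | \<gamma> \<in> R \<and> cls \<gamma> = i. ee (- (of_real (orbit_rep j \<bullet> \<gamma>) / 3))) / 81)"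
  show ?thesis
  proof (rule that[of C])
    fix \<phi> k f \<tau> j assume A: "\<phi> \<in> jacobi_forms k 3" "has_expansion 3 \<phi> f" and \<tau>: "\<tau> \<in> uhp"
    define h where "h l = theta_comp f l (- 1 / \<tau>)" for l
    have "invariant_mod_3 h" unfolding h_def by (rule theta_comp_invariant[OF A inversion_in_uhp[OF \<tau>]])
    then have "(\<Sum>\<gamma>\<in>R. h \<gamma> * ee (- (of_real (orbit_rep j \<bullet> \<gamma>) / 3))) =
        (\<Sum>\<gamma>\<in>R. h (orbit_rep (cls \<gamma>)) * ee (- (of_real (orbit_rep j \<bullet> \<gamma>) / 3)))"
      using cls R(2) by (intro sum.cong) auto
    also have "\<dots> = (\<Sum>i\<in>UNIV. \<Sum>\<gamma> | \<gamma> \<in> R \<and> cls \<gamma> = i. h (orbit_rep (cls \<gamma>)) * ee (- (of_real (orbit_rep j \<bullet> \<gamma>) / 3)))"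
      using R(1) by (intro sum.group[symmetric]) auto
    also have "\<dots> = (\<Sum>i\<in>UNIV. h (orbit_rep i) * (\<Sum>\<gamma> | \<gamma> \<in> R \<and> cls \<gamma> = i. ee (- (of_real (orbit_rep j \<bullet> \<gamma>) / 3))))"
      unfolding sum_distrib_left by (intro sum.cong) auto
    also have "\<dots> = 81 * (\<Sum>i\<in>UNIV. C $ j $ i * h (orbit_rep i))"
      by (subst sum_distrib_left) (simp add: C_def mult.commute)
    finally show "\<tau> powi k * theta_comp f (orbit_rep j) \<tau> = \<tau> ^ 4 * (\<Sum>i\<in>UNIV. C $ j $ i * theta_comp f (orbit_rep i) (- 1 / \<tau>))"
      using theta_comp_inversion[OF A \<tau> orbit_rep_in_E8 R, of j] by (simp add: h_def)
  qed
qed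

lemma prod_5: "prod f (UNIV :: 5 set) = f 1 * f 2 * f 3 * f 4 * f 5"
  unfolding UNIV_5 by (simp add: mult.assoc)

text \<open>The determinant c of the inversion matrix is not computed: applying inversion twice
  gives c^6 = 1, so |G| is invariant under inversion, which is all that
  \<open>modular_invariant_constant\<close> asks for.\<close>

lemma det_basis_matrix_neq_0:
  assumes q: "norm q < 1"
  shows "det (basis_matrix q) \<noteq> 0"
proof -
  define P where "P q = det (basis_matrix q)" for q
  define H :: "complex \<Rightarrow> complex ^ 5 ^ 5" where "H \<tau> = (\<chi> j i. theta_comp (basis_coeff i) (orbit_rep j) \<tau>)" for \<tau>
  \<comment> \<open>The cube clears the thirds in the exponents of q, and the resulting q^5 cancels
    against that of \<open>DelQ\<close> to the fifth power. So \<open>G\<close> extends the quotient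
    of the cubed determinant by this power to the cusp.\<close>
  define G where "G q = P q ^ 3 / eulerQ q ^ 5" for q
  have exps: "theta_exponent 1 * \<tau> + theta_exponent 2 * \<tau> + theta_exponent 3 * \<tau> + theta_exponent 4 * \<tau> + theta_exponent 5 * \<tau> = 5 * \<tau> / 3" for \<tau>
    by (simp add: theta_exponent_def orbit_rep_norm min_exp_def algebra_simps)
  have DG: "det (H \<tau>) ^ 3 = DelQ (ee \<tau>) ^ 5 * G (ee \<tau>)" if \<tau>: "\<tau> \<in> uhp" for \<tau>
  proof -
    have "H \<tau> = (\<chi> j. ee (theta_exponent j * \<tau>) *s (basis_matrix (ee \<tau>) $ j))"
      by (simp add: vec_eq_iff H_def basis_matrix_def theta_comp_orbit_rep[OF basis_form_expansion \<tau>])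
    then have "det (H \<tau>) = (\<Prod>j\<in>UNIV. ee (theta_exponent j * \<tau>)) * P (ee \<tau>)"
      by (simp only: det_rows_mul vec_nth_inverse P_def)
    also have "(\<Prod>j\<in>UNIV. ee (theta_exponent j * \<tau>)) = ee (5 * \<tau> / 3)"
      unfolding prod_5 ee_add[symmetric] exps ..
    finally have "det (H \<tau>) ^ 3 = ee (5 * \<tau> / 3) ^ 3 * P (ee \<tau>) ^ 3" by (simp add: power_mult_distrib)
    also have "ee (5 * \<tau> / 3) ^ 3 = ee \<tau> ^ 5" by (simp add: ee_power)
    finally show ?thesis by (simp add: G_def DelQ_def power_mult_distrib)
  qed
  obtain C :: "complex ^ 5 ^ 5" where C: "\<And>\<phi> k f \<tau> j. \<phi> \<in> jacobi_forms k 3 \<Longrightarrow> has_expansion 3 \<phi> f \<Longrightarrow> \<tau> \<in> uhp \<Longrightarrow>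
    \<tau> powi k * theta_comp f (orbit_rep j) \<tau> = \<tau> ^ 4 * (\<Sum>i\<in>UNIV. C $ j $ i * theta_comp f (orbit_rep i) (- 1 / \<tau>))"
    by (rule theta_comp_matrix_inversion) (rule that)
  define c where "c = det C"
  have inv: "c ^ 3 * G (ee (- 1 / \<tau>)) = G (ee \<tau>)" if \<tau>: "\<tau> \<in> uhp" for \<tau>
  proof -
    have \<tau>0: "\<tau> \<noteq> 0" by (rule uhp_nonzero[OF \<tau>])
    have CH: "\<tau> powi basis_weight i * H \<tau> $ j $ i = \<tau> ^ 4 * (C ** H (- 1 / \<tau>)) $ j $ i" for i j
      using C[OF basis_form_jacobi_form basis_form_expansion \<tau>, of i j] by (simp add: H_def matrix_matrix_mult_def)
    \<comment> \<open>The weights scale columns; transposing turns this into the row scaling that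
      \<open>det_rows_mul\<close> handles.\<close>
    have "(\<chi> i. (\<tau> powi basis_weight i) *s (transpose (H \<tau>) $ i)) = (\<chi> i. (\<tau> ^ 4) *s (transpose (C ** H (- 1 / \<tau>)) $ i))"
      using CH by (simp add: vec_eq_iff transpose_def)
    then have "det (\<chi> i. (\<tau> powi basis_weight i) *s (transpose (H \<tau>) $ i)) = det (\<chi> i. (\<tau> ^ 4) *s (transpose (C ** H (- 1 / \<tau>)) $ i))"
      by (rule arg_cong)
    then have "(\<Prod>i\<in>UNIV. \<tau> powi basis_weight i) * det (H \<tau>) = (\<Prod>i\<in>(UNIV :: 5 set). \<tau> ^ 4) * (c * det (H (- 1 / \<tau>)))"
      unfolding det_rows_mul vec_nth_inverse det_transpose det_mul c_def .
    moreover have "(\<Prod>i\<in>UNIV. \<tau> powi basis_weight i) = \<tau> ^ 40"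
      by (simp add: prod_5 basis_weight_def power_int_def flip: power_add)
    ultimately have "\<tau> ^ 20 * (\<tau> ^ 20 * det (H \<tau>)) = \<tau> ^ 20 * (c * det (H (- 1 / \<tau>)))"
      by (simp add: mult.assoc[symmetric] flip: power_add power_mult)
    moreover have "\<tau> ^ 20 \<noteq> 0" using \<tau>0 by simp
    ultimately have "\<tau> ^ 20 * det (H \<tau>) = c * det (H (- 1 / \<tau>))" by (metis mult_left_cancel)
    then have "(\<tau> ^ 20 * det (H \<tau>)) ^ 3 = (c * det (H (- 1 / \<tau>))) ^ 3" by simp
    then have "\<tau> ^ 60 * det (H \<tau>) ^ 3 = c ^ 3 * det (H (- 1 / \<tau>)) ^ 3"
      by (simp add: power_mult_distrib flip: power_mult)
    moreover have "DelQ (ee (- 1 / \<tau>)) ^ 5 = \<tau> ^ 60 * DelQ (ee \<tau>) ^ 5"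
      by (simp only: DelQ_inversion[OF \<tau>] power_mult_distrib power_mult[symmetric]) simp
    ultimately have "(\<tau> ^ 60 * DelQ (ee \<tau>) ^ 5) * G (ee \<tau>) = (\<tau> ^ 60 * DelQ (ee \<tau>) ^ 5) * (c ^ 3 * G (ee (- 1 / \<tau>)))"
      unfolding DG[OF \<tau>] DG[OF inversion_in_uhp[OF \<tau>]] by (simp only: mult_ac)
    then show ?thesis using \<tau>0 DelQ_nonzero[OF ee_nonzero] by simp
  qed
  have hol: "G holomorphic_on ball 0 1"
    unfolding G_def[abs_def] P_def
    by (intro holomorphic_intros det_holomorphic basis_matrix_holomorphic eulerQ_holomorphic) auto
  have G0: "G 0 \<noteq> 0" using det_basis_matrix_0 by (simp add: G_def P_def)
  \<comment> \<open>A point away from the cusp at which G can be cancelled from c^6 G = G.\<close>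
  have "\<exists>\<tau>\<in>uhp. G (ee \<tau>) \<noteq> 0"
  proof (rule ccontr)
    assume "\<not> ?thesis"
    then have "G q = 0" if "q \<noteq> 0" "norm q < 1" for q using ee_surj_uhp[OF that] by metis
    with holomorphic_zero_at_0[OF hol] G0 show False by blast
  qed
  then obtain \<tau> where \<tau>: "\<tau> \<in> uhp" "G (ee \<tau>) \<noteq> 0" by blast
  have "c ^ 3 * (c ^ 3 * G (ee \<tau>)) = G (ee \<tau>)"
    using inv[OF inversion_in_uhp[OF \<tau>(1)]] inv[OF \<tau>(1)] by simp
  then have "(c ^ 3) ^ 2 = 1" using \<tau>(2) by (simp add: power2_eq_square mult.assoc[symmetric])
  then have "norm (c ^ 3) ^ 2 = 1" by (metis norm_one norm_power)
  then have "norm (c ^ 3) = 1" by (simp add: power2_eq_1_iff) (smt (verit) norm_ge_zero zero_le_power)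
  then have "norm (G (ee (- 1 / \<tau>))) = norm (G (ee \<tau>))" if "\<tau> \<in> uhp" for \<tau>
    using arg_cong[OF inv[OF that], of norm] by (simp add: norm_mult)
  then have "G q = G 0" by (rule modular_invariant_constant[OF hol _ q])
  then show ?thesis using G0 by (auto simp: G_def P_def)
qed

section \<open>Spanning and independence\<close>

text \<open>Stronger than independence over the ring: at each fixed tau the five functions of z are
  linearly independent over the complex numbers. In this form it also identifies the coefficients of
  a decomposition after inversion.\<close>

lemma basis_form_independent:
  assumes \<tau>: "\<tau> \<in> uhp" and zero: "\<And>z. (\<Sum>i\<in>UNIV. a i * basis_form i \<tau> z) = 0"
  shows "a i = 0"
proof -
  have "((\<lambda>l. \<Sum>i\<in>UNIV. a i * (coeff_series (basis_coeff i) l (ee \<tau>) * ee (cdot (cvec l) z))) has_sum 0) E8" for z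
    unfolding zero[of z, symmetric]
    by (intro has_sum_finite_sum has_sum_cmult_right coeff_series_expansion[OF basis_form_expansion \<tau>]) auto
  then have "((\<lambda>l. (\<Sum>i\<in>UNIV. a i * coeff_series (basis_coeff i) l (ee \<tau>)) * ee (cdot (cvec l) z)) has_sum 0) E8" for z
    by (simp add: sum_distrib_right mult.assoc)
  then have coeff: "(\<Sum>i\<in>UNIV. a i * coeff_series (basis_coeff i) l (ee \<tau>)) = 0" if "l \<in> E8" for l
    by (rule fourier_coefficient_zero) (rule that)
  have "basis_matrix (ee \<tau>) *v (\<chi> i. a i) = 0"
    unfolding vec_eq_iff
  proof
    fix j
    have "(\<Sum>i\<in>UNIV. a i * coeff_series (basis_coeff i) (orbit_rep j) (ee \<tau>)) =
        ee \<tau> ^ min_exp j * (basis_matrix (ee \<tau>) *v (\<chi> i. a i)) $ j"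
      by (simp add: coeff_series_orbit_rep[OF basis_form_expansion norm_ee_less_1[OF \<tau>]] matrix_vector_mult_def
          basis_matrix_def sum_distrib_left mult_ac)
    then show "(basis_matrix (ee \<tau>) *v (\<chi> i. a i)) $ j = 0 $ j" using coeff[OF orbit_rep_in_E8, of j] by simp
  qed
  then have "(\<chi> i. a i) = 0" using det_basis_matrix_neq_0[OF norm_ee_less_1[OF \<tau>]] unfolding det_neq_0_iff by blast
  then show ?thesis by (simp add: vec_eq_iff)
qed

lemma jacobi_form_decomposition:
  assumes \<phi>: "\<phi> \<in> jacobi_forms k 3"
  obtains m :: "5 \<Rightarrow> complex \<Rightarrow> complex" where "\<And>i. m i \<in> mod_ring"
    "\<And>\<tau> z. \<tau> \<in> uhp \<Longrightarrow> \<phi> \<tau> z = (\<Sum>i\<in>UNIV. m i \<tau> * basis_form i \<tau> z)"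
proof -
  obtain f where f: "has_expansion 3 \<phi> f" using jacobi_formsD(5)[OF \<phi>] by blast
  define v :: "complex \<Rightarrow> complex ^ 5" where "v q = (\<chi> j. reduced_series f j q)" for q
  define m where "m i q = det (\<chi> a b. if b = i then v q $ a else basis_matrix q $ a $ b) / det (basis_matrix q)" for i q
  have hol: "m i holomorphic_on ball 0 1" for i
    unfolding m_def[abs_def]
  proof (intro holomorphic_intros det_holomorphic basis_matrix_holomorphic)
    show "(\<lambda>q. (\<chi> a b. if b = i then v q $ a else basis_matrix q $ a $ b) $ a $ b) holomorphic_on ball 0 1" for a b
      using reduced_series_holomorphic[OF f] basis_matrix_holomorphic by (cases "b = i") (simp_all add: v_def)
  qed (simp add: det_basis_matrix_neq_0)
  have solve: "basis_matrix q *v (\<chi> i. m i q) = v q" if "norm q < 1" for q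
    unfolding cramer[OF det_basis_matrix_neq_0[OF that]] m_def by simp
  \<comment> \<open>Solving at the five representatives solves at every l, because the components of
    both sides are invariant modulo 3 and under the Weyl group.\<close>
  have comp: "theta_comp f l \<tau> = (\<Sum>i\<in>UNIV. m i (ee \<tau>) * theta_comp (basis_coeff i) l \<tau>)" if l: "l \<in> E8" and \<tau>: "\<tau> \<in> uhp" for l \<tau>
  proof -
    obtain j where j: "\<And>h. invariant_mod_3 h \<Longrightarrow> h l = h (orbit_rep j)" using orbit_representative[OF l] by blast
    have "reduced_series f j (ee \<tau>) = (\<Sum>i\<in>UNIV. m i (ee \<tau>) * reduced_series (basis_coeff i) j (ee \<tau>))"
      using arg_cong[OF solve[OF norm_ee_less_1[OF \<tau>]], of "\<lambda>v. v $ j"]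
      by (simp add: matrix_vector_mult_def basis_matrix_def v_def mult.commute)
    then have "theta_comp f (orbit_rep j) \<tau> = (\<Sum>i\<in>UNIV. m i (ee \<tau>) * theta_comp (basis_coeff i) (orbit_rep j) \<tau>)"
      by (simp add: theta_comp_orbit_rep[OF f \<tau>] theta_comp_orbit_rep[OF basis_form_expansion \<tau>] sum_distrib_left mult_ac)
    moreover have "theta_comp f l \<tau> = theta_comp f (orbit_rep j) \<tau>"
      by (rule j[OF theta_comp_invariant[OF \<phi> f \<tau>]])
    moreover have "theta_comp (basis_coeff i) l \<tau> = theta_comp (basis_coeff i) (orbit_rep j) \<tau>" for i
      by (rule j[OF theta_comp_invariant[OF basis_form_jacobi_form basis_form_expansion \<tau>]])
    ultimately show ?thesis by simp
  qed
  have \<phi>_eq: "\<phi> \<tau> z = (\<Sum>i\<in>UNIV. m i (ee \<tau>) * basis_form i \<tau> z)" if \<tau>: "\<tau> \<in> uhp" for \<tau> z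
  proof (rule has_sum_unique)
    let ?e = "\<lambda>l. ee (of_real (l \<bullet> l) * \<tau> / 6 + cdot (cvec l) z)"
    show "((\<lambda>l. theta_comp f l \<tau> * ?e l) has_sum \<phi> \<tau> z) E8" by (rule theta_comp_has_sum[OF f \<tau>])
    have "((\<lambda>l. \<Sum>i\<in>UNIV. m i (ee \<tau>) * (theta_comp (basis_coeff i) l \<tau> * ?e l)) has_sum (\<Sum>i\<in>UNIV. m i (ee \<tau>) * basis_form i \<tau> z)) E8"
      by (intro has_sum_finite_sum has_sum_cmult_right theta_comp_has_sum[OF basis_form_expansion \<tau>]) auto
    then show "((\<lambda>l. theta_comp f l \<tau> * ?e l) has_sum (\<Sum>i\<in>UNIV. m i (ee \<tau>) * basis_form i \<tau> z)) E8"
      by (rule has_sum_cong[THEN iffD1, rotated]) (simp add: comp[OF _ \<tau>] sum_distrib_right mult.assoc)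
  qed
  have "mform (k - basis_weight i) (m i)" for i
    unfolding mform_def
  proof (intro conjI ballI hol)
    fix \<tau> assume \<tau>: "\<tau> \<in> uhp"
    \<comment> \<open>The decomposition at -1/tau, moved back to tau, is a second decomposition of
      tau^k phi; independence compares the two.\<close>
    have "(\<Sum>i\<in>UNIV. (\<tau> powi basis_weight i * m i (ee (- 1 / \<tau>)) - \<tau> powi k * m i (ee \<tau>)) * basis_form i \<tau> z) = 0" for z
    proof -
      define E where "E = ee (of_nat 3 * cdot z z / (2 * \<tau>))"
      have "\<tau> powi k * E * \<phi> \<tau> z = (\<Sum>i\<in>UNIV. m i (ee (- 1 / \<tau>)) * (\<tau> powi basis_weight i * E * basis_form i \<tau> z))"
        using \<phi>_eq[OF inversion_in_uhp[OF \<tau>], of "(1 / \<tau>) *s z"]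
        unfolding jacobi_forms_S[OF \<phi> \<tau>] jacobi_forms_S[OF basis_form_jacobi_form \<tau>] E_def .
      then have "E * (\<tau> powi k * \<phi> \<tau> z) = E * (\<Sum>i\<in>UNIV. \<tau> powi basis_weight i * m i (ee (- 1 / \<tau>)) * basis_form i \<tau> z)"
        by (simp only: sum_distrib_left mult_ac)
      then have "\<tau> powi k * \<phi> \<tau> z = (\<Sum>i\<in>UNIV. \<tau> powi basis_weight i * m i (ee (- 1 / \<tau>)) * basis_form i \<tau> z)"
        by (simp add: E_def)
      then show ?thesis
        unfolding \<phi>_eq[OF \<tau>] by (simp add: sum_distrib_left left_diff_distrib sum_subtractf mult.assoc)
    qed
    from basis_form_independent[OF \<tau> this, of i]
    have "\<tau> powi basis_weight i * m i (ee (- 1 / \<tau>)) = \<tau> powi k * m i (ee \<tau>)" by simp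
    then show "m i (ee (- 1 / \<tau>)) = \<tau> powi (k - basis_weight i) * m i (ee \<tau>)"
      using uhp_nonzero[OF \<tau>] by (simp add: power_int_diff field_simps)
  qed
  then have "(\<lambda>\<tau>. m i (ee \<tau>)) \<in> mod_ring" for i by (rule mform_in_mod_ring)
  then show ?thesis using \<phi>_eq by (rule that)
qed

section \<open>Summation over the weights\<close>

lemma mod_ring_0: "(\<lambda>\<tau>. 0) \<in> mod_ring"
  unfolding mod_ring_def mem_Collect_eq by (intro exI[of _ 0] exI[of _ "\<lambda>_ _. 0"]) simp

text \<open>Both coefficient arrays are padded by 0 to the common range N + L.\<close>

lemma mod_ring_add:
  assumes "f \<in> mod_ring" "g \<in> mod_ring"
  shows "(\<lambda>\<tau>. f \<tau> + g \<tau>) \<in> mod_ring"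
proof -
  obtain N c where f: "\<And>\<tau>. \<tau> \<in> uhp \<Longrightarrow> f \<tau> = (\<Sum>i\<le>N. \<Sum>j\<le>N. c i j * Eis4 \<tau> ^ i * Eis6 \<tau> ^ j)"
    using assms(1) unfolding mod_ring_def by blast
  obtain L d where g: "\<And>\<tau>. \<tau> \<in> uhp \<Longrightarrow> g \<tau> = (\<Sum>i\<le>L. \<Sum>j\<le>L. d i j * Eis4 \<tau> ^ i * Eis6 \<tau> ^ j)"
    using assms(2) unfolding mod_ring_def by blast
  have extend: "(\<Sum>i\<le>N. \<Sum>j\<le>N. c i j * x ^ i * y ^ j) =
      (\<Sum>i\<le>M. \<Sum>j\<le>M. (if i \<le> N \<and> j \<le> N then c i j else 0) * x ^ i * y ^ j)"
    if "N \<le> M" for N M c and x y :: complex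
    unfolding sum.cartesian_product using that by (intro sum.mono_neutral_cong_left) (auto split: if_splits)
  show ?thesis
    unfolding mod_ring_def mem_Collect_eq
    by (intro exI[of _ "N + L"] exI[of _ "\<lambda>i j. (if i \<le> N \<and> j \<le> N then c i j else 0) + (if i \<le> L \<and> j \<le> L then d i j else 0)"] ballI)
      (simp only: f g extend[of N "N + L"] extend[of L "N + L"] le_add1 le_add2 ring_distribs sum.distrib)
qed

lemma mod_ring_sum:
  assumes "finite K" "\<And>k. k \<in> K \<Longrightarrow> f k \<in> mod_ring"
  shows "(\<lambda>\<tau>. \<Sum>k\<in>K. f k \<tau>) \<in> mod_ring"
  using assms
proof (induction K rule: finite_induct)
  case empty
  then show ?case using mod_ring_0 by simp
next
  case (insert k K)
  then show ?case using mod_ring_add[of "f k" "\<lambda>\<tau>. \<Sum>k\<in>K. f k \<tau>"] by simp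
qed

lemma jacobi_forms_graded_3_iff:
  "\<phi> \<in> jacobi_forms_graded 3 \<longleftrightarrow>
    (\<exists>m :: 5 \<Rightarrow> complex \<Rightarrow> complex. (\<forall>i. m i \<in> mod_ring) \<and> (\<forall>\<tau>\<in>uhp. \<forall>z. \<phi> \<tau> z = (\<Sum>i\<in>UNIV. m i \<tau> * basis_form i \<tau> z)))"
proof
  assume "\<phi> \<in> jacobi_forms_graded 3"
  then obtain K \<Phi> where K: "finite K" "\<And>k. k \<in> K \<Longrightarrow> \<Phi> k \<in> jacobi_forms k 3" "\<And>\<tau> z. \<tau> \<in> uhp \<Longrightarrow> \<phi> \<tau> z = (\<Sum>k\<in>K. \<Phi> k \<tau> z)"
    unfolding jacobi_forms_graded_def by blast
  have "\<forall>k\<in>K. \<exists>m :: 5 \<Rightarrow> complex \<Rightarrow> complex. (\<forall>i. m i \<in> mod_ring) \<and> (\<forall>\<tau>\<in>uhp. \<forall>z. \<Phi> k \<tau> z = (\<Sum>i\<in>UNIV. m i \<tau> * basis_form i \<tau> z))"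
  proof
    fix k assume "k \<in> K"
    then obtain m :: "5 \<Rightarrow> complex \<Rightarrow> complex" where "\<And>i. m i \<in> mod_ring"
      "\<And>\<tau> z. \<tau> \<in> uhp \<Longrightarrow> \<Phi> k \<tau> z = (\<Sum>i\<in>UNIV. m i \<tau> * basis_form i \<tau> z)"
      using jacobi_form_decomposition[OF K(2)] by metis
    then show "\<exists>m :: 5 \<Rightarrow> complex \<Rightarrow> complex. (\<forall>i. m i \<in> mod_ring) \<and> (\<forall>\<tau>\<in>uhp. \<forall>z. \<Phi> k \<tau> z = (\<Sum>i\<in>UNIV. m i \<tau> * basis_form i \<tau> z))"
      by blast
  qed
  then obtain m :: "int \<Rightarrow> 5 \<Rightarrow> complex \<Rightarrow> complex" where m: "\<And>k i. k \<in> K \<Longrightarrow> m k i \<in> mod_ring"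
    "\<And>k \<tau> z. k \<in> K \<Longrightarrow> \<tau> \<in> uhp \<Longrightarrow> \<Phi> k \<tau> z = (\<Sum>i\<in>UNIV. m k i \<tau> * basis_form i \<tau> z)"
    by metis
  have "\<phi> \<tau> z = (\<Sum>i\<in>UNIV. (\<Sum>k\<in>K. m k i \<tau>) * basis_form i \<tau> z)" if "\<tau> \<in> uhp" for \<tau> z
    unfolding K(3)[OF that] sum_distrib_right by (subst sum.swap) (simp add: m(2)[OF _ that])
  moreover have "(\<lambda>\<tau>. \<Sum>k\<in>K. m k i \<tau>) \<in> mod_ring" for i by (rule mod_ring_sum[OF K(1) m(1)])
  ultimately show "\<exists>m :: 5 \<Rightarrow> complex \<Rightarrow> complex. (\<forall>i. m i \<in> mod_ring) \<and> (\<forall>\<tau>\<in>uhp. \<forall>z. \<phi> \<tau> z = (\<Sum>i\<in>UNIV. m i \<tau> * basis_form i \<tau> z))"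
    by (intro exI[of _ "\<lambda>i \<tau>. \<Sum>k\<in>K. m k i \<tau>"]) blast
next
  assume "\<exists>m :: 5 \<Rightarrow> complex \<Rightarrow> complex. (\<forall>i. m i \<in> mod_ring) \<and> (\<forall>\<tau>\<in>uhp. \<forall>z. \<phi> \<tau> z = (\<Sum>i\<in>UNIV. m i \<tau> * basis_form i \<tau> z))"
  then obtain m :: "5 \<Rightarrow> complex \<Rightarrow> complex" where m: "\<And>i. m i \<in> mod_ring"
    "\<And>\<tau> z. \<tau> \<in> uhp \<Longrightarrow> \<phi> \<tau> z = (\<Sum>i\<in>UNIV. m i \<tau> * basis_form i \<tau> z)" by blast
  have "(\<lambda>\<tau> z. \<Sum>i\<in>UNIV. m i \<tau> * basis_form i \<tau> z) \<in> jacobi_forms_graded 3"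
    by (intro jacobi_forms_graded_sum mod_ring_mult_graded[OF m(1) basis_form_jacobi_form]) auto
  then show "\<phi> \<in> jacobi_forms_graded 3" by (rule jacobi_forms_graded_cong) (rule m(2))
qed

text \<open>Matches the index type 5 of the matrices, in which 5 = 0, with the list positions 0 to
  4.\<close>

definition basis_index :: "5 \<Rightarrow> nat" where
  "basis_index i = (if i = 1 then 0 else if i = 2 then 1 else if i = 3 then 2 else if i = 4 then 3 else 4)"

theorem theorem5p11:
  "free_basis (jacobi_forms_graded 3)
     [A_form 3,
      B_form 3,
      \<lambda>\<tau> z. A_form 2 \<tau> z * theta_E8 \<tau> z,
      \<lambda>\<tau> z. B_form 2 \<tau> z * theta_E8 \<tau> z,
      \<lambda>\<tau> z. theta_E8 \<tau> z ^ 3]"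
proof -
  let ?bs = "[A_form 3, B_form 3, \<lambda>\<tau> z. A_form 2 \<tau> z * theta_E8 \<tau> z,
      \<lambda>\<tau> z. B_form 2 \<tau> z * theta_E8 \<tau> z, \<lambda>\<tau> z. theta_E8 \<tau> z ^ 3]"
  have comb: "lin_comb m ?bs \<tau> z = (\<Sum>i\<in>UNIV. m (basis_index i) \<tau> * basis_form i \<tau> z)" for m \<tau> z
    unfolding lin_comb_def sum_5 by (simp add: basis_form_def basis_index_def eval_nat_numeral lessThan_Suc)
  have index: "basis_index i < 5" for i by (simp add: basis_index_def)
  have inj: "inj basis_index"
    unfolding inj_def forall_5 by (simp add: basis_index_def)
  have surj: "\<exists>i. n = basis_index i" if "n < 5" for n :: nat
  proof -
    have "n = basis_index 1 \<or> n = basis_index 2 \<or> n = basis_index 3 \<or> n = basis_index 4 \<or> n = basis_index 5"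
      using that by (simp add: basis_index_def) linarith
    then show ?thesis by blast
  qed
  have len: "length ?bs = 5" by simp
  show ?thesis
    unfolding free_basis_def len comb
  proof (intro conjI allI impI set_eqI)
    fix \<phi>
    show "\<phi> \<in> jacobi_forms_graded 3 \<longleftrightarrow> \<phi> \<in> {\<phi>. \<exists>m. (\<forall>i<5. m i \<in> mod_ring) \<and>
        (\<forall>\<tau>\<in>uhp. \<forall>z. \<phi> \<tau> z = (\<Sum>i\<in>UNIV. m (basis_index i) \<tau> * basis_form i \<tau> z))}"
      unfolding jacobi_forms_graded_3_iff mem_Collect_eq
    proof
      assume "\<exists>m :: 5 \<Rightarrow> complex \<Rightarrow> complex. (\<forall>i. m i \<in> mod_ring) \<and> (\<forall>\<tau>\<in>uhp. \<forall>z. \<phi> \<tau> z = (\<Sum>i\<in>UNIV. m i \<tau> * basis_form i \<tau> z))"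
      then obtain m :: "5 \<Rightarrow> complex \<Rightarrow> complex" where m: "\<forall>i. m i \<in> mod_ring"
        "\<forall>\<tau>\<in>uhp. \<forall>z. \<phi> \<tau> z = (\<Sum>i\<in>UNIV. m i \<tau> * basis_form i \<tau> z)" by blast
      then show "\<exists>m. (\<forall>i<5. m i \<in> mod_ring) \<and> (\<forall>\<tau>\<in>uhp. \<forall>z. \<phi> \<tau> z = (\<Sum>i\<in>UNIV. m (basis_index i) \<tau> * basis_form i \<tau> z))"
        by (intro exI[of _ "\<lambda>n. m (inv basis_index n)"]) (simp add: inv_f_f[OF inj])
    next
      assume "\<exists>m. (\<forall>i<5. m i \<in> mod_ring) \<and> (\<forall>\<tau>\<in>uhp. \<forall>z. \<phi> \<tau> z = (\<Sum>i\<in>UNIV. m (basis_index i) \<tau> * basis_form i \<tau> z))"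
      then obtain m where m: "\<forall>i<5. m i \<in> mod_ring" "\<forall>\<tau>\<in>uhp. \<forall>z. \<phi> \<tau> z = (\<Sum>i\<in>UNIV. m (basis_index i) \<tau> * basis_form i \<tau> z)"
        by blast
      then show "\<exists>m :: 5 \<Rightarrow> complex \<Rightarrow> complex. (\<forall>i. m i \<in> mod_ring) \<and> (\<forall>\<tau>\<in>uhp. \<forall>z. \<phi> \<tau> z = (\<Sum>i\<in>UNIV. m i \<tau> * basis_form i \<tau> z))"
        using index by (intro exI[of _ "\<lambda>i. m (basis_index i)"]) simp
    qed
  next
    fix m :: "nat \<Rightarrow> complex \<Rightarrow> complex" and n :: nat assume zero: "\<forall>\<tau>\<in>uhp. \<forall>z. (\<Sum>i\<in>UNIV. m (basis_index i) \<tau> * basis_form i \<tau> z) = 0" and n: "n < 5"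
    obtain i where i: "n = basis_index i" using surj[OF n] by blast
    show "\<forall>\<tau>\<in>uhp. m n \<tau> = 0"
    proof
      fix \<tau> assume \<tau>: "\<tau> \<in> uhp"
      with zero have "(\<Sum>i\<in>UNIV. m (basis_index i) \<tau> * basis_form i \<tau> z) = 0" for z by blast
      from basis_form_independent[OF \<tau> this, of i] show "m n \<tau> = 0" by (simp add: i)
    qed
  qed
qed

end
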